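(* Let $\Omega$ be a bounded convex Reinhardt domain in $\mathbb{C}^2$ and $\phi\in C(\overline{\Omega})$. Then the following are equivalent: (i) $H_{\phi}$ is compact. (ii) $H^*_{\phi}H_{\phi}$ is compact. (iii) $\widetilde{H^*_{\phi}H_{\phi}}(z)=\|H_{\phi}k_z\|^2\to 0$ as $z\to b\Omega$. (iv) $\phi\circ f$ is holomorphic for any holomorphic function $f:\mathbb{D}\to b\Omega$.
   Context: $b\Omega$ denotes the boundary of $\Omega$ and $\mathbb{D}$ the open unit disc in $\mathbb{C}$; a holomorphic function $f:\mathbb{D}\to b\Omega$ is a holomorphic map $f:\mathbb{D}\to\mathbb{C}^2$ with $f(\mathbb{D})\subseteq b\Omega$. A domain $\Omega\subseteq\mathbb{C}^n$ is Reinhardt if $(\xi_1z_1,\ldots,\xi_nz_n)\in\Omega$ whenever $z\in\Omega$ and $|\xi_1|=\cdots=|\xi_n|=1$. $A^2(\Omega)$ is the Bergman space of holomorphic functions on $\Omega$ that are square integrable with respect to Lebesgue measure $dV$; $P:L^2(\Omega)\to A^2(\Omega)$ is the orthogonal (Bergman) projection; $K$ is the Bergman kernel of $\Omega$. For bounded $\phi$, the Hankel operator is $H_\phi:A^2(\Omega)\to L^2(\Omega)$, $H_\phi f=(I-P)(\phi f)$. The normalized Bergman kernel is $k_z(w)=K(w,z)/\sqrt{K(z,z)}$ for $z,w\in\Omega$. The Berezin transform of a bounded linear operator $T$ on $A^2(\Omega)$ is $\widetilde{T}(z)=\langle Tk_z,k_z\rangle$, $z\in\Omega$. $\|\cdot\|$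 is the $L^2(\Omega)$-norm. "$z\to b\Omega$" means that the distance from $z\in\Omega$ to $b\Omega$ tends to $0$. *)

theory Defs
  imports "HOL-Complex_Analysis.Complex_Analysis"
begin

text \<open>
  The space \<open>\<complex>\<^sup>2\<close> is the type \<open>complex \<times> complex\<close>, whose norm is the Euclidean one
  and whose Lebesgue measure is the four-dimensional one.
\<close>

type_synonym C2 = "complex \<times> complex"

definition reinhardt :: "C2 set \<Rightarrow> bool" where
  "reinhardt \<Omega> \<longleftrightarrow>
     (\<forall>z1 z2 \<xi>1 \<xi>2. (z1, z2) \<in> \<Omega> \<and> cmod \<xi>1 = 1 \<and> cmod \<xi>2 = 1 \<longrightarrow> (\<xi>1 * z1, \<xi>2 * z2) \<in> \<Omega>)"

text \<open>Holomorphy in two variables: the real Frechet derivative exists and is complex linear.\<close>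

definition holomorphic2_on :: "(C2 \<Rightarrow> complex) \<Rightarrow> C2 set \<Rightarrow> bool"
    (infixl \<open>holomorphic2'_on\<close> 50) where
  "f holomorphic2_on \<Omega> \<longleftrightarrow>
     (\<forall>z\<in>\<Omega>. \<exists>a b. (f has_derivative (\<lambda>h. a * fst h + b * snd h)) (at z))"

definition holomorphic_map_on :: "(complex \<Rightarrow> C2) \<Rightarrow> complex set \<Rightarrow> bool" where
  "holomorphic_map_on f S \<longleftrightarrow>
     (\<lambda>t. fst (f t)) holomorphic_on S \<and> (\<lambda>t. snd (f t)) holomorphic_on S"

text \<open>
  Elements of \<open>L\<^sup>2(\<Omega>)\<close> are represented by square integrable functions; two of them are the
  same element when \<open>l2_norm\<close> of their difference is 0.  Values outside \<open>\<Omega>\<close> are irrelevant.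
\<close>

definition L2 :: "C2 set \<Rightarrow> (C2 \<Rightarrow> complex) set" where
  "L2 \<Omega> = {f. f \<in> borel_measurable (lebesgue_on \<Omega>) \<and>
              integrable (lebesgue_on \<Omega>) (\<lambda>z. (cmod (f z))\<^sup>2)}"

definition l2_inner :: "C2 set \<Rightarrow> (C2 \<Rightarrow> complex) \<Rightarrow> (C2 \<Rightarrow> complex) \<Rightarrow> complex" where
  "l2_inner \<Omega> f g = (LINT z|lebesgue_on \<Omega>. f z * cnj (g z))"

definition l2_norm :: "C2 set \<Rightarrow> (C2 \<Rightarrow> complex) \<Rightarrow> real" where
  "l2_norm \<Omega> f = sqrt (LINT z|lebesgue_on \<Omega>. (cmod (f z))\<^sup>2)"

text \<open>
  The Bergman space.  Its elements are normalised to vanish outside \<open>\<Omega>\<close>, so that for open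
  \<open>\<Omega>\<close> each element has exactly one representative and the descriptions with \<open>THE\<close>
  below are unique.
\<close>

definition A2 :: "C2 set \<Rightarrow> (C2 \<Rightarrow> complex) set" where
  "A2 \<Omega> = {f. f holomorphic2_on \<Omega> \<and> f \<in> L2 \<Omega> \<and> (\<forall>z. z \<notin> \<Omega> \<longrightarrow> f z = 0)}"

definition bergman_proj :: "C2 set \<Rightarrow> (C2 \<Rightarrow> complex) \<Rightarrow> (C2 \<Rightarrow> complex)" where
  "bergman_proj \<Omega> f =
     (THE g. g \<in> A2 \<Omega> \<and> (\<forall>h\<in>A2 \<Omega>. l2_inner \<Omega> (\<lambda>z. f z - g z) h = 0))"

text \<open>
  \<open>bergman_kernel \<Omega> w z\<close> is \<open>K(w,z)\<close>: for \<open>z \<in> \<Omega>\<close> the function \<open>K(\<cdot>,z)\<close> is the element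
  of the Bergman space that represents evaluation at \<open>z\<close>.
\<close>

definition bergman_kernel :: "C2 set \<Rightarrow> C2 \<Rightarrow> C2 \<Rightarrow> complex" where
  "bergman_kernel \<Omega> w z =
     (THE k. k \<in> A2 \<Omega> \<and> (\<forall>f\<in>A2 \<Omega>. f z = l2_inner \<Omega> f k)) w"

text \<open>\<open>K(z,z)\<close> is a nonnegative real, on which \<open>csqrt\<close> is the real square root.\<close>

definition normalized_kernel :: "C2 set \<Rightarrow> C2 \<Rightarrow> (C2 \<Rightarrow> complex)" where
  "normalized_kernel \<Omega> z = (\<lambda>w. bergman_kernel \<Omega> w z / csqrt (bergman_kernel \<Omega> z z))"

definition hankel :: "C2 set \<Rightarrow> (C2 \<Rightarrow> complex) \<Rightarrow> (C2 \<Rightarrow> complex) \<Rightarrow> (C2 \<Rightarrow> complex)" where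
  "hankel \<Omega> \<phi> f = (\<lambda>z. \<phi> z * f z - bergman_proj \<Omega> (\<lambda>w. \<phi> w * f w) z)"

text \<open>The Hilbert space adjoint \<open>T\<^sup>* : L\<^sup>2(\<Omega>) \<rightarrow> A\<^sup>2(\<Omega>)\<close> of \<open>T : A\<^sup>2(\<Omega>) \<rightarrow> L\<^sup>2(\<Omega>)\<close>.\<close>

definition A2_adjoint ::
    "C2 set \<Rightarrow> ((C2 \<Rightarrow> complex) \<Rightarrow> (C2 \<Rightarrow> complex)) \<Rightarrow> ((C2 \<Rightarrow> complex) \<Rightarrow> (C2 \<Rightarrow> complex))" where
  "A2_adjoint \<Omega> T g =
     (THE h. h \<in> A2 \<Omega> \<and> (\<forall>f\<in>A2 \<Omega>. l2_inner \<Omega> (T f) g = l2_inner \<Omega> f h))"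

text \<open>
  Compactness of a linear operator \<open>T : X \<rightarrow> Y\<close> between subspaces of \<open>L\<^sup>2(\<Omega>)\<close>: every bounded
  sequence in \<open>X\<close> has a subsequence whose image converges in norm to an element of \<open>Y\<close>.
\<close>

definition compact_operator ::
    "C2 set \<Rightarrow> (C2 \<Rightarrow> complex) set \<Rightarrow> (C2 \<Rightarrow> complex) set \<Rightarrow>
     ((C2 \<Rightarrow> complex) \<Rightarrow> (C2 \<Rightarrow> complex)) \<Rightarrow> bool" where
  "compact_operator \<Omega> X Y T \<longleftrightarrow>
     (\<forall>f\<in>X. T f \<in> Y) \<and>
     (\<forall>u :: nat \<Rightarrow> C2 \<Rightarrow> complex.
        (\<forall>n. u n \<in> X) \<and> (\<exists>C. \<forall>n. l2_norm \<Omega> (u n) \<le> C) \<longrightarrow>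
        (\<exists>r g. strict_mono r \<and> g \<in> Y \<and>
           (\<lambda>n. l2_norm \<Omega> (\<lambda>z. T (u (r n)) z - g z)) \<longlonglongrightarrow> 0))"

definition berezin ::
    "C2 set \<Rightarrow> ((C2 \<Rightarrow> complex) \<Rightarrow> (C2 \<Rightarrow> complex)) \<Rightarrow> C2 \<Rightarrow> complex" where
  "berezin \<Omega> T z = l2_inner \<Omega> (T (normalized_kernel \<Omega> z)) (normalized_kernel \<Omega> z)"

text \<open>The filter \<open>z \<rightarrow> b\<Omega>\<close>: points of \<open>\<Omega>\<close> whose distance to the boundary tends to 0.\<close>

definition to_boundary :: "C2 set \<Rightarrow> C2 filter" where
  "to_boundary \<Omega> = inf (filtercomap (\<lambda>z. infdist z (frontier \<Omega>)) (nhds 0)) (principal \<Omega>)"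

end

theory Submission
  imports Defs "HOL-Library.Diagonal_Subsequence"
begin

text \<open>
  Everything is reduced to monomials.  A bounded convex Reinhardt domain is complete, so the monomials
  form an orthogonal basis of its Bergman space, and a continuous symbol is a uniform limit of finite
  combinations of its components \<open>\<phi>\<^sub>k\<^sub>l\<close> of bidegree \<open>(k, l)\<close> under the torus action.

  Compactness of \<open>H\<close> and of \<open>H\<^sup>*H\<close> both say that weakly null sequences are sent to norm null ones
  (\<open>compact_hankel_iff\<close>, \<open>compact_HH_iff\<close>).  The normalised kernels are weakly null at the boundary, because
  the powers of a supporting functional make the kernel blow up there; so compactness implies that
  \<open>\<parallel>H k\<^sub>z\<parallel>\<close> tends to 0 (\<open>hankel_wc_imp_boundary_limit\<close>).

  Suppose this limit holds.  A nonconstant analytic disc in the boundary keeps one coordinate \<open>X\<close> constant,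
  at its maximal modulus \<open>r\<close> (\<open>disc_in_frontier\<close>).  The kernels at points of the axis \<open>Y = 0\<close> are series in the powers of
  \<open>X\<close>, and averaging \<open>\<parallel>H k\<^sub>z\<parallel>\<^sup>2\<close> over rotations shows that \<open>H\<close> is small on arbitrarily high normalised powers
  of \<open>X\<close> (\<open>boundary_limit_imp_hankel_axis_small\<close>).  So the products of a component \<open>\<phi>\<^sub>k\<^sub>l\<close> with these powers, whose
  mass concentrates on \<open>|X| = r\<close>, are nearly monomials, and in the limit \<open>\<phi>\<^sub>k\<^sub>l\<close> is a multiple of a power of \<open>Y\<close> on the discs
  \<open>X = const\<close> (\<open>axis_small_imp_slice\<close>).  Hence the symbol is holomorphic along every disc in the boundary.

  Suppose finally that the symbol is holomorphic along the boundary discs.  The Hankel operator of \<open>\<phi>\<^sub>k\<^sub>l\<close> has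
  mutually orthogonal values on the monomials \<open>e\<^sub>\<alpha>\<close>, so it is enough that \<open>\<parallel>H e\<^sub>\<alpha>\<parallel>\<close> tends to 0
  (\<open>hankel_wc_diagonal\<close>).  Along a sequence of exponents with limiting direction \<open>(a, 1 - a)\<close> the mass of \<open>e\<^sub>\<alpha>\<close> concentrates on
  the set where \<open>|z\<^sub>1|\<^sup>a |z\<^sub>2|\<^bsup>1-a\<^esup>\<close> is maximal (\<open>monomial_concentration\<close>).  For \<open>0 < a < 1\<close> convexity makes this set a
  single torus, on which a homogeneous function is a multiple of a monomial; for \<open>a = 0\<close> and \<open>a = 1\<close> it consists of
  boundary discs and points, where the hypothesis does the same.  In all cases \<open>\<phi>\<^sub>k\<^sub>l e\<^sub>\<alpha>\<close> is close to a holomorphic monomial,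
  so its Hankel image is small (\<open>disc_condition_imp_component_small\<close>).
\<close>

section \<open>The semi-inner product space of square integrable functions\<close>

lemma L2_borel: "f \<in> L2 \<Omega> \<Longrightarrow> f \<in> borel_measurable (lebesgue_on \<Omega>)"
  by (simp add: L2_def)

lemma L2_integrable_sq: "f \<in> L2 \<Omega> \<Longrightarrow> integrable (lebesgue_on \<Omega>) (\<lambda>z. (cmod (f z))\<^sup>2)"
  by (simp add: L2_def)

lemma L2_integrable_inner:
  assumes "f \<in> L2 \<Omega>" "g \<in> L2 \<Omega>"
  shows "integrable (lebesgue_on \<Omega>) (\<lambda>z. f z * cnj (g z))"
proof (rule Bochner_Integration.integrable_bound)
  show "integrable (lebesgue_on \<Omega>) (\<lambda>z. (cmod (f z))\<^sup>2 + (cmod (g z))\<^sup>2)"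
    using assms by (simp add: L2_integrable_sq)
  show "(\<lambda>z. f z * cnj (g z)) \<in> borel_measurable (lebesgue_on \<Omega>)"
    by (intro borel_measurable_times L2_borel[OF assms(1)]
        borel_measurable_continuous_on[OF _ L2_borel[OF assms(2)]] continuous_intros)
  have "x * y \<le> x\<^sup>2 + y\<^sup>2" if "x \<ge> 0" "y \<ge> 0" for x y :: real
    using sum_squares_bound[of x y] mult_nonneg_nonneg[OF that] by linarith
  then show "AE z in lebesgue_on \<Omega>. norm (f z * cnj (g z)) \<le> norm ((cmod (f z))\<^sup>2 + (cmod (g z))\<^sup>2)"
    by (simp add: norm_mult)
qed

lemma L2_zero [simp]: "(\<lambda>z. 0) \<in> L2 \<Omega>"
  by (simp add: L2_def)

lemma L2_scale: "f \<in> L2 \<Omega> \<Longrightarrow> (\<lambda>z. c * f z) \<in> L2 \<Omega>"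
  unfolding L2_def mem_Collect_eq norm_mult power_mult_distrib
  by (intro conjI borel_measurable_times borel_measurable_const integrable_mult_right) auto

lemma L2_add:
  assumes "f \<in> L2 \<Omega>" "g \<in> L2 \<Omega>"
  shows "(\<lambda>z. f z + g z) \<in> L2 \<Omega>"
proof -
  have m: "(\<lambda>z. f z + g z) \<in> borel_measurable (lebesgue_on \<Omega>)"
    using L2_borel[OF assms(1)] L2_borel[OF assms(2)] by simp
  have "integrable (lebesgue_on \<Omega>) (\<lambda>z. (cmod (f z + g z))\<^sup>2)"
  proof (rule Bochner_Integration.integrable_bound)
    show "integrable (lebesgue_on \<Omega>) (\<lambda>z. 2 * (cmod (f z))\<^sup>2 + 2 * (cmod (g z))\<^sup>2)"
      using assms by (simp add: L2_integrable_sq)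
    show "(\<lambda>z. (cmod (f z + g z))\<^sup>2) \<in> borel_measurable (lebesgue_on \<Omega>)"
      using m by simp
    have "(cmod (a + b))\<^sup>2 \<le> 2 * (cmod a)\<^sup>2 + 2 * (cmod b)\<^sup>2" for a b
    proof -
      have "(cmod (a + b))\<^sup>2 \<le> (cmod a + cmod b)\<^sup>2"
        by (intro power_mono norm_triangle_ineq) auto
      also have "\<dots> \<le> 2 * (cmod a)\<^sup>2 + 2 * (cmod b)\<^sup>2"
        using sum_squares_bound[of "cmod a" "cmod b"] by (simp add: power2_sum)
      finally show ?thesis .
    qed
    then show "AE z in lebesgue_on \<Omega>. norm ((cmod (f z + g z))\<^sup>2)
        \<le> norm (2 * (cmod (f z))\<^sup>2 + 2 * (cmod (g z))\<^sup>2)"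
      by simp
  qed
  with m show ?thesis by (simp add: L2_def)
qed

lemma L2_diff:
  assumes "f \<in> L2 \<Omega>" "g \<in> L2 \<Omega>"
  shows "(\<lambda>z. f z - g z) \<in> L2 \<Omega>"
  using L2_add[OF assms(1) L2_scale[OF assms(2), of "-1"]] by simp

lemma L2_sum:
  assumes "\<And>i. i \<in> I \<Longrightarrow> f i \<in> L2 \<Omega>"
  shows "(\<lambda>z. \<Sum>i\<in>I. f i z) \<in> L2 \<Omega>"
  using assms by (induction I rule: infinite_finite_induct) (auto intro: L2_add)

lemma L2_mult_bounded:
  assumes f: "f \<in> L2 \<Omega>" and \<psi>: "\<psi> \<in> borel_measurable (lebesgue_on \<Omega>)"
    and B: "\<And>z. z \<in> \<Omega> \<Longrightarrow> cmod (\<psi> z) \<le> B"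
  shows "(\<lambda>z. \<psi> z * f z) \<in> L2 \<Omega>"
proof -
  have m: "(\<lambda>z. \<psi> z * f z) \<in> borel_measurable (lebesgue_on \<Omega>)"
    by (rule borel_measurable_times[OF \<psi> L2_borel[OF f]])
  have "integrable (lebesgue_on \<Omega>) (\<lambda>z. (cmod (\<psi> z * f z))\<^sup>2)"
  proof (rule Bochner_Integration.integrable_bound)
    show "integrable (lebesgue_on \<Omega>) (\<lambda>z. B\<^sup>2 * (cmod (f z))\<^sup>2)"
      using f by (simp add: L2_integrable_sq)
    show "(\<lambda>z. (cmod (\<psi> z * f z))\<^sup>2) \<in> borel_measurable (lebesgue_on \<Omega>)"
      using m by simp
    have "(cmod (\<psi> z * f z))\<^sup>2 \<le> B\<^sup>2 * (cmod (f z))\<^sup>2" if "z \<in> \<Omega>" for z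
      unfolding norm_mult power_mult_distrib
      by (intro mult_right_mono power_mono B that) auto
    then show "AE z in lebesgue_on \<Omega>. norm ((cmod (\<psi> z * f z))\<^sup>2) \<le> norm (B\<^sup>2 * (cmod (f z))\<^sup>2)"
      by (intro AE_I2) simp
  qed
  with m show ?thesis by (simp add: L2_def)
qed

lemma l2_inner_add_left:
  assumes "f \<in> L2 \<Omega>" "g \<in> L2 \<Omega>" "h \<in> L2 \<Omega>"
  shows "l2_inner \<Omega> (\<lambda>z. f z + g z) h = l2_inner \<Omega> f h + l2_inner \<Omega> g h"
  using L2_integrable_inner[OF assms(1,3)] L2_integrable_inner[OF assms(2,3)]
  unfolding l2_inner_def distrib_right by (rule Bochner_Integration.integral_add)

lemma l2_inner_diff_left:
  assumes "f \<in> L2 \<Omega>" "g \<in> L2 \<Omega>" "h \<in> L2 \<Omega>"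
  shows "l2_inner \<Omega> (\<lambda>z. f z - g z) h = l2_inner \<Omega> f h - l2_inner \<Omega> g h"
  using L2_integrable_inner[OF assms(1,3)] L2_integrable_inner[OF assms(2,3)]
  unfolding l2_inner_def left_diff_distrib by (rule Bochner_Integration.integral_diff)

lemma l2_inner_scale_left: "l2_inner \<Omega> (\<lambda>z. c * f z) h = c * l2_inner \<Omega> f h"
  by (simp add: l2_inner_def mult.assoc)

lemma l2_inner_cnj: "cnj (l2_inner \<Omega> f g) = l2_inner \<Omega> g f"
  unfolding l2_inner_def
  by (subst Bochner_Integration.integral_cnj[symmetric]) (simp only: complex_cnj_mult complex_cnj_cnj mult.commute)

lemma l2_inner_add_right:
  assumes "f \<in> L2 \<Omega>" "g \<in> L2 \<Omega>" "h \<in> L2 \<Omega>"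
  shows "l2_inner \<Omega> h (\<lambda>z. f z + g z) = l2_inner \<Omega> h f + l2_inner \<Omega> h g"
  using L2_integrable_inner[OF assms(3,1)] L2_integrable_inner[OF assms(3,2)]
  unfolding l2_inner_def complex_cnj_add distrib_left by (rule Bochner_Integration.integral_add)

lemma l2_inner_diff_right:
  assumes "f \<in> L2 \<Omega>" "g \<in> L2 \<Omega>" "h \<in> L2 \<Omega>"
  shows "l2_inner \<Omega> h (\<lambda>z. f z - g z) = l2_inner \<Omega> h f - l2_inner \<Omega> h g"
  using L2_integrable_inner[OF assms(3,1)] L2_integrable_inner[OF assms(3,2)]
  unfolding l2_inner_def complex_cnj_diff right_diff_distrib by (rule Bochner_Integration.integral_diff)

lemma l2_inner_scale_right: "l2_inner \<Omega> h (\<lambda>z. c * f z) = cnj c * l2_inner \<Omega> h f"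
proof -
  have "l2_inner \<Omega> h (\<lambda>z. c * f z) = (LINT z|lebesgue_on \<Omega>. cnj c * (h z * cnj (f z)))"
    unfolding l2_inner_def by (simp add: mult_ac)
  then show ?thesis by (simp add: l2_inner_def)
qed

lemma l2_inner_sum_left:
  assumes "\<And>i. i \<in> I \<Longrightarrow> f i \<in> L2 \<Omega>" "h \<in> L2 \<Omega>"
  shows "l2_inner \<Omega> (\<lambda>z. \<Sum>i\<in>I. f i z) h = (\<Sum>i\<in>I. l2_inner \<Omega> (f i) h)"
  using assms
proof (induction I rule: infinite_finite_induct)
  case (insert i I)
  have "l2_inner \<Omega> (\<lambda>z. f i z + (\<Sum>i\<in>I. f i z)) h
      = l2_inner \<Omega> (f i) h + l2_inner \<Omega> (\<lambda>z. \<Sum>i\<in>I. f i z) h"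
    by (intro l2_inner_add_left L2_sum) (use insert in auto)
  with insert show ?case by simp
qed (auto simp: l2_inner_def)

lemma l2_inner_sum_right:
  assumes "\<And>i. i \<in> I \<Longrightarrow> f i \<in> L2 \<Omega>" "h \<in> L2 \<Omega>"
  shows "l2_inner \<Omega> h (\<lambda>z. \<Sum>i\<in>I. f i z) = (\<Sum>i\<in>I. l2_inner \<Omega> h (f i))"
proof -
  have "l2_inner \<Omega> h (\<lambda>z. \<Sum>i\<in>I. f i z) = cnj (l2_inner \<Omega> (\<lambda>z. \<Sum>i\<in>I. f i z) h)"
    by (rule l2_inner_cnj[symmetric])
  also have "\<dots> = (\<Sum>i\<in>I. cnj (l2_inner \<Omega> (f i) h))"
    by (simp only: l2_inner_sum_left[OF assms] cnj_sum)
  finally show ?thesis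
    by (simp only: l2_inner_cnj)
qed

lemma l2_norm_nonneg [simp]: "0 \<le> l2_norm \<Omega> f"
  by (simp add: l2_norm_def)

lemma l2_norm_sq: "(l2_norm \<Omega> f)\<^sup>2 = (LINT z|lebesgue_on \<Omega>. (cmod (f z))\<^sup>2)"
  by (simp add: l2_norm_def)

lemma l2_inner_self: "l2_inner \<Omega> f f = complex_of_real ((l2_norm \<Omega> f)\<^sup>2)"
  unfolding l2_norm_sq l2_inner_def
  by (subst integral_complex_of_real[symmetric])
     (intro Bochner_Integration.integral_cong refl, simp only: complex_norm_square)

lemma l2_norm_scale: "l2_norm \<Omega> (\<lambda>z. c * f z) = cmod c * l2_norm \<Omega> f"
  by (simp add: l2_norm_def norm_mult power_mult_distrib real_sqrt_mult)

lemma l2_norm_cong: "(\<And>z. z \<in> \<Omega> \<Longrightarrow> cmod (f z) = cmod (g z)) \<Longrightarrow> l2_norm \<Omega> f = l2_norm \<Omega> g"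
  unfolding l2_norm_def by (intro arg_cong[of _ _ sqrt] Bochner_Integration.integral_cong) auto

lemma l2_inner_cong:
  "(\<And>z. z \<in> \<Omega> \<Longrightarrow> f z = f' z) \<Longrightarrow> (\<And>z. z \<in> \<Omega> \<Longrightarrow> g z = g' z) \<Longrightarrow> l2_inner \<Omega> f g = l2_inner \<Omega> f' g'"
  unfolding l2_inner_def by (intro Bochner_Integration.integral_cong) auto

lemma L2_cong: "(\<And>z. z \<in> \<Omega> \<Longrightarrow> f z = g z) \<Longrightarrow> f \<in> L2 \<Omega> \<longleftrightarrow> g \<in> L2 \<Omega>"
  unfolding L2_def mem_Collect_eq
  by (intro conj_cong measurable_cong Bochner_Integration.integrable_cong) auto

lemma l2_norm_minus_commute: "l2_norm \<Omega> (\<lambda>z. f z - g z) = l2_norm \<Omega> (\<lambda>z. g z - f z)"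
  by (intro l2_norm_cong norm_minus_commute)

lemma l2_norm_zero [simp]: "l2_norm \<Omega> (\<lambda>z. 0) = 0"
  by (simp add: l2_norm_def)

lemma l2_Cauchy_Schwarz:
  assumes f: "f \<in> L2 \<Omega>" and g: "g \<in> L2 \<Omega>"
  shows "cmod (l2_inner \<Omega> f g) \<le> l2_norm \<Omega> f * l2_norm \<Omega> g"
proof -
  let ?M = "lebesgue_on \<Omega>"
  have sq: "(\<integral>\<^sup>+z. (ennreal (cmod (u z)))\<^sup>2 \<partial>?M) = ennreal ((l2_norm \<Omega> u)\<^sup>2)" if "u \<in> L2 \<Omega>" for u
  proof -
    have "(\<integral>\<^sup>+z. (ennreal (cmod (u z)))\<^sup>2 \<partial>?M) = (\<integral>\<^sup>+z. ennreal ((cmod (u z))\<^sup>2) \<partial>?M)"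
      by (simp add: ennreal_power)
    also have "\<dots> = ennreal ((l2_norm \<Omega> u)\<^sup>2)"
      unfolding l2_norm_sq by (rule nn_integral_eq_integral) (use that in \<open>auto simp: L2_integrable_sq\<close>)
    finally show ?thesis .
  qed
  have "ennreal (cmod (l2_inner \<Omega> f g)) \<le> (\<integral>\<^sup>+z. norm (f z * cnj (g z)) \<partial>?M)"
    unfolding l2_inner_def by (rule integral_norm_bound_ennreal[OF L2_integrable_inner[OF f g]])
  also have "\<dots> = (\<integral>\<^sup>+z. ennreal (cmod (f z)) * ennreal (cmod (g z)) \<partial>?M)"
    by (simp add: norm_mult ennreal_mult)
  finally have 1: "(ennreal (cmod (l2_inner \<Omega> f g)))\<^sup>2
      \<le> (\<integral>\<^sup>+z. ennreal (cmod (f z)) * ennreal (cmod (g z)) \<partial>?M)\<^sup>2"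
    by (rule power_mono) simp
  also have "\<dots> \<le> (\<integral>\<^sup>+z. (ennreal (cmod (f z)))\<^sup>2 \<partial>?M) * (\<integral>\<^sup>+z. (ennreal (cmod (g z)))\<^sup>2 \<partial>?M)"
    using L2_borel[OF f] L2_borel[OF g] by (intro Cauchy_Schwarz_nn_integral) auto
  also have "\<dots> = ennreal ((l2_norm \<Omega> f * l2_norm \<Omega> g)\<^sup>2)"
    by (simp add: sq f g ennreal_mult power_mult_distrib)
  finally have "(cmod (l2_inner \<Omega> f g))\<^sup>2 \<le> (l2_norm \<Omega> f * l2_norm \<Omega> g)\<^sup>2"
    by (simp add: ennreal_power)
  then show ?thesis by (rule power2_le_imp_le) simp
qed

lemma l2_norm_add_sq:
  assumes "f \<in> L2 \<Omega>" "g \<in> L2 \<Omega>"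
  shows "(l2_norm \<Omega> (\<lambda>z. f z + g z))\<^sup>2
    = (l2_norm \<Omega> f)\<^sup>2 + (l2_norm \<Omega> g)\<^sup>2 + 2 * Re (l2_inner \<Omega> f g)"
proof -
  have "complex_of_real ((l2_norm \<Omega> (\<lambda>z. f z + g z))\<^sup>2)
      = l2_inner \<Omega> f f + l2_inner \<Omega> g g + (l2_inner \<Omega> f g + cnj (l2_inner \<Omega> f g))"
    unfolding l2_inner_self[symmetric] l2_inner_cnj
    using assms by (simp add: l2_inner_add_left l2_inner_add_right L2_add)
  also have "\<dots> = complex_of_real ((l2_norm \<Omega> f)\<^sup>2 + (l2_norm \<Omega> g)\<^sup>2 + 2 * Re (l2_inner \<Omega> f g))"
    by (simp only: l2_inner_self complex_add_cnj of_real_add)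
  finally show ?thesis using of_real_eq_iff by blast
qed

lemma l2_triangle:
  assumes "f \<in> L2 \<Omega>" "g \<in> L2 \<Omega>"
  shows "l2_norm \<Omega> (\<lambda>z. f z + g z) \<le> l2_norm \<Omega> f + l2_norm \<Omega> g"
proof (rule power2_le_imp_le)
  have "Re (l2_inner \<Omega> f g) \<le> l2_norm \<Omega> f * l2_norm \<Omega> g"
    using complex_Re_le_cmod l2_Cauchy_Schwarz[OF assms] by (rule order_trans)
  then show "(l2_norm \<Omega> (\<lambda>z. f z + g z))\<^sup>2 \<le> (l2_norm \<Omega> f + l2_norm \<Omega> g)\<^sup>2"
    by (simp add: l2_norm_add_sq[OF assms] power2_sum)
qed simp

lemma l2_triangle_diff:
  assumes "f \<in> L2 \<Omega>" "g \<in> L2 \<Omega>" "h \<in> L2 \<Omega>"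
  shows "l2_norm \<Omega> (\<lambda>z. f z - h z) \<le> l2_norm \<Omega> (\<lambda>z. f z - g z) + l2_norm \<Omega> (\<lambda>z. g z - h z)"
  using l2_triangle[OF L2_diff[OF assms(1,2)] L2_diff[OF assms(2,3)]] by simp

lemma l2_triangle_sub:
  assumes "f \<in> L2 \<Omega>" "g \<in> L2 \<Omega>"
  shows "l2_norm \<Omega> f \<le> l2_norm \<Omega> (\<lambda>z. f z - g z) + l2_norm \<Omega> g"
  using l2_triangle_diff[OF assms L2_zero] by simp

lemma l2_norm_sum:
  assumes "\<And>i. i \<in> I \<Longrightarrow> f i \<in> L2 \<Omega>"
  shows "l2_norm \<Omega> (\<lambda>z. \<Sum>i\<in>I. f i z) \<le> (\<Sum>i\<in>I. l2_norm \<Omega> (f i))"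
  using assms
proof (induction I rule: infinite_finite_induct)
  case (insert i I)
  have "l2_norm \<Omega> (\<lambda>z. f i z + (\<Sum>i\<in>I. f i z)) \<le> l2_norm \<Omega> (f i) + l2_norm \<Omega> (\<lambda>z. \<Sum>i\<in>I. f i z)"
    by (intro l2_triangle L2_sum) (use insert in auto)
  with insert show ?case by force
qed auto

lemma l2_norm_mono:
  assumes "g \<in> L2 \<Omega>" "f \<in> L2 \<Omega>" "\<And>z. z \<in> \<Omega> \<Longrightarrow> cmod (f z) \<le> cmod (g z)"
  shows "l2_norm \<Omega> f \<le> l2_norm \<Omega> g"
  unfolding l2_norm_def
  using assms by (intro real_sqrt_le_mono integral_mono_AE AE_I2) (auto simp: L2_integrable_sq power_mono)

lemma l2_norm_mult_bounded:
  assumes f: "f \<in> L2 \<Omega>" and \<psi>: "\<psi> \<in> borel_measurable (lebesgue_on \<Omega>)"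
    and B: "\<And>z. z \<in> \<Omega> \<Longrightarrow> cmod (\<psi> z) \<le> B" and "B \<ge> 0"
  shows "l2_norm \<Omega> (\<lambda>z. \<psi> z * f z) \<le> B * l2_norm \<Omega> f"
proof -
  have "l2_norm \<Omega> (\<lambda>z. \<psi> z * f z) \<le> l2_norm \<Omega> (\<lambda>z. complex_of_real B * f z)"
    by (intro l2_norm_mono L2_scale f L2_mult_bounded[OF f \<psi> B])
       (use \<open>B \<ge> 0\<close> B in \<open>auto simp: norm_mult intro: mult_right_mono\<close>)
  with \<open>B \<ge> 0\<close> show ?thesis by (simp add: l2_norm_scale)
qed

lemma l2_norm_orthogonal_sum:
  assumes "finite I" "\<And>i. i \<in> I \<Longrightarrow> f i \<in> L2 \<Omega>"
    and orth: "\<And>i j. i \<in> I \<Longrightarrow> j \<in> I \<Longrightarrow> i \<noteq> j \<Longrightarrow> l2_inner \<Omega> (f i) (f j) = 0"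
  shows "(l2_norm \<Omega> (\<lambda>z. \<Sum>i\<in>I. f i z))\<^sup>2 = (\<Sum>i\<in>I. (l2_norm \<Omega> (f i))\<^sup>2)"
  using assms
proof (induction I rule: finite_induct)
  case (insert i I)
  have "l2_inner \<Omega> (f i) (\<lambda>z. \<Sum>i\<in>I. f i z) = (\<Sum>j\<in>I. l2_inner \<Omega> (f i) (f j))"
    by (intro l2_inner_sum_right) (use insert in auto)
  also have "\<dots> = 0"
    by (intro sum.neutral ballI) (use insert in auto)
  finally have "(l2_norm \<Omega> (\<lambda>z. f i z + (\<Sum>i\<in>I. f i z)))\<^sup>2
      = (l2_norm \<Omega> (f i))\<^sup>2 + (l2_norm \<Omega> (\<lambda>z. \<Sum>i\<in>I. f i z))\<^sup>2"
    by (subst l2_norm_add_sq) (use insert in \<open>auto intro: L2_sum\<close>)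
  moreover have "(l2_norm \<Omega> (\<lambda>z. \<Sum>i\<in>I. f i z))\<^sup>2 = (\<Sum>i\<in>I. (l2_norm \<Omega> (f i))\<^sup>2)"
    by (rule insert.IH) (use insert.prems in auto)
  ultimately show ?case using insert.hyps by simp
qed simp

section \<open>The torus action\<close>

definition act :: "complex \<Rightarrow> complex \<Rightarrow> C2 \<Rightarrow> C2" where
  "act \<xi> \<eta> z = (\<xi> * fst z, \<eta> * snd z)"

lemma fst_act [simp]: "fst (act \<xi> \<eta> z) = \<xi> * fst z"
  and snd_act [simp]: "snd (act \<xi> \<eta> z) = \<eta> * snd z"
  by (simp_all add: act_def)

lemma act_act: "act \<xi> \<eta> (act \<xi>' \<eta>' z) = act (\<xi> * \<xi>') (\<eta> * \<eta>') z"
  by (simp add: act_def mult.assoc)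

lemma act_1 [simp]: "act 1 1 z = z"
  by (simp add: act_def)

lemma continuous_on_act [continuous_intros]:
  "continuous_on A f \<Longrightarrow> continuous_on A g \<Longrightarrow> continuous_on A h \<Longrightarrow>
   continuous_on A (\<lambda>x. act (f x) (g x) (h x))"
  unfolding act_def by (intro continuous_intros)

lemma reinhardt_act:
  assumes "reinhardt S" "cmod \<xi> = 1" "cmod \<eta> = 1" "z \<in> S"
  shows "act \<xi> \<eta> z \<in> S"
  using assms unfolding reinhardt_def act_def by (metis prod.collapse)

lemma reinhardt_act_iff:
  assumes "reinhardt S" "cmod \<xi> = 1" "cmod \<eta> = 1"
  shows "act \<xi> \<eta> z \<in> S \<longleftrightarrow> z \<in> S"
proof
  assume "act \<xi> \<eta> z \<in> S"
  then have "act (inverse \<xi>) (inverse \<eta>) (act \<xi> \<eta> z) \<in> S"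
    by (rule reinhardt_act[rotated 3]) (use assms in \<open>auto simp: norm_inverse\<close>)
  moreover have "\<xi> \<noteq> 0" "\<eta> \<noteq> 0" using assms(2,3) by force+
  ultimately show "z \<in> S" by (simp add: act_act left_inverse)
qed (use assms reinhardt_act in blast)

text \<open>Identifying the complex plane with \<open>\<real>\<^sup>2\<close> makes the invariance of Lebesgue measure under orthogonal
  transformations applicable to rotations of the plane.\<close>

lemma lborel_complex_eq_distr_vec:
  "(lborel :: complex measure) = distr (lborel :: (real^2) measure) borel (\<lambda>v. Complex (v$1) (v$2))"
proof (rule lborel_eqI)
  let ?c = "\<lambda>v :: real^2. Complex (v$1) (v$2)"
  have cm: "?c \<in> borel_measurable borel"
    by (intro borel_measurable_continuous_onI) (auto simp: Complex_eq intro!: continuous_intros)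
  fix l u :: complex assume lu: "\<And>b. b \<in> Basis \<Longrightarrow> l \<bullet> b \<le> u \<bullet> b"
  have pre: "?c -` box l u = box (vector [Re l, Im l]) (vector [Re u, Im u])"
    by (auto simp: box_def Basis_complex_def Basis_vec_def forall_2 inner_axis)
  have [simp]: "(axis 1 1 :: real^2) \<noteq> axis 2 1"
    by (simp add: axis_eq_axis)
  have Ba: "Basis = {axis 1 1, axis 2 1 :: real^2}"
    by (auto simp: Basis_vec_def UNIV_2)
  have "Re l \<le> Re u" "Im l \<le> Im u"
    using lu[of 1] lu[of \<i>] by (auto simp: Basis_complex_def)
  then have "emeasure lborel (box (vector [Re l, Im l]) (vector [Re u, Im u]) :: (real^2) set)
      = ennreal ((Re u - Re l) * (Im u - Im l))"
    by (subst emeasure_lborel_box) (auto simp: inner_axis Ba)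
  moreover have "(\<Prod>b\<in>Basis. (u - l) \<bullet> b) = (Re u - Re l) * (Im u - Im l)"
    by (simp add: Basis_complex_def)
  ultimately show "emeasure (distr lborel borel ?c) (box l u) = (\<Prod>b\<in>Basis. (u - l) \<bullet> b)"
    using cm by (subst emeasure_distr) (auto simp: pre)
qed simp

text \<open>A rotation of the complex plane becomes, under the identification of the plane with
  \<open>\<real>\<^sup>2\<close>, an orthogonal transformation, and those preserve Lebesgue measure.\<close>

lemma lborel_distr_rotation:
  assumes "cmod \<xi> = 1"
  shows "distr lborel borel ((*) \<xi>) = (lborel :: complex measure)"
proof (rule lborel_eqI[symmetric])
  let ?c = "\<lambda>v :: real^2. Complex (v$1) (v$2)"
  let ?d = "\<lambda>z :: complex. vector [Re z, Im z] :: real^2"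
  define V where "V = (\<lambda>v. ?d (inverse \<xi> * ?c v))"
  have [simp]: "?d (?c v) = v" for v by (simp add: vec_eq_iff forall_2)
  have [simp]: "?c (?d z) = z" for z by simp
  have \<xi>0: "\<xi> \<noteq> 0" using assms by auto
  have ndist: "norm (?d z) = cmod z" for z
    by (simp add: norm_vec_def L2_set_def sum_2 cmod_def)
  have "orthogonal_transformation V"
    unfolding orthogonal_transformation
  proof
    show "linear V"
      by (rule linearI) (auto simp: V_def vec_eq_iff forall_2 algebra_simps add_divide_distrib Complex_eq)
    show "\<forall>v. norm (V v) = norm v"
    proof
      fix v
      have "norm (V v) = cmod (?c v)"
        unfolding V_def ndist using assms by (simp add: norm_mult norm_inverse)
      also have "\<dots> = norm (?d (?c v))" by (rule ndist[symmetric])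
      also have "?d (?c v) = v" by (simp add: vec_eq_iff forall_2)
      finally show "norm (V v) = norm v" .
    qed
  qed
  note V = this
  have cm: "?c \<in> borel_measurable borel"
    by (intro borel_measurable_continuous_onI) (auto simp: Complex_eq intro!: continuous_intros)
  fix l u :: complex assume lu: "\<And>b. b \<in> Basis \<Longrightarrow> l \<bullet> b \<le> u \<bullet> b"
  have xm: "(*) \<xi> \<in> borel_measurable borel"
    by (intro borel_measurable_continuous_onI continuous_intros)
  have xb: "(*) \<xi> -` box l u \<in> sets borel"
    using measurable_sets[OF xm, of "box l u"] by simp
  let ?B = "?c -` box l u"
  have pre: "?B = box (?d l) (?d u)"
    by (auto simp: box_def Basis_complex_def Basis_vec_def forall_2 inner_axis)
  have Vim: "?c -` ((*) \<xi> -` box l u) = V ` ?B"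
  proof (intro set_eqI iffI)
    fix v assume "v \<in> ?c -` ((*) \<xi> -` box l u)"
    then have "\<xi> * ?c v \<in> box l u" by simp
    moreover have "?c (?d (\<xi> * ?c v)) = \<xi> * ?c v" by (rule complex_eqI) simp_all
    ultimately have inB: "?d (\<xi> * ?c v) \<in> ?B" by (simp only: vimage_eq)
    have Vv: "V (?d (\<xi> * ?c v)) = v"
    proof -
      have "V (?d (\<xi> * ?c v)) = ?d (inverse \<xi> * (\<xi> * ?c v))"
        unfolding V_def by (rule arg_cong[where f = "\<lambda>w. ?d (inverse \<xi> * w)"]) (rule complex_eqI; simp)
      also have "inverse \<xi> * (\<xi> * ?c v) = ?c v" using \<xi>0 by (simp add: mult.assoc[symmetric])
      also have "?d (?c v) = v" by (simp add: vec_eq_iff forall_2)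
      finally show ?thesis .
    qed
    show "v \<in> V ` ?B" by (rule image_eqI[where f = V, OF Vv[symmetric] inB])
  next
    fix v assume "v \<in> V ` ?B"
    then obtain w where w: "?c w \<in> box l u" "v = V w" by auto
    have "?c v = inverse \<xi> * ?c w" unfolding w(2) V_def by (rule complex_eqI) simp_all
    then show "v \<in> ?c -` ((*) \<xi> -` box l u)" using w(1) \<xi>0 by (simp add: mult.assoc[symmetric])
  qed
  have lm: "?B \<in> lmeasurable" unfolding pre by (rule lmeasurable_box)
  have "emeasure (distr lborel borel ((*) \<xi>)) (box l u) = emeasure lborel ((*) \<xi> -` box l u)"
    using xm by (subst emeasure_distr) auto
  also have "\<dots> = emeasure (distr (lborel :: (real^2) measure) borel ?c) ((*) \<xi> -` box l u)"
    by (simp only: lborel_complex_eq_distr_vec[symmetric])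
  also have "\<dots> = emeasure lborel (V ` ?B)"
    using cm xb by (subst emeasure_distr) (auto simp: Vim[symmetric])
  also have "\<dots> = emeasure lebesgue (V ` ?B)"
    unfolding Vim[symmetric] using measurable_sets[OF cm xb] by (simp add: emeasure_completion)
  also have "\<dots> = emeasure lebesgue ?B"
    by (simp only: emeasure_eq_measure2[OF lm] measure_orthogonal_image[OF V lm]
        emeasure_eq_measure2[OF measurable_orthogonal_image[OF V lm]])
  also have "\<dots> = emeasure lborel ?B"
    unfolding pre by (simp add: emeasure_completion)
  also have "\<dots> = emeasure (lborel :: complex measure) (box l u)"
    by (subst lborel_complex_eq_distr_vec, subst emeasure_distr) (use cm in auto)
  also have "\<dots> = (\<Prod>b\<in>Basis. (u - l) \<bullet> b)"
    using lu by (simp add: emeasure_lborel_box)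
  finally show "emeasure (distr lborel borel ((*) \<xi>)) (box l u) = (\<Prod>b\<in>Basis. (u - l) \<bullet> b)" .
qed simp

lemma measurable_act: "act \<xi> \<eta> \<in> borel_measurable borel"
  by (intro borel_measurable_continuous_onI) (intro continuous_intros)

lemma lborel_distr_act:
  assumes "cmod \<xi> = 1" "cmod \<eta> = 1"
  shows "distr lborel borel (act \<xi> \<eta>) = lborel"
proof -
  have xm: "(*) c \<in> borel_measurable borel" for c :: complex
    by (intro borel_measurable_continuous_onI continuous_intros)
  have "distr lborel borel ((*) \<xi>) \<Otimes>\<^sub>M distr lborel borel ((*) \<eta>)
      = distr (lborel \<Otimes>\<^sub>M lborel) (borel \<Otimes>\<^sub>M borel) (\<lambda>(x, y). (\<xi> * x, \<eta> * y))"
    using xm by (intro pair_measure_distr)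
      (auto simp: lborel_distr_rotation[OF assms(2)] intro: lborel.sigma_finite_measure_axioms)
  moreover have "act \<xi> \<eta> = (\<lambda>(x, y). (\<xi> * x, \<eta> * y))"
    by (auto simp: act_def)
  ultimately show ?thesis
    by (simp add: lborel_distr_rotation assms lborel_prod borel_prod)
qed

lemma nn_integral_act:
  assumes "F \<in> borel_measurable borel" "cmod \<xi> = 1" "cmod \<eta> = 1"
  shows "(\<integral>\<^sup>+z. F (act \<xi> \<eta> z) \<partial>lborel) = (\<integral>\<^sup>+z. F z \<partial>lborel)"
  using assms nn_integral_distr[of "act \<xi> \<eta>" lborel borel F] measurable_act[of \<xi> \<eta>]
  by (simp add: lborel_distr_act)

lemma open_sets_lebesgue: "open S \<Longrightarrow> S \<in> sets lebesgue" for S :: "'a::euclidean_space set"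
  by (simp add: sets_completionI_sets)

lemma borel_measurable_lebesgue_on_continuous:
  fixes g :: "C2 \<Rightarrow> complex"
  assumes "open S" "continuous_on S g"
  shows "g \<in> borel_measurable (lebesgue_on S)"
  by (rule continuous_imp_measurable_on_sets_lebesgue[OF assms(2) open_sets_lebesgue[OF assms(1)]])

lemma lebesgue_on_integral_eq_lborel:
  fixes g :: "C2 \<Rightarrow> 'b::euclidean_space"
  assumes "open S" "continuous_on S g"
  shows "(LINT z|lebesgue_on S. g z) = (LINT z|lborel. indicator S z *\<^sub>R g z)"
proof -
  have "(LINT z|lebesgue_on S. g z) = (LINT z|lebesgue. indicator S z *\<^sub>R g z)"
    using open_sets_lebesgue[OF assms(1)] by (subst integral_restrict_space) auto
  also have "\<dots> = (LINT z|lborel. indicator S z *\<^sub>R g z)"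
    using assms by (intro integral_completion) (simp add: borel_measurable_continuous_on_indicator)
  finally show ?thesis .
qed

lemma lebesgue_on_nn_integral_eq_lborel:
  fixes g :: "C2 \<Rightarrow> ennreal"
  assumes "open S"
  shows "(\<integral>\<^sup>+z. g z \<partial>lebesgue_on S) = (\<integral>\<^sup>+z. g z * indicator S z \<partial>lborel)"
proof -
  have "(\<integral>\<^sup>+z. g z \<partial>lebesgue_on S) = (\<integral>\<^sup>+z. g z * indicator S z \<partial>lebesgue)"
    using open_sets_lebesgue[OF assms(1)] by (subst nn_integral_restrict_space) auto
  then show ?thesis by (simp add: nn_integral_completion)
qed

text \<open>Continuity on the open set lets the integral be computed with Borel measure, where the change of variables
  \<open>z \<mapsto> (\<xi> z\<^sub>1, \<eta> z\<^sub>2)\<close> is available coordinate by coordinate.\<close>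

lemma integral_lebesgue_on_act:
  fixes g :: "C2 \<Rightarrow> 'b::euclidean_space"
  assumes S: "open S" "reinhardt S" and g: "continuous_on S g" and "cmod \<xi> = 1" "cmod \<eta> = 1"
  shows "(LINT z|lebesgue_on S. g (act \<xi> \<eta> z)) = (LINT z|lebesgue_on S. g z)"
proof -
  have c: "continuous_on S (\<lambda>z. g (act \<xi> \<eta> z))"
    by (rule continuous_on_compose2[OF g]) (use assms in \<open>auto intro!: continuous_intros reinhardt_act\<close>)
  have "(LINT z|lebesgue_on S. g (act \<xi> \<eta> z)) = (LINT z|lborel. indicator S (act \<xi> \<eta> z) *\<^sub>R g (act \<xi> \<eta> z))"
    unfolding lebesgue_on_integral_eq_lborel[OF S(1) c]
    by (simp add: indicator_def reinhardt_act_iff assms)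
  also have "\<dots> = (LINT z|distr lborel borel (act \<xi> \<eta>). indicator S z *\<^sub>R g z)"
    using S g measurable_act
    by (intro integral_distr[symmetric]) (auto simp: borel_measurable_continuous_on_indicator)
  also have "\<dots> = (LINT z|lebesgue_on S. g z)"
    by (simp add: lborel_distr_act assms lebesgue_on_integral_eq_lborel)
  finally show ?thesis .
qed

lemma l2_inner_act:
  assumes "open S" "reinhardt S" "continuous_on S f" "continuous_on S g" "cmod \<xi> = 1" "cmod \<eta> = 1"
  shows "l2_inner S (\<lambda>z. f (act \<xi> \<eta> z)) (\<lambda>z. g (act \<xi> \<eta> z)) = l2_inner S f g"
  unfolding l2_inner_def
  by (rule integral_lebesgue_on_act[of S "\<lambda>z. f z * cnj (g z)"]) (intro assms continuous_intros)+

lemma L2_continuous_iff: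
  assumes "open S" "continuous_on S g"
  shows "g \<in> L2 S \<longleftrightarrow> (\<integral>\<^sup>+z. ennreal ((cmod (g z))\<^sup>2) * indicator S z \<partial>lborel) < \<infinity>"
proof -
  have "g \<in> L2 S \<longleftrightarrow> integrable (lebesgue_on S) (\<lambda>z. (cmod (g z))\<^sup>2)"
    using borel_measurable_lebesgue_on_continuous[OF assms] by (simp add: L2_def)
  also have "\<dots> \<longleftrightarrow> (\<integral>\<^sup>+z. ennreal ((cmod (g z))\<^sup>2) \<partial>lebesgue_on S) < \<infinity>"
    using borel_measurable_lebesgue_on_continuous[OF assms] by (simp add: integrable_iff_bounded)
  finally show ?thesis by (simp add: lebesgue_on_nn_integral_eq_lborel[OF assms(1)])
qed

lemma L2_nn_integral:
  assumes "open S" "g \<in> L2 S"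
  shows "(\<integral>\<^sup>+z. ennreal ((cmod (g z))\<^sup>2) * indicator S z \<partial>lborel) = ennreal ((l2_norm S g)\<^sup>2)"
  unfolding lebesgue_on_nn_integral_eq_lborel[OF assms(1), symmetric] l2_norm_sq
  by (rule nn_integral_eq_integral) (use assms in \<open>auto simp: L2_integrable_sq\<close>)

section \<open>Fourier coefficients along the torus action\<close>

text \<open>The character \<open>e\<^bsup>2\<pi>it\<^esup>\<close> of the circle, parametrised so that the period is 1.\<close>

definition ex :: "real \<Rightarrow> complex" where "ex t = cis (2 * pi * t)"

lemma norm_ex [simp]: "cmod (ex t) = 1" by (simp add: ex_def)
lemma ex_0 [simp]: "ex 0 = 1" by (simp add: ex_def)
lemma ex_add: "ex (s + t) = ex s * ex t" by (simp add: ex_def cis_mult distrib_left)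
lemma ex_minus: "ex (- t) = cnj (ex t)" by (simp add: ex_def cis_cnj)
lemma ex_cnj: "ex t * cnj (ex t) = 1" by (simp add: complex_norm_square[symmetric])
lemma ex_of_int [simp]: "ex (of_int k) = 1"
  using cis_multiple_2pi[of "of_int k"] by (simp add: ex_def)
lemma ex_power: "ex t ^ n = ex (of_nat n * t)"
  using Complex.DeMoivre[of "2 * pi * t" n] by (simp only: ex_def mult.left_commute mult.assoc)
lemma continuous_on_ex [continuous_intros]: "continuous_on A f \<Longrightarrow> continuous_on A (\<lambda>x. ex (f x))"
  unfolding ex_def by (intro continuous_intros)
lemma ex_nonzero [simp]: "ex t \<noteq> 0" by (simp add: ex_def)

lemma has_integral_complex_of_realD:
  "((\<lambda>t. complex_of_real (f t)) has_integral of_real I) S \<Longrightarrow> (f has_integral I) S"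
  using has_integral_linear[OF _ bounded_linear_Re, of "\<lambda>t. complex_of_real (f t)" "of_real I" S]
  by (simp add: o_def)

lemma unimodular_ex:
  assumes "cmod \<xi> = 1" obtains t where "\<xi> = ex t"
proof -
  have "\<xi> = cis (Arg \<xi>)" using assms cis_Arg[of \<xi>] by (force simp: sgn_eq)
  then have "\<xi> = ex (Arg \<xi> / (2*pi))" by (simp add: ex_def)
  then show ?thesis using that by blast
qed

lemma has_integral_ex:
  "((\<lambda>t. ex (of_int k * t)) has_integral (if k = 0 then 1 else 0)) {0..1}"
proof (cases "k = 0")
  case True
  then show ?thesis using has_integral_const_real[of "1::complex" 0 1] by simp
next
  case False
  define c where "c = 2 * pi * of_int k * \<i>"
  have c0: "c \<noteq> 0" using False by (simp add: c_def)
  have e: "ex (of_int k * t) = exp (c * of_real t)" for t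
    by (simp add: ex_def cis_conv_exp c_def mult_ac)
  have "((\<lambda>t. exp (c * of_real t) / c) has_vector_derivative exp (c * of_real t)) (at t within {0..1})" for t
    by (rule has_vector_derivative_real_field) (use c0 in \<open>auto intro!: derivative_eq_intros\<close>)
  then have "((\<lambda>t. exp (c * of_real t)) has_integral (exp (c * of_real 1) / c - exp (c * of_real 0) / c)) {0..1}"
    by (intro fundamental_theorem_of_calculus) auto
  moreover have "exp (c * of_real 1) = 1" using e[of 1] by simp
  ultimately show ?thesis using False by (simp add: e)
qed

lemma integral_periodic_shift:
  fixes h :: "real \<Rightarrow> complex"
  assumes c: "continuous_on UNIV h" and p: "\<And>t. h (t + 1) = h t"
  shows "integral {0..1} (\<lambda>t. h (t + s)) = integral {0..1} h"
proof -
  have int: "h integrable_on {a..b}" for a b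
    by (intro integrable_continuous_real continuous_on_subset[OF c]) auto
  have sh: "integral {a..b} (\<lambda>t. h (t + r)) = integral {a+r..b+r} h" for a b r
    using integral_shift_real_ivl[of "a+r" r "b+r" h] by (simp add: add.commute)
  define G where "G = (\<lambda>s. integral {0..1} (\<lambda>t. h (t + s)))"
  have fr: "G s = G 0" if "0 \<le> s" "s \<le> 1" for s
  proof -
    have "G s = integral {s..1} h + integral {1..1+s} h"
      unfolding G_def sh using that by (subst Henstock_Kurzweil_Integration.integral_combine[OF _ _ int]) (auto simp: add.commute)
    also have "integral {1..1+s} h = integral {0..s} (\<lambda>t. h (t + 1))"
      unfolding sh by (simp add: add.commute)
    also have "\<dots> = integral {0..s} h" by (simp add: p)
    also have "integral {s..1} h + integral {0..s} h = integral {0..1} h"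
      using Henstock_Kurzweil_Integration.integral_combine[OF that int] by (simp add: add.commute)
    finally show ?thesis by (simp add: G_def)
  qed
  have pn: "h (t + of_nat n) = h t" for t n
    by (induction n) (auto simp: p add.assoc[symmetric] add.commute[of 1])
  have pz: "h (t + of_int n) = h t" for t n
  proof (cases "n \<ge> 0")
    case True then show ?thesis using pn[of t "nat n"] by simp
  next
    case False then show ?thesis using pn[of "t + of_int n" "nat (-n)"] by simp
  qed
  have "h (t + s) = h (t + frac s)" for t
    using pz[of "t + frac s" "\<lfloor>s\<rfloor>"] by (simp add: frac_def)
  then have "G s = G (frac s)" by (simp add: G_def)
  also have "\<dots> = G 0" by (intro fr) (auto simp: frac_lt_1 less_imp_le)
  finally show ?thesis by (simp add: G_def)
qed

text \<open>The Fourier coefficient with index \<open>k\<close> along the orbit of a one-parameter group of rotations.  With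
  \<open>(p, q) = (1, 0)\<close> or \<open>(0, 1)\<close> only the first or only the second coordinate rotates.\<close>

definition fcoef :: "real \<Rightarrow> real \<Rightarrow> int \<Rightarrow> (C2 \<Rightarrow> complex) \<Rightarrow> C2 \<Rightarrow> complex" where
  "fcoef p q k g z = integral {0..1} (\<lambda>t. g (act (ex (p * t)) (ex (q * t)) z) * ex (- of_int k * t))"

abbreviation axis_weights :: "real \<Rightarrow> real \<Rightarrow> bool" where
  "axis_weights p q \<equiv> (p, q) = (1, 0) \<or> (p, q) = (0, 1)"

lemma continuous_on_orbit:
  assumes "reinhardt S" "continuous_on S g" "z \<in> S"
  shows "continuous_on A (\<lambda>t. g (act (ex (p * t)) (ex (q * t)) z))"
  by (rule continuous_on_compose2[OF assms(2)]) (use assms in \<open>auto intro!: continuous_intros reinhardt_act\<close>)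

lemma continuous_on_fcoef:
  assumes S: "reinhardt S" and g: "continuous_on S g"
  shows "continuous_on S (fcoef p q k g)"
proof -
  have "continuous_on (S \<times> cbox 0 1) (\<lambda>(z, t). g (act (ex (p * t)) (ex (q * t)) z) * ex (- of_int k * t))"
    unfolding case_prod_beta
    by (intro continuous_intros continuous_on_compose2[OF g])
      (use S in \<open>auto intro!: continuous_intros reinhardt_act\<close>)
  from integral_continuous_on_param[OF this] show ?thesis
    by (simp add: fcoef_def[abs_def] cbox_interval)
qed

lemma fcoef_homogeneous:
  assumes S: "reinhardt S" "continuous_on S g" "z \<in> S" and w: "axis_weights p q"
  shows "fcoef p q k g (act (ex (p * s)) (ex (q * s)) z) = ex (of_int k * s) * fcoef p q k g z"
proof -
  define h where "h = (\<lambda>t. g (act (ex (p * t)) (ex (q * t)) z) * ex (- of_int k * t))"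
  have c: "continuous_on UNIV h"
    unfolding h_def by (intro continuous_intros continuous_on_orbit[OF S])
  have e1: "ex (t + 1) = ex t" "ex (- of_int k * (t + 1)) = ex (- of_int k * t)" for t
    using ex_add[of t 1] ex_add[of "- of_int k * t" "of_int (-k)"] ex_of_int[of 1] ex_of_int[of "-k"]
    by (simp_all add: algebra_simps del: ex_of_int)
  have p: "h (t + 1) = h t" for t
    using w unfolding h_def e1 by (auto simp: e1)
  have "fcoef p q k g (act (ex (p * s)) (ex (q * s)) z)
      = integral {0..1} (\<lambda>t. ex (of_int k * s) * h (t + s))"
    unfolding fcoef_def h_def
    by (intro integral_cong) (simp add: act_act ex_add[symmetric] distrib_left mult_ac algebra_simps)
  also have "\<dots> = ex (of_int k * s) * integral {0..1} (\<lambda>t. h (t + s))"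
    by simp
  also have "integral {0..1} (\<lambda>t. h (t + s)) = integral {0..1} h"
    by (rule integral_periodic_shift[OF c p])
  finally show ?thesis by (simp add: h_def fcoef_def)
qed

lemma fcoef_preserves_homogeneous:
  assumes S: "reinhardt S" "z \<in> S" and u: "cmod \<xi> = 1" "cmod \<eta> = 1"
    and h: "\<And>w. w \<in> S \<Longrightarrow> g (act \<xi> \<eta> w) = c * g w"
  shows "fcoef p q k g (act \<xi> \<eta> z) = c * fcoef p q k g z"
proof -
  have "g (act (ex (p * t)) (ex (q * t)) (act \<xi> \<eta> z)) = c * g (act (ex (p * t)) (ex (q * t)) z)" for t
    using h[of "act (ex (p * t)) (ex (q * t)) z"] S by (simp add: act_act mult.commute reinhardt_act)
  then show ?thesis by (simp add: fcoef_def mult.assoc)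
qed

lemma fcoef_sum:
  assumes S: "reinhardt S" "z \<in> S" and g: "\<And>i. i \<in> I \<Longrightarrow> continuous_on S (g i)"
  shows "fcoef p q k (\<lambda>z. \<Sum>i\<in>I. w i * g i z) z = (\<Sum>i\<in>I. w i * fcoef p q k (g i) z)"
proof (cases "finite I")
  case True
  have int: "(\<lambda>t. g i (act (ex (p * t)) (ex (q * t)) z) * ex (- of_int k * t)) integrable_on {0..1}"
    if "i \<in> I" for i
    by (intro integrable_continuous_real continuous_intros continuous_on_orbit[OF S(1) g S(2)] that)
  have "fcoef p q k (\<lambda>z. \<Sum>i\<in>I. w i * g i z) z
      = integral {0..1} (\<lambda>t. \<Sum>i\<in>I. w i * (g i (act (ex (p * t)) (ex (q * t)) z) * ex (- of_int k * t)))"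
    by (simp add: fcoef_def sum_distrib_right mult.assoc)
  also have "\<dots> = (\<Sum>i\<in>I. integral {0..1} (\<lambda>t. w i * (g i (act (ex (p * t)) (ex (q * t)) z) * ex (- of_int k * t))))"
    by (intro integral_sum True integrable_on_mult_right int)
  finally show ?thesis by (simp add: fcoef_def)
qed (simp add: fcoef_def)

subsection \<open>Approximation by the de la Vallee-Poussin kernel\<close>

definition vp_weight :: "nat \<Rightarrow> nat \<Rightarrow> real" where
  "vp_weight n i = of_nat ((2*n) choose i) / of_nat ((2*n) choose n)"

text \<open>By the binomial theorem \<open>|1 + e\<^bsup>2\<pi>it\<^esup>|\<^bsup>2n\<^esup>\<close> is a nonnegative trigonometric polynomial with explicit coefficients;
  dividing by the central one gives it mean 1.\<close>

definition vp_kernel :: "nat \<Rightarrow> real \<Rightarrow> real" where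
  "vp_kernel n t = (cmod (1 + ex t))^(2*n) / of_nat ((2*n) choose n)"

lemma vp_kernel_nonneg: "vp_kernel n t \<ge> 0" by (simp add: vp_kernel_def)

lemma vp_kernel_eq:
  "complex_of_real (vp_kernel n t) = (\<Sum>i\<le>2*n. of_real (vp_weight n i) * ex (of_int (int i - int n) * t))"
proof -
  have sq: "of_real ((cmod (1 + ex t))\<^sup>2) = (1 + ex t)^2 * ex (-t)"
    unfolding complex_norm_square using ex_cnj[of t] by (simp add: ex_minus algebra_simps power2_eq_square)
  have "complex_of_real ((cmod (1 + ex t))^(2*n)) = ((1 + ex t)^2 * ex (-t))^n"
    unfolding power_mult using sq by (metis of_real_power)
  also have "\<dots> = (ex t + 1)^(2*n) * ex (- (of_nat n * t))"
    by (simp add: power_mult_distrib power_mult[symmetric] ex_power add.commute)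
  also have "\<dots> = (\<Sum>i\<le>2*n. of_nat ((2*n) choose i) * ex (of_int (int i - int n) * t))"
    unfolding binomial_ring sum_distrib_right
  proof (intro sum.cong refl)
    fix i
    have "ex (of_nat i * t) * ex (- (of_nat n * t)) = ex (of_int (int i - int n) * t)"
      unfolding ex_add[symmetric] by (simp add: algebra_simps)
    then show "of_nat (2 * n choose i) * ex t ^ i * 1 ^ (2 * n - i) * ex (- (of_nat n * t)) =
         of_nat (2 * n choose i) * ex (of_int (int i - int n) * t)"
      by (simp add: ex_power mult.assoc)
  qed
  finally show ?thesis
    by (simp add: vp_kernel_def vp_weight_def sum_divide_distrib)
qed

lemma continuous_on_vp_kernel [continuous_intros]: "continuous_on A (vp_kernel n)"
  unfolding vp_kernel_def[abs_def] by (intro continuous_intros) auto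

lemma vp_kernel_coef:
  assumes "\<bar>k\<bar> \<le> int n"
  shows "((\<lambda>t. complex_of_real (vp_kernel n t) * ex (of_int k * t)) has_integral
     of_real (vp_weight n (nat (int n - k)))) {0..1}"
proof -
  have "((\<lambda>t. \<Sum>i\<le>2*n. of_real (vp_weight n i) * ex (of_int (int i - int n + k) * t)) has_integral
     (\<Sum>i\<le>2*n. of_real (vp_weight n i) * (if int i - int n + k = 0 then 1 else 0))) {0..1}"
    by (intro has_integral_sum has_integral_mult_right has_integral_ex) auto
  moreover have "(\<Sum>i\<le>2*n. of_real (vp_weight n i) * (if int i - int n + k = 0 then 1 else 0))
      = (\<Sum>i\<le>2*n. if i = nat (int n - k) then complex_of_real (vp_weight n i) else 0)"
    using assms by (intro sum.cong) auto
  moreover have "\<dots> = of_real (vp_weight n (nat (int n - k)))"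
    using assms by (subst sum.delta) auto
  moreover have "(\<Sum>i\<le>2*n. of_real (vp_weight n i) * ex (of_int (int i - int n + k) * t))
      = complex_of_real (vp_kernel n t) * ex (of_int k * t)" for t
  proof -
    have e: "ex (of_int (int i - int n) * t) * ex (of_int k * t) = ex (of_int (int i - int n + k) * t)" for i
      unfolding ex_add[symmetric] by (simp add: algebra_simps)
    show ?thesis unfolding vp_kernel_eq sum_distrib_right by (simp only: mult.assoc e)
  qed
  ultimately show ?thesis by simp
qed

lemma vp_kernel_integral: "(vp_kernel n has_integral 1) {0..1}"
proof -
  have "((\<lambda>t. complex_of_real (vp_kernel n t)) has_integral of_real 1) {0..1}"
    using vp_kernel_coef[of 0 n] by (simp add: vp_weight_def)
  then show ?thesis by (intro has_integral_complex_of_realD) simp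
qed

text \<open>The second moment \<open>2 - 2n/(n+1)\<close> tends to 0, so the kernel is an approximate identity.\<close>

lemma vp_kernel_moment:
  assumes "n > 0"
  shows "((\<lambda>t. vp_kernel n t * (cmod (ex t - 1))\<^sup>2) has_integral (2 / (of_nat n + 1))) {0..1}"
proof -
  have w: "vp_weight n (nat (int n - 1)) = of_nat n / (of_nat n + 1)" "vp_weight n (nat (int n + 1)) = of_nat n / (of_nat n + 1)"
  proof -
    obtain m where m: "n = Suc m" using assms by (cases n) auto
    have "2 * n - n = n" by simp
    with binomial_absorb_comp[of "2*n" n] have "n * (2*n choose n) = 2 * n * (2 * n - 1 choose n)"
      by (simp only:)
    then have "Suc n * (2*n choose Suc n) = n * (2*n choose n)"
      using binomial_absorption[of n "2*n"] by (simp only:)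
    then have "(of_nat n + 1) * real (2*n choose Suc n) = of_nat n * real (2*n choose n)"
      by (metis of_nat_Suc of_nat_mult add.commute)
    moreover have "real (2*n choose n) > 0" by simp
    ultimately show *: "vp_weight n (nat (int n + 1)) = of_nat n / (of_nat n + 1)"
      by (simp add: vp_weight_def field_simps nat_add_distrib)
    have "(2*n choose (n - 1)) = (2*n choose Suc n)"
      using assms binomial_symmetric[of "n - 1" "2*n"] by (simp add: m)
    then show "vp_weight n (nat (int n - 1)) = of_nat n / (of_nat n + 1)"
      using * assms by (simp add: vp_weight_def nat_diff_distrib nat_add_distrib)
  qed
  have id: "complex_of_real (vp_kernel n t * (cmod (ex t - 1))\<^sup>2)
     = 2 * of_real (vp_kernel n t) - of_real (vp_kernel n t) * ex (of_int 1 * t)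
      - of_real (vp_kernel n t) * ex (of_int (-1) * t)" for t
    unfolding of_real_mult complex_norm_square using ex_cnj[of t]
    by (simp add: ex_minus algebra_simps)
  have "((\<lambda>t. complex_of_real (vp_kernel n t * (cmod (ex t - 1))\<^sup>2)) has_integral
     (2 * of_real 1 - of_real (vp_weight n (nat (int n - 1))) - of_real (vp_weight n (nat (int n - (-1)))))) {0..1}"
    unfolding id using assms
    by (intro has_integral_diff has_integral_mult_right vp_kernel_coef has_integral_of_real vp_kernel_integral) auto
  moreover have "2 * of_real 1 - of_real (vp_weight n (nat (int n - 1))) - of_real (vp_weight n (nat (int n - (-1))))
     = complex_of_real (2 / (of_nat n + 1))"
  proof -
    have "2 - real n / (real n + 1) - real n / (real n + 1) = 2 - 2 * real n / (real n + 1)"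
      by simp
    also have "\<dots> = 2 / (real n + 1)"
      by (simp add: field_simps)
    finally have "2 - real n / (real n + 1) - real n / (real n + 1) = 2 / (real n + 1)" .
    then have "complex_of_real (2 - real n / (real n + 1) - real n / (real n + 1)) = of_real (2 / (real n + 1))"
      by (simp only:)
    then show ?thesis unfolding diff_minus_eq_add w by simp
  qed
  ultimately show ?thesis by (intro has_integral_complex_of_realD) simp
qed

lemma cmod_diff_triangle: "cmod (a - c) \<le> cmod (a - b) + cmod (b - c)"
  using norm_triangle_ineq[of "a - b" "b - c"] by simp

text \<open>Convolution with the kernel is a finite sum of Fourier coefficients.  Close to \<open>t = 0\<close> uniform continuity
  controls the difference of the values; elsewhere that difference is at most a constant times \<open>|e\<^bsup>2\<pi>it\<^esup> - 1|\<^sup>2\<close>, whose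
  mean against the kernel is the second moment.\<close>

lemma fcoef_approx:
  assumes S: "compact S" "reinhardt S" and g: "continuous_on S g" and w: "axis_weights p q" and "\<epsilon> > 0"
  shows "\<exists>n. \<forall>z\<in>S. cmod (g z - (\<Sum>i\<le>2*n. of_real (vp_weight n i) * fcoef p q (int n - int i) g z)) < \<epsilon>"
proof -
  let ?a = "\<lambda>t. act (ex (p * t)) (ex (q * t))"
  obtain \<delta> where \<delta>: "\<delta> > 0" "\<And>z w. z \<in> S \<Longrightarrow> w \<in> S \<Longrightarrow> dist z w < \<delta> \<Longrightarrow> dist (g z) (g w) < \<epsilon>/2"
    using compact_uniformly_continuous[OF g S(1)] \<open>\<epsilon> > 0\<close>
    unfolding uniformly_continuous_on_def by (metis half_gt_zero)
  obtain B where B: "\<And>z. z \<in> S \<Longrightarrow> cmod (g z) \<le> B"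
    using compact_imp_bounded[OF compact_continuous_image[OF g S(1)]] unfolding bounded_iff by auto
  obtain R where R: "\<And>z. z \<in> S \<Longrightarrow> norm z \<le> R"
    using compact_imp_bounded[OF S(1)] unfolding bounded_iff by auto
  define C where "C = 2 * \<bar>B\<bar> * R\<^sup>2 / \<delta>\<^sup>2"
  have C0: "C \<ge> 0" by (simp add: C_def)
  have key: "cmod (g z - g (?a t z)) \<le> \<epsilon>/2 + C * (cmod (ex t - 1))\<^sup>2" if z: "z \<in> S" for z t
  proof -
    have az: "?a t z \<in> S" by (intro reinhardt_act S z) auto
    have d: "dist z (?a t z) \<le> cmod (ex t - 1) * R"
    proof -
      have "dist z (?a t z) = norm (?a t z - z)" by (simp add: dist_norm norm_minus_commute)
      also have "?a t z - z = ((ex (p*t) - 1) * fst z, (ex (q*t) - 1) * snd z)"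
        by (auto simp: act_def algebra_simps intro: prod_eqI)
      also have "norm \<dots> \<le> cmod (ex t - 1) * norm z"
        using w norm_fst_le[of "fst z" "snd z"] norm_snd_le[of "snd z" "fst z"]
        by (auto simp: norm_Pair norm_mult intro!: mult_left_mono)
      also have "\<dots> \<le> cmod (ex t - 1) * R" using R[OF z] by (intro mult_left_mono) auto
      finally show ?thesis .
    qed
    show ?thesis
    proof (cases "dist z (?a t z) < \<delta>")
      case True
      have "0 \<le> C * (cmod (ex t - 1))\<^sup>2" using C0 by simp
      then show ?thesis using \<delta>(2)[OF z az True] by (simp add: dist_norm)
    next
      case False
      then have "\<delta> \<le> cmod (ex t - 1) * R" using d by linarith
      then have "\<delta>\<^sup>2 \<le> (cmod (ex t - 1) * R)\<^sup>2" using \<delta>(1) by (intro power_mono) auto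
      then have "1 \<le> (cmod (ex t - 1))\<^sup>2 * R\<^sup>2 / \<delta>\<^sup>2" using \<delta>(1) by (simp add: power_mult_distrib)
      then have "2 * \<bar>B\<bar> * 1 \<le> 2 * \<bar>B\<bar> * ((cmod (ex t - 1))\<^sup>2 * R\<^sup>2 / \<delta>\<^sup>2)"
        by (intro mult_left_mono) auto
      also have "\<dots> = C * (cmod (ex t - 1))\<^sup>2" by (simp add: C_def)
      finally have "2 * \<bar>B\<bar> \<le> C * (cmod (ex t - 1))\<^sup>2" by simp
      moreover have "cmod (g z - g (?a t z)) \<le> 2 * \<bar>B\<bar>"
        using norm_triangle_ineq4[of "g z" "g (?a t z)"] B[OF z] B[OF az] by linarith
      ultimately show ?thesis using \<open>\<epsilon> > 0\<close> by linarith
    qed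
  qed
  obtain n :: nat where n: "n > 0" "C * (2 / (real n + 1)) < \<epsilon>/2"
  proof -
    obtain n :: nat where "real n > 4 * C / \<epsilon>" using reals_Archimedean2 by blast
    then have "4 * C < \<epsilon> * (real (Suc n) + 1)" using \<open>\<epsilon> > 0\<close> by (simp add: field_simps)
    then show ?thesis using that[of "Suc n"] \<open>\<epsilon> > 0\<close> by (simp add: field_simps)
  qed
  show ?thesis
  proof (intro exI ballI)
    fix z assume z: "z \<in> S"
    let ?W = "\<Sum>i\<le>2*n. of_real (vp_weight n i) * fcoef p q (int n - int i) g z"
    have "((\<lambda>t. \<Sum>i\<le>2*n. of_real (vp_weight n i) * (g (?a t z) * ex (- of_int (int n - int i) * t))) has_integral ?W) {0..1}"
      unfolding fcoef_def
      by (intro has_integral_sum has_integral_mult_right integrable_integral integrable_continuous_real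
          continuous_intros continuous_on_orbit[OF S(2) g z]) auto
    moreover have "(\<Sum>i\<le>2*n. of_real (vp_weight n i) * (g (?a t z) * ex (- of_int (int n - int i) * t)))
        = of_real (vp_kernel n t) * g (?a t z)" for t
      unfolding vp_kernel_eq sum_distrib_right by (intro sum.cong) (simp_all add: mult_ac)
    ultimately have W: "((\<lambda>t. of_real (vp_kernel n t) * g (?a t z)) has_integral ?W) {0..1}" by simp
    have "((\<lambda>t. of_real (vp_kernel n t) * g z) has_integral (of_real 1 * g z)) {0..1}"
      by (intro has_integral_mult_left has_integral_of_real vp_kernel_integral)
    then have 1: "((\<lambda>t. of_real (vp_kernel n t) * g z - of_real (vp_kernel n t) * g (?a t z)) has_integral (of_real 1 * g z - ?W)) {0..1}"
      by (intro has_integral_diff W)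
    have 2: "((\<lambda>t. vp_kernel n t * (\<epsilon>/2) + C * (vp_kernel n t * (cmod (ex t - 1))\<^sup>2)) has_integral
         (1 * (\<epsilon>/2) + C * (2 / (real n + 1)))) {0..1}"
      by (intro has_integral_add has_integral_mult_left has_integral_mult_right vp_kernel_integral vp_kernel_moment n)
    have 3: "norm (of_real (vp_kernel n t) * g z - of_real (vp_kernel n t) * g (?a t z))
        \<le> vp_kernel n t * (\<epsilon>/2) + C * (vp_kernel n t * (cmod (ex t - 1))\<^sup>2)" for t
    proof -
      have "norm (of_real (vp_kernel n t) * g z - of_real (vp_kernel n t) * g (?a t z))
          = vp_kernel n t * cmod (g z - g (?a t z))"
        using vp_kernel_nonneg[of n t] by (simp add: norm_mult right_diff_distrib[symmetric])
      also have "\<dots> \<le> vp_kernel n t * (\<epsilon>/2 + C * (cmod (ex t - 1))\<^sup>2)"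
        by (intro mult_left_mono key z vp_kernel_nonneg)
      finally show ?thesis by (simp add: algebra_simps)
    qed
    have "norm (integral {0..1} (\<lambda>t. of_real (vp_kernel n t) * g z - of_real (vp_kernel n t) * g (?a t z)))
        \<le> integral {0..1} (\<lambda>t. vp_kernel n t * (\<epsilon>/2) + C * (vp_kernel n t * (cmod (ex t - 1))\<^sup>2))"
      by (rule integral_norm_bound_integral[OF has_integral_integrable[OF 1] has_integral_integrable[OF 2] 3])
    then have "cmod (of_real 1 * g z - ?W) \<le> 1 * (\<epsilon>/2) + C * (2 / (real n + 1))"
      by (simp only: integral_unique[OF 1] integral_unique[OF 2])
    then have "cmod (g z - ?W) \<le> \<epsilon>/2 + C * (2 / (real n + 1))"
      by (simp only: of_real_1 mult_1)
    with n(2) show "cmod (g z - ?W) < \<epsilon>" by linarith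
  qed
qed

text \<open>The component of bidegree \<open>(k, l)\<close> under the action of the torus.\<close>

definition tcoef :: "int \<Rightarrow> int \<Rightarrow> (C2 \<Rightarrow> complex) \<Rightarrow> C2 \<Rightarrow> complex" where
  "tcoef k l g = fcoef 1 0 k (fcoef 0 1 l g)"

lemma continuous_on_tcoef:
  "reinhardt S \<Longrightarrow> continuous_on S g \<Longrightarrow> continuous_on S (tcoef k l g)"
  unfolding tcoef_def by (intro continuous_on_fcoef)

lemma tcoef_homogeneous:
  assumes S: "reinhardt S" "continuous_on S g" "z \<in> S"
  shows "tcoef k l g (act (ex s) (ex t) z) = ex (of_int k * s) * ex (of_int l * t) * tcoef k l g z"
proof -
  have z': "act 1 (ex t) z \<in> S" by (intro reinhardt_act S) auto
  have h: "fcoef 0 1 l g (act 1 (ex t) w) = ex (of_int l * t) * fcoef 0 1 l g w" if "w \<in> S" for w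
    using fcoef_homogeneous[OF S(1,2) that, of 0 1 l t] by simp
  have fc: "continuous_on S (fcoef 0 1 l g)" by (rule continuous_on_fcoef[OF S(1,2)])
  have "tcoef k l g (act (ex s) (ex t) z) = tcoef k l g (act (ex s) 1 (act 1 (ex t) z))"
    by (simp add: act_act)
  also have "\<dots> = ex (of_int k * s) * tcoef k l g (act 1 (ex t) z)"
    unfolding tcoef_def
    using fcoef_homogeneous[OF S(1) fc z', where p = 1 and q = 0 and k = k and s = s] by simp
  also have "tcoef k l g (act 1 (ex t) z) = ex (of_int l * t) * tcoef k l g z"
    unfolding tcoef_def by (rule fcoef_preserves_homogeneous[OF S(1,3)]) (auto simp: h)
  finally show ?thesis by (simp add: mult.assoc)
qed

text \<open>The approximation in one variable is applied first to the function and then, in the other variable, to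
  each of the finitely many coefficients that occur.\<close>

lemma tcoef_approx:
  assumes S: "compact S" "reinhardt S" and g: "continuous_on S g" and "\<epsilon> > 0"
  shows "\<exists>(I :: (nat \<times> nat) set) w K L. finite I \<and>
     (\<forall>z\<in>S. cmod (g z - (\<Sum>i\<in>I. w i * tcoef (K i) (L i) g z)) < \<epsilon>)"
proof -
  obtain m where m: "\<And>z. z \<in> S \<Longrightarrow>
      cmod (g z - (\<Sum>j\<le>2*m. of_real (vp_weight m j) * fcoef 0 1 (int m - int j) g z)) < \<epsilon>/2"
    using fcoef_approx[OF S g, of 0 1 "\<epsilon>/2"] \<open>\<epsilon> > 0\<close> by auto
  define G where "G = (\<lambda>z. \<Sum>j\<le>2*m. of_real (vp_weight m j) * fcoef 0 1 (int m - int j) g z)"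
  have Gc: "continuous_on S G"
    unfolding G_def by (intro continuous_intros continuous_on_fcoef S g)
  obtain n where n: "\<And>z. z \<in> S \<Longrightarrow>
      cmod (G z - (\<Sum>i\<le>2*n. of_real (vp_weight n i) * fcoef 1 0 (int n - int i) G z)) < \<epsilon>/2"
    using fcoef_approx[OF S Gc, of 1 0 "\<epsilon>/2"] \<open>\<epsilon> > 0\<close> by auto
  define I where "I = {..2*n} \<times> {..2*m}"
  have "cmod (g z - (\<Sum>i\<in>I. (of_real (vp_weight n (fst i)) * of_real (vp_weight m (snd i)))
      * tcoef (int n - int (fst i)) (int m - int (snd i)) g z)) < \<epsilon>" if z: "z \<in> S" for z
  proof -
    have "fcoef 1 0 k G z = (\<Sum>j\<le>2*m. of_real (vp_weight m j) * tcoef k (int m - int j) g z)" for k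
      unfolding G_def tcoef_def by (intro fcoef_sum[OF S(2) z] continuous_on_fcoef S g)
    then have eq: "(\<Sum>i\<in>I. (of_real (vp_weight n (fst i)) * of_real (vp_weight m (snd i)))
      * tcoef (int n - int (fst i)) (int m - int (snd i)) g z)
      = (\<Sum>i\<le>2*n. of_real (vp_weight n i) * fcoef 1 0 (int n - int i) G z)"
      by (simp add: I_def sum.cartesian_product' sum_distrib_left mult.assoc)
    have "cmod (g z - G z) < \<epsilon>/2" unfolding G_def by (rule m[OF z])
    moreover have "cmod (g z - (\<Sum>i\<le>2*n. of_real (vp_weight n i) * fcoef 1 0 (int n - int i) G z))
        \<le> cmod (g z - G z) + cmod (G z - (\<Sum>i\<le>2*n. of_real (vp_weight n i) * fcoef 1 0 (int n - int i) G z))"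
      by (rule cmod_diff_triangle)
    ultimately show ?thesis unfolding eq using n[OF z] by linarith
  qed
  moreover have "finite I" by (simp add: I_def)
  ultimately show ?thesis
    by (intro exI[of _ I] exI[of _ "\<lambda>i. of_real (vp_weight n (fst i)) * of_real (vp_weight m (snd i))"]
        exI[of _ "\<lambda>i. int n - int (fst i)"] exI[of _ "\<lambda>i. int m - int (snd i)"] conjI ballI)
qed

subsection \<open>Taking a Fourier coefficient is an \<open>L\<^sup>2\<close> contraction\<close>

lemma circle_Jensen:
  fixes u :: "real \<Rightarrow> complex"
  assumes u: "continuous_on {0..1} u"
  shows "(cmod (integral {0..1} u))\<^sup>2 \<le> integral {0..1} (\<lambda>t. (cmod (u t))\<^sup>2)"
proof -
  define m where "m = integral {0..1} (\<lambda>t. cmod (u t))"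
  have i1: "(\<lambda>t. cmod (u t)) integrable_on {0..1}" and i2: "(\<lambda>t. (cmod (u t))\<^sup>2) integrable_on {0..1}"
    by (intro integrable_continuous_real continuous_intros u)+
  have "((\<lambda>t. (cmod (u t))\<^sup>2 - 2 * m * cmod (u t) + m\<^sup>2) has_integral
     (integral {0..1} (\<lambda>t. (cmod (u t))\<^sup>2) - 2 * m * m + m\<^sup>2)) {0..1}"
    unfolding m_def using has_integral_const_real[of "(integral {0..1} (\<lambda>t. cmod (u t)))\<^sup>2" 0 1]
    by (intro has_integral_add has_integral_diff has_integral_mult_right integrable_integral i1 i2) simp
  moreover have "(cmod (u t))\<^sup>2 - 2 * m * cmod (u t) + m\<^sup>2 \<ge> 0" for t
    using zero_le_power2[of "cmod (u t) - m"] by (simp add: power2_diff mult_ac)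
  ultimately have "integral {0..1} (\<lambda>t. (cmod (u t))\<^sup>2) - 2 * m * m + m\<^sup>2 \<ge> 0"
    by (rule has_integral_nonneg)
  then have "m\<^sup>2 \<le> integral {0..1} (\<lambda>t. (cmod (u t))\<^sup>2)" by (simp add: power2_eq_square)
  moreover have "cmod (integral {0..1} u) \<le> m"
    unfolding m_def by (intro integral_norm_bound_integral i1 integrable_continuous_real u) auto
  ultimately show ?thesis by (meson norm_ge_zero order_trans power_mono)
qed

text \<open>Jensen's inequality bounds the square of a coefficient by a mean of squares over the orbit; integrating
  over the domain and exchanging the integrals, each rotate has the same norm.\<close>

lemma fcoef_contraction:
  assumes S: "open S" "reinhardt S" and g: "continuous_on S g" "g \<in> L2 S"
  shows "fcoef p q k g \<in> L2 S" "l2_norm S (fcoef p q k g) \<le> l2_norm S g"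
proof -
  let ?a = "\<lambda>t. act (ex (p * t)) (ex (q * t))"
  let ?h = "fcoef p q k g"
  have hc: "continuous_on S ?h" by (rule continuous_on_fcoef[OF S(2) g(1)])
  define F where "F = (\<lambda>z. ennreal (indicator S z *\<^sub>R (cmod (g z))\<^sup>2))"
  have F: "F z = ennreal ((cmod (g z))\<^sup>2) * indicator S z" for z
    by (auto simp: F_def indicator_def)
  have Fm: "F \<in> borel_measurable borel"
  proof -
    have "(\<lambda>z. indicator S z *\<^sub>R (cmod (g z))\<^sup>2) \<in> borel_measurable borel"
      using S by (intro borel_measurable_continuous_on_indicator) (auto intro!: continuous_intros g)
    then show ?thesis unfolding F_def by simp
  qed
  have am: "(\<lambda>(z, t). ?a t z) \<in> borel_measurable (borel \<Otimes>\<^sub>M borel)"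
    unfolding borel_prod case_prod_beta
    by (intro borel_measurable_continuous_onI) (intro continuous_intros)
  have m2: "(\<lambda>(z, t). F (?a t z) * indicator {0..1} t) \<in> borel_measurable (lborel \<Otimes>\<^sub>M (lborel :: real measure))"
  proof -
    have "(\<lambda>x. F (case x of (z, t) \<Rightarrow> ?a t z)) \<in> borel_measurable (borel \<Otimes>\<^sub>M (borel :: real measure))"
      by (rule measurable_compose[OF am Fm])
    then have "(\<lambda>(z, t). F (?a t z)) \<in> borel_measurable (lborel \<Otimes>\<^sub>M (lborel :: real measure))"
      by (simp add: case_prod_beta cong: measurable_cong_sets sets_pair_measure_cong)
    then show ?thesis by (simp add: case_prod_beta)
  qed
  have pw: "ennreal ((cmod (?h z))\<^sup>2) * indicator S z \<le> (\<integral>\<^sup>+t. F (?a t z) * indicator {0..1} t \<partial>lborel)" for z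
  proof (cases "z \<in> S")
    case True
    define u where "u = (\<lambda>t. g (?a t z) * ex (- of_int k * t))"
    have uc: "continuous_on {0..1} u"
      unfolding u_def by (intro continuous_intros continuous_on_orbit[OF S(2) g(1) True])
    have un: "cmod (u t) = cmod (g (?a t z))" for t by (simp add: u_def norm_mult)
    have "ennreal ((cmod (?h z))\<^sup>2) \<le> ennreal (integral {0..1} (\<lambda>t. (cmod (u t))\<^sup>2))"
      using circle_Jensen[OF uc] by (intro ennreal_leI) (simp add: fcoef_def u_def)
    also have "\<dots> = (\<integral>\<^sup>+t. ennreal ((cmod (u t))\<^sup>2) * indicator {0..1} t \<partial>lborel)"
      by (intro nn_integral_has_integral_lebesgue'[symmetric] integrable_integral integrable_continuous_real
           continuous_intros uc) auto
    also have "\<dots> = (\<integral>\<^sup>+t. F (?a t z) * indicator {0..1} t \<partial>lborel)"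
      using True by (simp add: un F reinhardt_act[OF S(2)])
    finally show ?thesis using True by simp
  qed simp
  have "(\<integral>\<^sup>+z. ennreal ((cmod (?h z))\<^sup>2) * indicator S z \<partial>lborel)
      \<le> (\<integral>\<^sup>+z. (\<integral>\<^sup>+t. F (?a t z) * indicator {0..1} t \<partial>lborel) \<partial>lborel)"
    by (intro nn_integral_mono pw)
  also have "\<dots> = (\<integral>\<^sup>+t. (\<integral>\<^sup>+z. F (?a t z) * indicator {0..1} t \<partial>lborel) \<partial>lborel)"
    using lborel_pair.Fubini'[OF m2] by simp
  also have "\<dots> = (\<integral>\<^sup>+t. (\<integral>\<^sup>+z. F z \<partial>lborel) * indicator {0..1::real} t \<partial>lborel)"
  proof (intro nn_integral_cong)
    fix t
    have "(\<lambda>z. F (?a t z)) \<in> borel_measurable lborel"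
      using measurable_compose[OF measurable_act Fm] by simp
    then show "(\<integral>\<^sup>+z. F (?a t z) * indicator {0..1} t \<partial>lborel) = (\<integral>\<^sup>+z. F z \<partial>lborel) * indicator {0..1} t"
      by (simp add: nn_integral_multc nn_integral_act[OF Fm])
  qed
  also have "\<dots> = (\<integral>\<^sup>+z. F z \<partial>lborel)"
    by (subst nn_integral_cmult) auto
  also have "\<dots> = ennreal ((l2_norm S g)\<^sup>2)"
    unfolding F by (rule L2_nn_integral[OF S(1) g(2)])
  finally have le: "(\<integral>\<^sup>+z. ennreal ((cmod (?h z))\<^sup>2) * indicator S z \<partial>lborel) \<le> ennreal ((l2_norm S g)\<^sup>2)" .
  then show hL: "?h \<in> L2 S"
    unfolding L2_continuous_iff[OF S(1) hc] using le_less_trans[OF le ennreal_less_top] by simp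
  from le have "(l2_norm S ?h)\<^sup>2 \<le> (l2_norm S g)\<^sup>2"
    unfolding L2_nn_integral[OF S(1) hL] by simp
  then show "l2_norm S ?h \<le> l2_norm S g"
    by (rule power2_le_imp_le) simp
qed

lemma tcoef_contraction:
  assumes S: "open S" "reinhardt S" and g: "continuous_on S g" "g \<in> L2 S"
  shows "tcoef k l g \<in> L2 S" "l2_norm S (tcoef k l g) \<le> l2_norm S g"
proof -
  note 1 = fcoef_contraction[OF S g, where p = 0 and q = 1 and k = l]
  note 2 = fcoef_contraction[OF S continuous_on_fcoef[OF S(2) g(1)] 1(1), where p = 1 and q = 0 and k = k]
  show "tcoef k l g \<in> L2 S" "l2_norm S (tcoef k l g) \<le> l2_norm S g"
    unfolding tcoef_def by (rule 2(1), rule order_trans[OF 2(2) 1(2)])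
qed

section \<open>Fourier coefficients of holomorphic functions\<close>

text \<open>For \<open>k \<ge> 0\<close> this is Cauchy's formula for a Taylor coefficient on the circle of radius \<open>|\<zeta>|\<close>, for
  \<open>k < 0\<close> it is Cauchy's theorem.\<close>

lemma circle_mean_holomorphic:
  assumes f: "f holomorphic_on ball 0 R" and z: "cmod \<zeta> < R"
  shows "integral {0..1} (\<lambda>t. f (ex t * \<zeta>) * ex (- of_int k * t))
    = (if k \<ge> 0 then (deriv ^^ nat k) f 0 / fact (nat k) * \<zeta> ^ nat k else 0)"
proof (cases "\<zeta> = 0")
  case True
  have "((\<lambda>t. f 0 * ex (of_int (- k) * t)) has_integral (f 0 * (if - k = 0 then 1 else 0))) {0..1}"
    by (intro has_integral_mult_right has_integral_ex)
  then have "integral {0..1} (\<lambda>t. f 0 * ex (of_int (- k) * t)) = f 0 * (if - k = 0 then 1 else 0)"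
    by (rule integral_unique)
  then show ?thesis using True by (auto simp: zero_power)
next
  case False
  define r where "r = cmod \<zeta>"
  have r: "r > 0" "r < R" using False z by (auto simp: r_def)
  define c where "c = \<zeta> / of_real r"
  have c: "cmod c = 1" "c * of_real r = \<zeta>" using r by (auto simp: c_def norm_divide r_def)
  define g where "g = (\<lambda>u. f (c * u))"
  have g: "g holomorphic_on ball 0 R"
    unfolding g_def by (rule holomorphic_on_compose_gen[OF _ f, unfolded o_def])
      (auto intro!: holomorphic_intros simp: norm_mult c)
  have path: "circlepath 0 r t = of_real r * ex t" for t
    by (simp add: circlepath ex_def cis_conv_exp mult_ac)
  have vd: "vector_derivative (circlepath 0 r) (at t) = 2 * of_real pi * \<i> * (of_real r * ex t)" for t
    by (simp add: vector_derivative_circlepath ex_def cis_conv_exp mult_ac)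
  have gv: "g (of_real r * ex t) = f (ex t * \<zeta>)" for t
    using c(2) by (simp add: g_def mult_ac) (metis mult.assoc mult.commute)
  show ?thesis
  proof (cases "k \<ge> 0")
    case True
    define n where "n = nat k"
    have k: "k = int n" using True by (simp add: n_def)
    have "((\<lambda>u. g u / (u - 0) ^ Suc n) has_contour_integral
        ((2 * pi * \<i>) / (fact n) * (deriv ^^ n) g 0)) (circlepath 0 r)"
      by (intro Cauchy_has_contour_integral_higher_derivative_circlepath
          holomorphic_on_imp_continuous_on holomorphic_on_subset[OF g]) (use r in auto)
    then have "((\<lambda>t. g (of_real r * ex t) / (of_real r * ex t) ^ Suc n * (2 * of_real pi * \<i> * (of_real r * ex t)))
        has_integral (2 * of_real pi * \<i>) / fact n * (deriv ^^ n) g 0) {0..1}"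
      unfolding has_contour_integral vd path by simp
    note * = has_integral_mult_right[OF this, of "of_real r ^ n / (2 * of_real pi * \<i>)"]
    have "((\<lambda>t. of_real r ^ n / (2 * of_real pi * \<i>) * (g (of_real r * ex t) / (of_real r * ex t) ^ Suc n
          * (2 * of_real pi * \<i> * (of_real r * ex t))))
        has_integral of_real r ^ n / fact n * (deriv ^^ n) g 0) {0..1}"
    proof -
      have "of_real r ^ n / (2 * of_real pi * \<i>) * ((2 * of_real pi * \<i>) / fact n * (deriv ^^ n) g 0)
          = of_real r ^ n / fact n * (deriv ^^ n) g 0"
        by (simp add: field_simps)
      with * show ?thesis by (simp only:)
    qed
    moreover have "of_real r ^ n / (2 * of_real pi * \<i>) * (g (of_real r * ex t) / (of_real r * ex t) ^ Suc n
          * (2 * of_real pi * \<i> * (of_real r * ex t))) = f (ex t * \<zeta>) * ex (- of_int k * t)" for t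
    proof -
      have e: "ex (- of_int k * t) * ex t ^ n = 1"
        by (simp add: ex_power k ex_add[symmetric])
      have "of_real r ^ n / (2 * of_real pi * \<i>) * (g (of_real r * ex t) / (of_real r * ex t) ^ Suc n
          * (2 * of_real pi * \<i> * (of_real r * ex t))) = g (of_real r * ex t) / ex t ^ n"
        using r by (simp add: field_simps power_mult_distrib)
      also have "\<dots> = g (of_real r * ex t) * ex (- of_int k * t)"
        using e by (simp add: field_simps)
      finally show ?thesis by (simp only: gv)
    qed
    ultimately have "integral {0..1} (\<lambda>t. f (ex t * \<zeta>) * ex (- of_int k * t)) = of_real r ^ n / fact n * (deriv ^^ n) g 0"
      by (simp add: integral_unique)
    also have "(deriv ^^ n) g 0 = c ^ n * (deriv ^^ n) f (c * 0)"
      unfolding g_def by (rule higher_deriv_compose_linear[OF f, where S="ball 0 R"]) (use r c in \<open>auto simp: norm_mult\<close>)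
    finally show ?thesis using True
      by (simp add: n_def[symmetric] c(2)[symmetric] power_mult_distrib)
  next
    case False
    define n where "n = nat (- k - 1)"
    have k: "k = - int (Suc n)" using False by (simp add: n_def)
    have "((\<lambda>u. g u * u ^ n) has_contour_integral 0) (circlepath 0 r)"
      by (rule Cauchy_theorem_disc_simple[of _ 0 R]) (use r in \<open>auto intro!: holomorphic_intros g simp: path_image_circlepath\<close>)
    then have "((\<lambda>t. g (of_real r * ex t) * (of_real r * ex t) ^ n * (2 * of_real pi * \<i> * (of_real r * ex t))) has_integral 0) {0..1}"
      unfolding has_contour_integral vd path .
    from has_integral_mult_right[OF this, of "inverse (2 * of_real pi * \<i> * of_real r ^ Suc n)"]
    have "((\<lambda>t. inverse (2 * of_real pi * \<i> * of_real r ^ Suc n) *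
        (g (of_real r * ex t) * (of_real r * ex t) ^ n * (2 * of_real pi * \<i> * (of_real r * ex t)))) has_integral 0) {0..1}"
      by simp
    moreover have "inverse (2 * of_real pi * \<i> * of_real r ^ Suc n) *
        (g (of_real r * ex t) * (of_real r * ex t) ^ n * (2 * of_real pi * \<i> * (of_real r * ex t)))
        = f (ex t * \<zeta>) * ex (- of_int k * t)" for t
    proof -
      have e: "ex (- of_int k * t) = ex t ^ Suc n"
        by (simp only: ex_power k) (simp add: algebra_simps)
      show ?thesis unfolding e gv[symmetric] using r by (simp add: field_simps power_mult_distrib)
    qed
    ultimately show ?thesis using False by (simp add: integral_unique)
  qed
qed

lemma holomorphic2_on_imp_continuous_on: "f holomorphic2_on S \<Longrightarrow> continuous_on S f"
  unfolding holomorphic2_on_def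
  by (metis continuous_at_imp_continuous_on has_derivative_continuous)

lemma holomorphic2_slice_snd:
  assumes f: "f holomorphic2_on S" and U: "\<And>u. u \<in> U \<Longrightarrow> (a, u) \<in> S"
  shows "(\<lambda>u. f (a, u)) holomorphic_on U"
  unfolding holomorphic_on_def
proof
  fix u assume "u \<in> U"
  then obtain A B where d: "(f has_derivative (\<lambda>h. A * fst h + B * snd h)) (at (a, u))"
    using f U unfolding holomorphic2_on_def by blast
  have "((\<lambda>u. f (a, u)) has_derivative (\<lambda>h. A * fst (0, h) + B * snd (0::complex, h))) (at u)"
    by (rule has_derivative_compose[where f="\<lambda>u. (a, u)" and g = f, OF _ d])
      (auto intro!: derivative_eq_intros)
  then have "((\<lambda>u. f (a, u)) has_field_derivative B) (at u)"
    by (simp add: has_field_derivative_def)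
  then show "(\<lambda>u. f (a, u)) field_differentiable at u within U"
    using field_differentiable_def field_differentiable_at_within by blast
qed

lemma holomorphic2_slice_fst:
  assumes f: "f holomorphic2_on S" and U: "\<And>u. u \<in> U \<Longrightarrow> (u, b) \<in> S"
  shows "(\<lambda>u. f (u, b)) holomorphic_on U"
  unfolding holomorphic_on_def
proof
  fix u assume "u \<in> U"
  then obtain A B where d: "(f has_derivative (\<lambda>h. A * fst h + B * snd h)) (at (u, b))"
    using f U unfolding holomorphic2_on_def by blast
  have "((\<lambda>u. f (u, b)) has_derivative (\<lambda>h. A * fst (h, 0::complex) + B * snd (h, 0))) (at u)"
    by (rule has_derivative_compose[where f="\<lambda>u. (u, b)" and g = f, OF _ d])
      (auto intro!: derivative_eq_intros)
  then have "((\<lambda>u. f (u, b)) has_field_derivative A) (at u)"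
    by (simp add: has_field_derivative_def)
  then show "(\<lambda>u. f (u, b)) field_differentiable at u within U"
    using field_differentiable_def field_differentiable_at_within by blast
qed

definition complete_reinhardt :: "C2 set \<Rightarrow> bool" where
  "complete_reinhardt S \<longleftrightarrow> (\<forall>z\<in>S. \<forall>w. cmod (fst w) \<le> cmod (fst z) \<and> cmod (snd w) \<le> cmod (snd z) \<longrightarrow> w \<in> S)"

lemma complete_reinhardtD:
  "complete_reinhardt S \<Longrightarrow> z \<in> S \<Longrightarrow> cmod (fst w) \<le> cmod (fst z) \<Longrightarrow> cmod (snd w) \<le> cmod (snd z) \<Longrightarrow> w \<in> S"
  unfolding complete_reinhardt_def by blast

lemma complete_reinhardt_imp_reinhardt: "complete_reinhardt S \<Longrightarrow> reinhardt S"
  unfolding reinhardt_def complete_reinhardt_def by (force simp: norm_mult)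

text \<open>The point with coordinates \<open>|z\<^sub>1|\<close> and \<open>|z\<^sub>2|\<close> has a neighbourhood in the set, which contains points with both
  moduli larger.\<close>

lemma complete_reinhardt_enlarge:
  assumes S: "open S" "complete_reinhardt S" and z: "z \<in> S"
  obtains r where "r > 0" "\<And>w. cmod (fst w) < cmod (fst z) + r \<Longrightarrow> cmod (snd w) < cmod (snd z) + r \<Longrightarrow> w \<in> S"
proof -
  let ?z = "(of_real (cmod (fst z)), of_real (cmod (snd z))) :: C2"
  have "?z \<in> S" by (rule complete_reinhardtD[OF S(2) z]) auto
  then obtain e where e: "e > 0" "ball ?z e \<subseteq> S" using S(1) open_contains_ball by blast
  define r where "r = e/2 / sqrt 2"
  have r: "r > 0" using e by (simp add: r_def)
  let ?w = "(of_real (cmod (fst z) + r), of_real (cmod (snd z) + r)) :: C2"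
  have "dist ?z ?w < e"
  proof -
    have "dist ?z ?w = sqrt (r\<^sup>2 + r\<^sup>2)"
      using r by (simp add: dist_norm norm_Pair)
    also have "\<dots> = sqrt 2 * r" using r by (simp add: real_sqrt_mult flip: mult_2)
    also have "\<dots> < e" using e by (simp add: r_def)
    finally show ?thesis .
  qed
  then have w: "?w \<in> S" using e by (auto simp: subset_iff)
  show ?thesis
  proof (rule that[OF r])
    fix w assume "cmod (fst w) < cmod (fst z) + r" "cmod (snd w) < cmod (snd z) + r"
    then show "w \<in> S" by (intro complete_reinhardtD[OF S(2) w]) (use r in \<open>auto simp del: of_real_add\<close>)
  qed
qed

text \<open>The iterated integral over the torus may be taken in either order.\<close>

lemma tcoef_swap:
  assumes S: "reinhardt S" "continuous_on S f" and z: "z \<in> S"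
  shows "tcoef k l f z = fcoef 0 1 l (fcoef 1 0 k f) z"
proof -
  let ?F = "\<lambda>s t. f (act (ex s) (ex t) z) * ex (- of_int k * s) * ex (- of_int l * t)"
  have "continuous_on (cbox (0, 0) (1, 1)) (\<lambda>(s, t). ?F s t)"
    unfolding case_prod_beta
    by (intro continuous_intros continuous_on_compose2[OF S(2)])
      (use S z in \<open>auto intro!: continuous_intros reinhardt_act\<close>)
  then have "integral (cbox 0 1) (\<lambda>s. integral (cbox 0 1) (?F s)) = integral (cbox 0 1) (\<lambda>t. integral (cbox 0 1) (\<lambda>s. ?F s t))"
    by (rule integral_swap_continuous)
  moreover have "tcoef k l f z = integral (cbox 0 1) (\<lambda>s. integral (cbox 0 1) (?F s))"
    unfolding tcoef_def fcoef_def integral_mult_left[symmetric]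
    by (simp add: act_act mult_ac)
  moreover have "fcoef 0 1 l (fcoef 1 0 k f) z = integral (cbox 0 1) (\<lambda>t. integral (cbox 0 1) (\<lambda>s. ?F s t))"
    unfolding fcoef_def integral_mult_left[symmetric]
    by (simp add: act_act)
  ultimately show ?thesis by simp
qed

text \<open>On a complete Reinhardt domain a Fourier coefficient of a holomorphic function is a multiple of the
  corresponding monomial.  Integrating first over the second circle shows that it is a multiple of
  \<open>z\<^sub>2\<^sup>l\<close> with a factor depending on \<open>z\<^sub>1\<close>, and integrating in the other order gives the same statement with the
  coordinates exchanged; together these leave only \<open>z\<^sub>1\<^sup>k z\<^sub>2\<^sup>l\<close>.\<close>

lemma tcoef_holomorphic2:
  assumes S: "open S" "complete_reinhardt S" "S \<noteq> {}" and f: "f holomorphic2_on S"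
  obtains c where "\<And>z. z \<in> S \<Longrightarrow> tcoef k l f z
    = (if k \<ge> 0 \<and> l \<ge> 0 then c * fst z ^ nat k * snd z ^ nat l else 0)"
proof -
  have R: "reinhardt S" by (rule complete_reinhardt_imp_reinhardt[OF S(2)])
  have fc: "continuous_on S f" by (rule holomorphic2_on_imp_continuous_on[OF f])
  define b where "b = (\<lambda>a. (deriv ^^ nat l) (\<lambda>u. f (a, u)) 0 / fact (nat l))"
  define b' where "b' = (\<lambda>a. (deriv ^^ nat k) (\<lambda>u. f (u, a)) 0 / fact (nat k))"
  have in2: "fcoef 0 1 l f z = (if l \<ge> 0 then b (fst z) * snd z ^ nat l else 0)" if z: "z \<in> S" for z
  proof -
    obtain r where r: "r > 0" "\<And>w. cmod (fst w) < cmod (fst z) + r \<Longrightarrow> cmod (snd w) < cmod (snd z) + r \<Longrightarrow> w \<in> S"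
      using complete_reinhardt_enlarge[OF S(1,2) z] by metis
    have "(\<lambda>u. f (fst z, u)) holomorphic_on ball 0 (cmod (snd z) + r)"
      by (rule holomorphic2_slice_snd[OF f]) (use r in auto)
    from circle_mean_holomorphic[OF this, of "snd z" l] show ?thesis
      using r(1) by (simp add: fcoef_def act_def b_def)
  qed
  have in1: "fcoef 1 0 k f z = (if k \<ge> 0 then b' (snd z) * fst z ^ nat k else 0)" if z: "z \<in> S" for z
  proof -
    obtain r where r: "r > 0" "\<And>w. cmod (fst w) < cmod (fst z) + r \<Longrightarrow> cmod (snd w) < cmod (snd z) + r \<Longrightarrow> w \<in> S"
      using complete_reinhardt_enlarge[OF S(1,2) z] by metis
    have "(\<lambda>u. f (u, snd z)) holomorphic_on ball 0 (cmod (fst z) + r)"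
      by (rule holomorphic2_slice_fst[OF f]) (use r in auto)
    from circle_mean_holomorphic[OF this, of "fst z" k] show ?thesis
      using r(1) by (simp add: fcoef_def act_def b'_def)
  qed
  note swap = tcoef_swap[OF R fc]
  show ?thesis
  proof (cases "k \<ge> 0 \<and> l \<ge> 0")
    case False
    have "tcoef k l f z = 0" if z: "z \<in> S" for z
    proof (cases "l \<ge> 0")
      case True
      have "fcoef 1 0 k f (act (ex (0 * t)) (ex (1 * t)) z) = 0" for t
        using True False in1[OF reinhardt_act[OF R _ _ z]] by simp
      then show ?thesis unfolding swap[OF z] by (subst fcoef_def) simp
    next
      case l: False
      have "fcoef 0 1 l f (act (ex (1 * t)) (ex (0 * t)) z) = 0" for t
        using l in2[OF reinhardt_act[OF R _ _ z]] by simp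
      then show ?thesis unfolding tcoef_def by (subst fcoef_def) simp
    qed
    then show ?thesis using that False by auto
  next
    case True
    define B where "B = (\<lambda>a. integral {0..1} (\<lambda>s. b (ex s * a) * ex (- of_int k * s)))"
    define A where "A = (\<lambda>a. integral {0..1} (\<lambda>t. b' (ex t * a) * ex (- of_int l * t)))"
    have uB: "tcoef k l f z = B (fst z) * snd z ^ nat l" if z: "z \<in> S" for z
    proof -
      have "fcoef 0 1 l f (act (ex (1 * t)) (ex (0 * t)) z) = b (ex t * fst z) * snd z ^ nat l" for t
        using True in2[OF reinhardt_act[OF R _ _ z]] by simp
      then show ?thesis unfolding tcoef_def B_def
        by (subst fcoef_def) (simp add: mult_ac flip: integral_mult_left)
    qed
    have uA: "tcoef k l f z = A (snd z) * fst z ^ nat k" if z: "z \<in> S" for z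
    proof -
      have "fcoef 1 0 k f (act (ex (0 * t)) (ex (1 * t)) z) = b' (ex t * snd z) * fst z ^ nat k" for t
        using True in1[OF reinhardt_act[OF R _ _ z]] by simp
      then show ?thesis unfolding swap[OF z] A_def
        by (subst fcoef_def) (simp add: mult_ac flip: integral_mult_left)
    qed
    obtain z0 where "z0 \<in> S" using S(3) by blast
    then have "0 \<in> S" by (rule complete_reinhardtD[OF S(2)]) auto
    then obtain r where r: "r > 0" "\<And>w. cmod (fst w) < r \<Longrightarrow> cmod (snd w) < r \<Longrightarrow> w \<in> S"
      using complete_reinhardt_enlarge[OF S(1,2), of 0] by auto
    define \<delta> where "\<delta> = complex_of_real (r/2)"
    have \<delta>: "\<delta> \<noteq> 0" "cmod \<delta> = r/2" using r by (auto simp: \<delta>_def)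
    have dd: "(\<delta>, \<delta>) \<in> S" using r \<delta> by auto
    show ?thesis
    proof (rule that[of "A \<delta> / \<delta> ^ nat l"])
      fix z assume z: "z \<in> S"
      obtain \<rho> where \<rho>: "\<rho> > 0" "\<And>w. cmod (fst w) < cmod (fst z) + \<rho> \<Longrightarrow> cmod (snd w) < cmod (snd z) + \<rho> \<Longrightarrow> w \<in> S"
        using complete_reinhardt_enlarge[OF S(1,2) z] by metis
      define \<epsilon> where "\<epsilon> = complex_of_real (min (\<rho>/2) (r/2))"
      have \<epsilon>: "\<epsilon> \<noteq> 0" "cmod \<epsilon> \<le> \<rho>/2" "cmod \<epsilon> \<le> r/2" using \<rho>(1) r(1) by (auto simp: \<epsilon>_def min_def)
      have "cmod \<epsilon> < cmod (fst z) + \<rho>" using \<epsilon>(2) \<rho>(1) norm_ge_zero[of "fst z"] by linarith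
      then have z': "(\<epsilon>, snd z) \<in> S" using \<rho> by simp
      have ed: "(\<epsilon>, \<delta>) \<in> S" by (rule complete_reinhardtD[OF S(2) dd]) (use \<epsilon> \<delta> in auto)
      have 1: "A (snd z) * \<epsilon> ^ nat k = B \<epsilon> * snd z ^ nat l" using uA[OF z'] uB[OF z'] by simp
      have 2: "A \<delta> * \<epsilon> ^ nat k = B \<epsilon> * \<delta> ^ nat l" using uA[OF ed] uB[OF ed] by simp
      have "A (snd z) * \<epsilon> ^ nat k * \<delta> ^ nat l = A \<delta> * snd z ^ nat l * \<epsilon> ^ nat k"
        using 1 2 by (metis mult.assoc mult.commute)
      then have "A (snd z) = A \<delta> / \<delta> ^ nat l * snd z ^ nat l"
        using \<epsilon>(1) \<delta>(1) by (simp add: field_simps)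
      then show "tcoef k l f z = (if k \<ge> 0 \<and> l \<ge> 0 then A \<delta> / \<delta> ^ nat l * fst z ^ nat k * snd z ^ nat l else 0)"
        using True uA[OF z] by simp
    qed
  qed
qed

lemma tcoef_0_0_at_origin: "tcoef 0 0 f (0, 0) = f (0, 0)"
  by (simp add: tcoef_def fcoef_def act_def)

lemma tcoef_0_0_holomorphic2:
  assumes S: "open S" "complete_reinhardt S" and f: "f holomorphic2_on S" and z: "z \<in> S"
  shows "tcoef 0 0 f z = f (0, 0)"
proof -
  have "S \<noteq> {}" using z by blast
  then obtain c where c: "\<And>z. z \<in> S \<Longrightarrow> tcoef 0 0 f z = c"
    using tcoef_holomorphic2[OF S _ f, of 0 0] by auto
  have "(0, 0) \<in> S" by (rule complete_reinhardtD[OF S(2) z]) auto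
  then show ?thesis using c[OF z] c[of "(0, 0)"] by (simp add: tcoef_0_0_at_origin)
qed

section \<open>Geometry of convex Reinhardt domains\<close>

text \<open>A real multiple \<open>\<rho> a\<close> with \<open>0 \<le> \<rho> \<le> 1\<close> is a convex combination of \<open>a\<close> and its rotate \<open>-a\<close>, so each modulus
  can be decreased separately.\<close>

lemma convex_reinhardt_imp_complete:
  assumes "convex S" "reinhardt S"
  shows "complete_reinhardt S"
proof -
  have shrink: "\<exists>\<xi>. cmod \<xi> = 1 \<and> u = \<xi> * (of_real (cmod u / cmod v) * v)" if "cmod u \<le> cmod v" for u v :: complex
  proof (cases "u = 0")
    case True
    then show ?thesis by (intro exI[of _ 1]) simp
  next
    case False
    then have "v \<noteq> 0" using that by auto
    then show ?thesis using False
      by (intro exI[of _ "u / (of_real (cmod u / cmod v) * v)"]) (simp add: norm_divide norm_mult)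
  qed
  have 1: "(u, b) \<in> S" if ab: "(a, b) \<in> S" and u: "cmod u \<le> cmod a" for u a b
  proof -
    define \<rho> where "\<rho> = cmod u / cmod a"
    have \<rho>: "0 \<le> \<rho>" "\<rho> \<le> 1" using u by (auto simp: \<rho>_def divide_le_eq_1)
    have m: "(- a, b) \<in> S" using assms(2) ab unfolding reinhardt_def by (metis mult_1 mult_minus1 norm_minus_cancel norm_one)
    have "((1 + \<rho>) / 2) *\<^sub>R (a, b) + ((1 - \<rho>) / 2) *\<^sub>R (- a, b) \<in> S"
      by (rule convexD[OF assms(1) ab m]) (use \<rho> in \<open>auto simp: field_simps\<close>)
    also have "((1 + \<rho>) / 2) *\<^sub>R (a, b) + ((1 - \<rho>) / 2) *\<^sub>R (- a, b) = (of_real \<rho> * a, b)"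
      by (auto simp: scaleR_conv_of_real field_simps)
    finally have r: "(of_real \<rho> * a, b) \<in> S" .
    obtain \<xi> where "cmod \<xi> = 1" "u = \<xi> * (of_real \<rho> * a)" using shrink[OF u] by (auto simp: \<rho>_def)
    then show ?thesis using reinhardt_act[OF assms(2) _ _ r, of \<xi> 1] by (simp add: act_def)
  qed
  have 2: "(a, u) \<in> S" if ab: "(a, b) \<in> S" and u: "cmod u \<le> cmod b" for u a b
  proof -
    define \<rho> where "\<rho> = cmod u / cmod b"
    have \<rho>: "0 \<le> \<rho>" "\<rho> \<le> 1" using u by (auto simp: \<rho>_def divide_le_eq_1)
    have m: "(a, - b) \<in> S" using assms(2) ab unfolding reinhardt_def by (metis mult_1 mult_minus1 norm_minus_cancel norm_one)
    have "((1 + \<rho>) / 2) *\<^sub>R (a, b) + ((1 - \<rho>) / 2) *\<^sub>R (a, - b) \<in> S"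
      by (rule convexD[OF assms(1) ab m]) (use \<rho> in \<open>auto simp: field_simps\<close>)
    also have "((1 + \<rho>) / 2) *\<^sub>R (a, b) + ((1 - \<rho>) / 2) *\<^sub>R (a, - b) = (a, of_real \<rho> * b)"
      by (auto simp: scaleR_conv_of_real field_simps)
    finally have r: "(a, of_real \<rho> * b) \<in> S" .
    obtain \<xi> where "cmod \<xi> = 1" "u = \<xi> * (of_real \<rho> * b)" using shrink[OF u] by (auto simp: \<rho>_def)
    then show ?thesis using reinhardt_act[OF assms(2) _ _ r, of 1 \<xi>] by (simp add: act_def)
  qed
  show ?thesis unfolding complete_reinhardt_def
    using 1 2 by (metis prod.collapse)
qed

lemma reinhardt_closure:
  assumes "reinhardt S" shows "reinhardt (closure S)"
proof -
  have "act \<xi> \<eta> ` closure S \<subseteq> closure S" if "cmod \<xi> = 1" "cmod \<eta> = 1" for \<xi> \<eta>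
  proof (rule image_closure_subset)
    show "continuous_on (closure S) (act \<xi> \<eta>)" by (intro continuous_intros)
    show "act \<xi> \<eta> ` S \<subseteq> closure S" using reinhardt_act[OF assms that] closure_subset by blast
  qed simp
  then show ?thesis unfolding reinhardt_def act_def by (force simp: image_subset_iff)
qed

lemma Re_eq_norm_bound: "Re u = s \<Longrightarrow> cmod u \<le> s \<Longrightarrow> u = of_real s"
proof -
  assume 1: "Re u = s" and 2: "cmod u \<le> s"
  have "(cmod u)\<^sup>2 \<le> s\<^sup>2" using 2 by (intro power_mono) auto
  then have "(Im u)\<^sup>2 \<le> 0" using 1 by (simp add: cmod_power2)
  then show ?thesis using 1 by (simp add: complex_eq_iff)
qed

text \<open>Take a supporting real hyperplane at the boundary point and rotate the coordinates of a point of the set so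
  that both terms of the linear form become nonnegative reals.  The hyperplane thus gives a weighted
  \<open>\<ell>\<^sup>1\<close> norm whose unit ball contains the domain and touches its boundary at the point.\<close>

lemma reinhardt_supporting_functional:
  assumes S: "open S" "convex S" "reinhardt S" "S \<noteq> {}" and p: "p \<in> frontier S"
  obtains a b \<sigma> where "\<sigma> > 0" "a \<noteq> 0 \<or> b \<noteq> 0"
    "\<And>w. w \<in> closure S \<Longrightarrow> cmod a * cmod (fst w) + cmod b * cmod (snd w) \<le> \<sigma>"
    "\<And>w. w \<in> S \<Longrightarrow> cmod a * cmod (fst w) + cmod b * cmod (snd w) < \<sigma>"
    "a * fst p + b * snd p = of_real \<sigma>"
proof -
  have C: "complete_reinhardt S" by (rule convex_reinhardt_imp_complete[OF S(2,3)])
  have "p \<notin> S" using p S(1) by (simp add: frontier_def interior_open)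
  then obtain A \<beta> where "A \<noteq> 0" "\<forall>x\<in>S. A \<bullet> x \<le> \<beta>" "\<forall>x\<in>{p}. A \<bullet> x \<ge> \<beta>"
    using separating_hyperplane_sets[of S "{p}"] S(2,4) by auto
  then have A: "A \<noteq> 0" "\<And>x. x \<in> S \<Longrightarrow> A \<bullet> x \<le> A \<bullet> p" by force+
  define a b \<sigma> where "a = cnj (fst A)" and "b = cnj (snd A)" and "\<sigma> = A \<bullet> p"
  have inn: "A \<bullet> w = Re (a * fst w + b * snd w)" for w
    by (cases A; cases w) (simp add: a_def b_def inner_complex_def)
  have "a \<noteq> 0 \<or> b \<noteq> 0" using A(1) by (auto simp: a_def b_def prod_eq_iff)
  have le: "cmod a * cmod (fst w) + cmod b * cmod (snd w) \<le> \<sigma>" if w: "w \<in> S" for w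
  proof -
    have rot: "\<exists>\<xi>. cmod \<xi> = 1 \<and> u * \<xi> = of_real (cmod u)" for u :: complex
    proof (cases "u = 0")
      case False
      then show ?thesis
        by (intro exI[of _ "of_real (cmod u) / u"]) (simp add: norm_divide)
    qed (auto intro: exI[of _ 1])
    obtain \<xi> \<eta> where x: "cmod \<xi> = 1" "a * fst w * \<xi> = of_real (cmod (a * fst w))"
      and y: "cmod \<eta> = 1" "b * snd w * \<eta> = of_real (cmod (b * snd w))"
      using rot by metis
    have "A \<bullet> act \<xi> \<eta> w \<le> \<sigma>" unfolding \<sigma>_def by (intro A reinhardt_act S w x y)
    also have "A \<bullet> act \<xi> \<eta> w = Re (a * fst w * \<xi> + b * snd w * \<eta>)"
      unfolding inn by (simp add: mult_ac)
    finally show ?thesis unfolding x y by (simp add: norm_mult)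
  qed
  have cont: "continuous_on (closure S) (\<lambda>w. cmod a * cmod (fst w) + cmod b * cmod (snd w))"
    by (intro continuous_intros)
  have lec: "cmod a * cmod (fst w) + cmod b * cmod (snd w) \<le> \<sigma>" if w: "w \<in> closure S" for w
    by (rule continuous_le_on_closure[OF cont w]) (use le in auto)
  have lt: "cmod a * cmod (fst w) + cmod b * cmod (snd w) < \<sigma>" if w: "w \<in> S" for w
  proof -
    obtain r where r: "r > 0" "\<And>v. cmod (fst v) < cmod (fst w) + r \<Longrightarrow> cmod (snd v) < cmod (snd w) + r \<Longrightarrow> v \<in> S"
      using complete_reinhardt_enlarge[OF S(1) C w] by metis
    let ?v = "(of_real (cmod (fst w) + r/2), of_real (cmod (snd w) + r/2)) :: C2"
    have "cmod (fst ?v) = cmod (fst w) + r/2" "cmod (snd ?v) = cmod (snd w) + r/2"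
      using r(1) by (simp_all del: of_real_add)
    then have "?v \<in> S" using r by simp
    from le[OF this] have "cmod a * (cmod (fst w) + r/2) + cmod b * (cmod (snd w) + r/2) \<le> \<sigma>"
      using r(1) by (simp del: of_real_add)
    moreover have "cmod a * (r/2) + cmod b * (r/2) > 0"
      using \<open>a \<noteq> 0 \<or> b \<noteq> 0\<close> r(1) by (auto intro: add_pos_nonneg add_nonneg_pos)
    ultimately show ?thesis by (simp add: algebra_simps)
  qed
  obtain z0 where "z0 \<in> S" using S(4) by blast
  moreover have "0 \<le> cmod a * cmod (fst z0) + cmod b * cmod (snd z0)" by simp
  ultimately have "\<sigma> > 0" using lt[of z0] by linarith
  have "p \<in> closure S" using p by (simp add: frontier_def)
  have "Re (a * fst p + b * snd p) = \<sigma>" by (simp add: \<sigma>_def inn)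
  moreover have "cmod (a * fst p + b * snd p) \<le> \<sigma>"
    using norm_triangle_ineq[of "a * fst p" "b * snd p"] lec[OF \<open>p \<in> closure S\<close>] by (simp add: norm_mult)
  ultimately have "a * fst p + b * snd p = of_real \<sigma>"
    by (rule Re_eq_norm_bound)
  then show ?thesis using that \<open>\<sigma> > 0\<close> \<open>a \<noteq> 0 \<or> b \<noteq> 0\<close> lec lt by blast
qed

lemma holomorphic_nonneg_imp_constant:
  assumes h: "h holomorphic_on ball 0 1" and r: "\<And>t. t \<in> ball 0 1 \<Longrightarrow> h t = of_real (cmod (h t))"
  shows "h constant_on ball 0 1"
proof (rule ccontr)
  assume nc: "\<not> ?thesis"
  have "open (h ` ball 0 1)"
    by (rule open_mapping_thm[OF h _ _ _ _ nc]) auto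
  moreover have "h 0 \<in> h ` ball 0 1" by simp
  ultimately obtain e where e: "e > 0" "ball (h 0) e \<subseteq> h ` ball 0 1"
    using open_contains_ball by blast
  have "h 0 + \<i> * of_real (e/2) \<in> ball (h 0) e" using e(1) by (simp add: dist_norm norm_mult)
  then obtain t where t: "t \<in> ball 0 1" "h t = h 0 + \<i> * of_real (e/2)" using e(2) by (metis imageE subsetD)
  have "Im (h t) = 0" "Im (h 0) = 0" using r[OF t(1)] r[of 0] by (metis Im_complex_of_real centre_in_ball zero_less_one)+
  then show False using t(2) e(1) by simp
qed

text \<open>Along an analytic disc in the boundary the supporting functional of the centre is constant and equal to
  its maximum, which forces each of its two summands to be a nonnegative constant.\<close>

lemma disc_in_frontier:
  assumes S: "open S" "convex S" "reinhardt S" "S \<noteq> {}"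
    and f: "holomorphic_map_on f (ball 0 1)" "f ` ball 0 1 \<subseteq> frontier S"
  obtains (const) c where "\<And>t. t \<in> ball 0 1 \<Longrightarrow> f t = c"
  | (fst) c where "\<And>t. t \<in> ball 0 1 \<Longrightarrow> fst (f t) = c" "c \<noteq> 0" "\<And>w. w \<in> closure S \<Longrightarrow> cmod (fst w) \<le> cmod c"
  | (snd) c where "\<And>t. t \<in> ball 0 1 \<Longrightarrow> snd (f t) = c" "c \<noteq> 0" "\<And>w. w \<in> closure S \<Longrightarrow> cmod (snd w) \<le> cmod c"
proof -
  have fr: "f t \<in> frontier S" "f t \<in> closure S" if "t \<in> ball 0 1" for t
    using f(2) that unfolding frontier_def by blast+
  have h1: "(\<lambda>t. fst (f t)) holomorphic_on ball 0 1" and h2: "(\<lambda>t. snd (f t)) holomorphic_on ball 0 1"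
    using f(1) by (auto simp: holomorphic_map_on_def)
  have z: "(0::complex) \<in> ball 0 1" by simp
  obtain a b \<sigma> where s: "\<sigma> > 0" "a \<noteq> 0 \<or> b \<noteq> 0"
    "\<And>w. w \<in> closure S \<Longrightarrow> cmod a * cmod (fst w) + cmod b * cmod (snd w) \<le> \<sigma>"
    "a * fst (f 0) + b * snd (f 0) = of_real \<sigma>"
    using reinhardt_supporting_functional[OF S fr(1)[OF z]] by metis
  define h where "h = (\<lambda>t. a * fst (f t) + b * snd (f t))"
  have hh: "h holomorphic_on ball 0 1" unfolding h_def by (intro holomorphic_intros h1 h2)
  have hle: "cmod (h t) \<le> \<sigma>" if "t \<in> ball 0 1" for t
    using norm_triangle_ineq[of "a * fst (f t)" "b * snd (f t)"] s(3)[OF fr(2)[OF that]]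
    by (simp add: h_def norm_mult)
  have "h constant_on ball 0 1"
    by (rule maximum_modulus_principle[OF hh _ _ _ subset_refl z]) (use hle s in \<open>auto simp: h_def\<close>)
  then have hc: "h t = of_real \<sigma>" if "t \<in> ball 0 1" for t
    using that z s(4) unfolding constant_on_def h_def by metis
  have nn: "a * fst (f t) = of_real (cmod (a * fst (f t))) \<and> b * snd (f t) = of_real (cmod (b * snd (f t)))"
    if t: "t \<in> ball 0 1" for t
  proof -
    have "Re (a * fst (f t)) + Re (b * snd (f t)) = \<sigma>" using hc[OF t] by (simp add: h_def complex_eq_iff)
    moreover have "cmod (a * fst (f t)) + cmod (b * snd (f t)) \<le> \<sigma>"
      using s(3)[OF fr(2)[OF t]] by (simp add: norm_mult)
    ultimately have "Re (a * fst (f t)) = cmod (a * fst (f t))" "Re (b * snd (f t)) = cmod (b * snd (f t))"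
      using complex_Re_le_cmod[of "a * fst (f t)"] complex_Re_le_cmod[of "b * snd (f t)"] by linarith+
    moreover have "u = of_real (cmod u)" if "Re u = cmod u" for u
      using that by (intro Re_eq_norm_bound) auto
    ultimately show ?thesis by blast
  qed
  have "(\<lambda>t. a * fst (f t)) constant_on ball 0 1"
    by (rule holomorphic_nonneg_imp_constant) (intro holomorphic_intros h1, use nn in blast)
  then obtain c1 where c1: "\<And>t. t \<in> ball 0 1 \<Longrightarrow> a * fst (f t) = c1" unfolding constant_on_def by blast
  have "(\<lambda>t. b * snd (f t)) constant_on ball 0 1"
    by (rule holomorphic_nonneg_imp_constant) (intro holomorphic_intros h2, use nn in blast)
  then obtain c2 where c2: "\<And>t. t \<in> ball 0 1 \<Longrightarrow> b * snd (f t) = c2" unfolding constant_on_def by blast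
  show thesis
  proof (cases "a = 0")
    case True
    then have b: "b \<noteq> 0" using s by auto
    have c: "snd (f t) = of_real \<sigma> / b" if "t \<in> ball 0 1" for t
      using hc[OF that] True b by (simp add: h_def field_simps)
    show thesis
      by (rule snd[OF c]) (use s True b in \<open>auto simp: norm_divide field_simps\<close>)
  next
    case a: False
    show thesis
    proof (cases "b = 0")
      case True
      have c: "fst (f t) = of_real \<sigma> / a" if "t \<in> ball 0 1" for t
        using hc[OF that] True a by (simp add: h_def field_simps)
      show thesis
        by (rule fst[OF c]) (use s True a in \<open>auto simp: norm_divide field_simps\<close>)
    next
      case False
      show thesis
      proof (rule const)
        fix t :: complex assume "t \<in> ball 0 1"
        then show "f t = (c1 / a, c2 / b)"
          using c1[of t] c2[of t] a False by (auto simp: prod_eq_iff field_simps)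
      qed
    qed
  qed
qed

section \<open>The Bergman space of a bounded convex Reinhardt domain\<close>

lemma holomorphic2_const: "(\<lambda>z. c) holomorphic2_on S"
  unfolding holomorphic2_on_def
  by (intro ballI exI[of _ 0]) (auto intro!: derivative_eq_intros)

lemma holomorphic2_fst: "fst holomorphic2_on S"
  unfolding holomorphic2_on_def
  by (intro ballI exI[of _ 1] exI[of _ 0]) (auto intro!: derivative_eq_intros)

lemma holomorphic2_snd: "snd holomorphic2_on S"
  unfolding holomorphic2_on_def
  by (intro ballI exI[of _ 0] exI[of _ 1]) (auto intro!: derivative_eq_intros)

lemma holomorphic2_add:
  assumes "f holomorphic2_on S" "g holomorphic2_on S"
  shows "(\<lambda>z. f z + g z) holomorphic2_on S"
  unfolding holomorphic2_on_def
proof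
  fix z assume z: "z \<in> S"
  obtain a b a' b' where "(f has_derivative (\<lambda>h. a * fst h + b * snd h)) (at z)"
    "(g has_derivative (\<lambda>h. a' * fst h + b' * snd h)) (at z)"
    using assms z unfolding holomorphic2_on_def by blast
  then have "((\<lambda>z. f z + g z) has_derivative (\<lambda>h. (a * fst h + b * snd h) + (a' * fst h + b' * snd h))) (at z)"
    by (rule has_derivative_add)
  then show "\<exists>a b. ((\<lambda>z. f z + g z) has_derivative (\<lambda>h. a * fst h + b * snd h)) (at z)"
    by (intro exI[of _ "a + a'"] exI[of _ "b + b'"]) (simp add: algebra_simps)
qed

lemma holomorphic2_mult:
  assumes "f holomorphic2_on S" "g holomorphic2_on S"
  shows "(\<lambda>z. f z * g z) holomorphic2_on S"
  unfolding holomorphic2_on_def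
proof
  fix z assume z: "z \<in> S"
  obtain a b a' b' where "(f has_derivative (\<lambda>h. a * fst h + b * snd h)) (at z)"
    "(g has_derivative (\<lambda>h. a' * fst h + b' * snd h)) (at z)"
    using assms z unfolding holomorphic2_on_def by blast
  then have "((\<lambda>z. f z * g z) has_derivative (\<lambda>h. f z * (a' * fst h + b' * snd h) + (a * fst h + b * snd h) * g z)) (at z)"
    by (rule has_derivative_mult)
  then show "\<exists>a b. ((\<lambda>z. f z * g z) has_derivative (\<lambda>h. a * fst h + b * snd h)) (at z)"
    by (intro exI[of _ "f z * a' + a * g z"] exI[of _ "f z * b' + b * g z"]) (simp add: algebra_simps)
qed

lemma holomorphic2_power: "f holomorphic2_on S \<Longrightarrow> (\<lambda>z. f z ^ n) holomorphic2_on S"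
  by (induction n) (auto intro: holomorphic2_const holomorphic2_mult)

lemma holomorphic2_cong_open:
  assumes "open S" "\<And>z. z \<in> S \<Longrightarrow> f z = g z" "f holomorphic2_on S"
  shows "g holomorphic2_on S"
  unfolding holomorphic2_on_def
proof
  fix z assume z: "z \<in> S"
  obtain a b where "(f has_derivative (\<lambda>h. a * fst h + b * snd h)) (at z)"
    using assms z unfolding holomorphic2_on_def by blast
  then have "(g has_derivative (\<lambda>h. a * fst h + b * snd h)) (at z)"
    by (rule has_derivative_transform_within_open[OF _ assms(1) z]) (use assms in auto)
  then show "\<exists>a b. (g has_derivative (\<lambda>h. a * fst h + b * snd h)) (at z)" by blast
qed

lemma holomorphic2_compose_affine:
  assumes f: "f holomorphic2_on S" and T: "\<And>w. w \<in> T \<Longrightarrow> (x + \<xi> * fst w, y + \<eta> * snd w) \<in> S"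
  shows "(\<lambda>w. f (x + \<xi> * fst w, y + \<eta> * snd w)) holomorphic2_on T"
  unfolding holomorphic2_on_def
proof
  fix w assume "w \<in> T"
  then obtain a b where d: "(f has_derivative (\<lambda>h. a * fst h + b * snd h)) (at (x + \<xi> * fst w, y + \<eta> * snd w))"
    using f T unfolding holomorphic2_on_def by blast
  have "((\<lambda>w. f (x + \<xi> * fst w, y + \<eta> * snd w)) has_derivative
      (\<lambda>h. a * fst (\<xi> * fst h, \<eta> * snd h) + b * snd (\<xi> * fst h, \<eta> * snd h))) (at w)"
    by (rule has_derivative_compose[where f="\<lambda>w. (x + \<xi> * fst w, y + \<eta> * snd w)" and g = f, OF _ d])
      (auto intro!: derivative_eq_intros)
  then show "\<exists>a b. ((\<lambda>w. f (x + \<xi> * fst w, y + \<eta> * snd w)) has_derivative (\<lambda>h. a * fst h + b * snd h)) (at w)"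
    by (intro exI[of _ "a * \<xi>"] exI[of _ "b * \<eta>"]) (simp add: mult.assoc)
qed

lemma holomorphic2_derivative:
  assumes f: "f holomorphic2_on S" and z: "z \<in> S"
  shows "(f has_derivative (\<lambda>h. deriv (\<lambda>u. f (u, snd z)) (fst z) * fst h + deriv (\<lambda>u. f (fst z, u)) (snd z) * snd h)) (at z)"
proof -
  obtain a b where d: "(f has_derivative (\<lambda>h. a * fst h + b * snd h)) (at z)"
    using f z unfolding holomorphic2_on_def by blast
  have "((\<lambda>u. f (u, snd z)) has_derivative (\<lambda>h. a * fst (h, 0::complex) + b * snd (h, 0))) (at (fst z))"
    by (rule has_derivative_compose[where f="\<lambda>u. (u, snd z)" and g = f]) (use d in \<open>auto intro!: derivative_eq_intros\<close>)
  then have "((\<lambda>u. f (u, snd z)) has_field_derivative a) (at (fst z))"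
    by (simp add: has_field_derivative_def)
  then have 1: "deriv (\<lambda>u. f (u, snd z)) (fst z) = a" by (rule DERIV_imp_deriv)
  have "((\<lambda>u. f (fst z, u)) has_derivative (\<lambda>h. a * fst (0::complex, h) + b * snd (0::complex, h))) (at (snd z))"
    by (rule has_derivative_compose[where f="\<lambda>u. (fst z, u)" and g = f]) (use d in \<open>auto intro!: derivative_eq_intros\<close>)
  then have "((\<lambda>u. f (fst z, u)) has_field_derivative b) (at (snd z))"
    by (simp add: has_field_derivative_def)
  then have 2: "deriv (\<lambda>u. f (fst z, u)) (snd z) = b" by (rule DERIV_imp_deriv)
  show ?thesis using d by (simp add: 1 2)
qed

definition polydisc :: "C2 \<Rightarrow> real \<Rightarrow> C2 set" where
  "polydisc z r = ball (fst z) r \<times> ball (snd z) r"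

lemma mem_polydisc: "w \<in> polydisc z r \<longleftrightarrow> cmod (fst w - fst z) < r \<and> cmod (snd w - snd z) < r"
  by (auto simp: polydisc_def dist_norm norm_minus_commute mem_Times_iff)

lemma open_polydisc [simp]: "open (polydisc z r)" by (simp add: polydisc_def open_Times)
lemma convex_polydisc: "convex (polydisc z r)" by (simp add: polydisc_def convex_Times)
lemma bounded_polydisc: "bounded (polydisc z r)" by (simp add: polydisc_def bounded_Times)

lemma complete_reinhardt_polydisc: "complete_reinhardt (polydisc 0 r)"
  unfolding complete_reinhardt_def by (force simp: mem_polydisc)

lemma polydisc_in_open:
  assumes "open S" "z \<in> S" obtains r where "r > 0" "polydisc z r \<subseteq> S"
proof -
  obtain e where e: "e > 0" "ball z e \<subseteq> S" using assms open_contains_ball by blast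
  have "polydisc z (e/2) \<subseteq> ball z e"
  proof
    fix w assume "w \<in> polydisc z (e/2)"
    then have "cmod (fst w - fst z) + cmod (snd w - snd z) < e" by (simp add: mem_polydisc)
    moreover have "dist z w \<le> cmod (fst w - fst z) + cmod (snd w - snd z)"
      by (cases z; cases w) (simp add: dist_norm norm_Pair norm_minus_commute sqrt_sum_squares_le_sum)
    ultimately show "w \<in> ball z e" by simp
  qed
  then show ?thesis using that[of "e/2"] e by auto
qed

lemma lmeasurable_bounded_open: "bounded S \<Longrightarrow> open S \<Longrightarrow> S \<in> lmeasurable" for S :: "C2 set"
  by (simp add: bounded_set_imp_lmeasurable sets_completionI_sets)

lemma bounded_continuous_L2:
  assumes S: "open S" "bounded S" and g: "continuous_on S g" and B: "\<And>z. z \<in> S \<Longrightarrow> cmod (g z) \<le> B"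
  shows "g \<in> L2 S"
proof -
  have "(\<lambda>z. 1) \<in> L2 S"
    using lmeasurable_bounded_open[OF S(2,1)]
    by (simp add: L2_def finite_measure.integrable_const[OF finite_measure_lebesgue_on])
  from L2_mult_bounded[OF this borel_measurable_lebesgue_on_continuous[OF S(1) g] B] show ?thesis by simp
qed

lemma l2_norm_const:
  assumes S: "open S" "bounded S"
  shows "l2_norm S (\<lambda>z. c) = cmod c * sqrt (measure lebesgue S)"
  unfolding l2_norm_def
  using open_sets_lebesgue[OF S(1)] by (simp add: measure_restrict_space real_sqrt_mult)

lemma measure_open_pos:
  fixes S :: "C2 set"
  assumes "open S" "S \<noteq> {}" "bounded S" shows "measure lebesgue S > 0"
proof -
  have "\<not> negligible S" using assms open_not_negligible by blast
  then have "measure lebesgue S \<noteq> 0"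
    using lmeasurable_bounded_open[OF assms(3,1)] by (simp add: negligible_iff_measure)
  then show ?thesis by (simp add: zero_less_measure_iff)
qed

lemma A2D:
  assumes "f \<in> A2 \<Omega>"
  shows "f holomorphic2_on \<Omega>" "f \<in> L2 \<Omega>" "\<And>z. z \<notin> \<Omega> \<Longrightarrow> f z = 0" "continuous_on \<Omega> f"
  using assms holomorphic2_on_imp_continuous_on unfolding A2_def by auto

lemma A2_zero: "(\<lambda>z. 0) \<in> A2 \<Omega>"
  by (simp add: A2_def holomorphic2_const)

lemma A2_add: "f \<in> A2 \<Omega> \<Longrightarrow> g \<in> A2 \<Omega> \<Longrightarrow> (\<lambda>z. f z + g z) \<in> A2 \<Omega>"
  by (simp add: A2_def holomorphic2_add L2_add)

lemma A2_scale: "f \<in> A2 \<Omega> \<Longrightarrow> (\<lambda>z. c * f z) \<in> A2 \<Omega>"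
  by (simp add: A2_def holomorphic2_mult holomorphic2_const L2_scale)

lemma A2_diff: "f \<in> A2 \<Omega> \<Longrightarrow> g \<in> A2 \<Omega> \<Longrightarrow> (\<lambda>z. f z - g z) \<in> A2 \<Omega>"
  using A2_add[of f \<Omega> "\<lambda>z. (-1) * g z"] A2_scale[of g \<Omega> "-1"] by simp

lemma A2_sum: "(\<And>i. i \<in> I \<Longrightarrow> f i \<in> A2 \<Omega>) \<Longrightarrow> (\<lambda>z. \<Sum>i\<in>I. f i z) \<in> A2 \<Omega>"
  by (induction I rule: infinite_finite_induct) (auto intro: A2_add A2_zero)

text \<open>The mean over the torus of a function holomorphic on a polydisc is its value at the centre, so the
  contraction property of Fourier coefficients bounds that value by the norm.\<close>

lemma point_evaluation_polydisc:
  assumes \<Omega>: "open \<Omega>" and r: "r > 0" and sub: "polydisc z r \<subseteq> \<Omega>" and f: "f \<in> A2 \<Omega>"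
  shows "cmod (f z) \<le> l2_norm \<Omega> f / sqrt (measure lebesgue (polydisc (0::C2) r))"
proof -
  let ?D = "polydisc (0::C2) r"
  note D = open_polydisc[of "0::C2" r] complete_reinhardt_polydisc[of r]
  note R = complete_reinhardt_imp_reinhardt[OF D(2)]
  define g where "g = (\<lambda>w. f (z + w))"
  have zD: "z + w \<in> \<Omega>" if "w \<in> ?D" for w
    using subsetD[OF sub, of "z + w"] that by (simp add: mem_polydisc)
  have gh: "g holomorphic2_on ?D"
    using holomorphic2_compose_affine[OF A2D(1)[OF f], of ?D "fst z" 1 "snd z" 1] zD
    by (simp add: g_def plus_prod_def)
  have gc: "continuous_on ?D g" by (rule holomorphic2_on_imp_continuous_on[OF gh])
  define F where "F = (\<lambda>z. ennreal (indicator \<Omega> z *\<^sub>R (cmod (f z))\<^sup>2))"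
  have F: "F z = ennreal ((cmod (f z))\<^sup>2) * indicator \<Omega> z" for z
    by (auto simp: F_def indicator_def)
  have Fm: "F \<in> borel_measurable borel"
  proof -
    have "(\<lambda>z. indicator \<Omega> z *\<^sub>R (cmod (f z))\<^sup>2) \<in> borel_measurable borel"
      using \<Omega> by (intro borel_measurable_continuous_on_indicator) (auto intro!: continuous_intros A2D(4)[OF f])
    then show ?thesis unfolding F_def by simp
  qed
  have "(\<integral>\<^sup>+w. ennreal ((cmod (g w))\<^sup>2) * indicator ?D w \<partial>lborel) \<le> (\<integral>\<^sup>+w. F (z + w) \<partial>lborel)"
    by (intro nn_integral_mono) (auto simp: F g_def indicator_def zD)
  also have "\<dots> = (\<integral>\<^sup>+w. F w \<partial>(distr lborel borel ((+) z)))"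
    using Fm by (subst nn_integral_distr) auto
  also have "\<dots> = ennreal ((l2_norm \<Omega> f)\<^sup>2)"
    unfolding lborel_distr_plus F by (rule L2_nn_integral[OF \<Omega> A2D(2)[OF f]])
  finally have le: "(\<integral>\<^sup>+w. ennreal ((cmod (g w))\<^sup>2) * indicator ?D w \<partial>lborel) \<le> ennreal ((l2_norm \<Omega> f)\<^sup>2)" .
  have gL: "g \<in> L2 ?D"
    unfolding L2_continuous_iff[OF D(1) gc] using le_less_trans[OF le ennreal_less_top] by simp
  from le have "(l2_norm ?D g)\<^sup>2 \<le> (l2_norm \<Omega> f)\<^sup>2"
    unfolding L2_nn_integral[OF D(1) gL] by simp
  then have gle: "l2_norm ?D g \<le> l2_norm \<Omega> f" by (rule power2_le_imp_le) simp
  have "cmod (f z) * sqrt (measure lebesgue ?D) = l2_norm ?D (\<lambda>w. f z)"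
    by (simp add: l2_norm_const[OF D(1) bounded_polydisc])
  also have "\<dots> = l2_norm ?D (tcoef 0 0 g)"
    using tcoef_0_0_holomorphic2[OF D gh]
    by (intro l2_norm_cong) (simp add: g_def zero_prod_def[symmetric])
  also have "\<dots> \<le> l2_norm \<Omega> f"
    using tcoef_contraction(2)[OF D(1) R gc gL] gle by (rule order_trans)
  finally have "cmod (f z) * sqrt (measure lebesgue ?D) \<le> l2_norm \<Omega> f" .
  moreover have "measure lebesgue ?D > 0"
    by (rule measure_open_pos[OF D(1) _ bounded_polydisc]) (use r in \<open>auto simp: polydisc_def\<close>)
  ultimately show ?thesis by (simp add: pos_le_divide_eq)
qed

lemma point_evaluation_locally_bounded:
  assumes \<Omega>: "open \<Omega>" and z: "z \<in> \<Omega>"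
  obtains r C where "r > 0" "C > 0" "polydisc z r \<subseteq> \<Omega>"
    "\<And>f w. f \<in> A2 \<Omega> \<Longrightarrow> w \<in> polydisc z r \<Longrightarrow> cmod (f w) \<le> C * l2_norm \<Omega> f"
proof -
  obtain r where r: "r > 0" "polydisc z r \<subseteq> \<Omega>" using polydisc_in_open[OF \<Omega> z] by metis
  have sub: "polydisc w (r/2) \<subseteq> polydisc z r" if "w \<in> polydisc z (r/2)" for w
  proof
    fix v assume "v \<in> polydisc w (r/2)"
    then show "v \<in> polydisc z r"
      using that norm_triangle_ineq[of "fst v - fst w" "fst w - fst z"]
        norm_triangle_ineq[of "snd v - snd w" "snd w - snd z"]
      by (simp add: mem_polydisc)
  qed
  define M where "M = sqrt (measure lebesgue (polydisc (0::C2) (r/2)))"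
  have "M > 0" unfolding M_def real_sqrt_gt_0_iff
    by (rule measure_open_pos[OF open_polydisc _ bounded_polydisc]) (use r in \<open>auto simp: polydisc_def\<close>)
  show ?thesis
  proof (rule that[of "r/2" "1 / M"])
    show "polydisc z (r/2) \<subseteq> \<Omega>" using r by (auto simp: subset_iff mem_polydisc)
    fix f w assume "f \<in> A2 \<Omega>" "w \<in> polydisc z (r/2)"
    then show "cmod (f w) \<le> 1 / M * l2_norm \<Omega> f"
      using point_evaluation_polydisc[OF \<Omega>, of "r/2" w f] sub[of w] r unfolding M_def by auto
  qed (use r \<open>M > 0\<close> in auto)
qed

lemma point_evaluation_bounded:
  assumes "open \<Omega>" "z \<in> \<Omega>"
  obtains C where "C > 0" "\<And>f. f \<in> A2 \<Omega> \<Longrightarrow> cmod (f z) \<le> C * l2_norm \<Omega> f"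
proof (rule point_evaluation_locally_bounded[OF assms])
  fix r C assume "r > 0" "C > 0" "\<And>f w. f \<in> A2 \<Omega> \<Longrightarrow> w \<in> polydisc z r \<Longrightarrow> cmod (f w) \<le> C * l2_norm \<Omega> f"
  then show ?thesis by (intro that[of C]) (auto simp: mem_polydisc)
qed

lemma A2_norm_zero:
  assumes "open \<Omega>" "f \<in> A2 \<Omega>" "l2_norm \<Omega> f = 0"
  shows "f = (\<lambda>z. 0)"
proof
  fix z show "f z = 0"
  proof (cases "z \<in> \<Omega>")
    case True
    obtain C where "cmod (f z) \<le> C * l2_norm \<Omega> f"
      by (rule point_evaluation_bounded[OF assms(1) True]) (use assms(2) in blast)
    then show ?thesis using assms by simp
  qed (use A2D(3)[OF assms(2)] in auto)
qed

text \<open>Local uniform convergence of the functions and, by Cauchy's inequality, of their derivatives makes the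
  pointwise limit of a Cauchy sequence holomorphic; Fatou's lemma makes it the limit in norm.\<close>

lemma A2_complete:
  assumes \<Omega>: "open \<Omega>" and f: "\<And>n::nat. f n \<in> A2 \<Omega>"
    and cau: "\<And>e. e > 0 \<Longrightarrow> \<exists>N. \<forall>m\<ge>N. \<forall>n\<ge>N. l2_norm \<Omega> (\<lambda>z. f m z - f n z) < e"
  obtains g where "g \<in> A2 \<Omega>" "(\<lambda>n. l2_norm \<Omega> (\<lambda>z. f n z - g z)) \<longlonglongrightarrow> 0" "\<And>z. (\<lambda>n. f n z) \<longlonglongrightarrow> g z"
proof -
  have fd: "(\<lambda>z. f m z - f n z) \<in> A2 \<Omega>" for m n by (intro A2_diff f)
  have cauz: "Cauchy (\<lambda>n. f n z)" for z
  proof (cases "z \<in> \<Omega>")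
    case True
    obtain C where C: "C > 0" "\<And>f. f \<in> A2 \<Omega> \<Longrightarrow> cmod (f z) \<le> C * l2_norm \<Omega> f"
      using point_evaluation_bounded[OF \<Omega> True] by blast
    show ?thesis
    proof (rule metric_CauchyI)
      fix e :: real assume "e > 0"
      then obtain N where N: "\<And>m n. m \<ge> N \<Longrightarrow> n \<ge> N \<Longrightarrow> l2_norm \<Omega> (\<lambda>z. f m z - f n z) < e / C"
        using cau[of "e / C"] C by auto
      have "dist (f m z) (f n z) < e" if "m \<ge> N" "n \<ge> N" for m n
        using C(2)[OF fd, of m n] N[OF that] C(1) by (simp add: dist_norm field_simps)
      then show "\<exists>M. \<forall>m\<ge>M. \<forall>n\<ge>M. dist (f m z) (f n z) < e" by blast
    qed
  qed (use A2D(3)[OF f] in \<open>simp add: Cauchy_def\<close>)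
  define g where "g = (\<lambda>z. lim (\<lambda>n. f n z))"
  have lim: "(\<lambda>n. f n z) \<longlonglongrightarrow> g z" for z
    unfolding g_def using Cauchy_convergent[OF cauz] by (simp add: convergent_LIMSEQ_iff)
  have hol: "g holomorphic2_on \<Omega>"
    unfolding holomorphic2_on_def
  proof
    fix z0 assume z0: "z0 \<in> \<Omega>"
    obtain r C where C: "r > 0" "C > 0" "polydisc z0 r \<subseteq> \<Omega>"
      "\<And>f w. f \<in> A2 \<Omega> \<Longrightarrow> w \<in> polydisc z0 r \<Longrightarrow> cmod (f w) \<le> C * l2_norm \<Omega> f"
      using point_evaluation_locally_bounded[OF \<Omega> z0] by metis
    let ?S = "polydisc z0 (r/2)"
    define a where "a = (\<lambda>(h :: C2 \<Rightarrow> complex) x. deriv (\<lambda>u. h (u, snd x)) (fst x) :: complex)"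
    define b where "b = (\<lambda>(h :: C2 \<Rightarrow> complex) x. deriv (\<lambda>u. h (fst x, u)) (snd x) :: complex)"
    have in1: "(u, snd x) \<in> polydisc z0 r" if "x \<in> ?S" "u \<in> cball (fst x) (r/3)" for x u
      using that norm_triangle_ineq[of "u - fst x" "fst x - fst z0"] C(1)
      by (simp add: mem_polydisc dist_norm norm_minus_commute)
    have in2: "(fst x, u) \<in> polydisc z0 r" if "x \<in> ?S" "u \<in> cball (snd x) (r/3)" for x u
      using that norm_triangle_ineq[of "u - snd x" "snd x - snd z0"] C(1)
      by (simp add: mem_polydisc dist_norm norm_minus_commute)
    have ab: "cmod (a h x) \<le> 3 * C / r * l2_norm \<Omega> h \<and> cmod (b h x) \<le> 3 * C / r * l2_norm \<Omega> h"
      if h: "h \<in> A2 \<Omega>" and x: "x \<in> ?S" for h x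
    proof
      have hol1: "(\<lambda>u. h (u, snd x)) holomorphic_on cball (fst x) (r/3)"
        by (rule holomorphic2_slice_fst[OF A2D(1)[OF h]]) (use in1[OF x] C(3) in blast)
      have "cmod ((deriv ^^ 1) (\<lambda>u. h (u, snd x)) (fst x)) \<le> fact 1 * (C * l2_norm \<Omega> h) / (r/3) ^ 1"
        by (rule Cauchy_inequality)
          (use C(1,4) h in1[OF x] in \<open>auto simp: dist_norm intro: holomorphic_on_imp_continuous_on[OF hol1] holomorphic_on_subset[OF hol1]\<close>)
      then show "cmod (a h x) \<le> 3 * C / r * l2_norm \<Omega> h" by (simp add: a_def mult_ac)
      have hol2: "(\<lambda>u. h (fst x, u)) holomorphic_on cball (snd x) (r/3)"
        by (rule holomorphic2_slice_snd[OF A2D(1)[OF h]]) (use in2[OF x] C(3) in blast)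
      have "cmod ((deriv ^^ 1) (\<lambda>u. h (fst x, u)) (snd x)) \<le> fact 1 * (C * l2_norm \<Omega> h) / (r/3) ^ 1"
        by (rule Cauchy_inequality)
          (use C(1,4) h in2[OF x] in \<open>auto simp: dist_norm intro: holomorphic_on_imp_continuous_on[OF hol2] holomorphic_on_subset[OF hol2]\<close>)
      then show "cmod (b h x) \<le> 3 * C / r * l2_norm \<Omega> h" by (simp add: b_def mult_ac)
    qed
    have S\<Omega>: "x \<in> \<Omega>" if "x \<in> ?S" for x
      using subsetD[OF C(3), of x] C(1) that by (simp add: mem_polydisc)
    have lin: "a (\<lambda>z. f m z - f n z) x = a (f m) x - a (f n) x \<and> b (\<lambda>z. f m z - f n z) x = b (f m) x - b (f n) x"
      if x: "x \<in> ?S" for m n x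
    proof -
      have d: "(\<lambda>u. f m (u, snd x)) field_differentiable at (fst x)" for m
        by (rule holomorphic_on_imp_differentiable_at[of _ "ball (fst x) (r/3)"])
          (use C(1,3) in1[OF x] in \<open>auto intro!: holomorphic2_slice_fst[OF A2D(1)[OF f]]\<close>)
      have d': "(\<lambda>u. f m (fst x, u)) field_differentiable at (snd x)" for m
        by (rule holomorphic_on_imp_differentiable_at[of _ "ball (snd x) (r/3)"])
          (use C(1,3) in2[OF x] in \<open>auto intro!: holomorphic2_slice_snd[OF A2D(1)[OF f]]\<close>)
      show ?thesis unfolding a_def b_def by (simp add: d d')
    qed
    have ucau: "\<exists>N. \<forall>m\<ge>N. \<forall>n\<ge>N. \<forall>x\<in>?S. cmod (a (f m) x - a (f n) x) < e \<and> cmod (b (f m) x - b (f n) x) < e"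
      if "e > 0" for e
    proof -
      obtain N where N: "\<And>m n. m \<ge> N \<Longrightarrow> n \<ge> N \<Longrightarrow> l2_norm \<Omega> (\<lambda>z. f m z - f n z) < e / (3 * C / r)"
        using cau[OF divide_pos_pos[OF \<open>e > 0\<close>, of "3 * C / r"]] C(1,2) by fastforce
      have K: "3 * C / r * l2_norm \<Omega> (\<lambda>z. f m z - f n z) < e" if "m \<ge> N" "n \<ge> N" for m n
        using N[OF that] C(1,2) by (simp add: field_simps)
      have "cmod (a (f m) x - a (f n) x) < e \<and> cmod (b (f m) x - b (f n) x) < e"
        if "m \<ge> N" "n \<ge> N" "x \<in> ?S" for m n x
        using ab[OF fd that(3), of m n] K[OF that(1,2)] unfolding lin[OF that(3), of m n, THEN conjunct1]
          lin[OF that(3), of m n, THEN conjunct2] by linarith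
      then show ?thesis by blast
    qed
    define A where "A = (\<lambda>x. lim (\<lambda>n. a (f n) x))"
    define B where "B = (\<lambda>x. lim (\<lambda>n. b (f n) x))"
    have Al: "(\<lambda>n. a (f n) x) \<longlonglongrightarrow> A x" and Bl: "(\<lambda>n. b (f n) x) \<longlonglongrightarrow> B x" if x: "x \<in> ?S" for x
    proof -
      have "Cauchy (\<lambda>n. a (f n) x)" "Cauchy (\<lambda>n. b (f n) x)"
        unfolding Cauchy_def dist_norm using ucau x by meson+
      then show "(\<lambda>n. a (f n) x) \<longlonglongrightarrow> A x" "(\<lambda>n. b (f n) x) \<longlonglongrightarrow> B x"
        unfolding A_def B_def using Cauchy_convergent by (auto simp: convergent_LIMSEQ_iff)
    qed
    have "\<exists>g'. \<forall>x\<in>?S. (\<lambda>n. f n x) \<longlonglongrightarrow> g' x \<and> (g' has_derivative (\<lambda>h. A x * fst h + B x * snd h)) (at x within ?S)"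
    proof (rule has_derivative_sequence[where f' = "\<lambda>n x h. a (f n) x * fst h + b (f n) x * snd h"])
      show "convex ?S" by (rule convex_polydisc)
      show "(f n has_derivative (\<lambda>h. a (f n) x * fst h + b (f n) x * snd h)) (at x within ?S)" if "x \<in> ?S" for n x
        unfolding a_def b_def
        by (rule has_derivative_at_withinI[OF holomorphic2_derivative[OF A2D(1)[OF f] S\<Omega>[OF that]]])
      show "z0 \<in> ?S" using C(1) by (simp add: mem_polydisc)
      show "(\<lambda>n. f n z0) \<longlonglongrightarrow> g z0" by (rule lim)
      fix e :: real assume e: "e > 0"
      obtain N where N: "\<And>m n x. m \<ge> N \<Longrightarrow> n \<ge> N \<Longrightarrow> x \<in> ?S \<Longrightarrow>
          cmod (a (f m) x - a (f n) x) < e/2 \<and> cmod (b (f m) x - b (f n) x) < e/2"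
        using ucau[OF half_gt_zero[OF e]] by blast
      have "cmod (a (f n) x * fst h + b (f n) x * snd h - (A x * fst h + B x * snd h)) \<le> e * norm h"
        if n: "n \<ge> N" and x: "x \<in> ?S" for n x h
      proof -
        have 1: "cmod (a (f n) x - A x) \<le> e/2"
          by (rule LIMSEQ_le_const2[OF tendsto_norm[OF tendsto_diff[OF tendsto_const Al[OF x]]]])
            (use N[OF n _ x] less_imp_le in blast)
        have 2: "cmod (b (f n) x - B x) \<le> e/2"
          by (rule LIMSEQ_le_const2[OF tendsto_norm[OF tendsto_diff[OF tendsto_const Bl[OF x]]]])
            (use N[OF n _ x] less_imp_le in blast)
        have "cmod (a (f n) x * fst h + b (f n) x * snd h - (A x * fst h + B x * snd h))
            = cmod ((a (f n) x - A x) * fst h + (b (f n) x - B x) * snd h)" by (simp add: algebra_simps)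
        also have "\<dots> \<le> cmod (a (f n) x - A x) * cmod (fst h) + cmod (b (f n) x - B x) * cmod (snd h)"
          by (rule order_trans[OF norm_triangle_ineq]) (simp add: norm_mult)
        also have "\<dots> \<le> e/2 * norm h + e/2 * norm h"
          using norm_fst_le[of "fst h" "snd h"] norm_snd_le[of "snd h" "fst h"] e
          by (intro add_mono mult_mono 1 2) auto
        finally show ?thesis by simp
      qed
      then show "\<forall>\<^sub>F n in sequentially. \<forall>x\<in>?S. \<forall>h. norm (a (f n) x * fst h + b (f n) x * snd h - (A x * fst h + B x * snd h)) \<le> e * norm h"
        unfolding eventually_sequentially by blast
    qed
    then obtain g' where g': "\<And>x. x \<in> ?S \<Longrightarrow> (\<lambda>n. f n x) \<longlonglongrightarrow> g' x"
      "\<And>x. x \<in> ?S \<Longrightarrow> (g' has_derivative (\<lambda>h. A x * fst h + B x * snd h)) (at x within ?S)" by blast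
    have z0S: "z0 \<in> ?S" using C(1) by (simp add: mem_polydisc)
    have "(g' has_derivative (\<lambda>h. A z0 * fst h + B z0 * snd h)) (at z0)"
      using g'(2)[OF z0S] at_within_open[OF z0S open_polydisc] by simp
    then have "(g has_derivative (\<lambda>h. A z0 * fst h + B z0 * snd h)) (at z0)"
      by (rule has_derivative_transform_within_open[OF _ open_polydisc z0S])
        (use LIMSEQ_unique[OF lim g'(1)] in auto)
    then show "\<exists>a b. (g has_derivative (\<lambda>h. a * fst h + b * snd h)) (at z0)" by blast
  qed
  have gc: "continuous_on \<Omega> g" by (rule holomorphic2_on_imp_continuous_on[OF hol])
  have fatou: "(\<integral>\<^sup>+z. ennreal ((cmod (f n z - g z))\<^sup>2) * indicator \<Omega> z \<partial>lborel) \<le> ennreal (e\<^sup>2)"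
    if N: "\<And>m. m \<ge> N \<Longrightarrow> l2_norm \<Omega> (\<lambda>z. f n z - f m z) \<le> e" and e: "e \<ge> 0" for n N e
  proof -
    have m: "(\<lambda>z. ennreal ((cmod (f n z - f m z))\<^sup>2)) \<in> borel_measurable (lebesgue_on \<Omega>)" for m
      using borel_measurable_lebesgue_on_continuous[OF \<Omega> A2D(4)[OF fd, of n m]] by simp
    have "(\<integral>\<^sup>+z. ennreal ((cmod (f n z - g z))\<^sup>2) \<partial>lebesgue_on \<Omega>)
        = (\<integral>\<^sup>+z. liminf (\<lambda>m. ennreal ((cmod (f n z - f m z))\<^sup>2)) \<partial>lebesgue_on \<Omega>)"
    proof (intro nn_integral_cong)
      fix z
      have "(\<lambda>m. ennreal ((cmod (f n z - f m z))\<^sup>2)) \<longlonglongrightarrow> ennreal ((cmod (f n z - g z))\<^sup>2)"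
        by (intro tendsto_ennrealI tendsto_intros lim)
      from lim_imp_Liminf[OF _ this]
      show "ennreal ((cmod (f n z - g z))\<^sup>2) = liminf (\<lambda>m. ennreal ((cmod (f n z - f m z))\<^sup>2))" by simp
    qed
    also have "\<dots> \<le> liminf (\<lambda>m. \<integral>\<^sup>+z. ennreal ((cmod (f n z - f m z))\<^sup>2) \<partial>lebesgue_on \<Omega>)"
      by (rule nn_integral_liminf[OF m])
    also have "\<dots> = liminf (\<lambda>m. ennreal ((l2_norm \<Omega> (\<lambda>z. f n z - f m z))\<^sup>2))"
      using L2_nn_integral[OF \<Omega> A2D(2)[OF fd]] by (simp add: lebesgue_on_nn_integral_eq_lborel[OF \<Omega>])
    also have "\<dots> \<le> ennreal (e\<^sup>2)"
    proof (rule Liminf_le)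
      show "\<forall>\<^sub>F m in sequentially. ennreal ((l2_norm \<Omega> (\<lambda>z. f n z - f m z))\<^sup>2) \<le> ennreal (e\<^sup>2)"
        unfolding eventually_sequentially using N by (intro exI[of _ N]) (auto intro!: ennreal_leI power_mono)
    qed simp
    finally show ?thesis by (simp add: lebesgue_on_nn_integral_eq_lborel[OF \<Omega>])
  qed
  have dc: "continuous_on \<Omega> (\<lambda>z. f n z - g z)" for n by (intro continuous_intros gc A2D(4)[OF f])
  have norm_le: "\<exists>N. \<forall>n\<ge>N. (\<lambda>z. f n z - g z) \<in> L2 \<Omega> \<and> l2_norm \<Omega> (\<lambda>z. f n z - g z) \<le> e" if e: "e > 0" for e
  proof -
    obtain N where N: "\<And>m n. m \<ge> N \<Longrightarrow> n \<ge> N \<Longrightarrow> l2_norm \<Omega> (\<lambda>z. f m z - f n z) < e" using cau[OF e] by blast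
    have "(\<lambda>z. f n z - g z) \<in> L2 \<Omega> \<and> l2_norm \<Omega> (\<lambda>z. f n z - g z) \<le> e" if n: "n \<ge> N" for n
    proof -
      have le: "(\<integral>\<^sup>+z. ennreal ((cmod (f n z - g z))\<^sup>2) * indicator \<Omega> z \<partial>lborel) \<le> ennreal (e\<^sup>2)"
        by (rule fatou[of N]) (use N[OF n] e less_imp_le in auto)
      have L: "(\<lambda>z. f n z - g z) \<in> L2 \<Omega>"
        unfolding L2_continuous_iff[OF \<Omega> dc] using le_less_trans[OF le ennreal_less_top] by simp
      from le have "(l2_norm \<Omega> (\<lambda>z. f n z - g z))\<^sup>2 \<le> e\<^sup>2" unfolding L2_nn_integral[OF \<Omega> L] by simp
      then have "l2_norm \<Omega> (\<lambda>z. f n z - g z) \<le> e" by (rule power2_le_imp_le) (use e in simp)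
      with L show ?thesis by simp
    qed
    then show ?thesis by blast
  qed
  obtain n where "(\<lambda>z. f n z - g z) \<in> L2 \<Omega>" using norm_le[of 1] by auto
  from L2_diff[OF A2D(2)[OF f[of n]] this] have "g \<in> L2 \<Omega>" by simp
  moreover have "g z = 0" if "z \<notin> \<Omega>" for z
    using LIMSEQ_unique[OF lim[of z], of 0] A2D(3)[OF f that] by simp
  ultimately have "g \<in> A2 \<Omega>" using hol by (simp add: A2_def)
  moreover have "(\<lambda>n. l2_norm \<Omega> (\<lambda>z. f n z - g z)) \<longlonglongrightarrow> 0"
  proof (rule LIMSEQ_I)
    fix r :: real assume "r > 0"
    then show "\<exists>no. \<forall>n\<ge>no. norm (l2_norm \<Omega> (\<lambda>z. f n z - g z) - 0) < r"
      using norm_le[of "r/2"] by (force intro: le_less_trans)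
  qed
  ultimately show ?thesis using that lim by blast
qed

locale reinhardt_domain =
  fixes \<Omega> :: "C2 set"
  assumes open_Omega: "open \<Omega>" and bounded_Omega: "bounded \<Omega>" and convex_Omega: "convex \<Omega>"
    and reinhardt_Omega: "reinhardt \<Omega>" and nonempty_Omega: "\<Omega> \<noteq> {}"
begin

abbreviation nrm :: "(C2 \<Rightarrow> complex) \<Rightarrow> real" where "nrm \<equiv> l2_norm \<Omega>"
abbreviation inn :: "(C2 \<Rightarrow> complex) \<Rightarrow> (C2 \<Rightarrow> complex) \<Rightarrow> complex" where "inn \<equiv> l2_inner \<Omega>"

lemma complete_Omega: "complete_reinhardt \<Omega>"
  by (rule convex_reinhardt_imp_complete[OF convex_Omega reinhardt_Omega])

lemma zero_in_Omega: "(0, 0) \<in> \<Omega>"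
proof -
  obtain z where "z \<in> \<Omega>" using nonempty_Omega by blast
  then show ?thesis by (rule complete_reinhardtD[OF complete_Omega]) auto
qed

lemma continuous_bounded_L2: "continuous_on \<Omega> g \<Longrightarrow> (\<And>z. z \<in> \<Omega> \<Longrightarrow> cmod (g z) \<le> B) \<Longrightarrow> g \<in> L2 \<Omega>"
  by (rule bounded_continuous_L2[OF open_Omega bounded_Omega])

subsection \<open>The orthonormal basis of monomials\<close>

text \<open>Zero off the domain, as for every element of the Bergman space.\<close>

definition mono :: "nat \<times> nat \<Rightarrow> C2 \<Rightarrow> complex" where
  "mono \<alpha> z = (if z \<in> \<Omega> then fst z ^ fst \<alpha> * snd z ^ snd \<alpha> else 0)"

lemma mono_A2: "mono \<alpha> \<in> A2 \<Omega>"
proof -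
  let ?m = "\<lambda>z :: C2. fst z ^ fst \<alpha> * snd z ^ snd \<alpha>"
  have h: "?m holomorphic2_on \<Omega>"
    by (intro holomorphic2_mult holomorphic2_power holomorphic2_fst holomorphic2_snd)
  obtain R where R: "\<And>z. z \<in> \<Omega> \<Longrightarrow> norm z \<le> R" using bounded_Omega unfolding bounded_iff by blast
  have "?m \<in> L2 \<Omega>"
  proof (rule continuous_bounded_L2[OF holomorphic2_on_imp_continuous_on[OF h]])
    fix z assume z: "z \<in> \<Omega>"
    have "0 \<le> R" using order_trans[OF norm_ge_zero R[OF z]] .
    moreover have "cmod (fst z) \<le> R" "cmod (snd z) \<le> R"
      using R[OF z] norm_fst_le[of "fst z" "snd z"] norm_snd_le[of "snd z" "fst z"] by auto
    ultimately show "cmod (fst z ^ fst \<alpha> * snd z ^ snd \<alpha>) \<le> R ^ fst \<alpha> * R ^ snd \<alpha>"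
      unfolding norm_mult norm_power by (intro mult_mono power_mono) auto
  qed
  then have "mono \<alpha> \<in> L2 \<Omega>" by (subst L2_cong[of \<Omega> _ ?m]) (auto simp: mono_def)
  moreover have "mono \<alpha> holomorphic2_on \<Omega>"
    by (rule holomorphic2_cong_open[OF open_Omega _ h]) (auto simp: mono_def)
  ultimately show ?thesis by (simp add: A2_def mono_def)
qed

lemma mono_norm_pos: "nrm (mono \<alpha>) > 0"
proof -
  obtain r where r: "r > 0" "\<And>w. cmod (fst w) < r \<Longrightarrow> cmod (snd w) < r \<Longrightarrow> w \<in> \<Omega>"
    using complete_reinhardt_enlarge[OF open_Omega complete_Omega zero_in_Omega] by auto
  let ?w = "(of_real (r/2), of_real (r/2)) :: C2"
  have "?w \<in> \<Omega>" using r by auto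
  then have "mono \<alpha> ?w \<noteq> 0" using r(1) by (simp add: mono_def)
  then have "nrm (mono \<alpha>) \<noteq> 0" using A2_norm_zero[OF open_Omega mono_A2[of \<alpha>]] by auto
  then show ?thesis using l2_norm_nonneg[of \<Omega> "mono \<alpha>"] by linarith
qed

definition emon :: "nat \<times> nat \<Rightarrow> C2 \<Rightarrow> complex" where
  "emon \<alpha> = (\<lambda>z. complex_of_real (1 / nrm (mono \<alpha>)) * mono \<alpha> z)"

lemma emon_A2: "emon \<alpha> \<in> A2 \<Omega>"
  unfolding emon_def by (intro A2_scale mono_A2)

lemma emon_norm: "nrm (emon \<alpha>) = 1"
  unfolding emon_def l2_norm_scale using mono_norm_pos[of \<alpha>] by (simp add: norm_divide)

text \<open>Weight \<open>(k, l)\<close> under the torus; negative weights occur for components of a symbol.\<close>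

definition homog :: "int \<Rightarrow> int \<Rightarrow> (C2 \<Rightarrow> complex) \<Rightarrow> bool" where
  "homog k l g \<longleftrightarrow> (\<forall>z\<in>\<Omega>. \<forall>s t. g (act (ex s) (ex t) z) = ex (of_int k * s) * ex (of_int l * t) * g z)"

text \<open>Rotating both functions does not change the inner product, but multiplies it by a character that takes
  values other than 1.\<close>

lemma homog_inner_zero:
  assumes f: "continuous_on \<Omega> f" "homog k l f" and g: "continuous_on \<Omega> g" "homog k' l' g"
    and ne: "(k, l) \<noteq> (k', l')"
  shows "inn f g = 0"
proof -
  have shift: "inn f g = ex (of_int (k - k') * s) * ex (of_int (l - l') * t) * inn f g" for s t
  proof -
    have "inn f g = inn (\<lambda>z. f (act (ex s) (ex t) z)) (\<lambda>z. g (act (ex s) (ex t) z))"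
      using l2_inner_act[OF open_Omega reinhardt_Omega f(1) g(1), of "ex s" "ex t"] by simp
    also have "\<dots> = inn (\<lambda>z. ex (of_int k * s) * ex (of_int l * t) * f z) (\<lambda>z. ex (of_int k' * s) * ex (of_int l' * t) * g z)"
      by (rule l2_inner_cong) (use f(2) g(2) in \<open>auto simp: homog_def\<close>)
    also have "\<dots> = (ex (of_int k * s) * cnj (ex (of_int k' * s))) * (ex (of_int l * t) * cnj (ex (of_int l' * t))) * inn f g"
      unfolding l2_inner_scale_left l2_inner_scale_right by (simp add: mult_ac)
    also have "ex (of_int k * s) * cnj (ex (of_int k' * s)) = ex (of_int (k - k') * s)"
      unfolding ex_minus[symmetric] ex_add[symmetric] by (simp add: algebra_simps)
    also have "ex (of_int l * t) * cnj (ex (of_int l' * t)) = ex (of_int (l - l') * t)"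
      unfolding ex_minus[symmetric] ex_add[symmetric] by (simp add: algebra_simps)
    finally show ?thesis .
  qed
  have half: "ex (1/2) = -1" by (simp add: ex_def)
  show ?thesis
  proof (cases "k = k'")
    case True
    then have "l \<noteq> l'" using ne by simp
    then have "of_int (l - l') * (1 / (2 * of_int (l - l'))) = (1/2 :: real)" by simp
    with shift[of 0 "1 / (2 * of_int (l - l'))"] have "inn f g = - inn f g" by (simp only: half mult_zero_right ex_0) simp
    then show ?thesis by simp
  next
    case False
    then have "of_int (k - k') * (1 / (2 * of_int (k - k'))) = (1/2 :: real)" by simp
    with shift[of "1 / (2 * of_int (k - k'))" 0] have "inn f g = - inn f g" by (simp only: half mult_zero_right ex_0) simp
    then show ?thesis by simp
  qed
qed

lemma mono_homog: "homog (int (fst \<alpha>)) (int (snd \<alpha>)) (mono \<alpha>)"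
  unfolding homog_def
  by (simp add: mono_def reinhardt_act_iff[OF reinhardt_Omega] power_mult_distrib ex_power mult_ac)

lemma homog_scale: "homog k l g \<Longrightarrow> homog k l (\<lambda>z. c * g z)"
  by (simp add: homog_def mult_ac)

lemma emon_homog: "homog (int (fst \<alpha>)) (int (snd \<alpha>)) (emon \<alpha>)"
  unfolding emon_def by (intro homog_scale mono_homog)

lemma emon_orthonormal: "inn (emon \<alpha>) (emon \<beta>) = (if \<alpha> = \<beta> then 1 else 0)"
proof (cases "\<alpha> = \<beta>")
  case True
  then show ?thesis by (simp add: l2_inner_self emon_norm)
next
  case False
  then have "inn (emon \<alpha>) (emon \<beta>) = 0"
    by (intro homog_inner_zero[OF A2D(4)[OF emon_A2] emon_homog A2D(4)[OF emon_A2] emon_homog])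
      (simp add: prod_eq_iff)
  with False show ?thesis by simp
qed

lemma fcoef_linear:
  assumes f: "continuous_on \<Omega> f" and g: "continuous_on \<Omega> g" and z: "z \<in> \<Omega>"
  shows "fcoef p q k (\<lambda>z. f z + c * g z) z = fcoef p q k f z + c * fcoef p q k g z"
proof -
  have i: "(\<lambda>t. h (act (ex (p * t)) (ex (q * t)) z) * ex (- of_int k * t)) integrable_on {0..1}"
    if "continuous_on \<Omega> h" for h
    by (intro integrable_continuous_real continuous_intros continuous_on_orbit[OF reinhardt_Omega that z])
  show ?thesis
    using integral_add[OF i[OF f] integrable_on_mult_right[OF i[OF g], of c]]
    by (simp add: fcoef_def distrib_right mult.assoc)
qed

lemma fcoef_cong:
  assumes "\<And>z. z \<in> \<Omega> \<Longrightarrow> f z = g z" "z \<in> \<Omega>"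
  shows "fcoef p q k f z = fcoef p q k g z"
  unfolding fcoef_def using assms reinhardt_act[OF reinhardt_Omega] by simp

lemma tcoef_linear:
  assumes f: "continuous_on \<Omega> f" and g: "continuous_on \<Omega> g" and z: "z \<in> \<Omega>"
  shows "tcoef k l (\<lambda>z. f z + c * g z) z = tcoef k l f z + c * tcoef k l g z"
proof -
  have "tcoef k l (\<lambda>z. f z + c * g z) z = fcoef 1 0 k (\<lambda>z. fcoef 0 1 l f z + c * fcoef 0 1 l g z) z"
    unfolding tcoef_def by (rule fcoef_cong[OF fcoef_linear[OF f g] z])
  then show ?thesis unfolding tcoef_def
    using fcoef_linear[OF continuous_on_fcoef[OF reinhardt_Omega f] continuous_on_fcoef[OF reinhardt_Omega g] z]
    by simp
qed

lemma tcoef_homog: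
  assumes g: "homog k l g" and z: "z \<in> \<Omega>"
  shows "tcoef k l g z = g z"
proof -
  have ee: "ex (of_int m * t) * ex (- (of_int m * t)) = 1" for m t
    using ex_cnj by (simp add: ex_minus)
  have 1: "fcoef 0 1 l g w = g w" if w: "w \<in> \<Omega>" for w
  proof -
    have "g (act (ex (0 * t)) (ex (1 * t)) w) = ex (of_int l * t) * g w" for t
      using g w unfolding homog_def by (metis mult_zero_left mult_zero_right mult_1 ex_0)
    then have "g (act (ex (0 * t)) (ex (1 * t)) w) * ex (- of_int l * t) = g w" for t
      using ee[of l t] by (simp add: mult_ac)
    then show ?thesis by (simp only: fcoef_def) simp
  qed
  have 2: "fcoef 1 0 k g z = g z"
  proof -
    have "g (act (ex (1 * t)) (ex (0 * t)) z) = ex (of_int k * t) * g z" for t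
      using g z unfolding homog_def by (metis mult_zero_left mult_zero_right mult_1 mult_1_right ex_0)
    then have "g (act (ex (1 * t)) (ex (0 * t)) z) * ex (- of_int k * t) = g z" for t
      using ee[of k t] by (simp add: mult_ac)
    then show ?thesis by (simp only: fcoef_def) simp
  qed
  have "tcoef k l g z = fcoef 1 0 k g z" unfolding tcoef_def by (rule fcoef_cong[OF 1 z])
  with 2 show ?thesis by simp
qed

text \<open>If \<open>f\<close> is orthogonal to the monomial \<open>m\<close> while its Fourier coefficient is \<open>c m\<close>, the contraction
  property applied to \<open>f + s c m\<close> gives \<open>(1 + s)\<^sup>2 |c|\<^sup>2 \<parallel>m\<parallel>\<^sup>2 \<le> \<parallel>f\<parallel>\<^sup>2 + s\<^sup>2 |c|\<^sup>2 \<parallel>m\<parallel>\<^sup>2\<close>, which fails for large \<open>s\<close>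
  unless \<open>c = 0\<close>.\<close>

lemma tcoef_orthogonal_zero:
  assumes f: "f \<in> A2 \<Omega>" and orth: "\<And>\<alpha>. inn f (mono \<alpha>) = 0" and z: "z \<in> \<Omega>"
  shows "tcoef k l f z = 0"
proof -
  obtain c where c: "\<And>z. z \<in> \<Omega> \<Longrightarrow> tcoef k l f z
      = (if k \<ge> 0 \<and> l \<ge> 0 then c * fst z ^ nat k * snd z ^ nat l else 0)"
    using tcoef_holomorphic2[OF open_Omega complete_Omega nonempty_Omega A2D(1)[OF f], of k l] by blast
  show ?thesis
  proof (cases "k \<ge> 0 \<and> l \<ge> 0")
    case True
    define m where "m = mono (nat k, nat l)"
    have m: "m \<in> A2 \<Omega>" unfolding m_def by (rule mono_A2)
    have cm: "tcoef k l f z = c * m z" if "z \<in> \<Omega>" for z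
      using c[OF that] True that by (simp add: m_def mono_def)
    define X where "X = (cmod c * nrm m)\<^sup>2"
    have key: "(1 + s)\<^sup>2 * X \<le> (nrm f)\<^sup>2 + s\<^sup>2 * X" for s :: real
    proof -
      let ?g = "\<lambda>z. f z + (of_real s * c) * m z"
      have g: "?g \<in> A2 \<Omega>" by (intro A2_add A2_scale f m)
      have hm: "homog k l m" using mono_homog[of "(nat k, nat l)"] True by (simp add: m_def)
      have "tcoef k l ?g z = of_real (1 + s) * c * m z" if "z \<in> \<Omega>" for z
        using tcoef_linear[OF A2D(4)[OF f] A2D(4)[OF m] that, of k l "of_real s * c"]
        unfolding cm[OF that] tcoef_homog[OF hm that] by (simp add: algebra_simps)
      then have "nrm (tcoef k l ?g) = nrm (\<lambda>z. of_real (1 + s) * c * m z)"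
        by (intro l2_norm_cong) simp
      also have "\<dots> = \<bar>1 + s\<bar> * (cmod c * nrm m)"
        unfolding l2_norm_scale by (simp add: norm_mult del: of_real_add)
      finally have 1: "(\<bar>1 + s\<bar> * (cmod c * nrm m))\<^sup>2 \<le> (nrm ?g)\<^sup>2"
        using tcoef_contraction(2)[OF open_Omega reinhardt_Omega A2D(4)[OF g] A2D(2)[OF g], of k l]
        by (intro power_mono) auto
      have "inn f (\<lambda>z. (of_real s * c) * m z) = 0"
        unfolding l2_inner_scale_right by (simp add: m_def orth)
      then have "(nrm ?g)\<^sup>2 = (nrm f)\<^sup>2 + (nrm (\<lambda>z. (of_real s * c) * m z))\<^sup>2"
        by (subst l2_norm_add_sq[OF A2D(2)[OF f] L2_scale[OF A2D(2)[OF m]]]) simp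
      then show ?thesis using 1
        unfolding l2_norm_scale X_def by (simp add: power_mult_distrib norm_mult)
    qed
    have "X = 0"
    proof (rule ccontr)
      assume "X \<noteq> 0"
      then have "X > 0" by (simp add: X_def)
      have "X + 2 * ((nrm f)\<^sup>2 / X) * X \<le> (nrm f)\<^sup>2"
        using key[of "(nrm f)\<^sup>2 / X"] by (simp add: power2_sum distrib_right)
      then have "X + 2 * (nrm f)\<^sup>2 \<le> (nrm f)\<^sup>2" using \<open>X > 0\<close> by simp
      then show False using \<open>X > 0\<close> zero_le_power2[of "nrm f"] by linarith
    qed
    then have "c = 0" using mono_norm_pos[of "(nat k, nat l)"] by (simp add: X_def m_def)
    then show ?thesis using cm[OF z] by simp
  qed (use c[OF z] in auto)
qed

text \<open>All homogeneous components vanish, and on the torus through a point they approximate the function.\<close>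

lemma A2_orthogonal_monomials_zero:
  assumes f: "f \<in> A2 \<Omega>" and orth: "\<And>\<alpha>. inn f (emon \<alpha>) = 0"
  shows "f = (\<lambda>z. 0)"
proof
  fix z
  have om: "inn f (mono \<alpha>) = 0" for \<alpha>
    using orth[of \<alpha>] mono_norm_pos[of \<alpha>] unfolding emon_def l2_inner_scale_right by simp
  show "f z = 0"
  proof (cases "z \<in> \<Omega>")
    case True
    define S where "S = (\<lambda>(\<xi>, \<eta>). act \<xi> \<eta> z) ` (sphere 0 1 \<times> sphere 0 1)"
    have S: "compact S" unfolding S_def case_prod_beta
      by (intro compact_continuous_image compact_Times) (auto intro!: continuous_intros)
    have R: "reinhardt S" unfolding reinhardt_def
    proof (intro allI impI, elim conjE)
      fix z1 z2 \<xi>1 \<xi>2 assume "(z1, z2) \<in> S" and u: "cmod \<xi>1 = 1" "cmod \<xi>2 = 1"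
      then obtain \<xi> \<eta> where x: "cmod \<xi> = 1" "cmod \<eta> = 1" "(z1, z2) = act \<xi> \<eta> z" by (auto simp: S_def)
      then have "(\<xi>1 * z1, \<xi>2 * z2) = act (\<xi>1 * \<xi>) (\<xi>2 * \<eta>) z" by (simp add: act_def mult.assoc)
      then show "(\<xi>1 * z1, \<xi>2 * z2) \<in> S"
        unfolding S_def using x u by (intro image_eqI[of _ _ "(\<xi>1 * \<xi>, \<xi>2 * \<eta>)"]) (auto simp: norm_mult)
    qed
    have sub: "S \<subseteq> \<Omega>" unfolding S_def using reinhardt_act[OF reinhardt_Omega _ _ True] by auto
    have zS: "z \<in> S" unfolding S_def by (rule image_eqI[of _ _ "(1, 1)"]) auto
    have "cmod (f z) < \<epsilon>" if \<epsilon>: "\<epsilon> > 0" for \<epsilon>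
    proof -
      obtain I :: "(nat \<times> nat) set" and w K L where "cmod (f z - (\<Sum>i\<in>I. w i * tcoef (K i) (L i) f z)) < \<epsilon>"
        using tcoef_approx[OF S R continuous_on_subset[OF A2D(4)[OF f] sub] \<epsilon>] zS by blast
      then show ?thesis by (simp add: tcoef_orthogonal_zero[OF f om True])
    qed
    then show ?thesis by (metis less_irrefl zero_less_norm_iff)
  qed (use A2D(3)[OF f] in auto)
qed

subsection \<open>Expansions in the basis\<close>

definition basis :: "nat \<Rightarrow> C2 \<Rightarrow> complex" where "basis n = emon (prod_decode n)"

lemma basis_A2: "basis n \<in> A2 \<Omega>" by (simp add: basis_def emon_A2)
lemma basis_L2: "basis n \<in> L2 \<Omega>" by (rule A2D(2)[OF basis_A2])
lemma basis_norm [simp]: "nrm (basis n) = 1" by (simp add: basis_def emon_norm)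
lemma basis_orthonormal: "inn (basis m) (basis n) = (if m = n then 1 else 0)"
  by (simp add: basis_def emon_orthonormal)

definition psum :: "(nat \<Rightarrow> complex) \<Rightarrow> nat set \<Rightarrow> C2 \<Rightarrow> complex" where
  "psum c I = (\<lambda>z. \<Sum>n\<in>I. c n * basis n z)"

lemma psum_A2: "psum c I \<in> A2 \<Omega>"
  unfolding psum_def by (intro A2_sum A2_scale basis_A2)

lemma psum_inner: "finite I \<Longrightarrow> inn (psum c I) (basis n) = (if n \<in> I then c n else 0)"
  unfolding psum_def
  by (subst l2_inner_sum_left) (auto simp: l2_inner_scale_left basis_orthonormal L2_scale basis_L2 if_distrib cong: if_cong)

lemma psum_norm: "finite I \<Longrightarrow> (nrm (psum c I))\<^sup>2 = (\<Sum>n\<in>I. (cmod (c n))\<^sup>2)"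
  unfolding psum_def
  by (subst l2_norm_orthogonal_sum)
    (auto simp: l2_norm_scale L2_scale basis_L2 l2_inner_scale_left l2_inner_scale_right basis_orthonormal)

lemma bessel:
  assumes g: "g \<in> L2 \<Omega>" and I: "finite I"
  shows "(\<Sum>n\<in>I. (cmod (inn g (basis n)))\<^sup>2) \<le> (nrm g)\<^sup>2"
proof -
  let ?c = "\<lambda>n. inn g (basis n)"
  let ?s = "psum ?c I"
  have s: "?s \<in> L2 \<Omega>" by (rule A2D(2)[OF psum_A2])
  have r: "(\<lambda>z. g z - ?s z) \<in> L2 \<Omega>" by (intro L2_diff g s)
  have "inn (\<lambda>z. g z - ?s z) (basis n) = 0" if "n \<in> I" for n
    using that by (simp add: l2_inner_diff_left[OF g s basis_L2] psum_inner[OF I])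
  then have "inn (\<lambda>z. g z - ?s z) ?s = 0"
    unfolding psum_def[of ?c I] using r unfolding psum_def
    by (subst l2_inner_sum_right) (auto simp: L2_scale basis_L2 l2_inner_scale_right)
  then have "(nrm (\<lambda>z. (g z - ?s z) + ?s z))\<^sup>2 = (nrm (\<lambda>z. g z - ?s z))\<^sup>2 + (nrm ?s)\<^sup>2"
    by (subst l2_norm_add_sq[OF r s]) simp
  then have "(nrm g)\<^sup>2 = (nrm (\<lambda>z. g z - ?s z))\<^sup>2 + (nrm ?s)\<^sup>2" by simp
  then show ?thesis using psum_norm[OF I, of ?c] by simp
qed

lemma riesz_fischer:
  assumes B: "\<And>N. (\<Sum>n<N. (cmod (c n))\<^sup>2) \<le> B"
  obtains u where "u \<in> A2 \<Omega>" "\<And>n. inn u (basis n) = c n"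
    "(\<lambda>N. nrm (\<lambda>z. psum c {..<N} z - u z)) \<longlonglongrightarrow> 0"
proof -
  have "summable (\<lambda>n. (cmod (c n))\<^sup>2)"
    by (rule summableI_nonneg_bounded[OF _ B]) simp
  then have cau: "\<exists>N. \<forall>m\<ge>N. \<forall>n. norm (\<Sum>i=m..<n. (cmod (c i))\<^sup>2) < e" if "e > 0" for e
    unfolding summable_Cauchy using that by simp
  have diff: "psum c {..<m} z - psum c {..<n} z = psum c {n..<m} z" if "n \<le> m" for m n z
    unfolding psum_def using that by (simp add: sum_diff_nat_ivl lessThan_atLeast0)
  have cs: "\<exists>N. \<forall>m\<ge>N. \<forall>n\<ge>N. nrm (\<lambda>z. psum c {..<m} z - psum c {..<n} z) < e" if e: "e > 0" for e
  proof -
    obtain N where N: "\<And>m n. m \<ge> N \<Longrightarrow> (\<Sum>i=m..<n. (cmod (c i))\<^sup>2) < e\<^sup>2"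
      using cau[OF zero_less_power[OF e, of 2]] unfolding real_norm_def
      by (meson abs_ge_self le_less_trans)
    have 1: "nrm (\<lambda>z. psum c {..<m} z - psum c {..<n} z) < e" if "N \<le> n" "n \<le> m" for m n
    proof -
      have "(nrm (\<lambda>z. psum c {..<m} z - psum c {..<n} z))\<^sup>2 < e\<^sup>2"
        unfolding diff[OF that(2)] using psum_norm[of "{n..<m}" c] N[OF that(1), of m] by simp
      then show ?thesis by (rule power2_less_imp_less) (use e in simp)
    qed
    have "nrm (\<lambda>z. psum c {..<m} z - psum c {..<n} z) < e" if "m \<ge> N" "n \<ge> N" for m n
    proof (cases "n \<le> m")
      case True
      then show ?thesis using 1 that by blast
    next
      case False
      then show ?thesis using 1[OF that(1), of n] by (subst l2_norm_minus_commute) simp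
    qed
    then show ?thesis by blast
  qed
  obtain u where u: "u \<in> A2 \<Omega>" "(\<lambda>N. nrm (\<lambda>z. psum c {..<N} z - u z)) \<longlonglongrightarrow> 0"
    using A2_complete[OF open_Omega psum_A2 cs] by blast
  have "inn u (basis n) = c n" for n
  proof -
    have "cmod (inn u (basis n) - c n) \<le> nrm (\<lambda>z. psum c {..<N} z - u z)" if "N > n" for N
    proof -
      have "inn (\<lambda>z. psum c {..<N} z - u z) (basis n) = c n - inn u (basis n)"
        using that by (simp add: l2_inner_diff_left[OF A2D(2)[OF psum_A2] A2D(2)[OF u(1)] basis_L2] psum_inner)
      then show ?thesis
        using l2_Cauchy_Schwarz[OF L2_diff[OF A2D(2)[OF psum_A2] A2D(2)[OF u(1)]] basis_L2, of c "{..<N}" n]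
        by (simp add: norm_minus_commute)
    qed
    then have "cmod (inn u (basis n) - c n) \<le> 0"
      by (intro LIMSEQ_le_const[OF u(2)] exI[of _ "Suc n"]) auto
    then show ?thesis by simp
  qed
  then show ?thesis using that u by blast
qed

lemma basis_expansion:
  assumes f: "f \<in> A2 \<Omega>"
  shows "(\<lambda>N. nrm (\<lambda>z. psum (\<lambda>n. inn f (basis n)) {..<N} z - f z)) \<longlonglongrightarrow> 0"
proof -
  let ?c = "\<lambda>n. inn f (basis n)"
  have B: "(\<Sum>n<N. (cmod (?c n))\<^sup>2) \<le> (nrm f)\<^sup>2" for N
    by (rule bessel[OF A2D(2)[OF f]]) simp
  then obtain u where u: "u \<in> A2 \<Omega>" "\<And>n. inn u (basis n) = ?c n"
    "(\<lambda>N. nrm (\<lambda>z. psum ?c {..<N} z - u z)) \<longlonglongrightarrow> 0"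
    using riesz_fischer[OF B] by blast
  have "inn (\<lambda>z. u z - f z) (emon \<alpha>) = 0" for \<alpha>
    using u(2)[of "prod_encode \<alpha>"]
    by (simp add: l2_inner_diff_left[OF A2D(2)[OF u(1)] A2D(2)[OF f] A2D(2)[OF emon_A2]] basis_def)
  from A2_orthogonal_monomials_zero[OF A2_diff[OF u(1) f] this] have "u = f"
    by (simp add: fun_eq_iff)
  with u(3) show ?thesis by simp
qed

lemma inner_tendsto:
  assumes g: "g \<in> L2 \<Omega>" and f: "f \<in> L2 \<Omega>" and s: "\<And>N. s N \<in> L2 \<Omega>" "(\<lambda>N::nat. nrm (\<lambda>z. s N z - f z)) \<longlonglongrightarrow> 0"
  shows "(\<lambda>N. inn (s N) g) \<longlonglongrightarrow> inn f g"
proof (rule Lim_null[THEN iffD2], rule Lim_null_comparison)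
  show "\<forall>\<^sub>F N in sequentially. norm (inn (s N) g - inn f g) \<le> nrm (\<lambda>z. s N z - f z) * nrm g"
    using l2_Cauchy_Schwarz[OF L2_diff[OF s(1) f] g]
    by (simp add: l2_inner_diff_left[OF s(1) f g])
  show "(\<lambda>N. nrm (\<lambda>z. s N z - f z) * nrm g) \<longlonglongrightarrow> 0"
    using tendsto_mult_left_zero[OF s(2)] .
qed

lemma orthogonal_basis_imp_A2:
  assumes g: "g \<in> L2 \<Omega>" and o: "\<And>n. inn (basis n) g = 0" and h: "h \<in> A2 \<Omega>"
  shows "inn h g = 0"
proof -
  let ?s = "\<lambda>N. psum (\<lambda>n. inn h (basis n)) {..<N}"
  have "inn (?s N) g = 0" for N
    unfolding psum_def by (subst l2_inner_sum_left) (auto simp: L2_scale basis_L2 g l2_inner_scale_left o)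
  with inner_tendsto[OF g A2D(2)[OF h] A2D(2)[OF psum_A2] basis_expansion[OF h]] show ?thesis
    by (simp add: LIMSEQ_const_iff)
qed

subsection \<open>The Bergman projection and kernel\<close>

abbreviation P where "P \<equiv> bergman_proj \<Omega>"

text \<open>The coefficients of \<open>g\<close> are square summable by Bessel's inequality, so their orthonormal series converges
  in the Bergman space; its sum is the projection.\<close>

lemma bergman_proj_ex1:
  assumes g: "g \<in> L2 \<Omega>"
  shows "\<exists>!p. p \<in> A2 \<Omega> \<and> (\<forall>h\<in>A2 \<Omega>. inn (\<lambda>z. g z - p z) h = 0)"
proof (rule ex_ex1I)
  have B: "(\<Sum>n<N. (cmod (inn g (basis n)))\<^sup>2) \<le> (nrm g)\<^sup>2" for N by (rule bessel[OF g]) simp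
  then obtain p where p: "p \<in> A2 \<Omega>" "\<And>n. inn p (basis n) = inn g (basis n)"
    using riesz_fischer[OF B] by blast
  have r: "(\<lambda>z. g z - p z) \<in> L2 \<Omega>" by (intro L2_diff g A2D(2)[OF p(1)])
  have "inn (basis n) (\<lambda>z. g z - p z) = 0" for n
  proof -
    have "inn (\<lambda>z. g z - p z) (basis n) = 0"
      by (simp add: l2_inner_diff_left[OF g A2D(2)[OF p(1)] basis_L2] p(2))
    then show ?thesis by (metis l2_inner_cnj complex_cnj_zero)
  qed
  then have "inn h (\<lambda>z. g z - p z) = 0" if "h \<in> A2 \<Omega>" for h
    using orthogonal_basis_imp_A2[OF r _ that] by blast
  then have "inn (\<lambda>z. g z - p z) h = 0" if "h \<in> A2 \<Omega>" for h
    using that by (metis l2_inner_cnj complex_cnj_zero)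
  then show "\<exists>p. p \<in> A2 \<Omega> \<and> (\<forall>h\<in>A2 \<Omega>. inn (\<lambda>z. g z - p z) h = 0)" using p(1) by blast
next
  fix p q assume p: "p \<in> A2 \<Omega> \<and> (\<forall>h\<in>A2 \<Omega>. inn (\<lambda>z. g z - p z) h = 0)"
    and q: "q \<in> A2 \<Omega> \<and> (\<forall>h\<in>A2 \<Omega>. inn (\<lambda>z. g z - q z) h = 0)"
  have d: "(\<lambda>z. p z - q z) \<in> A2 \<Omega>" using p q A2_diff by blast
  have gp: "(\<lambda>z. g z - p z) \<in> L2 \<Omega>" and gq: "(\<lambda>z. g z - q z) \<in> L2 \<Omega>"
    using p q by (auto intro: L2_diff g A2D(2))
  have "inn (\<lambda>z. (g z - q z) - (g z - p z)) (\<lambda>z. p z - q z) = 0"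
    using p q d by (subst l2_inner_diff_left[OF gq gp A2D(2)[OF d]]) simp
  then have "inn (\<lambda>z. p z - q z) (\<lambda>z. p z - q z) = 0" by simp
  then have "nrm (\<lambda>z. p z - q z) = 0" unfolding l2_inner_self by simp
  from A2_norm_zero[OF open_Omega d this] show "p = q" by (simp add: fun_eq_iff)
qed

lemma P_A2: "g \<in> L2 \<Omega> \<Longrightarrow> P g \<in> A2 \<Omega>"
  and P_orth: "g \<in> L2 \<Omega> \<Longrightarrow> h \<in> A2 \<Omega> \<Longrightarrow> inn (\<lambda>z. g z - P g z) h = 0"
  using theI'[OF bergman_proj_ex1] unfolding bergman_proj_def by blast+

lemma P_unique:
  assumes "g \<in> L2 \<Omega>" "p \<in> A2 \<Omega>" "\<And>h. h \<in> A2 \<Omega> \<Longrightarrow> inn (\<lambda>z. g z - p z) h = 0"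
  shows "P g = p"
  unfolding bergman_proj_def by (rule the1_equality[OF bergman_proj_ex1]) (use assms in auto)

lemma P_L2: "g \<in> L2 \<Omega> \<Longrightarrow> P g \<in> L2 \<Omega>" by (rule A2D(2)[OF P_A2])

lemma P_inner: "g \<in> L2 \<Omega> \<Longrightarrow> h \<in> A2 \<Omega> \<Longrightarrow> inn (P g) h = inn g h"
  using P_orth[of g h] l2_inner_diff_left[of g \<Omega> "P g" h] P_L2 A2D(2) by simp

lemma P_best:
  assumes g: "g \<in> L2 \<Omega>" and h: "h \<in> A2 \<Omega>"
  shows "nrm (\<lambda>z. g z - P g z) \<le> nrm (\<lambda>z. g z - h z)"
proof (rule power2_le_imp_le)
  have d: "(\<lambda>z. P g z - h z) \<in> A2 \<Omega>" by (intro A2_diff P_A2 g h)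
  have "(nrm (\<lambda>z. (g z - P g z) + (P g z - h z)))\<^sup>2 = (nrm (\<lambda>z. g z - P g z))\<^sup>2 + (nrm (\<lambda>z. P g z - h z))\<^sup>2"
    using P_orth[OF g d] by (subst l2_norm_add_sq) (auto intro: L2_diff g P_L2 A2D(2)[OF d])
  then show "(nrm (\<lambda>z. g z - P g z))\<^sup>2 \<le> (nrm (\<lambda>z. g z - h z))\<^sup>2" by simp
qed simp

lemma P_norm_le:
  assumes g: "g \<in> L2 \<Omega>" shows "nrm (P g) \<le> nrm g"
proof (rule power2_le_imp_le)
  have "(nrm (\<lambda>z. (g z - P g z) + P g z))\<^sup>2 = (nrm (\<lambda>z. g z - P g z))\<^sup>2 + (nrm (P g))\<^sup>2"
    using P_orth[OF g P_A2[OF g]] by (subst l2_norm_add_sq) (auto intro: L2_diff g P_L2)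
  then show "(nrm (P g))\<^sup>2 \<le> (nrm g)\<^sup>2" by simp
qed simp

text \<open>Point evaluation is bounded, which makes the numbers \<open>cnj (e\<^sub>n z)\<close> square summable; they are the coefficients of
  the kernel.\<close>

lemma bergman_kernel_ex1:
  assumes z: "z \<in> \<Omega>"
  shows "\<exists>!k. k \<in> A2 \<Omega> \<and> (\<forall>f\<in>A2 \<Omega>. f z = inn f k)"
proof (rule ex_ex1I)
  obtain C where C: "C > 0" "\<And>f. f \<in> A2 \<Omega> \<Longrightarrow> cmod (f z) \<le> C * nrm f"
    using point_evaluation_bounded[OF open_Omega z] by blast
  have B: "(\<Sum>n<N. (cmod (cnj (basis n z)))\<^sup>2) \<le> C\<^sup>2" for N
  proof -
    let ?c = "\<lambda>n. cnj (basis n z)"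
    define X where "X = (\<Sum>n<N. (cmod (?c n))\<^sup>2)"
    have X0: "X \<ge> 0" unfolding X_def by (intro sum_nonneg) simp
    have "psum ?c {..<N} z = of_real X"
      unfolding psum_def X_def of_real_sum
      by (intro sum.cong refl) (simp only: complex_norm_square complex_cnj_cnj)
    then have "X \<le> C * nrm (psum ?c {..<N})" using C(2)[OF psum_A2, of ?c "{..<N}"] X0 by simp
    moreover have "(nrm (psum ?c {..<N}))\<^sup>2 = X" unfolding X_def by (rule psum_norm) simp
    ultimately have "X\<^sup>2 \<le> C\<^sup>2 * X" using X0 by (metis power_mono power_mult_distrib)
    then show ?thesis
      unfolding X_def[symmetric] using X0 by (cases "X = 0") (auto simp: power2_eq_square)
  qed
  then obtain k where k: "k \<in> A2 \<Omega>" "\<And>n. inn k (basis n) = cnj (basis n z)"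
    using riesz_fischer[OF B] by blast
  have "f z = inn f k" if f: "f \<in> A2 \<Omega>" for f
  proof -
    let ?s = "\<lambda>N. psum (\<lambda>n. inn f (basis n)) {..<N}"
    have "inn (basis n) k = basis n z" for n using k(2)[of n] by (metis l2_inner_cnj complex_cnj_cnj)
    then have "inn (?s N) k = ?s N z" for N
      unfolding psum_def by (subst l2_inner_sum_left) (auto simp: L2_scale basis_L2 A2D(2)[OF k(1)] l2_inner_scale_left)
    with inner_tendsto[OF A2D(2)[OF k(1)] A2D(2)[OF f] A2D(2)[OF psum_A2] basis_expansion[OF f]]
    have 1: "(\<lambda>N. ?s N z) \<longlonglongrightarrow> inn f k" by simp
    have "(\<lambda>N. ?s N z) \<longlonglongrightarrow> f z"
    proof (rule Lim_null[THEN iffD2], rule Lim_null_comparison)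
      show "\<forall>\<^sub>F N in sequentially. norm (?s N z - f z) \<le> C * nrm (\<lambda>z. ?s N z - f z)"
        using C(2)[OF A2_diff[OF psum_A2 f]] by simp
      show "(\<lambda>N. C * nrm (\<lambda>z. ?s N z - f z)) \<longlonglongrightarrow> 0"
        using tendsto_mult_right_zero[OF basis_expansion[OF f]] .
    qed
    then show ?thesis using 1 LIMSEQ_unique by blast
  qed
  then show "\<exists>k. k \<in> A2 \<Omega> \<and> (\<forall>f\<in>A2 \<Omega>. f z = inn f k)" using k(1) by blast
next
  fix k k' assume k: "k \<in> A2 \<Omega> \<and> (\<forall>f\<in>A2 \<Omega>. f z = inn f k)" and k': "k' \<in> A2 \<Omega> \<and> (\<forall>f\<in>A2 \<Omega>. f z = inn f k')"
  have d: "(\<lambda>z. k z - k' z) \<in> A2 \<Omega>" using k k' A2_diff by blast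
  have e: "inn (\<lambda>z. k z - k' z) k = inn (\<lambda>z. k z - k' z) k'" using k k' d by metis
  have "inn (\<lambda>z. k z - k' z) (\<lambda>z. k z - k' z) = 0"
    using k k' d e by (subst l2_inner_diff_right) (auto intro: A2D(2))
  then have "nrm (\<lambda>z. k z - k' z) = 0" unfolding l2_inner_self by simp
  from A2_norm_zero[OF open_Omega d this] show "k = k'" by (simp add: fun_eq_iff)
qed

definition kern :: "C2 \<Rightarrow> C2 \<Rightarrow> complex" where "kern z = (\<lambda>w. bergman_kernel \<Omega> w z)"

lemma kern_A2: "z \<in> \<Omega> \<Longrightarrow> kern z \<in> A2 \<Omega>"
  and kern_reproducing: "z \<in> \<Omega> \<Longrightarrow> f \<in> A2 \<Omega> \<Longrightarrow> inn f (kern z) = f z"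
  using theI'[OF bergman_kernel_ex1, of z] unfolding kern_def bergman_kernel_def by simp_all

lemma kern_diag: "z \<in> \<Omega> \<Longrightarrow> kern z z = complex_of_real ((nrm (kern z))\<^sup>2)"
  using kern_reproducing[OF _ kern_A2, of z z] by (simp only: l2_inner_self)

lemma kern_norm_ge:
  assumes "z \<in> \<Omega>" "f \<in> A2 \<Omega>" shows "cmod (f z) \<le> nrm f * nrm (kern z)"
  using l2_Cauchy_Schwarz[OF A2D(2)[OF assms(2)] A2D(2)[OF kern_A2[OF assms(1)]]]
  by (simp add: kern_reproducing assms)

lemma kern_norm_pos:
  assumes "z \<in> \<Omega>" shows "nrm (kern z) > 0"
proof -
  have "mono (0, 0) z = 1" using assms by (simp add: mono_def)
  then have "1 \<le> nrm (mono (0, 0)) * nrm (kern z)" using kern_norm_ge[OF assms mono_A2[of "(0, 0)"]] by simp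
  then have "nrm (kern z) \<noteq> 0" by auto
  then show ?thesis using l2_norm_nonneg[of \<Omega> "kern z"] by linarith
qed

abbreviation nk where "nk \<equiv> normalized_kernel \<Omega>"

lemma nk_eq:
  assumes "z \<in> \<Omega>" shows "nk z = (\<lambda>w. complex_of_real (1 / nrm (kern z)) * kern z w)"
proof -
  have "csqrt (bergman_kernel \<Omega> z z) = of_real (nrm (kern z))"
    using kern_diag[OF assms] by (simp add: kern_def csqrt_of_real_nonneg del: of_real_power)
  then show ?thesis by (simp add: normalized_kernel_def kern_def fun_eq_iff)
qed

lemma nk_A2: "z \<in> \<Omega> \<Longrightarrow> nk z \<in> A2 \<Omega>"
  unfolding nk_eq by (intro A2_scale kern_A2)

lemma nk_norm: "z \<in> \<Omega> \<Longrightarrow> nrm (nk z) = 1"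
  using kern_norm_pos[of z] by (simp add: nk_eq l2_norm_scale del: of_real_divide)

lemma nk_inner: "z \<in> \<Omega> \<Longrightarrow> f \<in> A2 \<Omega> \<Longrightarrow> inn f (nk z) = f z / of_real (nrm (kern z))"
  by (simp add: nk_eq l2_inner_scale_right kern_reproducing del: of_real_divide) simp

end

section \<open>Hankel operators\<close>

lemma tendsto_zero_subseq:
  fixes X :: "nat \<Rightarrow> real"
  assumes "\<And>s :: nat \<Rightarrow> nat. strict_mono s \<Longrightarrow> \<exists>r :: nat \<Rightarrow> nat. strict_mono r \<and> (\<lambda>n. X (s (r n))) \<longlonglongrightarrow> 0"
  shows "X \<longlonglongrightarrow> 0"
proof (rule ccontr)
  assume "\<not> ?thesis"
  then obtain e where e: "e > 0" "\<And>N. \<exists>n\<ge>N. \<not> \<bar>X n\<bar> < e"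
    unfolding LIMSEQ_iff by auto
  then have "infinite {n. \<not> \<bar>X n\<bar> < e}"
    unfolding infinite_nat_iff_unbounded_le by blast
  then obtain s :: "nat \<Rightarrow> nat" where s: "strict_mono s" "\<And>n. s n \<in> {n. \<not> \<bar>X n\<bar> < e}"
    using infinite_enumerate by blast
  obtain r where "(\<lambda>n. X (s (r n))) \<longlonglongrightarrow> 0" using assms[OF s(1)] by blast
  then obtain N where "\<And>n. n \<ge> N \<Longrightarrow> \<bar>X (s (r n))\<bar> < e"
    unfolding LIMSEQ_iff using e(1) by auto
  then show False using s(2)[of "r N"] by auto
qed

context reinhardt_domain
begin

abbreviation H where "H \<equiv> hankel \<Omega>"

abbreviation sym :: "(C2 \<Rightarrow> complex) \<Rightarrow> bool" where "sym \<phi> \<equiv> continuous_on (closure \<Omega>) \<phi>"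

lemma compact_closure_Omega: "compact (closure \<Omega>)"
  using bounded_Omega by (simp add: compact_closure)

lemma sym_continuous: "sym \<phi> \<Longrightarrow> continuous_on \<Omega> \<phi>"
  by (rule continuous_on_subset[OF _ closure_subset])

lemma sym_bounded:
  assumes "sym \<phi>" obtains B where "B > 0" "\<And>z. z \<in> closure \<Omega> \<Longrightarrow> cmod (\<phi> z) \<le> B"
proof -
  have "bounded (\<phi> ` closure \<Omega>)"
    by (rule compact_imp_bounded[OF compact_continuous_image[OF assms compact_closure_Omega]])
  then obtain B where B: "B > 0" "\<forall>x\<in>\<phi> ` closure \<Omega>. norm x \<le> B"
    using bounded_pos by blast
  then show ?thesis using that by blast
qed

lemma in_closure: "z \<in> \<Omega> \<Longrightarrow> z \<in> closure \<Omega>"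
  using closure_subset by blast

lemma mult_L2:
  assumes "sym \<phi>" "f \<in> L2 \<Omega>" shows "(\<lambda>z. \<phi> z * f z) \<in> L2 \<Omega>"
proof -
  obtain B where "\<And>z. z \<in> closure \<Omega> \<Longrightarrow> cmod (\<phi> z) \<le> B" using sym_bounded[OF assms(1)] by blast
  then show ?thesis
    by (intro L2_mult_bounded[OF assms(2) borel_measurable_lebesgue_on_continuous[OF open_Omega sym_continuous[OF assms(1)]]])
      (auto intro: in_closure)
qed

lemma mult_norm_le:
  assumes "sym \<phi>" "f \<in> L2 \<Omega>" and B: "\<And>z. z \<in> closure \<Omega> \<Longrightarrow> cmod (\<phi> z) \<le> B" and "B \<ge> 0"
  shows "nrm (\<lambda>z. \<phi> z * f z) \<le> B * nrm f"
  by (rule l2_norm_mult_bounded[OF assms(2) borel_measurable_lebesgue_on_continuous[OF open_Omega sym_continuous[OF assms(1)]]])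
    (use B \<open>B \<ge> 0\<close> in \<open>auto intro: in_closure\<close>)

lemma sym_cnj: "sym \<phi> \<Longrightarrow> sym (\<lambda>z. cnj (\<phi> z))" by (intro continuous_intros)

lemma P_add:
  assumes f: "f \<in> L2 \<Omega>" and g: "g \<in> L2 \<Omega>"
  shows "P (\<lambda>z. f z + g z) = (\<lambda>z. P f z + P g z)"
proof (rule P_unique)
  show "(\<lambda>z. f z + g z) \<in> L2 \<Omega>" by (intro L2_add f g)
  show "(\<lambda>z. P f z + P g z) \<in> A2 \<Omega>" by (intro A2_add P_A2 f g)
  fix h assume h: "h \<in> A2 \<Omega>"
  have "inn (\<lambda>z. (f z - P f z) + (g z - P g z)) h = 0"
    by (subst l2_inner_add_left[OF L2_diff[OF f P_L2[OF f]] L2_diff[OF g P_L2[OF g]] A2D(2)[OF h]])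
      (simp add: P_orth f g h)
  moreover have "(\<lambda>z. (f z - P f z) + (g z - P g z)) = (\<lambda>z. f z + g z - (P f z + P g z))" by auto
  ultimately show "inn (\<lambda>z. f z + g z - (P f z + P g z)) h = 0" by simp
qed

lemma P_scale:
  assumes f: "f \<in> L2 \<Omega>" shows "P (\<lambda>z. c * f z) = (\<lambda>z. c * P f z)"
proof (rule P_unique)
  show "(\<lambda>z. c * f z) \<in> L2 \<Omega>" by (intro L2_scale f)
  show "(\<lambda>z. c * P f z) \<in> A2 \<Omega>" by (intro A2_scale P_A2 f)
  fix h assume h: "h \<in> A2 \<Omega>"
  have "inn (\<lambda>z. c * (f z - P f z)) h = 0" unfolding l2_inner_scale_left P_orth[OF f h] by simp
  then show "inn (\<lambda>z. c * f z - c * P f z) h = 0" by (simp add: right_diff_distrib)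
qed

lemma P_diff:
  assumes "f \<in> L2 \<Omega>" "g \<in> L2 \<Omega>"
  shows "P (\<lambda>z. f z - g z) = (\<lambda>z. P f z - P g z)"
  using P_add[OF assms(1) L2_scale[OF assms(2), of "-1"]] P_scale[OF assms(2), of "-1"] by simp

lemma P_of_A2: "f \<in> A2 \<Omega> \<Longrightarrow> P f = f"
  by (rule P_unique) (auto intro: A2D(2) simp: l2_inner_def)

lemma P_sum:
  assumes "\<And>i. i \<in> I \<Longrightarrow> f i \<in> L2 \<Omega>"
  shows "P (\<lambda>z. \<Sum>i\<in>I. f i z) = (\<lambda>z. \<Sum>i\<in>I. P (f i) z)"
  using assms
proof (induction I rule: infinite_finite_induct)
  case (insert i I)
  have "P (\<lambda>z. f i z + (\<Sum>i\<in>I. f i z)) = (\<lambda>z. P (f i) z + P (\<lambda>z. \<Sum>i\<in>I. f i z) z)"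
    by (intro P_add L2_sum) (use insert in auto)
  with insert show ?case by simp
qed (simp_all add: P_of_A2 A2_zero)

lemma hankel_L2: "sym \<phi> \<Longrightarrow> f \<in> L2 \<Omega> \<Longrightarrow> H \<phi> f \<in> L2 \<Omega>"
  unfolding hankel_def by (intro L2_diff P_L2 mult_L2)

lemma hankel_orth: "sym \<phi> \<Longrightarrow> f \<in> L2 \<Omega> \<Longrightarrow> h \<in> A2 \<Omega> \<Longrightarrow> inn (H \<phi> f) h = 0"
  unfolding hankel_def by (intro P_orth mult_L2)

lemma hankel_best: "sym \<phi> \<Longrightarrow> f \<in> L2 \<Omega> \<Longrightarrow> h \<in> A2 \<Omega> \<Longrightarrow> nrm (H \<phi> f) \<le> nrm (\<lambda>z. \<phi> z * f z - h z)"
  unfolding hankel_def by (intro P_best mult_L2)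

lemma hankel_continuous:
  assumes "sym \<phi>" "f \<in> A2 \<Omega>" shows "continuous_on \<Omega> (H \<phi> f)"
  unfolding hankel_def
  by (intro continuous_on_diff continuous_on_mult sym_continuous[OF assms(1)] A2D(4)[OF assms(2)]
      A2D(4)[OF P_A2[OF mult_L2[OF assms(1) A2D(2)[OF assms(2)]]]])

lemma hankel_bound:
  assumes "sym \<phi>" "f \<in> L2 \<Omega>" "\<And>z. z \<in> closure \<Omega> \<Longrightarrow> cmod (\<phi> z) \<le> B" "B \<ge> 0"
  shows "nrm (H \<phi> f) \<le> B * nrm f"
  using hankel_best[OF assms(1,2) A2_zero] mult_norm_le[OF assms] by simp

lemma hankel_add_symbol:
  assumes \<phi>: "sym \<phi>" and \<psi>: "sym \<psi>" and f: "f \<in> L2 \<Omega>"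
  shows "nrm (H (\<lambda>z. \<phi> z + \<psi> z) f) \<le> nrm (H \<phi> f) + nrm (H \<psi> f)"
proof -
  have "nrm (H (\<lambda>z. \<phi> z + \<psi> z) f) \<le> nrm (\<lambda>z. (\<phi> z + \<psi> z) * f z - (P (\<lambda>w. \<phi> w * f w) z + P (\<lambda>w. \<psi> w * f w) z))"
    by (intro hankel_best continuous_intros \<phi> \<psi> f A2_add P_A2 mult_L2)
  also have "\<dots> = nrm (\<lambda>z. H \<phi> f z + H \<psi> f z)"
    by (intro l2_norm_cong) (simp add: hankel_def algebra_simps)
  also have "\<dots> \<le> nrm (H \<phi> f) + nrm (H \<psi> f)"
    by (intro l2_triangle hankel_L2 \<phi> \<psi> f)
  finally show ?thesis .
qed

lemma hankel_scale_symbol: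
  assumes \<phi>: "sym \<phi>" and f: "f \<in> L2 \<Omega>"
  shows "nrm (H (\<lambda>z. c * \<phi> z) f) \<le> cmod c * nrm (H \<phi> f)"
proof -
  have "nrm (H (\<lambda>z. c * \<phi> z) f) \<le> nrm (\<lambda>z. (c * \<phi> z) * f z - c * P (\<lambda>w. \<phi> w * f w) z)"
    by (intro hankel_best continuous_intros \<phi> f A2_scale P_A2 mult_L2)
  also have "\<dots> = nrm (\<lambda>z. c * H \<phi> f z)"
    by (intro l2_norm_cong) (simp add: hankel_def algebra_simps)
  finally show ?thesis by (simp add: l2_norm_scale)
qed

lemma hankel_diff:
  assumes \<phi>: "sym \<phi>" and f: "f \<in> L2 \<Omega>" and g: "g \<in> L2 \<Omega>"
  shows "H \<phi> (\<lambda>z. f z - g z) = (\<lambda>z. H \<phi> f z - H \<phi> g z)"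
proof -
  have "P (\<lambda>w. \<phi> w * (f w - g w)) = (\<lambda>z. P (\<lambda>w. \<phi> w * f w) z - P (\<lambda>w. \<phi> w * g w) z)"
    using P_diff[OF mult_L2[OF \<phi> f] mult_L2[OF \<phi> g]] by (simp add: right_diff_distrib)
  then show ?thesis by (simp add: hankel_def fun_eq_iff algebra_simps)
qed

lemma hankel_lincomb:
  assumes \<phi>: "sym \<phi>" and f: "\<And>i. i \<in> I \<Longrightarrow> f i \<in> L2 \<Omega>"
  shows "H \<phi> (\<lambda>z. \<Sum>i\<in>I. c i * f i z) = (\<lambda>z. \<Sum>i\<in>I. c i * H \<phi> (f i) z)"
proof -
  have "P (\<lambda>w. \<phi> w * (\<Sum>i\<in>I. c i * f i w)) = P (\<lambda>w. \<Sum>i\<in>I. c i * (\<phi> w * f i w))"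
    by (simp add: sum_distrib_left mult_ac)
  also have "\<dots> = (\<lambda>z. \<Sum>i\<in>I. P (\<lambda>w. c i * (\<phi> w * f i w)) z)"
    by (rule P_sum) (intro L2_scale mult_L2 \<phi> f)
  also have "\<dots> = (\<lambda>z. \<Sum>i\<in>I. c i * P (\<lambda>w. \<phi> w * f i w) z)"
    by (intro ext sum.cong refl) (simp add: P_scale[OF mult_L2[OF \<phi> f]])
  finally show ?thesis
    by (simp add: hankel_def fun_eq_iff sum_subtractf sum_distrib_left right_diff_distrib mult_ac)
qed

lemma inner_zero_sym: "inn f g = 0 \<Longrightarrow> inn g f = 0"
  using l2_inner_cnj[of \<Omega> f g] by simp

lemma inner_cmod_commute: "cmod (inn f g) = cmod (inn g f)"
  using complex_mod_cnj[of "inn f g"] unfolding l2_inner_cnj by simp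

lemma inner_mult: "inn (\<lambda>z. \<phi> z * f z) g = inn f (\<lambda>z. cnj (\<phi> z) * g z)"
  unfolding l2_inner_def by (simp add: mult_ac)

text \<open>The adjoint of a Hankel operator is \<open>g \<mapsto> P(cnj \<phi> (g - P g))\<close>.\<close>

definition hadj :: "(C2 \<Rightarrow> complex) \<Rightarrow> (C2 \<Rightarrow> complex) \<Rightarrow> C2 \<Rightarrow> complex" where
  "hadj \<phi> g = P (\<lambda>z. cnj (\<phi> z) * (g z - P g z))"

lemma hadj_A2: "sym \<phi> \<Longrightarrow> g \<in> L2 \<Omega> \<Longrightarrow> hadj \<phi> g \<in> A2 \<Omega>"
  unfolding hadj_def by (intro P_A2 mult_L2 sym_cnj L2_diff P_L2)

lemma hadj_inner:
  assumes \<phi>: "sym \<phi>" and g: "g \<in> L2 \<Omega>" and f: "f \<in> A2 \<Omega>"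
  shows "inn (H \<phi> f) g = inn f (hadj \<phi> g)"
proof -
  note fL = A2D(2)[OF f]
  let ?r = "\<lambda>z. g z - P g z"
  have r: "?r \<in> L2 \<Omega>" by (intro L2_diff g P_L2)
  have cr: "(\<lambda>z. cnj (\<phi> z) * ?r z) \<in> L2 \<Omega>" by (intro mult_L2 sym_cnj \<phi> r)
  have "inn (H \<phi> f) g = inn (H \<phi> f) ?r"
    using hankel_orth[OF \<phi> fL P_A2[OF g]]
    by (simp add: l2_inner_diff_right[OF g P_L2[OF g] hankel_L2[OF \<phi> fL]])
  also have "\<dots> = inn (\<lambda>z. \<phi> z * f z) ?r - inn (P (\<lambda>z. \<phi> z * f z)) ?r"
    unfolding hankel_def by (rule l2_inner_diff_left[OF mult_L2[OF \<phi> fL] P_L2[OF mult_L2[OF \<phi> fL]] r])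
  also have "inn (P (\<lambda>z. \<phi> z * f z)) ?r = 0"
    by (rule inner_zero_sym[OF P_orth[OF g P_A2[OF mult_L2[OF \<phi> fL]]]])
  also have "inn (\<lambda>z. \<phi> z * f z) ?r = inn f (\<lambda>z. cnj (\<phi> z) * ?r z)" by (rule inner_mult)
  also have "\<dots> = cnj (inn (P (\<lambda>z. cnj (\<phi> z) * ?r z)) f)"
    unfolding P_inner[OF cr f] by (rule l2_inner_cnj[symmetric])
  also have "\<dots> = inn f (hadj \<phi> g)"
    unfolding hadj_def by (rule l2_inner_cnj)
  finally show ?thesis by simp
qed

lemma A2_adjoint_eq:
  assumes \<phi>: "sym \<phi>" and g: "g \<in> L2 \<Omega>"
  shows "A2_adjoint \<Omega> (H \<phi>) g = hadj \<phi> g"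
  unfolding A2_adjoint_def
proof (rule the_equality)
  show "hadj \<phi> g \<in> A2 \<Omega> \<and> (\<forall>f\<in>A2 \<Omega>. inn (H \<phi> f) g = inn f (hadj \<phi> g))"
    using hadj_A2[OF \<phi> g] hadj_inner[OF \<phi> g] by blast
  fix h assume h: "h \<in> A2 \<Omega> \<and> (\<forall>f\<in>A2 \<Omega>. inn (H \<phi> f) g = inn f h)"
  let ?d = "\<lambda>z. h z - hadj \<phi> g z"
  have d: "?d \<in> A2 \<Omega>" using h hadj_A2[OF \<phi> g] A2_diff by blast
  have "inn ?d h = inn ?d (hadj \<phi> g)" using h d hadj_inner[OF \<phi> g d] by simp
  then have "inn ?d ?d = 0"
    using h by (subst l2_inner_diff_right[OF _ A2D(2)[OF hadj_A2[OF \<phi> g]] A2D(2)[OF d]]) (auto intro: A2D(2))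
  then have "nrm ?d = 0" unfolding l2_inner_self by simp
  from A2_norm_zero[OF open_Omega d this] show "h = hadj \<phi> g" by (simp add: fun_eq_iff)
qed

abbreviation HH where "HH \<phi> \<equiv> (\<lambda>f. A2_adjoint \<Omega> (H \<phi>) (H \<phi> f))"

lemma HH_eq:
  assumes \<phi>: "sym \<phi>" and f: "f \<in> A2 \<Omega>"
  shows "HH \<phi> f = P (\<lambda>z. cnj (\<phi> z) * H \<phi> f z)"
proof -
  have "P (H \<phi> f) = (\<lambda>z. 0)"
    by (rule P_unique) (simp_all add: hankel_L2 hankel_orth \<phi> A2D(2)[OF f] A2_zero)
  then show ?thesis by (simp add: A2_adjoint_eq[OF \<phi> hankel_L2[OF \<phi> A2D(2)[OF f]]] hadj_def)
qed

lemma HH_A2: "sym \<phi> \<Longrightarrow> f \<in> A2 \<Omega> \<Longrightarrow> HH \<phi> f \<in> A2 \<Omega>"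
  by (simp add: A2_adjoint_eq hankel_L2 A2D(2) hadj_A2)

lemma HH_inner:
  assumes \<phi>: "sym \<phi>" and f: "f \<in> A2 \<Omega>" and h: "h \<in> A2 \<Omega>"
  shows "inn (HH \<phi> f) h = inn (H \<phi> f) (H \<phi> h)"
proof -
  note Hf = hankel_L2[OF \<phi> A2D(2)[OF f]]
  have "inn (HH \<phi> f) h = cnj (inn h (hadj \<phi> (H \<phi> f)))"
    unfolding A2_adjoint_eq[OF \<phi> Hf] by (rule l2_inner_cnj[symmetric])
  also have "\<dots> = cnj (inn (H \<phi> h) (H \<phi> f))" by (simp only: hadj_inner[OF \<phi> Hf h])
  finally show ?thesis by (simp only: l2_inner_cnj)
qed

lemma HH_norm_le:
  assumes \<phi>: "sym \<phi>" and f: "f \<in> A2 \<Omega>" and B: "\<And>z. z \<in> closure \<Omega> \<Longrightarrow> cmod (\<phi> z) \<le> B" "B \<ge> 0"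
  shows "nrm (HH \<phi> f) \<le> B * nrm (H \<phi> f)"
proof -
  note Hf = hankel_L2[OF \<phi> A2D(2)[OF f]]
  have "nrm (HH \<phi> f) \<le> nrm (\<lambda>z. cnj (\<phi> z) * H \<phi> f z)"
    unfolding HH_eq[OF \<phi> f] by (intro P_norm_le mult_L2 sym_cnj \<phi> Hf)
  also have "\<dots> \<le> B * nrm (H \<phi> f)"
    by (rule mult_norm_le[OF sym_cnj[OF \<phi>] Hf]) (use B in auto)
  finally show ?thesis .
qed

lemma HH_diff:
  assumes \<phi>: "sym \<phi>" and f: "f \<in> A2 \<Omega>" and g: "g \<in> A2 \<Omega>"
  shows "HH \<phi> (\<lambda>z. f z - g z) = (\<lambda>z. HH \<phi> f z - HH \<phi> g z)"
proof -
  have "HH \<phi> (\<lambda>z. f z - g z) = P (\<lambda>z. cnj (\<phi> z) * H \<phi> (\<lambda>z. f z - g z) z)"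
    by (rule HH_eq[OF \<phi> A2_diff[OF f g]])
  also have "\<dots> = P (\<lambda>z. cnj (\<phi> z) * H \<phi> f z - cnj (\<phi> z) * H \<phi> g z)"
    by (simp only: hankel_diff[OF \<phi> A2D(2)[OF f] A2D(2)[OF g]] right_diff_distrib)
  also have "\<dots> = (\<lambda>z. HH \<phi> f z - HH \<phi> g z)"
    unfolding HH_eq[OF \<phi> f] HH_eq[OF \<phi> g]
    by (intro P_diff mult_L2 sym_cnj \<phi> hankel_L2 A2D(2)[OF f] A2D(2)[OF g])
  finally show ?thesis .
qed

lemma berezin_HH:
  assumes \<phi>: "sym \<phi>" and z: "z \<in> \<Omega>"
  shows "berezin \<Omega> (HH \<phi>) z = complex_of_real ((nrm (H \<phi> (nk z)))\<^sup>2)"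
  unfolding berezin_def HH_inner[OF \<phi> nk_A2[OF z] nk_A2[OF z]] by (rule l2_inner_self)

subsection \<open>Compactness in terms of weakly null sequences\<close>

definition weakly_null :: "(nat \<Rightarrow> C2 \<Rightarrow> complex) \<Rightarrow> bool" where
  "weakly_null u \<longleftrightarrow> (\<forall>n. u n \<in> A2 \<Omega>) \<and> (\<exists>C. \<forall>n. nrm (u n) \<le> C) \<and> (\<forall>h\<in>A2 \<Omega>. (\<lambda>n. inn (u n) h) \<longlonglongrightarrow> 0)"

lemma weakly_null_subseq: "weakly_null u \<Longrightarrow> strict_mono s \<Longrightarrow> weakly_null (\<lambda>n. u (s n))"
  unfolding weakly_null_def using LIMSEQ_subseq_LIMSEQ[unfolded o_def] by blast

lemma weakly_nullD:
  assumes "weakly_null u"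
  shows "u n \<in> A2 \<Omega>" "\<exists>C. \<forall>n. nrm (u n) \<le> C" "h \<in> A2 \<Omega> \<Longrightarrow> (\<lambda>n. inn (u n) h) \<longlonglongrightarrow> 0"
  using assms unfolding weakly_null_def by blast+

lemma compact_operatorD:
  fixes u :: "nat \<Rightarrow> C2 \<Rightarrow> complex"
  assumes "compact_operator \<Omega> X Y T" "\<And>n. u n \<in> X" "\<exists>C. \<forall>n. nrm (u n) \<le> C"
  shows "\<exists>r g. strict_mono r \<and> g \<in> Y \<and> (\<lambda>n. nrm (\<lambda>z. T (u (r n)) z - g z)) \<longlonglongrightarrow> 0"
  by (rule assms(1)[unfolded compact_operator_def, THEN conjunct2, THEN spec, THEN mp]) (use assms(2,3) in blast)

lemma weakly_nullI_basis:
  assumes u: "\<And>n. u n \<in> A2 \<Omega>" and C: "\<And>n. nrm (u n) \<le> C" and b: "\<And>k. (\<lambda>n. inn (u n) (basis k)) \<longlonglongrightarrow> 0"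
  shows "weakly_null u"
  unfolding weakly_null_def
proof (intro conjI ballI)
  show "\<forall>n. u n \<in> A2 \<Omega>" "\<exists>C. \<forall>n. nrm (u n) \<le> C" using u C by blast+
  fix h assume h: "h \<in> A2 \<Omega>"
  let ?s = "\<lambda>N. psum (\<lambda>n. inn h (basis n)) {..<N}"
  have C0: "C \<ge> 0" using C[of 0] l2_norm_nonneg order_trans by blast
  show "(\<lambda>n. inn (u n) h) \<longlonglongrightarrow> 0"
  proof (rule LIMSEQ_I)
    fix e :: real assume e: "e > 0"
    then have "e / (2 * (C + 1)) > 0" using C0 by simp
    then obtain N where N: "nrm (\<lambda>z. ?s N z - h z) < e / (2 * (C + 1))"
      using LIMSEQ_D[OF basis_expansion[OF h]] by fastforce
    have "(\<lambda>n. inn (u n) (?s N)) \<longlonglongrightarrow> (\<Sum>k<N. cnj (inn h (basis k)) * 0)"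
    proof -
      have "inn (u n) (?s N) = (\<Sum>k<N. cnj (inn h (basis k)) * inn (u n) (basis k))" for n
        unfolding psum_def
        by (subst l2_inner_sum_right) (auto simp: L2_scale basis_L2 A2D(2)[OF u] l2_inner_scale_right)
      then show ?thesis by (simp only:) (intro tendsto_sum tendsto_mult tendsto_const b)
    qed
    then have "(\<lambda>n. inn (u n) (?s N)) \<longlonglongrightarrow> 0" by simp
    then obtain M where M: "\<And>n. n \<ge> M \<Longrightarrow> cmod (inn (u n) (?s N)) < e / 2"
      using LIMSEQ_D[of _ 0 "e/2"] e by fastforce
    have "cmod (inn (u n) h) < e" if "n \<ge> M" for n
    proof -
      have "inn (u n) h = inn (u n) (?s N) - inn (u n) (\<lambda>z. ?s N z - h z)"
        by (simp add: l2_inner_diff_right[OF A2D(2)[OF psum_A2] A2D(2)[OF h] A2D(2)[OF u]])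
      then have "cmod (inn (u n) h) \<le> cmod (inn (u n) (?s N)) + cmod (inn (u n) (\<lambda>z. ?s N z - h z))"
        by (simp only:) (rule norm_triangle_ineq4)
      moreover have "cmod (inn (u n) (\<lambda>z. ?s N z - h z)) \<le> C * (e / (2 * (C + 1)))"
      proof -
        have "cmod (inn (u n) (\<lambda>z. ?s N z - h z)) \<le> nrm (u n) * nrm (\<lambda>z. ?s N z - h z)"
          by (intro l2_Cauchy_Schwarz A2D(2)[OF u] L2_diff A2D(2)[OF psum_A2] A2D(2)[OF h])
        also have "\<dots> \<le> C * (e / (2 * (C + 1)))"
          using N by (intro mult_mono C C0) auto
        finally show ?thesis .
      qed
      moreover have "C * (e / (2 * (C + 1))) \<le> e / 2"
        using C0 e by (simp add: field_simps)
      ultimately show ?thesis using M[OF that] by linarith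
    qed
    then show "\<exists>no. \<forall>n\<ge>no. norm (inn (u n) h - 0) < e" by auto
  qed
qed

text \<open>A diagonal subsequence makes every coefficient converge.  Bessel's inequality passes to the limits, so they
  are the coefficients of an element of the space.\<close>

lemma bounded_imp_weakly_convergent_subseq:
  fixes u :: "nat \<Rightarrow> C2 \<Rightarrow> complex"
  assumes u: "\<And>n. u n \<in> A2 \<Omega>" and C: "\<And>n. nrm (u n) \<le> C"
  obtains r v where "strict_mono r" "v \<in> A2 \<Omega>" "weakly_null (\<lambda>n z. u (r n) z - v z)"
proof -
  define Q where "Q = (\<lambda>k (s :: nat \<Rightarrow> nat). convergent (\<lambda>n. inn (u (s n)) (basis k)))"
  have bd: "cmod (inn (u n) (basis k)) \<le> C" for n k
    using l2_Cauchy_Schwarz[OF A2D(2)[OF u] basis_L2, of n k] C[of n] by simp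
  interpret subseqs Q
  proof
    fix k s assume "strict_mono (s :: nat \<Rightarrow> nat)"
    have "bounded (range (\<lambda>n. inn (u (s n)) (basis k)))"
      unfolding bounded_iff using bd by blast
    then obtain l r where "strict_mono r" "((\<lambda>n. inn (u (s n)) (basis k)) \<circ> r) \<longlonglongrightarrow> l"
      using bounded_imp_convergent_subsequence by blast
    then show "\<exists>r'. strict_mono r' \<and> Q k (s \<circ> r')"
      unfolding Q_def convergent_def by (auto simp: o_def)
  qed
  define r where "r = diagseq"
  have r: "strict_mono r" unfolding r_def by (rule subseq_diagseq)
  have "\<exists>l. (\<lambda>n. inn (u (r n)) (basis k)) \<longlonglongrightarrow> l" for k
  proof -
    have "Q k (diagseq \<circ> ((+) (Suc k)))"
    proof (rule diagseq_holds)
      fix s t :: "nat \<Rightarrow> nat" and n assume "strict_mono s" "Q n t"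
      then obtain l where "(\<lambda>i. inn (u (t i)) (basis n)) \<longlonglongrightarrow> l" unfolding Q_def convergent_def by blast
      from LIMSEQ_subseq_LIMSEQ[OF this \<open>strict_mono s\<close>] show "Q n (t \<circ> s)"
        unfolding Q_def convergent_def o_def by blast
    qed
    then obtain l where "(\<lambda>n. inn (u (r (n + Suc k))) (basis k)) \<longlonglongrightarrow> l"
      unfolding Q_def convergent_def r_def by (auto simp: o_def add.commute)
    then show ?thesis using LIMSEQ_offset[of "\<lambda>n. inn (u (r n)) (basis k)" "Suc k"] by blast
  qed
  then obtain c where c: "\<And>k. (\<lambda>n. inn (u (r n)) (basis k)) \<longlonglongrightarrow> c k" by metis
  have "(\<Sum>k<N. (cmod (c k))\<^sup>2) \<le> C\<^sup>2" for N
  proof (rule LIMSEQ_le_const2)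
    show "(\<lambda>n. \<Sum>k<N. (cmod (inn (u (r n)) (basis k)))\<^sup>2) \<longlonglongrightarrow> (\<Sum>k<N. (cmod (c k))\<^sup>2)"
      by (intro tendsto_intros c)
    have "(\<Sum>k<N. (cmod (inn (u (r n)) (basis k)))\<^sup>2) \<le> C\<^sup>2" for n
      using bessel[OF A2D(2)[OF u], of "{..<N}" "r n"] power_mono[OF C[of "r n"], of 2] by fastforce
    then show "\<exists>M. \<forall>n\<ge>M. (\<Sum>k<N. (cmod (inn (u (r n)) (basis k)))\<^sup>2) \<le> C\<^sup>2" by blast
  qed
  note B = this
  obtain v where v: "v \<in> A2 \<Omega>" "\<And>n. inn v (basis n) = c n" using riesz_fischer[OF B] by blast
  have "weakly_null (\<lambda>n z. u (r n) z - v z)"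
  proof (rule weakly_nullI_basis)
    show "(\<lambda>z. u (r n) z - v z) \<in> A2 \<Omega>" for n by (intro A2_diff u v)
    show "nrm (\<lambda>z. u (r n) z - v z) \<le> C + nrm v" for n
      using l2_triangle[OF A2D(2)[OF u] L2_scale[OF A2D(2)[OF v(1)], of "-1"], of "r n"] C[of "r n"]
        l2_norm_scale[of \<Omega> "-1" v] by simp
    show "(\<lambda>n. inn (\<lambda>z. u (r n) z - v z) (basis k)) \<longlonglongrightarrow> 0" for k
      using tendsto_diff[OF c[of k] tendsto_const[of "c k"]]
      by (simp add: l2_inner_diff_left[OF A2D(2)[OF u] A2D(2)[OF v(1)] basis_L2] v(2))
  qed
  then show ?thesis by (rule that[OF r v(1)])
qed

text \<open>For a Hilbert space operator, compactness amounts to sending weakly null sequences to norm null ones.  The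
  two operators of the theorem are compared through this condition.\<close>

definition hankel_wc :: "(C2 \<Rightarrow> complex) \<Rightarrow> bool" where
  "hankel_wc \<phi> \<longleftrightarrow> (\<forall>u. weakly_null u \<longrightarrow> (\<lambda>n. nrm (H \<phi> (u n))) \<longlonglongrightarrow> 0)"

text \<open>A bounded sequence converges weakly along a subsequence, which gives one direction.  Conversely the
  image of a weakly null sequence tends weakly to 0, so that is the only possible norm limit.\<close>

lemma compact_hankel_iff:
  assumes \<phi>: "sym \<phi>"
  shows "compact_operator \<Omega> (A2 \<Omega>) (L2 \<Omega>) (H \<phi>) \<longleftrightarrow> hankel_wc \<phi>"
proof
  assume c: "compact_operator \<Omega> (A2 \<Omega>) (L2 \<Omega>) (H \<phi>)"
  show "hankel_wc \<phi>" unfolding hankel_wc_def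
  proof (intro allI impI)
    fix u assume u: "weakly_null u"
    show "(\<lambda>n. nrm (H \<phi> (u n))) \<longlonglongrightarrow> 0"
    proof (rule tendsto_zero_subseq)
      fix s :: "nat \<Rightarrow> nat" assume s: "strict_mono s"
      have us: "weakly_null (\<lambda>n. u (s n))" by (rule weakly_null_subseq[OF u s])
      obtain r g where r: "strict_mono r" "g \<in> L2 \<Omega>" "(\<lambda>n. nrm (\<lambda>z. H \<phi> (u (s (r n))) z - g z)) \<longlonglongrightarrow> 0"
        using compact_operatorD[OF c weakly_nullD(1)[OF us] weakly_nullD(2)[OF us]] by blast
      have uA: "u n \<in> A2 \<Omega>" for n by (rule weakly_nullD(1)[OF u])
      have HL: "H \<phi> (u n) \<in> L2 \<Omega>" for n by (intro hankel_L2 \<phi> A2D(2)[OF uA])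
      have "(\<lambda>n. inn (H \<phi> (u (s (r n)))) g) \<longlonglongrightarrow> inn g g"
        by (rule inner_tendsto[OF r(2) r(2) HL r(3)])
      moreover have "(\<lambda>n. inn (H \<phi> (u (s (r n)))) g) \<longlonglongrightarrow> 0"
        unfolding hadj_inner[OF \<phi> r(2) uA]
        by (rule weakly_nullD(3)[OF weakly_null_subseq[OF us r(1)] hadj_A2[OF \<phi> r(2)]])
      ultimately have "inn g g = 0" using LIMSEQ_unique by blast
      then have g0: "nrm g = 0" unfolding l2_inner_self by simp
      have "(\<lambda>n. nrm (H \<phi> (u (s (r n))))) \<longlonglongrightarrow> 0"
      proof (rule Lim_null_comparison[OF _ r(3)])
        show "\<forall>\<^sub>F n in sequentially. norm (nrm (H \<phi> (u (s (r n))))) \<le> nrm (\<lambda>z. H \<phi> (u (s (r n))) z - g z)"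
          using l2_triangle_sub[OF HL r(2)] g0 by simp
      qed
      with r(1) show "\<exists>r. strict_mono r \<and> (\<lambda>n. nrm (H \<phi> (u (s (r n))))) \<longlonglongrightarrow> 0"
        by (intro exI[of _ r] conjI)
    qed
  qed
next
  assume w: "hankel_wc \<phi>"
  show "compact_operator \<Omega> (A2 \<Omega>) (L2 \<Omega>) (H \<phi>)"
    unfolding compact_operator_def
  proof (intro conjI allI impI ballI)
    show "H \<phi> f \<in> L2 \<Omega>" if "f \<in> A2 \<Omega>" for f by (intro hankel_L2 \<phi> A2D(2)[OF that])
    fix u :: "nat \<Rightarrow> C2 \<Rightarrow> complex" assume "(\<forall>n. u n \<in> A2 \<Omega>) \<and> (\<exists>C. \<forall>n. nrm (u n) \<le> C)"
    then obtain C where u: "\<And>n. u n \<in> A2 \<Omega>" and C: "\<And>n. nrm (u n) \<le> C" by blast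
    obtain r v where r: "strict_mono r" "v \<in> A2 \<Omega>" "weakly_null (\<lambda>n z. u (r n) z - v z)"
      by (rule bounded_imp_weakly_convergent_subseq[OF u C]) (rule that)
    have "(\<lambda>n. nrm (H \<phi> (\<lambda>z. u (r n) z - v z))) \<longlonglongrightarrow> 0"
      by (rule w[unfolded hankel_wc_def, rule_format, OF r(3)])
    then have "(\<lambda>n. nrm (\<lambda>z. H \<phi> (u (r n)) z - H \<phi> v z)) \<longlonglongrightarrow> 0"
      by (simp add: hankel_diff[OF \<phi> A2D(2)[OF u] A2D(2)[OF r(2)]])
    with r(1) hankel_L2[OF \<phi> A2D(2)[OF r(2)]]
    show "\<exists>r g. strict_mono r \<and> g \<in> L2 \<Omega> \<and> (\<lambda>n. nrm (\<lambda>z. H \<phi> (u (r n)) z - g z)) \<longlonglongrightarrow> 0"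
      by (intro exI[of _ r] exI[of _ "H \<phi> v"] conjI)
  qed
qed

text \<open>This follows from \<open>\<parallel>H u\<parallel>\<^sup>2 = \<langle>H\<^sup>*H u, u\<rangle>\<close> and \<open>\<parallel>H\<^sup>*H u\<parallel> \<le> B \<parallel>H u\<parallel>\<close>.\<close>

lemma compact_HH_iff:
  assumes \<phi>: "sym \<phi>"
  shows "compact_operator \<Omega> (A2 \<Omega>) (A2 \<Omega>) (HH \<phi>) \<longleftrightarrow> hankel_wc \<phi>"
proof
  assume c: "compact_operator \<Omega> (A2 \<Omega>) (A2 \<Omega>) (HH \<phi>)"
  show "hankel_wc \<phi>" unfolding hankel_wc_def
  proof (intro allI impI)
    fix u assume u: "weakly_null u"
    have uA: "u n \<in> A2 \<Omega>" for n by (rule weakly_nullD(1)[OF u])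
    obtain C where C: "\<And>n. nrm (u n) \<le> C" using weakly_nullD(2)[OF u] by blast
    show "(\<lambda>n. nrm (H \<phi> (u n))) \<longlonglongrightarrow> 0"
    proof (rule tendsto_zero_subseq)
      fix s :: "nat \<Rightarrow> nat" assume s: "strict_mono s"
      have us: "weakly_null (\<lambda>n. u (s n))" by (rule weakly_null_subseq[OF u s])
      obtain r g where r: "strict_mono r" "g \<in> A2 \<Omega>" "(\<lambda>n. nrm (\<lambda>z. HH \<phi> (u (s (r n))) z - g z)) \<longlonglongrightarrow> 0"
        using compact_operatorD[OF c weakly_nullD(1)[OF us] weakly_nullD(2)[OF us]] by blast
      let ?v = "\<lambda>n. u (s (r n))"
      note gL = A2D(2)[OF r(2)]
      have hl: "HH \<phi> (?v n) \<in> L2 \<Omega>" for n by (rule A2D(2)[OF HH_A2[OF \<phi> uA]])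
      have le: "(nrm (H \<phi> (?v n)))\<^sup>2 \<le> nrm (\<lambda>z. HH \<phi> (?v n) z - g z) * C + cmod (inn (?v n) g)" for n
      proof -
        have "complex_of_real ((nrm (H \<phi> (?v n)))\<^sup>2) = inn (HH \<phi> (?v n)) (?v n)"
          unfolding HH_inner[OF \<phi> uA uA] by (rule l2_inner_self[symmetric])
        also have "\<dots> = inn (\<lambda>z. HH \<phi> (?v n) z - g z) (?v n) + inn g (?v n)"
          by (simp add: l2_inner_diff_left[OF hl gL A2D(2)[OF uA]])
        finally have "(nrm (H \<phi> (?v n)))\<^sup>2 = cmod (inn (\<lambda>z. HH \<phi> (?v n) z - g z) (?v n) + inn g (?v n))"
          using norm_of_real[of "(nrm (H \<phi> (?v n)))\<^sup>2", where ?'a = complex] by simp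
        also have "\<dots> \<le> cmod (inn (\<lambda>z. HH \<phi> (?v n) z - g z) (?v n)) + cmod (inn g (?v n))"
          by (rule norm_triangle_ineq)
        also have "cmod (inn g (?v n)) = cmod (inn (?v n) g)" by (rule inner_cmod_commute)
        also have "cmod (inn (\<lambda>z. HH \<phi> (?v n) z - g z) (?v n)) \<le> nrm (\<lambda>z. HH \<phi> (?v n) z - g z) * nrm (?v n)"
          by (intro l2_Cauchy_Schwarz L2_diff hl gL A2D(2)[OF uA])
        also have "\<dots> \<le> nrm (\<lambda>z. HH \<phi> (?v n) z - g z) * C" by (intro mult_left_mono C) auto
        finally show ?thesis by simp
      qed
      have "(\<lambda>n. inn (?v n) g) \<longlonglongrightarrow> 0"
        by (rule weakly_nullD(3)[OF weakly_null_subseq[OF us r(1)] r(2)])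
      then have "(\<lambda>n. nrm (\<lambda>z. HH \<phi> (?v n) z - g z) * C + cmod (inn (?v n) g)) \<longlonglongrightarrow> 0 * C + cmod 0"
        by (intro tendsto_intros r(3))
      then have lim: "(\<lambda>n. nrm (\<lambda>z. HH \<phi> (?v n) z - g z) * C + cmod (inn (?v n) g)) \<longlonglongrightarrow> 0" by simp
      have "(\<lambda>n. (nrm (H \<phi> (?v n)))\<^sup>2) \<longlonglongrightarrow> 0"
        by (rule Lim_null_comparison[OF _ lim]) (use le in simp)
      then have "(\<lambda>n. sqrt ((nrm (H \<phi> (?v n)))\<^sup>2)) \<longlonglongrightarrow> sqrt 0" by (rule tendsto_real_sqrt)
      then have "(\<lambda>n. nrm (H \<phi> (?v n))) \<longlonglongrightarrow> 0" by simp
      with r(1) show "\<exists>r. strict_mono r \<and> (\<lambda>n. nrm (H \<phi> (u (s (r n))))) \<longlonglongrightarrow> 0"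
        by (intro exI[of _ r] conjI)
    qed
  qed
next
  assume w: "hankel_wc \<phi>"
  show "compact_operator \<Omega> (A2 \<Omega>) (A2 \<Omega>) (HH \<phi>)"
    unfolding compact_operator_def
  proof (intro conjI allI impI ballI)
    show "HH \<phi> f \<in> A2 \<Omega>" if "f \<in> A2 \<Omega>" for f by (rule HH_A2[OF \<phi> that])
    fix u :: "nat \<Rightarrow> C2 \<Rightarrow> complex" assume "(\<forall>n. u n \<in> A2 \<Omega>) \<and> (\<exists>C. \<forall>n. nrm (u n) \<le> C)"
    then obtain C where u: "\<And>n. u n \<in> A2 \<Omega>" and C: "\<And>n. nrm (u n) \<le> C" by blast
    obtain r v where r: "strict_mono r" "v \<in> A2 \<Omega>" "weakly_null (\<lambda>n z. u (r n) z - v z)"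
      by (rule bounded_imp_weakly_convergent_subseq[OF u C]) (rule that)
    obtain B where B: "B > 0" "\<And>z. z \<in> closure \<Omega> \<Longrightarrow> cmod (\<phi> z) \<le> B" using sym_bounded[OF \<phi>] by blast
    have lim: "(\<lambda>n. nrm (H \<phi> (\<lambda>z. u (r n) z - v z))) \<longlonglongrightarrow> 0"
      by (rule w[unfolded hankel_wc_def, rule_format, OF r(3)])
    have "(\<lambda>n. nrm (HH \<phi> (\<lambda>z. u (r n) z - v z))) \<longlonglongrightarrow> 0"
    proof (rule Lim_null_comparison[OF _ tendsto_mult_right_zero[OF lim, of B]])
      show "\<forall>\<^sub>F n in sequentially. norm (nrm (HH \<phi> (\<lambda>z. u (r n) z - v z))) \<le> B * nrm (H \<phi> (\<lambda>z. u (r n) z - v z))"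
        using HH_norm_le[OF \<phi> A2_diff[OF u r(2)] B(2)] B(1) by simp
    qed
    then have "(\<lambda>n. nrm (\<lambda>z. HH \<phi> (u (r n)) z - HH \<phi> v z)) \<longlonglongrightarrow> 0"
      by (simp only: HH_diff[OF \<phi> u r(2)])
    with r(1) HH_A2[OF \<phi> r(2)]
    show "\<exists>r g. strict_mono r \<and> g \<in> A2 \<Omega> \<and> (\<lambda>n. nrm (\<lambda>z. HH \<phi> (u (r n)) z - g z)) \<longlonglongrightarrow> 0"
      by (intro exI[of _ r] exI[of _ "HH \<phi> v"] conjI)
  qed
qed

end

section \<open>The Bergman kernel near the boundary\<close>

context reinhardt_domain
begin

lemma frontier_eq: "frontier \<Omega> = closure \<Omega> - \<Omega>"
  using open_Omega by (simp add: frontier_def interior_open)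

lemma frontier_nonempty: "frontier \<Omega> \<noteq> {}"
  using frontier_eq_empty[of \<Omega>] nonempty_Omega bounded_Omega not_bounded_UNIV by auto

lemma compact_frontier_Omega: "compact (frontier \<Omega>)"
  using bounded_Omega by (rule compact_frontier_bounded)

text \<open>With \<open>\<ell>\<close> the supporting functional at a boundary point \<open>p\<close>, scaled so that \<open>|\<ell>| < 1\<close> on the domain and
  \<open>\<ell>(p) = 1\<close>, the powers \<open>\<ell>\<^sup>n\<close> tend to 0 in norm but keep absolute value 1 at \<open>p\<close>.\<close>

lemma kern_blowup_point:
  assumes p: "p \<in> frontier \<Omega>" and M: "M > 0"
  obtains d where "d > 0" "\<And>z. z \<in> \<Omega> \<Longrightarrow> dist z p < d \<Longrightarrow> nrm (kern z) > M"
proof -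
  obtain a b \<sigma> where s: "\<sigma> > 0" "\<And>w. w \<in> \<Omega> \<Longrightarrow> cmod a * cmod (fst w) + cmod b * cmod (snd w) < \<sigma>"
    "a * fst p + b * snd p = of_real \<sigma>"
    by (rule reinhardt_supporting_functional[OF open_Omega convex_Omega reinhardt_Omega nonempty_Omega p]) (rule that)
  define l where "l = (\<lambda>z :: C2. (a / of_real \<sigma>) * fst z + (b / of_real \<sigma>) * snd z)"
  have lh: "l holomorphic2_on \<Omega>"
    unfolding l_def by (intro holomorphic2_add holomorphic2_mult holomorphic2_const holomorphic2_fst holomorphic2_snd)
  have lc: "continuous_on A l" for A unfolding l_def by (intro continuous_intros)
  have l1: "cmod (l z) < 1" if z: "z \<in> \<Omega>" for z
  proof -
    have "cmod (l z) \<le> cmod ((a / of_real \<sigma>) * fst z) + cmod ((b / of_real \<sigma>) * snd z)"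
      unfolding l_def by (rule norm_triangle_ineq)
    also have "\<dots> = (cmod a * cmod (fst z) + cmod b * cmod (snd z)) / \<sigma>"
      using s(1) by (simp add: norm_mult norm_divide add_divide_distrib)
    also have "\<dots> < 1" using s(2)[OF z] s(1) by simp
    finally show ?thesis .
  qed
  have lp: "l p = 1"
  proof -
    have "l p = (a * fst p + b * snd p) / of_real \<sigma>" by (simp add: l_def add_divide_distrib)
    then show ?thesis using s(1,3) by simp
  qed
  define F where "F = (\<lambda>n z. if z \<in> \<Omega> then l z ^ n else 0)"
  have FA: "F n \<in> A2 \<Omega>" for n
  proof -
    have h: "(\<lambda>z. l z ^ n) holomorphic2_on \<Omega>" by (rule holomorphic2_power[OF lh])
    have "(\<lambda>z. l z ^ n) \<in> L2 \<Omega>"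
      by (rule continuous_bounded_L2[OF holomorphic2_on_imp_continuous_on[OF h], of 1])
        (simp only: norm_power, intro power_le_one norm_ge_zero less_imp_le l1)
    then have "F n \<in> L2 \<Omega>" by (subst L2_cong[of \<Omega> _ "\<lambda>z. l z ^ n"]) (auto simp: F_def)
    moreover have "F n holomorphic2_on \<Omega>"
      by (rule holomorphic2_cong_open[OF open_Omega _ h]) (auto simp: F_def)
    ultimately show ?thesis by (simp add: A2_def F_def)
  qed
  have fin: "finite_measure (lebesgue_on \<Omega>)"
    by (rule finite_measure_lebesgue_on[OF lmeasurable_bounded_open[OF bounded_Omega open_Omega]])
  have "(\<lambda>n. LINT z|lebesgue_on \<Omega>. (cmod (F n z))\<^sup>2) \<longlonglongrightarrow> (LINT z|lebesgue_on \<Omega>. 0)"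
  proof (rule integral_dominated_convergence[where w = "\<lambda>z. 1"])
    show "(\<lambda>z. (cmod (F n z))\<^sup>2) \<in> borel_measurable (lebesgue_on \<Omega>)" for n
      using L2_borel[OF A2D(2)[OF FA]] by simp
    show "integrable (lebesgue_on \<Omega>) (\<lambda>z. 1 :: real)"
      by (rule finite_measure.integrable_const[OF fin])
    have "(\<lambda>n. (cmod (F n z))\<^sup>2) \<longlonglongrightarrow> 0" if z: "z \<in> \<Omega>" for z
    proof -
      have "(\<lambda>n. ((cmod (l z))\<^sup>2) ^ n) \<longlonglongrightarrow> 0"
        using l1[OF z] by (intro LIMSEQ_power_zero) (simp add: power_less_one_iff abs_square_less_1)
      then show ?thesis using z by (simp add: F_def norm_power power_mult[symmetric] mult.commute)
    qed
    then show "AE z in lebesgue_on \<Omega>. (\<lambda>n. (cmod (F n z))\<^sup>2) \<longlonglongrightarrow> 0" by (intro AE_I2) simp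
    have "(cmod (F n z))\<^sup>2 \<le> 1" if "z \<in> \<Omega>" for z n
      using l1[OF that] that by (simp add: F_def norm_power power_le_one)
    then show "AE z in lebesgue_on \<Omega>. norm ((cmod (F n z))\<^sup>2) \<le> 1" for n by (intro AE_I2) simp
  qed simp
  then have "(\<lambda>n. (nrm (F n))\<^sup>2) \<longlonglongrightarrow> 0" by (simp add: l2_norm_sq)
  moreover have "(1 / (2 * M))\<^sup>2 > 0" using M by simp
  ultimately obtain n where "(nrm (F n))\<^sup>2 < (1 / (2 * M))\<^sup>2"
    using order_tendstoD(2) eventually_sequentially by (metis (no_types, lifting) order_refl)
  then have n: "nrm (F n) < 1 / (2 * M)" using M by (rule_tac power2_less_imp_less) auto
  have "continuous (at p) (\<lambda>z. cmod (l z ^ n))"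
  proof -
    have "continuous (at p) l" using lc[of UNIV] continuous_on_eq_continuous_at[OF open_UNIV] by blast
    then show ?thesis by (intro continuous_intros)
  qed
  then obtain d where d: "d > 0" "\<And>z. dist z p < d \<Longrightarrow> dist (cmod (l z ^ n)) (cmod (l p ^ n)) < 1/2"
    unfolding continuous_at_eps_delta by (metis half_gt_zero zero_less_one)
  show ?thesis
  proof (rule that[OF d(1)])
    fix z assume z: "z \<in> \<Omega>" "dist z p < d"
    have "\<bar>cmod (l z ^ n) - 1\<bar> < 1/2" using d(2)[OF z(2)] lp by (simp add: dist_real_def)
    then have "1/2 < cmod (l z ^ n)" by linarith
    then have "1/2 < cmod (F n z)" using z(1) by (simp add: F_def)
    also have "\<dots> \<le> nrm (F n) * nrm (kern z)" by (rule kern_norm_ge[OF z(1) FA])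
    also have "\<dots> < 1 / (2 * M) * nrm (kern z)" by (rule mult_strict_right_mono[OF n kern_norm_pos[OF z(1)]])
    finally show "nrm (kern z) > M" using M by (simp add: field_simps)
  qed
qed

lemma infdist_frontier_attained:
  obtains p where "p \<in> frontier \<Omega>" "infdist z (frontier \<Omega>) = dist z p"
  using infdist_attains_inf[OF frontier_closed frontier_nonempty] by metis

text \<open>The estimate at single boundary points extends to the whole boundary by compactness.\<close>

lemma kern_blowup:
  assumes M: "M > 0"
  obtains d where "d > 0" "\<And>z. z \<in> \<Omega> \<Longrightarrow> infdist z (frontier \<Omega>) < d \<Longrightarrow> nrm (kern z) > M"
proof (rule ccontr)
  assume "\<not> thesis"
  then have "\<exists>z\<in>\<Omega>. infdist z (frontier \<Omega>) < 1 / real (Suc n) \<and> nrm (kern z) \<le> M" for n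
    using that[of "1 / real (Suc n)"] by fastforce
  then obtain z where z: "\<And>n. z n \<in> \<Omega>" "\<And>n. infdist (z n) (frontier \<Omega>) < 1 / real (Suc n)" "\<And>n. nrm (kern (z n)) \<le> M"
    by metis
  have "\<exists>p. p \<in> frontier \<Omega> \<and> infdist (z n) (frontier \<Omega>) = dist (z n) p" for n
    by (rule infdist_frontier_attained) blast
  then obtain p where p: "\<And>n. p n \<in> frontier \<Omega>" "\<And>n. infdist (z n) (frontier \<Omega>) = dist (z n) (p n)" by metis
  obtain q r where q: "q \<in> frontier \<Omega>" "strict_mono r" "(p \<circ> r) \<longlonglongrightarrow> q"
    using compact_frontier_Omega p(1) unfolding compact_def by metis
  obtain d where d: "d > 0" "\<And>z. z \<in> \<Omega> \<Longrightarrow> dist z q < d \<Longrightarrow> nrm (kern z) > M"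
    using kern_blowup_point[OF q(1) M] by blast
  obtain N where N: "\<And>n. n \<ge> N \<Longrightarrow> dist (p (r n)) q < d/2"
    using metric_LIMSEQ_D[OF q(3), of "d/2"] d(1) by auto
  obtain m :: nat where m: "2 / d < real m" using reals_Archimedean2 by blast
  let ?n = "max N m"
  have "r ?n \<ge> m" using seq_suble[OF q(2), of ?n] by linarith
  then have "2 / d < real (Suc (r ?n))" using m by linarith
  then have "1 / real (Suc (r ?n)) < d / 2" using d(1) by (simp add: field_simps)
  then have "dist (z (r ?n)) (p (r ?n)) < d/2" using z(2)[of "r ?n"] p(2)[of "r ?n"] by linarith
  then have "dist (z (r ?n)) q < d" using N[of ?n] dist_triangle[of "z (r ?n)" q "p (r ?n)"] by linarith
  then show False using d(2)[OF z(1)] z(3)[of "r ?n"] by fastforce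
qed

lemma eventually_to_boundary:
  "eventually Q (to_boundary \<Omega>) \<longleftrightarrow> (\<exists>d>0. \<forall>z\<in>\<Omega>. infdist z (frontier \<Omega>) < d \<longrightarrow> Q z)"
proof -
  have "eventually Q (to_boundary \<Omega>) \<longleftrightarrow>
      (\<exists>R. eventually R (nhds (0::real)) \<and> (\<forall>z. R (infdist z (frontier \<Omega>)) \<longrightarrow> z \<in> \<Omega> \<longrightarrow> Q z))"
    unfolding to_boundary_def eventually_inf_principal eventually_filtercomap by simp
  also have "\<dots> \<longleftrightarrow> (\<exists>d>0. \<forall>z\<in>\<Omega>. infdist z (frontier \<Omega>) < d \<longrightarrow> Q z)"
  proof
    assume "\<exists>R. eventually R (nhds (0::real)) \<and> (\<forall>z. R (infdist z (frontier \<Omega>)) \<longrightarrow> z \<in> \<Omega> \<longrightarrow> Q z)"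
    then obtain R d where "d > 0" "\<And>x. dist x 0 < d \<Longrightarrow> R x" "\<And>z. R (infdist z (frontier \<Omega>)) \<Longrightarrow> z \<in> \<Omega> \<Longrightarrow> Q z"
      unfolding eventually_nhds_metric by blast
    then show "\<exists>d>0. \<forall>z\<in>\<Omega>. infdist z (frontier \<Omega>) < d \<longrightarrow> Q z"
      by (intro exI[of _ d]) (auto simp: infdist_nonneg)
  next
    assume "\<exists>d>0. \<forall>z\<in>\<Omega>. infdist z (frontier \<Omega>) < d \<longrightarrow> Q z"
    then obtain d where "d > 0" "\<And>z. z \<in> \<Omega> \<Longrightarrow> infdist z (frontier \<Omega>) < d \<Longrightarrow> Q z" by blast
    then show "\<exists>R. eventually R (nhds (0::real)) \<and> (\<forall>z. R (infdist z (frontier \<Omega>)) \<longrightarrow> z \<in> \<Omega> \<longrightarrow> Q z)"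
      by (intro exI[of _ "\<lambda>x. x < d"]) (auto simp: eventually_nhds_metric dist_real_def)
  qed
  finally show ?thesis .
qed

lemma mono_bounded: obtains C where "\<And>z. z \<in> \<Omega> \<Longrightarrow> cmod (mono \<alpha> z) \<le> C"
proof -
  obtain R where R: "\<And>z. z \<in> \<Omega> \<Longrightarrow> norm z \<le> R" using bounded_Omega unfolding bounded_iff by blast
  have "cmod (mono \<alpha> z) \<le> R ^ fst \<alpha> * R ^ snd \<alpha>" if z: "z \<in> \<Omega>" for z
  proof -
    have "0 \<le> R" using order_trans[OF norm_ge_zero R[OF z]] .
    moreover have "cmod (fst z) \<le> R" "cmod (snd z) \<le> R"
      using R[OF z] norm_fst_le[of "fst z" "snd z"] norm_snd_le[of "snd z" "fst z"] by auto
    ultimately show ?thesis using z unfolding mono_def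
      by (simp add: norm_mult norm_power) (intro mult_mono power_mono; simp)
  qed
  then show ?thesis by (rule that)
qed

lemma emon_bounded: obtains C where "\<And>z. z \<in> \<Omega> \<Longrightarrow> cmod (emon \<alpha> z) \<le> C"
proof -
  obtain C where C: "\<And>z. z \<in> \<Omega> \<Longrightarrow> cmod (mono \<alpha> z) \<le> C" using mono_bounded by blast
  show ?thesis
    by (rule that[of "C / nrm (mono \<alpha>)"])
      (use C mono_norm_pos[of \<alpha>] in \<open>simp add: emon_def norm_divide divide_right_mono\<close>)
qed

text \<open>The inner product of a basis monomial with \<open>k\<^sub>z\<close> is its value at \<open>z\<close>, which is bounded, divided by the
  norm of the kernel, which blows up.\<close>

lemma normalized_kernel_weakly_null:
  assumes z: "\<And>n. z n \<in> \<Omega>" and lim: "(\<lambda>n. infdist (z n) (frontier \<Omega>)) \<longlonglongrightarrow> 0"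
  shows "weakly_null (\<lambda>n. nk (z n))"
proof (rule weakly_nullI_basis[of _ 1])
  show "nk (z n) \<in> A2 \<Omega>" "nrm (nk (z n)) \<le> 1" for n using nk_A2[OF z] nk_norm[OF z] by auto
  fix k
  obtain C where C: "\<And>z. z \<in> \<Omega> \<Longrightarrow> cmod (basis k z) \<le> C" unfolding basis_def using emon_bounded by blast
  have C0: "C \<ge> 0" using C[OF z[of 0]] norm_ge_zero order_trans by blast
  have eq: "cmod (inn (nk (z n)) (basis k)) = cmod (basis k (z n)) / nrm (kern (z n))" for n
    unfolding inner_cmod_commute[of "nk (z n)"] nk_inner[OF z basis_A2] by (simp add: norm_divide)
  show "(\<lambda>n. inn (nk (z n)) (basis k)) \<longlonglongrightarrow> 0"
  proof (rule LIMSEQ_I)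
    fix e :: real assume e: "e > 0"
    then have "(C + 1) / e > 0" using C0 by simp
    then obtain d where d: "d > 0" "\<And>z. z \<in> \<Omega> \<Longrightarrow> infdist z (frontier \<Omega>) < d \<Longrightarrow> nrm (kern z) > (C + 1) / e"
      using kern_blowup by blast
    obtain N where N: "\<And>n. n \<ge> N \<Longrightarrow> infdist (z n) (frontier \<Omega>) < d"
      using LIMSEQ_D[OF lim d(1)] by (auto simp: infdist_nonneg)
    have "cmod (inn (nk (z n)) (basis k)) < e" if "n \<ge> N" for n
    proof -
      have "cmod (basis k (z n)) < e * nrm (kern (z n))"
        using C[OF z[of n]] d(2)[OF z N[OF that]] e by (simp add: field_simps)
      then show ?thesis unfolding eq using kern_norm_pos[OF z[of n]] by (simp add: field_simps)
    qed
    then show "\<exists>no. \<forall>n\<ge>no. norm (inn (nk (z n)) (basis k) - 0) < e" by auto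
  qed
qed

lemma hankel_wc_imp_boundary_limit:
  assumes w: "hankel_wc \<phi>" and e: "e > 0"
  shows "\<exists>d>0. \<forall>z\<in>\<Omega>. infdist z (frontier \<Omega>) < d \<longrightarrow> nrm (H \<phi> (nk z)) < e"
proof (rule ccontr)
  assume n: "\<not> ?thesis"
  have "\<exists>z\<in>\<Omega>. infdist z (frontier \<Omega>) < 1 / real (Suc n) \<and> nrm (H \<phi> (nk z)) \<ge> e" for n
  proof (rule ccontr)
    assume "\<not> (\<exists>z\<in>\<Omega>. infdist z (frontier \<Omega>) < 1 / real (Suc n) \<and> nrm (H \<phi> (nk z)) \<ge> e)"
    then have "\<forall>z\<in>\<Omega>. infdist z (frontier \<Omega>) < 1 / real (Suc n) \<longrightarrow> nrm (H \<phi> (nk z)) < e" by force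
    moreover have "1 / real (Suc n) > 0" by simp
    ultimately show False using n by blast
  qed
  then obtain z where z: "\<And>n. z n \<in> \<Omega>" "\<And>n. infdist (z n) (frontier \<Omega>) < 1 / real (Suc n)"
    "\<And>n. nrm (H \<phi> (nk (z n))) \<ge> e" by metis
  have "(\<lambda>n. infdist (z n) (frontier \<Omega>)) \<longlonglongrightarrow> 0"
  proof (rule Lim_null_comparison)
    show "\<forall>\<^sub>F n in sequentially. norm (infdist (z n) (frontier \<Omega>)) \<le> 1 / real (Suc n)"
      using z(2) by (simp add: infdist_nonneg less_imp_le)
    show "(\<lambda>n. 1 / real (Suc n)) \<longlonglongrightarrow> 0" by (rule LIMSEQ_Suc[OF lim_1_over_n])
  qed
  from normalized_kernel_weakly_null[OF z(1) this] have "(\<lambda>n. nrm (H \<phi> (nk (z n)))) \<longlonglongrightarrow> 0"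
    by (rule w[unfolded hankel_wc_def, rule_format])
  from LIMSEQ_D[OF this e] obtain N where "\<And>n. n \<ge> N \<Longrightarrow> nrm (H \<phi> (nk (z n))) < e" by auto
  then show False using z(3)[of N] by fastforce
qed

subsection \<open>Averaging over rotated kernels\<close>

lemma parseval:
  assumes f: "f \<in> A2 \<Omega>"
  shows "(\<lambda>k. (cmod (inn f (basis k)))\<^sup>2) sums (nrm f)\<^sup>2"
proof -
  let ?s = "\<lambda>N. psum (\<lambda>n. inn f (basis n)) {..<N}"
  have "(\<lambda>N. nrm (?s N)) \<longlonglongrightarrow> nrm f"
  proof (rule Lim_null[THEN iffD2], rule Lim_null_comparison[OF _ basis_expansion[OF f]])
    have "\<bar>nrm (?s N) - nrm f\<bar> \<le> nrm (\<lambda>z. ?s N z - f z)" for N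
      using l2_triangle_sub[OF A2D(2)[OF psum_A2] A2D(2)[OF f], of "\<lambda>n. inn f (basis n)" "{..<N}"]
        l2_triangle_sub[OF A2D(2)[OF f] A2D(2)[OF psum_A2], of "\<lambda>n. inn f (basis n)" "{..<N}"]
        l2_norm_minus_commute[of \<Omega> f "?s N"] by linarith
    then show "\<forall>\<^sub>F N in sequentially. norm (nrm (?s N) - nrm f) \<le> nrm (\<lambda>z. ?s N z - f z)" by simp
  qed
  from tendsto_power[OF this, of 2] show ?thesis
    unfolding sums_def by (simp add: psum_norm)
qed

lemma residual_norm:
  assumes f: "f \<in> L2 \<Omega>" and I: "finite I" and e: "\<And>i. i \<in> I \<Longrightarrow> e i \<in> L2 \<Omega>"
    "\<And>i j. i \<in> I \<Longrightarrow> j \<in> I \<Longrightarrow> inn (e i) (e j) = (if i = j then 1 else 0)"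
  shows "(nrm (\<lambda>z. f z - (\<Sum>i\<in>I. inn f (e i) * e i z)))\<^sup>2 = (nrm f)\<^sup>2 - (\<Sum>i\<in>I. (cmod (inn f (e i)))\<^sup>2)"
proof -
  let ?s = "\<lambda>z. \<Sum>i\<in>I. inn f (e i) * e i z"
  have s: "?s \<in> L2 \<Omega>" by (intro L2_sum L2_scale e)
  have r: "(\<lambda>z. f z - ?s z) \<in> L2 \<Omega>" by (intro L2_diff f s)
  have ns: "(nrm ?s)\<^sup>2 = (\<Sum>i\<in>I. (cmod (inn f (e i)))\<^sup>2)"
  proof -
    have n1: "nrm (e i) = 1" if "i \<in> I" for i
    proof -
      have "complex_of_real ((nrm (e i))\<^sup>2) = 1" using e(2)[OF that that] by (simp only: l2_inner_self) simp
      then have "(nrm (e i))\<^sup>2 = 1" by (simp only: of_real_eq_1_iff)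
      then show ?thesis using l2_norm_nonneg[of \<Omega> "e i"] by (simp add: power2_eq_1_iff)
    qed
    have "(nrm ?s)\<^sup>2 = (\<Sum>i\<in>I. (nrm (\<lambda>z. inn f (e i) * e i z))\<^sup>2)"
      by (rule l2_norm_orthogonal_sum[OF I]) (auto simp: L2_scale e l2_inner_scale_left l2_inner_scale_right)
    then show ?thesis by (simp add: l2_norm_scale n1)
  qed
  have si: "inn ?s (e j) = inn f (e j)" if j: "j \<in> I" for j
  proof -
    have "inn ?s (e j) = (\<Sum>i\<in>I. inn f (e i) * inn (e i) (e j))"
      by (subst l2_inner_sum_left) (auto simp: L2_scale e j l2_inner_scale_left)
    also have "\<dots> = (\<Sum>i\<in>I. if i = j then inn f (e i) else 0)"
      by (intro sum.cong refl) (simp add: e(2) j)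
    finally show ?thesis using I j by simp
  qed
  have "inn (\<lambda>z. f z - ?s z) (\<lambda>z. inn f (e i) * e i z) = 0" if i: "i \<in> I" for i
    unfolding l2_inner_scale_right l2_inner_diff_left[OF f s e(1)[OF i]] si[OF i] by simp
  then have o: "inn (\<lambda>z. f z - ?s z) ?s = 0"
    by (subst l2_inner_sum_right[OF _ r]) (auto simp: L2_scale e)
  have "(nrm (\<lambda>z. (f z - ?s z) + ?s z))\<^sup>2 = (nrm (\<lambda>z. f z - ?s z))\<^sup>2 + (nrm ?s)\<^sup>2"
    by (subst l2_norm_add_sq[OF r s]) (simp add: o)
  then show ?thesis by (simp add: ns)
qed

text \<open>The mean over the circle of the squared norm of a trigonometric polynomial with vector coefficients.\<close>

lemma circle_parseval:
  assumes v: "\<And>n. n < M \<Longrightarrow> v n \<in> L2 \<Omega>"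
    and Q: "\<And>t. (nrm (\<lambda>z. \<Sum>n<M. ex (- (of_nat n * t)) * v n z))\<^sup>2 \<le> Q"
  shows "(\<Sum>n<M. (nrm (v n))\<^sup>2) \<le> Q"
proof -
  let ?u = "\<lambda>t z. \<Sum>n<M. ex (- (of_nat n * t)) * v n z"
  have uL: "?u t \<in> L2 \<Omega>" for t by (intro L2_sum L2_scale v) simp
  have expand: "complex_of_real ((nrm (?u t))\<^sup>2) = (\<Sum>n<M. \<Sum>m<M. inn (v n) (v m) * ex (of_int (int m - int n) * t))" for t
  proof -
    have "complex_of_real ((nrm (?u t))\<^sup>2) = inn (?u t) (?u t)" by (rule l2_inner_self[symmetric])
    also have "\<dots> = (\<Sum>n<M. ex (- (of_nat n * t)) * inn (v n) (?u t))"
      by (subst l2_inner_sum_left) (auto simp: L2_scale uL v l2_inner_scale_left)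
    also have "\<dots> = (\<Sum>n<M. \<Sum>m<M. inn (v n) (v m) * ex (of_int (int m - int n) * t))"
    proof (intro sum.cong refl)
      fix n assume n: "n \<in> {..<M}"
      have "inn (v n) (?u t) = (\<Sum>m<M. ex (of_nat m * t) * inn (v n) (v m))"
        using n by (subst l2_inner_sum_right) (auto simp: L2_scale v l2_inner_scale_right ex_minus)
      then have "ex (- (of_nat n * t)) * inn (v n) (?u t) = (\<Sum>m<M. inn (v n) (v m) * (ex (of_nat m * t) * ex (- (of_nat n * t))))"
        by (simp add: sum_distrib_left mult_ac)
      also have "\<dots> = (\<Sum>m<M. inn (v n) (v m) * ex (of_int (int m - int n) * t))"
        by (intro sum.cong refl) (simp add: ex_add[symmetric] algebra_simps)
      finally show "ex (- (of_nat n * t)) * inn (v n) (?u t) = (\<Sum>m<M. inn (v n) (v m) * ex (of_int (int m - int n) * t))" .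
    qed
    finally show ?thesis .
  qed
  have "((\<lambda>t. complex_of_real ((nrm (?u t))\<^sup>2)) has_integral
      (\<Sum>n<M. \<Sum>m<M. inn (v n) (v m) * (if int m - int n = 0 then 1 else 0))) {0..1}"
    unfolding expand by (intro has_integral_sum has_integral_mult_right has_integral_ex) auto
  moreover have "(\<Sum>n<M. \<Sum>m<M. inn (v n) (v m) * (if int m - int n = 0 then 1 else 0)) = complex_of_real (\<Sum>n<M. (nrm (v n))\<^sup>2)"
  proof -
    have "(\<Sum>m<M. inn (v n) (v m) * (if int m - int n = 0 then 1 else 0)) = complex_of_real ((nrm (v n))\<^sup>2)" if n: "n \<in> {..<M}" for n
    proof -
      have "(\<Sum>m<M. inn (v n) (v m) * (if int m - int n = 0 then 1 else 0)) = (\<Sum>m<M. if m = n then inn (v n) (v m) else 0)"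
        by (intro sum.cong refl) auto
      also have "\<dots> = inn (v n) (v n)" using n by simp
      finally show ?thesis by (simp only: l2_inner_self)
    qed
    then show ?thesis by (simp only: of_real_sum cong: sum.cong)
  qed
  ultimately have "((\<lambda>t. (nrm (?u t))\<^sup>2) has_integral (\<Sum>n<M. (nrm (v n))\<^sup>2)) {0..1}"
    by (intro has_integral_complex_of_realD) simp
  moreover have "((\<lambda>t. Q) has_integral Q) {0..1::real}"
    using has_integral_const_real[of Q 0 1] by simp
  ultimately show ?thesis by (rule has_integral_le) (rule Q)
qed

text \<open>The kernels at the points of one coordinate axis expand in the powers of that coordinate alone.  Averaging
  \<open>\<parallel>H k\<^sub>z\<parallel>\<^sup>2\<close> over a rotated orbit gives a convex combination of the numbers \<open>\<parallel>H e\<^sub>n\<parallel>\<^sup>2\<close> whose weights leave every finite set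
  of indices as the point approaches the boundary, so these numbers cannot stay away from 0.\<close>

lemma boundary_limit_imp_hankel_axis_small:
  fixes \<alpha> :: "nat \<Rightarrow> nat \<times> nat" and pt :: "complex \<Rightarrow> C2"
  assumes \<phi>: "sym \<phi>"
    and lim: "\<And>e. e > 0 \<Longrightarrow> \<exists>d>0. \<forall>z\<in>\<Omega>. infdist z (frontier \<Omega>) < d \<longrightarrow> nrm (H \<phi> (nk z)) < e"
    and inj: "inj \<alpha>"
    and m1: "\<And>c n. pt c \<in> \<Omega> \<Longrightarrow> mono (\<alpha> n) (pt c) = c ^ n"
    and m2: "\<And>c \<beta>. pt c \<in> \<Omega> \<Longrightarrow> \<beta> \<notin> range \<alpha> \<Longrightarrow> mono \<beta> (pt c) = 0"
    and q: "q > 0" "\<And>c. cmod c = q \<Longrightarrow> pt c \<in> frontier \<Omega>" "\<And>c. cmod c < q \<Longrightarrow> pt c \<in> \<Omega>"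
    and iso: "\<And>a b. dist (pt a) (pt b) = dist a b"
    and \<delta>: "\<delta> > 0"
  shows "\<exists>n\<ge>N. nrm (H \<phi> (emon (\<alpha> n))) < \<delta>"
proof (rule ccontr)
  assume "\<not> ?thesis"
  then have big: "nrm (H \<phi> (emon (\<alpha> n))) \<ge> \<delta>" if "n \<ge> N" for n using that by force
  obtain B where B: "B > 0" "\<And>z. z \<in> closure \<Omega> \<Longrightarrow> cmod (\<phi> z) \<le> B" using sym_bounded[OF \<phi>] by blast
  have "\<delta>/4 > 0" using \<delta> by simp
  then obtain d1 where d1: "d1 > 0" "\<And>z. z \<in> \<Omega> \<Longrightarrow> infdist z (frontier \<Omega>) < d1 \<Longrightarrow> nrm (H \<phi> (nk z)) < \<delta>/4"
    using lim by blast
  \<comment> \<open>\<open>A\<close> bounds the part of the squared kernel norm carried by the first \<open>N\<close> indices; a kernel larger than \<open>K\<close>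
    gives these indices less than a quarter of the total weight.\<close>
  define A where "A = (\<Sum>n<N. (q ^ n / nrm (mono (\<alpha> n)))\<^sup>2)"
  have A0: "A \<ge> 0" unfolding A_def by (intro sum_nonneg) simp
  define K where "K = sqrt (4 * A + 1)"
  have K0: "K > 0" and K2: "K\<^sup>2 = 4 * A + 1" using A0 by (simp_all add: K_def)
  obtain d2 where d2: "d2 > 0" "\<And>z. z \<in> \<Omega> \<Longrightarrow> infdist z (frontier \<Omega>) < d2 \<Longrightarrow> nrm (kern z) > K"
    using kern_blowup[OF K0] by blast
  define x where "x = q - min (q/2) (min d1 d2 / 2)"
  have x: "0 < x" "x < q" "q - x < d1" "q - x < d2"
    using q(1) d1(1) d2(1) by (auto simp: x_def min_def)
  define z where "z = (\<lambda>t. pt (ex t * of_real x))"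
  have z\<Omega>: "z t \<in> \<Omega>" for t unfolding z_def by (rule q(3)) (use x in \<open>simp add: norm_mult\<close>)
  have zd: "infdist (z t) (frontier \<Omega>) \<le> q - x" for t
  proof -
    have "pt (ex t * of_real q) \<in> frontier \<Omega>" by (rule q(2)) (use q(1) in \<open>simp add: norm_mult\<close>)
    then have "infdist (z t) (frontier \<Omega>) \<le> dist (z t) (pt (ex t * of_real q))" by (rule infdist_le)
    also have "\<dots> = cmod (ex t * of_real x - ex t * of_real q)" unfolding z_def iso by (simp add: dist_norm)
    also have "\<dots> = cmod (of_real (x - q))" by (simp add: right_diff_distrib[symmetric] norm_mult del: of_real_diff flip: of_real_diff)
    also have "\<dots> = q - x" using x by (simp only: norm_of_real)
    finally show ?thesis .
  qed
  have small: "nrm (H \<phi> (nk (z t))) < \<delta>/4" for t using d1(2)[OF z\<Omega>] zd[of t] x(3) by fastforce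
  have Kz: "nrm (kern (z t)) > K" for t using d2(2)[OF z\<Omega>] zd[of t] x(4) by fastforce
  define a where "a = (\<lambda>n. x ^ n / nrm (mono (\<alpha> n)))"
  have a0: "a n \<ge> 0" for n unfolding a_def using x(1) by simp
  have ez: "emon (\<alpha> n) (z t) = of_real (a n) * ex (of_nat n * t)" for n t
    using m1[OF z\<Omega>[unfolded z_def], of n t] by (simp add: emon_def a_def z_def power_mult_distrib ex_power mult_ac)
  have ez0: "emon \<beta> (z t) = 0" if "\<beta> \<notin> range \<alpha>" for \<beta> t
    using m2[OF z\<Omega>[unfolded z_def] that, of t] by (simp add: emon_def z_def)
  define \<kappa> where "\<kappa> = nrm (kern (z 0))"
  have pars: "(\<lambda>k. (cmod (basis k (z t)))\<^sup>2) sums (nrm (kern (z t)))\<^sup>2" for t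
  proof -
    have "cmod (inn (kern (z t)) (basis k)) = cmod (basis k (z t))" for k
      unfolding inner_cmod_commute[of "kern (z t)" "basis k"] kern_reproducing[OF z\<Omega> basis_A2] ..
    then show ?thesis using parseval[OF kern_A2[OF z\<Omega>], of t] by (simp only:)
  qed
  have \<kappa>: "nrm (kern (z t)) = \<kappa>" for t
  proof -
    have "cmod (basis k (z t)) = cmod (basis k (z 0))" for k
    proof (cases "prod_decode k \<in> range \<alpha>")
      case True
      then show ?thesis by (auto simp: basis_def ez norm_mult)
    qed (simp add: basis_def ez0)
    then have "(nrm (kern (z t)))\<^sup>2 = \<kappa>\<^sup>2"
      unfolding \<kappa>_def using sums_unique2[OF pars[of t]] pars[of 0] by simp
    then show ?thesis by (simp add: \<kappa>_def power2_eq_iff_nonneg)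
  qed
  have \<kappa>0: "\<kappa> > K" using Kz[of 0] by (simp add: \<kappa>_def)
  then have \<kappa>p: "\<kappa> > 0" using K0 by simp
  \<comment> \<open>Cutting the expansion of the normalised kernel at a tail of squared norm \<open>\<tau>\<close> costs at most \<open>\<delta>/4\<close>, because the
    Hankel operator has norm at most \<open>B\<close>.\<close>
  define \<tau> where "\<tau> = min (1/4) ((\<delta> / (4 * B))\<^sup>2)"
  have \<tau>: "\<tau> > 0" "\<tau> \<le> 1/4" "\<tau> \<le> (\<delta> / (4 * B))\<^sup>2" using \<delta> B(1) by (auto simp: \<tau>_def)
  obtain M where M: "(\<Sum>n<M. (a n / \<kappa>)\<^sup>2) \<ge> 1 - \<tau>"
  proof -
    have "\<kappa>\<^sup>2 * (1 - \<tau>) < \<kappa>\<^sup>2" using \<tau>(1) \<kappa>p by simp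
    then have "eventually (\<lambda>N. \<kappa>\<^sup>2 * (1 - \<tau>) < (\<Sum>k<N. (cmod (basis k (z 0)))\<^sup>2)) sequentially"
      using pars[of 0] unfolding sums_def \<kappa> by (intro order_tendstoD(1)) auto
    then obtain N' where N': "\<kappa>\<^sup>2 * (1 - \<tau>) < (\<Sum>k<N'. (cmod (basis k (z 0)))\<^sup>2)"
      unfolding eventually_sequentially by blast
    let ?g = "\<lambda>n. prod_encode (\<alpha> n)"
    have ig: "inj ?g" using inj inj_prod_encode[of UNIV] by (auto simp: inj_def)
    define J where "J = ?g -` {..<N'}"
    have J: "finite J" unfolding J_def by (intro finite_vimageI ig) simp
    then obtain M where JM: "J \<subseteq> {..<M}" using finite_nat_bounded by blast
    have "(\<Sum>k<N'. (cmod (basis k (z 0)))\<^sup>2) = (\<Sum>k\<in>?g ` J. (cmod (basis k (z 0)))\<^sup>2)"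
    proof (rule sum.mono_neutral_right)
      show "\<forall>k\<in>{..<N'} - ?g ` J. (cmod (basis k (z 0)))\<^sup>2 = 0"
      proof
        fix k assume k: "k \<in> {..<N'} - ?g ` J"
        have "prod_decode k \<notin> range \<alpha>"
        proof
          assume "prod_decode k \<in> range \<alpha>"
          then obtain n where "prod_decode k = \<alpha> n" by blast
          then have "k = ?g n" by (metis prod_decode_inverse)
          then show False using k by (auto simp: J_def)
        qed
        then show "(cmod (basis k (z 0)))\<^sup>2 = 0" by (simp add: basis_def ez0)
      qed
    qed (auto simp: J_def)
    also have "\<dots> = (\<Sum>n\<in>J. (cmod (basis (?g n) (z 0)))\<^sup>2)"
      by (subst sum.reindex[OF inj_on_subset[OF ig subset_UNIV]]) (simp add: o_def)
    also have "\<dots> = (\<Sum>n\<in>J. (a n)\<^sup>2)"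
      by (simp add: basis_def ez norm_mult)
    also have "\<dots> \<le> (\<Sum>n<M. (a n)\<^sup>2)" by (intro sum_mono2 JM) auto
    finally have "\<kappa>\<^sup>2 * (1 - \<tau>) \<le> (\<Sum>n<M. (a n)\<^sup>2)" using N' by linarith
    then have "1 - \<tau> \<le> (\<Sum>n<M. (a n)\<^sup>2) / \<kappa>\<^sup>2" using \<kappa>p by (simp add: pos_le_divide_eq mult.commute)
    then show thesis by (intro that[of M]) (simp add: power_divide sum_divide_distrib)
  qed
  have eL: "emon \<beta> \<in> L2 \<Omega>" for \<beta> by (rule A2D(2)[OF emon_A2])
  have inn_nk: "inn (nk (z t)) (emon (\<alpha> n)) = ex (- (of_nat n * t)) * of_real (a n / \<kappa>)" for t n
  proof -
    have "inn (nk (z t)) (emon (\<alpha> n)) = cnj (inn (emon (\<alpha> n)) (nk (z t)))" by (rule l2_inner_cnj[symmetric])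
    also have "inn (emon (\<alpha> n)) (nk (z t)) = emon (\<alpha> n) (z t) / of_real \<kappa>"
      unfolding nk_inner[OF z\<Omega> emon_A2] \<kappa> ..
    finally show ?thesis by (simp add: ez ex_minus)
  qed
  define v where "v = (\<lambda>n z. complex_of_real (a n / \<kappa>) * H \<phi> (emon (\<alpha> n)) z)"
  have vL: "v n \<in> L2 \<Omega>" for n unfolding v_def by (intro L2_scale hankel_L2 \<phi> eL)
  have "(\<Sum>n<M. (nrm (v n))\<^sup>2) \<le> (\<delta>/2)\<^sup>2"
  proof (rule circle_parseval[OF vL])
    fix t
    let ?u = "\<lambda>w. \<Sum>n<M. inn (nk (z t)) (emon (\<alpha> n)) * emon (\<alpha> n) w"
    note nkL = A2D(2)[OF nk_A2[OF z\<Omega>[of t]]]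
    have uL: "?u \<in> L2 \<Omega>" by (intro L2_sum L2_scale eL)
    have "(nrm (\<lambda>w. nk (z t) w - ?u w))\<^sup>2 = (nrm (nk (z t)))\<^sup>2 - (\<Sum>n<M. (cmod (inn (nk (z t)) (emon (\<alpha> n))))\<^sup>2)"
      by (rule residual_norm[OF nkL]) (auto simp: eL emon_orthonormal inj_eq[OF inj])
    also have "\<dots> = 1 - (\<Sum>n<M. (a n / \<kappa>)\<^sup>2)"
      unfolding inn_nk nk_norm[OF z\<Omega>] using a0 \<kappa>p by (simp add: norm_mult norm_divide)
    also have "\<dots> \<le> (\<delta> / (4 * B))\<^sup>2" using M \<tau>(3) by linarith
    finally have "nrm (\<lambda>w. nk (z t) w - ?u w) \<le> \<delta> / (4 * B)"
      by (rule power2_le_imp_le) (use \<delta> B(1) in simp)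
    then have "B * nrm (\<lambda>w. nk (z t) w - ?u w) \<le> \<delta> / 4" using B(1) by (simp add: field_simps)
    then have 1: "nrm (H \<phi> (\<lambda>w. nk (z t) w - ?u w)) \<le> \<delta> / 4"
      using hankel_bound[OF \<phi> L2_diff[OF nkL uL] B(2)] B(1) by linarith
    have "nrm (H \<phi> ?u) \<le> nrm (\<lambda>w. H \<phi> ?u w - H \<phi> (nk (z t)) w) + nrm (H \<phi> (nk (z t)))"
      by (intro l2_triangle_sub hankel_L2 \<phi> nkL uL)
    also have "nrm (\<lambda>w. H \<phi> ?u w - H \<phi> (nk (z t)) w) = nrm (H \<phi> (\<lambda>w. nk (z t) w - ?u w))"
      unfolding hankel_diff[OF \<phi> nkL uL] by (rule l2_norm_minus_commute)
    finally have "nrm (H \<phi> ?u) \<le> \<delta> / 2" using 1 small[of t] by linarith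
    moreover have "H \<phi> ?u = (\<lambda>w. \<Sum>n<M. ex (- (of_nat n * t)) * v n w)"
      unfolding hankel_lincomb[OF \<phi> eL] inn_nk v_def by (simp add: mult.assoc)
    ultimately show "(nrm (\<lambda>w. \<Sum>n<M. ex (- (of_nat n * t)) * v n w))\<^sup>2 \<le> (\<delta>/2)\<^sup>2"
      by (intro power_mono) auto
  qed
  moreover have "\<delta>\<^sup>2 * (\<Sum>n\<in>{..<M} - {..<N}. (a n / \<kappa>)\<^sup>2) \<le> (\<Sum>n<M. (nrm (v n))\<^sup>2)"
  proof -
    have "\<delta>\<^sup>2 * (\<Sum>n\<in>{..<M} - {..<N}. (a n / \<kappa>)\<^sup>2) = (\<Sum>n\<in>{..<M} - {..<N}. (a n / \<kappa> * \<delta>)\<^sup>2)"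
      unfolding sum_distrib_left by (intro sum.cong refl) (simp add: power_mult_distrib power_divide)
    also have "\<dots> \<le> (\<Sum>n\<in>{..<M} - {..<N}. (nrm (v n))\<^sup>2)"
    proof (intro sum_mono power_mono)
      fix n assume n: "n \<in> {..<M} - {..<N}"
      have "nrm (v n) = a n / \<kappa> * nrm (H \<phi> (emon (\<alpha> n)))"
        unfolding v_def l2_norm_scale using a0[of n] \<kappa>p by (simp add: norm_divide)
      then show "a n / \<kappa> * \<delta> \<le> nrm (v n)"
        using n big[of n] a0[of n] \<kappa>p by (simp add: mult_left_mono divide_right_mono)
      show "0 \<le> a n / \<kappa> * \<delta>" using a0[of n] \<kappa>p \<delta> by simp
    qed
    also have "\<dots> \<le> (\<Sum>n<M. (nrm (v n))\<^sup>2)" by (intro sum_mono2) auto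
    finally show ?thesis .
  qed
  moreover have "(\<Sum>n<M. (a n / \<kappa>)\<^sup>2) \<le> (\<Sum>n\<in>{..<M} - {..<N}. (a n / \<kappa>)\<^sup>2) + 1/4"
  proof -
    have "(\<Sum>n<M. (a n / \<kappa>)\<^sup>2) \<le> (\<Sum>n\<in>({..<M} - {..<N}) \<union> {..<N}. (a n / \<kappa>)\<^sup>2)"
      by (intro sum_mono2) auto
    also have "\<dots> = (\<Sum>n\<in>{..<M} - {..<N}. (a n / \<kappa>)\<^sup>2) + (\<Sum>n<N. (a n / \<kappa>)\<^sup>2)"
      by (intro sum.union_disjoint) auto
    also have "(\<Sum>n<N. (a n / \<kappa>)\<^sup>2) = (\<Sum>n<N. (a n)\<^sup>2) / \<kappa>\<^sup>2" by (simp add: power_divide sum_divide_distrib)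
    also have "(\<Sum>n<N. (a n)\<^sup>2) \<le> A"
      unfolding A_def a_def using x mono_norm_pos
      by (intro sum_mono power_mono divide_right_mono) (auto intro: less_imp_le)
    also have "A / \<kappa>\<^sup>2 \<le> 1/4"
    proof -
      have "4 * A \<le> K\<^sup>2" using K2 by simp
      also have "\<dots> \<le> \<kappa>\<^sup>2" using \<kappa>0 K0 by (intro power_mono) auto
      finally show ?thesis using \<kappa>p by (simp add: field_simps)
    qed
    finally show ?thesis using \<kappa>p by (simp add: divide_right_mono)
  qed
  ultimately have "\<delta>\<^sup>2 * (1/2) \<le> (\<delta>/2)\<^sup>2"
  proof -
    assume 1: "(\<Sum>n<M. (nrm (v n))\<^sup>2) \<le> (\<delta>/2)\<^sup>2"
      and 2: "\<delta>\<^sup>2 * (\<Sum>n\<in>{..<M} - {..<N}. (a n / \<kappa>)\<^sup>2) \<le> (\<Sum>n<M. (nrm (v n))\<^sup>2)"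
      and 3: "(\<Sum>n<M. (a n / \<kappa>)\<^sup>2) \<le> (\<Sum>n\<in>{..<M} - {..<N}. (a n / \<kappa>)\<^sup>2) + 1/4"
    have "1/2 \<le> (\<Sum>n\<in>{..<M} - {..<N}. (a n / \<kappa>)\<^sup>2)" using 3 M \<tau>(2) by linarith
    then have "\<delta>\<^sup>2 * (1/2) \<le> \<delta>\<^sup>2 * (\<Sum>n\<in>{..<M} - {..<N}. (a n / \<kappa>)\<^sup>2)" by (intro mult_left_mono) auto
    then show ?thesis using 1 2 by linarith
  qed
  then show False using \<delta> by (simp add: power_divide)
qed

end

section \<open>Homogeneous components of the symbol\<close>

lemma nn_integral_lborel_prod_mult:
  fixes F G :: "complex \<Rightarrow> ennreal"
  assumes F: "F \<in> borel_measurable borel" and G: "G \<in> borel_measurable borel"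
  shows "(\<integral>\<^sup>+z. F (fst z) * G (snd z) \<partial>(lborel :: C2 measure)) = (\<integral>\<^sup>+u. F u \<partial>lborel) * (\<integral>\<^sup>+w. G w \<partial>lborel)"
proof -
  have m1: "F \<in> borel_measurable lborel" "G \<in> borel_measurable lborel" using F G by simp_all
  have m: "(\<lambda>z. F (fst z) * G (snd z)) \<in> borel_measurable (lborel \<Otimes>\<^sub>M lborel)"
    using m1 by measurable
  have "(\<integral>\<^sup>+z. F (fst z) * G (snd z) \<partial>(lborel :: C2 measure)) = (\<integral>\<^sup>+z. F (fst z) * G (snd z) \<partial>(lborel \<Otimes>\<^sub>M lborel))"
    by (simp only: lborel_prod)
  also have "\<dots> = (\<integral>\<^sup>+u. (\<integral>\<^sup>+w. F u * G w \<partial>lborel) \<partial>lborel)"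
    using lborel.nn_integral_fst[OF m] by simp
  also have "\<dots> = (\<integral>\<^sup>+u. F u * (\<integral>\<^sup>+w. G w \<partial>lborel) \<partial>lborel)"
    using m1 by (simp add: nn_integral_cmult)
  also have "\<dots> = (\<integral>\<^sup>+u. F u \<partial>lborel) * (\<integral>\<^sup>+w. G w \<partial>lborel)"
    using m1 by (simp add: nn_integral_multc)
  finally show ?thesis .
qed

text \<open>Both coordinates are treated at once: \<open>ax\<close> tells whether the first or the second is the distinguished one.\<close>

definition cX :: "bool \<Rightarrow> C2 \<Rightarrow> complex" where "cX ax z = (if ax then fst z else snd z)"
definition cY :: "bool \<Rightarrow> C2 \<Rightarrow> complex" where "cY ax z = (if ax then snd z else fst z)"
definition pr :: "bool \<Rightarrow> 'a \<Rightarrow> 'a \<Rightarrow> 'a \<times> 'a" where "pr ax a b = (if ax then (a, b) else (b, a))"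
definition tc :: "bool \<Rightarrow> int \<Rightarrow> int \<Rightarrow> (C2 \<Rightarrow> complex) \<Rightarrow> C2 \<Rightarrow> complex" where
  "tc ax k l = (if ax then tcoef k l else tcoef l k)"

lemma cX_pr [simp]: "cX ax (pr ax a b) = a" and cY_pr [simp]: "cY ax (pr ax a b) = b"
  and pr_cX_cY [simp]: "pr ax (cX ax z) (cY ax z) = z"
  by (simp_all add: cX_def cY_def pr_def)

lemma continuous_on_cX [continuous_intros]: "continuous_on A f \<Longrightarrow> continuous_on A (\<lambda>x. cX ax (f x))"
  and continuous_on_cY [continuous_intros]: "continuous_on A f \<Longrightarrow> continuous_on A (\<lambda>x. cY ax (f x))"
  unfolding cX_def cY_def by (cases ax; auto intro!: continuous_intros)+

lemma continuous_on_pr [continuous_intros]: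
  "continuous_on A f \<Longrightarrow> continuous_on A g \<Longrightarrow> continuous_on A (\<lambda>x. pr ax (f x) (g x))"
  unfolding pr_def by (cases ax) (auto intro!: continuous_intros)

lemma dist_pr_eq: "dist (pr ax a b) (pr ax c b) = dist a c" for a :: complex
  by (simp add: pr_def dist_Pair_Pair)

lemma complete_reinhardtD_pr:
  assumes "complete_reinhardt S" "pr ax a b \<in> S" "cmod u \<le> cmod a" "cmod w \<le> cmod b"
  shows "pr ax u w \<in> S"
  by (rule complete_reinhardtD[OF assms(1,2)]) (use assms in \<open>auto simp: pr_def split: if_splits\<close>)

lemma nn_integral_cX_cY:
  fixes F G :: "complex \<Rightarrow> ennreal"
  assumes F: "F \<in> borel_measurable borel" and G: "G \<in> borel_measurable borel"
  shows "(\<integral>\<^sup>+z. F (cX ax z) * G (cY ax z) \<partial>(lborel :: C2 measure)) = (\<integral>\<^sup>+u. F u \<partial>lborel) * (\<integral>\<^sup>+w. G w \<partial>lborel)"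
proof (cases ax)
  case True then show ?thesis using nn_integral_lborel_prod_mult[OF F G] by (simp add: cX_def cY_def)
next
  case False then show ?thesis using nn_integral_lborel_prod_mult[OF G F] by (simp add: cX_def cY_def mult.commute)
qed

lemma tc_homogeneous:
  assumes "reinhardt S" "continuous_on S g" "pr ax a b \<in> S"
  shows "tc ax k l g (pr ax (ex s * a) (ex t * b)) = ex (of_int k * s) * ex (of_int l * t) * tc ax k l g (pr ax a b)"
proof (cases ax)
  case True
  then show ?thesis using tcoef_homogeneous[OF assms, of k l s t] by (simp add: pr_def tc_def act_def)
next
  case False
  then show ?thesis using tcoef_homogeneous[OF assms, of l k t s] by (simp add: pr_def tc_def act_def mult_ac)
qed

lemma continuous_on_tc: "reinhardt S \<Longrightarrow> continuous_on S g \<Longrightarrow> continuous_on S (tc ax k l g)"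
  unfolding tc_def using continuous_on_tcoef by auto

text \<open>Powers concentrate near the rim of a disc.\<close>

lemma disc_power_concentration:
  fixes r \<eta> :: real
  assumes r: "0 < \<eta>" "\<eta> < r"
  shows "\<exists>N. \<forall>n\<ge>N. (\<integral>\<^sup>+u. ennreal (cmod u ^ n) * indicator (ball 0 r) u \<partial>lborel)
      \<le> 2 * (\<integral>\<^sup>+u. ennreal (cmod u ^ n) * indicator (ball 0 r - cball 0 (r - \<eta>)) u \<partial>lborel)"
proof -
  let ?A = "ball 0 r - cball 0 (r - \<eta>) :: complex set"
  let ?A' = "ball 0 r - cball 0 (r - \<eta>/2) :: complex set"
  let ?C = "cball 0 (r - \<eta>) :: complex set"
  have mp: "(\<lambda>u :: complex. ennreal (cmod u ^ n) * indicator A u) \<in> borel_measurable borel" if "A \<in> sets borel" for A n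
    using that by measurable
  have mc: "(\<lambda>u :: complex. ennreal c * indicator A u) \<in> borel_measurable borel" if "A \<in> sets borel" for A c
    using that by measurable
  have oA': "open ?A'" by (intro open_Diff open_ball closed_cball)
  have "of_real (r - \<eta>/4) \<in> ?A'" using r by (simp del: of_real_diff)
  then have "?A' \<noteq> {}" by blast
  have bA': "bounded ?A'" by (rule bounded_subset[OF bounded_ball[of 0 r]]) auto
  have emA: "emeasure lborel ?A' = ennreal (measure lborel ?A')"
    using emeasure_bounded_finite[OF bA'] by (intro emeasure_eq_ennreal_measure) auto
  have "measure lborel ?A' > 0"
  proof -
    have "\<not> negligible ?A'" using open_not_negligible[OF oA' \<open>?A' \<noteq> {}\<close>] .
    then have "emeasure lborel ?A' \<noteq> 0"
      using oA' by (auto simp: negligible_iff_emeasure0 sets_completionI_sets)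
    then have "measure lborel ?A' \<noteq> 0" using emA by auto
    then show ?thesis by (simp add: zero_less_measure_iff)
  qed
  define V' where "V' = measure lborel ?A'"
  define V where "V = measure lborel ?C"
  have V': "V' > 0" using \<open>measure lborel ?A' > 0\<close> by (simp add: V'_def)
  have V0: "V \<ge> 0" by (simp add: V_def)
  have emC: "emeasure lborel ?C = ennreal V"
    unfolding V_def using emeasure_bounded_finite[of ?C] by (intro emeasure_eq_ennreal_measure) auto
  define x y where "x = r - \<eta>" and "y = r - \<eta>/2"
  have xy: "0 < x" "x < y" using r by (auto simp: x_def y_def)
  have "(\<lambda>n. (x / y) ^ n) \<longlonglongrightarrow> 0" 
  proof (rule LIMSEQ_power_zero)
    have "0 < x / y" "x / y < 1" using xy by simp_all
    then show "norm (x / y) < 1" by (simp only: real_norm_def abs_of_pos)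
  qed
  then have "(\<lambda>n. V * (x / y) ^ n) \<longlonglongrightarrow> V * 0" by (rule tendsto_mult[OF tendsto_const])
  then have "eventually (\<lambda>n. V * (x / y) ^ n < V') sequentially" using V' by (intro order_tendstoD(2)) auto
  then obtain N where N: "\<And>n. n \<ge> N \<Longrightarrow> V * (x / y) ^ n < V'" unfolding eventually_sequentially by blast
  have "(\<integral>\<^sup>+u. ennreal (cmod u ^ n) * indicator (ball 0 r) u \<partial>lborel)
      \<le> 2 * (\<integral>\<^sup>+u. ennreal (cmod u ^ n) * indicator ?A u \<partial>lborel)" if n: "n \<ge> N" for n
  proof -
    let ?I = "\<integral>\<^sup>+u. ennreal (cmod u ^ n) * indicator ?A u \<partial>lborel"
    have "(\<integral>\<^sup>+u. ennreal (cmod u ^ n) * indicator (ball 0 r) u \<partial>lborel)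
        \<le> (\<integral>\<^sup>+u. ennreal (cmod u ^ n) * indicator ?A u + ennreal (x ^ n) * indicator ?C u \<partial>lborel)"
    proof (intro nn_integral_mono)
      fix u :: complex
      have "cmod u ^ n \<le> x ^ n" if "u \<in> ?C" using that by (intro power_mono) (auto simp: x_def)
      then show "ennreal (cmod u ^ n) * indicator (ball 0 r) u \<le> ennreal (cmod u ^ n) * indicator ?A u + ennreal (x ^ n) * indicator ?C u"
        by (auto simp: indicator_def intro!: ennreal_leI)
    qed
    also have "\<dots> = ?I + ennreal (x ^ n) * emeasure lborel ?C"
      by (subst nn_integral_add) (auto intro!: mp mc simp: nn_integral_cmult_indicator)
    also have "ennreal (x ^ n) * emeasure lborel ?C \<le> ?I"
    proof -
      have "V * x ^ n \<le> V' * y ^ n"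
        using N[OF n] xy by (simp add: power_divide field_simps less_imp_le)
      then have "ennreal (x ^ n) * emeasure lborel ?C \<le> ennreal (y ^ n) * emeasure lborel ?A'"
        unfolding emC emA V'_def[symmetric] using xy V0 V'
        by (subst (1 2) ennreal_mult[symmetric]) (auto intro!: ennreal_leI simp: mult.commute)
      also have "\<dots> = (\<integral>\<^sup>+u. ennreal (y ^ n) * indicator ?A' u \<partial>lborel)"
        using oA' by (subst nn_integral_cmult_indicator) auto
      also have "\<dots> \<le> ?I"
      proof (intro nn_integral_mono)
        fix u :: complex
        have "y ^ n \<le> cmod u ^ n \<and> u \<in> ?A" if "u \<in> ?A'" using that xy r by (auto simp: y_def intro!: power_mono)
        then show "ennreal (y ^ n) * indicator ?A' u \<le> ennreal (cmod u ^ n) * indicator ?A u"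
          by (auto simp: indicator_def intro!: ennreal_leI)
      qed
      finally show ?thesis .
    qed
    finally show ?thesis by (simp add: mult_2 add_left_mono)
  qed
  then show ?thesis by blast
qed

context reinhardt_domain
begin

lemma reinhardt_closure_Omega: "reinhardt (closure \<Omega>)"
  by (rule reinhardt_closure[OF reinhardt_Omega])

lemma complete_closure: "complete_reinhardt (closure \<Omega>)"
  by (rule convex_reinhardt_imp_complete[OF convex_closure[OF convex_Omega] reinhardt_closure_Omega])

lemma sym_tcoef: "sym \<phi> \<Longrightarrow> sym (tcoef k l \<phi>)"
  by (rule continuous_on_tcoef[OF reinhardt_closure_Omega])

lemma sym_tc: "sym \<phi> \<Longrightarrow> sym (tc ax k l \<phi>)"
  by (rule continuous_on_tc[OF reinhardt_closure_Omega])

lemma mono_pr: "z \<in> \<Omega> \<Longrightarrow> mono (pr ax a b) z = cX ax z ^ a * cY ax z ^ b"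
  by (simp add: mono_def pr_def cX_def cY_def)

lemma fcoef_mult_homogeneous:
  assumes "\<And>t. g (act (ex (p * t)) (ex (q * t)) z) = ex (of_int a * t) * g z"
  shows "fcoef p q (k + a) (\<lambda>z. \<phi> z * g z) z = fcoef p q k \<phi> z * g z"
proof -
  have e: "ex (of_int a * t) * ex (- of_int (k + a) * t) = ex (- of_int k * t)" for t
    unfolding ex_add[symmetric] by (simp add: algebra_simps)
  have "\<phi> (act (ex (p * t)) (ex (q * t)) z) * g (act (ex (p * t)) (ex (q * t)) z) * ex (- of_int (k + a) * t)
      = \<phi> (act (ex (p * t)) (ex (q * t)) z) * ex (- of_int k * t) * g z" for t
  proof -
    have "\<phi> (act (ex (p * t)) (ex (q * t)) z) * g (act (ex (p * t)) (ex (q * t)) z) * ex (- of_int (k + a) * t)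
      = \<phi> (act (ex (p * t)) (ex (q * t)) z) * (ex (of_int a * t) * ex (- of_int (k + a) * t)) * g z"
      by (simp only: assms mult_ac)
    then show ?thesis by (simp only: e)
  qed
  then show ?thesis unfolding fcoef_def by (simp only: integral_mult_left)
qed

lemma tcoef_mult_homog:
  assumes g: "homog a b g" and z: "z \<in> \<Omega>"
  shows "tcoef (k + a) (l + b) (\<lambda>z. \<phi> z * g z) z = tcoef k l \<phi> z * g z"
proof -
  have h: "g (act (ex s) (ex t) w) = ex (of_int a * s) * ex (of_int b * t) * g w" if "w \<in> \<Omega>" for w s t
    using g that by (simp add: homog_def)
  have h2: "g (act (ex (0 * t)) (ex (1 * t)) w) = ex (of_int b * t) * g w" if "w \<in> \<Omega>" for w t
    using h[OF that, of 0 t] by simp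
  have h1: "g (act (ex (1 * t)) (ex (0 * t)) w) = ex (of_int a * t) * g w" if "w \<in> \<Omega>" for w t
    using h[OF that, of t 0] by simp
  have "tcoef (k + a) (l + b) (\<lambda>z. \<phi> z * g z) z = fcoef 1 0 (k + a) (\<lambda>z. fcoef 0 1 l \<phi> z * g z) z"
    unfolding tcoef_def by (rule fcoef_cong[OF fcoef_mult_homogeneous[OF h2] z])
  also have "\<dots> = tcoef k l \<phi> z * g z"
    unfolding tcoef_def by (rule fcoef_mult_homogeneous[OF h1[OF z]])
  finally show ?thesis .
qed

text \<open>Taking a Fourier coefficient of \<open>H e\<^sub>\<alpha> = \<phi> e\<^sub>\<alpha> - P(\<phi> e\<^sub>\<alpha>)\<close> replaces the symbol by its homogeneous component and the
  projection by a multiple of a monomial.\<close>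

lemma hankel_monomial_component:
  assumes \<phi>: "sym \<phi>"
  obtains c where "nrm (\<lambda>z. tcoef k l \<phi> z * emon (a, b) z -
      (if k + int a \<ge> 0 \<and> l + int b \<ge> 0
       then c * fst z ^ nat (k + int a) * snd z ^ nat (l + int b) else 0)) \<le> nrm (H \<phi> (emon (a, b)))"
proof -
  let ?e = "emon (a, b)" and ?k = "k + int a" and ?l = "l + int b"
  note eL = A2D(2)[OF emon_A2[of "(a, b)"]]
  define p where "p = P (\<lambda>z. \<phi> z * ?e z)"
  have p: "p \<in> A2 \<Omega>" unfolding p_def by (intro P_A2 mult_L2 \<phi> eL)
  obtain c where c: "\<And>z. z \<in> \<Omega> \<Longrightarrow> tcoef ?k ?l p z
      = (if ?k \<ge> 0 \<and> ?l \<ge> 0 then c * fst z ^ nat ?k * snd z ^ nat ?l else 0)"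
    using tcoef_holomorphic2[OF open_Omega complete_Omega nonempty_Omega A2D(1)[OF p], of ?k ?l] by blast
  have Hh: "H \<phi> ?e = (\<lambda>z. \<phi> z * ?e z + (-1) * p z)" by (simp add: hankel_def p_def)
  have pc: "continuous_on \<Omega> (\<lambda>z. \<phi> z * ?e z)"
    by (intro continuous_on_mult sym_continuous[OF \<phi>] A2D(4)[OF emon_A2])
  have T: "tcoef ?k ?l (H \<phi> ?e) z = tcoef k l \<phi> z * ?e z -
      (if ?k \<ge> 0 \<and> ?l \<ge> 0 then c * fst z ^ nat ?k * snd z ^ nat ?l else 0)" if z: "z \<in> \<Omega>" for z
    unfolding Hh tcoef_linear[OF pc A2D(4)[OF p] z] tcoef_mult_homog[OF emon_homog[of "(a, b)", unfolded fst_conv snd_conv] z] c[OF z] by simp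
  have "nrm (\<lambda>z. tcoef k l \<phi> z * ?e z -
      (if ?k \<ge> 0 \<and> ?l \<ge> 0 then c * fst z ^ nat ?k * snd z ^ nat ?l else 0)) = nrm (tcoef ?k ?l (H \<phi> ?e))"
    by (intro l2_norm_cong) (simp add: T)
  also have "\<dots> \<le> nrm (H \<phi> ?e)"
    by (rule tcoef_contraction(2)[OF open_Omega reinhardt_Omega hankel_continuous[OF \<phi> emon_A2] hankel_L2[OF \<phi> eL]])
  finally show ?thesis by (rule that)
qed

lemma hankel_monomial_component_axis:
  assumes \<phi>: "sym \<phi>" and n: "int n + k \<ge> 0"
  obtains c where "nrm (\<lambda>z. tc ax k l \<phi> z * emon (pr ax n 0) z -
      (if l \<ge> 0 then c * cX ax z ^ nat (int n + k) * cY ax z ^ nat l else 0)) \<le> nrm (H \<phi> (emon (pr ax n 0)))"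
proof (cases ax)
  case True
  obtain c where c: "nrm (\<lambda>z. tcoef k l \<phi> z * emon (n, 0) z -
      (if k + int n \<ge> 0 \<and> l \<ge> 0 then c * fst z ^ nat (k + int n) * snd z ^ nat l else 0)) \<le> nrm (H \<phi> (emon (n, 0)))"
    by (rule hankel_monomial_component[OF \<phi>, of k l n 0]) (rule that, unfold of_nat_0 add_0_right, assumption)
  show ?thesis
    by (rule that[of c]) (use c True n in \<open>cases "l \<ge> 0"; simp add: tc_def pr_def cX_def cY_def add.commute\<close>)
next
  case False
  obtain c where c: "nrm (\<lambda>z. tcoef l k \<phi> z * emon (0, n) z -
      (if l \<ge> 0 \<and> k + int n \<ge> 0 then c * fst z ^ nat l * snd z ^ nat (k + int n) else 0)) \<le> nrm (H \<phi> (emon (0, n)))"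
    by (rule hankel_monomial_component[OF \<phi>, of l k 0 n]) (rule that, unfold of_nat_0 add_0_right, assumption)
  show ?thesis
    by (rule that[of c]) (use c False n in \<open>cases "l \<ge> 0"; simp add: tc_def pr_def cX_def cY_def add.commute mult_ac\<close>)
qed

lemma open_box_in_Omega:
  assumes b: "pr ax (of_real r) (of_real s) \<in> closure \<Omega>" and "cmod u < r" "cmod w < s"
  shows "pr ax u w \<in> \<Omega>"
proof -
  let ?U = "{z. cmod (cX ax z) < r \<and> cmod (cY ax z) < s}"
  have "open ?U" by (intro open_Collect_conj open_Collect_less continuous_intros)
  moreover have "?U \<subseteq> closure \<Omega>"
  proof
    fix z assume "z \<in> ?U"
    then have "pr ax (cX ax z) (cY ax z) \<in> closure \<Omega>"
      by (intro complete_reinhardtD_pr[OF complete_closure b]) auto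
    then show "z \<in> closure \<Omega>" by simp
  qed
  ultimately have "?U \<subseteq> interior (closure \<Omega>)" by (rule interior_maximal[rotated])
  also have "\<dots> = \<Omega>" using convex_interior_closure[OF convex_Omega] open_Omega by (simp add: interior_open)
  finally show ?thesis using assms(2,3) by auto
qed

text \<open>The domain contains the product of the disc \<open>|X| < r\<close> with a disc, and is contained in such a product, so
  the normalised powers of \<open>X\<close> keep a fixed proportion of their mass on any annulus in \<open>Y\<close>.\<close>

lemma axis_mass_lower_bound:
  assumes r: "\<And>z. z \<in> \<Omega> \<Longrightarrow> cmod (cX ax z) < r" and b: "pr ax (of_real r) (of_real s) \<in> closure \<Omega>"
    and t: "0 < t" "t < s" and \<eta>: "0 < \<eta>" "\<eta> < r"
  shows "\<exists>\<kappa>>0. \<exists>N. \<forall>n\<ge>N. \<forall>D. D \<in> L2 \<Omega> \<longrightarrow>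
    (\<forall>z\<in>\<Omega>. r - \<eta> < cmod (cX ax z) \<and> \<bar>cmod (cY ax z) - t\<bar> < \<eta> \<longrightarrow> \<eta> * cmod (emon (pr ax n 0) z) \<le> cmod (D z)) \<longrightarrow>
    \<kappa> \<le> (nrm D)\<^sup>2"
proof -
  obtain R where R: "R > 0" "\<And>z. z \<in> \<Omega> \<Longrightarrow> cmod (cY ax z) < R"
  proof -
    obtain R where "\<And>z. z \<in> \<Omega> \<Longrightarrow> norm z \<le> R" using bounded_Omega unfolding bounded_iff by blast
    then have "cmod (cY ax z) < \<bar>R\<bar> + 1" if "z \<in> \<Omega>" for z
      using that norm_fst_le[of "fst z" "snd z"] norm_snd_le[of "snd z" "fst z"] by (fastforce simp: cY_def)
    then show ?thesis using that[of "\<bar>R\<bar> + 1"] by simp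
  qed
  let ?B = "{w :: complex. \<bar>cmod w - t\<bar> < \<eta> \<and> cmod w < s}"
  have oB: "open ?B" by (intro open_Collect_conj open_Collect_less continuous_intros)
  have "of_real t \<in> ?B" using t \<eta> by simp
  then have neB: "?B \<noteq> {}" by blast
  have bB: "bounded ?B" by (rule bounded_subset[OF bounded_ball[of 0 s]]) auto
  define VB where "VB = measure lborel ?B"
  define VR where "VR = measure lborel (ball 0 R :: complex set)"
  have emB: "emeasure lborel ?B = ennreal VB"
    unfolding VB_def using emeasure_bounded_finite[OF bB] by (intro emeasure_eq_ennreal_measure) auto
  have emR: "emeasure lborel (ball 0 R :: complex set) = ennreal VR"
    unfolding VR_def using emeasure_bounded_finite[of "ball 0 R :: complex set"] by (intro emeasure_eq_ennreal_measure) auto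
  have pos: "measure lborel U > 0" if "open U" "U \<noteq> {}" "emeasure lborel U = ennreal (measure lborel U)" for U :: "complex set"
  proof -
    have "\<not> negligible U" using open_not_negligible[OF that(1,2)] .
    then have "emeasure lborel U \<noteq> 0"
      using that(1) by (auto simp: negligible_iff_emeasure0 sets_completionI_sets)
    then have "measure lborel U \<noteq> 0" using that(3) by auto
    then show ?thesis by (simp add: zero_less_measure_iff)
  qed
  have VB: "VB > 0" unfolding VB_def by (rule pos[OF oB neB]) (use emB in \<open>simp add: VB_def\<close>)
  have VR: "VR > 0" unfolding VR_def by (rule pos) (use R(1) emR in \<open>auto simp: VR_def\<close>)
  obtain N where N: "\<And>n. n \<ge> N \<Longrightarrow> (\<integral>\<^sup>+u. ennreal (cmod u ^ n) * indicator (ball 0 r) u \<partial>lborel)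
      \<le> 2 * (\<integral>\<^sup>+u. ennreal (cmod u ^ n) * indicator (ball 0 r - cball 0 (r - \<eta>)) u \<partial>lborel)"
    using disc_power_concentration[OF \<eta>] by blast
  \<comment> \<open>At least half of the mass in \<open>X\<close> lies on the rim, and the annulus in \<open>Y\<close> has the share \<open>VB / VR\<close> of a disc that
    contains all values of \<open>Y\<close>.\<close>
  define \<kappa> where "\<kappa> = \<eta>\<^sup>2 * VB / (2 * VR)"
  have \<kappa>: "\<kappa> > 0" using \<eta> VB VR by (simp add: \<kappa>_def)
  have "\<kappa> \<le> (nrm D)\<^sup>2" if n: "n \<ge> N" and D: "D \<in> L2 \<Omega>"
    and big: "\<And>z. z \<in> \<Omega> \<Longrightarrow> r - \<eta> < cmod (cX ax z) \<Longrightarrow> \<bar>cmod (cY ax z) - t\<bar> < \<eta> \<Longrightarrow>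
       \<eta> * cmod (emon (pr ax n 0) z) \<le> cmod (D z)" for n D
  proof -
    let ?A = "ball 0 r - cball 0 (r - \<eta>) :: complex set"
    let ?m = "nrm (mono (pr ax n 0))"
    have m0: "?m > 0" by (rule mono_norm_pos)
    let ?I = "\<integral>\<^sup>+u. ennreal (cmod u ^ (2*n)) * indicator (ball 0 r) u \<partial>(lborel :: complex measure)"
    let ?J = "\<integral>\<^sup>+u. ennreal (cmod u ^ (2*n)) * indicator ?A u \<partial>(lborel :: complex measure)"
    have mp: "(\<lambda>u :: complex. ennreal (cmod u ^ k) * indicator A u) \<in> borel_measurable borel" if "A \<in> sets borel" for A k
      using that by measurable
    have mi: "(indicator A :: complex \<Rightarrow> ennreal) \<in> borel_measurable borel" if "A \<in> sets borel" for A
      using that by simp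
    have msq: "(cmod (mono (pr ax n 0) z))\<^sup>2 = cmod (cX ax z) ^ (2*n)" if "z \<in> \<Omega>" for z
      using that by (simp add: mono_pr norm_power power_mult[symmetric] mult.commute)
    have "ennreal (?m\<^sup>2) = (\<integral>\<^sup>+z. ennreal ((cmod (mono (pr ax n 0) z))\<^sup>2) * indicator \<Omega> z \<partial>lborel)"
      by (rule L2_nn_integral[OF open_Omega A2D(2)[OF mono_A2], symmetric])
    also have "\<dots> \<le> (\<integral>\<^sup>+z. (ennreal (cmod (cX ax z) ^ (2*n)) * indicator (ball 0 r) (cX ax z)) * indicator (ball 0 R) (cY ax z) \<partial>lborel)"
      by (intro nn_integral_mono) (use r R(2) in \<open>auto simp: indicator_def msq\<close>)
    also have "\<dots> = ?I * emeasure lborel (ball 0 R :: complex set)"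
      by (subst nn_integral_cX_cY) (auto intro!: mp mi)
    also have "?I \<le> 2 * ?J" using N[of "2*n"] n by simp
    finally have up: "ennreal (?m\<^sup>2) \<le> 2 * ?J * ennreal VR" unfolding emR by (simp add: mult_right_mono)
    have "ennreal (\<eta>\<^sup>2 / ?m\<^sup>2) * (?J * ennreal VB)
        = ennreal (\<eta>\<^sup>2 / ?m\<^sup>2) * (\<integral>\<^sup>+z. (ennreal (cmod (cX ax z) ^ (2*n)) * indicator ?A (cX ax z)) * indicator ?B (cY ax z) \<partial>lborel)"
      unfolding emB[symmetric] using oB by (subst nn_integral_cX_cY) (auto intro!: mp mi)
    also have "\<dots> = (\<integral>\<^sup>+z. ennreal (\<eta>\<^sup>2 / ?m\<^sup>2) * ((ennreal (cmod (cX ax z) ^ (2*n)) * indicator ?A (cX ax z)) * indicator ?B (cY ax z)) \<partial>lborel)"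
    proof (rule nn_integral_cmult[symmetric])
      have cm: "cX ax \<in> borel_measurable borel" "cY ax \<in> borel_measurable borel"
        by (intro borel_measurable_continuous_onI continuous_intros)+
      have "(\<lambda>z. ennreal (cmod (cX ax z) ^ (2*n)) * indicator ?A (cX ax z)) \<in> borel_measurable borel"
        by (rule measurable_compose[OF cm(1) mp]) simp
      moreover have "(\<lambda>z. indicator ?B (cY ax z) :: ennreal) \<in> borel_measurable borel"
        by (rule measurable_compose[OF cm(2) mi]) (use oB in simp)
      ultimately show "(\<lambda>z. (ennreal (cmod (cX ax z) ^ (2*n)) * indicator ?A (cX ax z)) * indicator ?B (cY ax z)) \<in> borel_measurable lborel"
        by simp
    qed
    also have "\<dots> \<le> (\<integral>\<^sup>+z. ennreal ((cmod (D z))\<^sup>2) * indicator \<Omega> z \<partial>lborel)"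
    proof (intro nn_integral_mono)
      fix z
      show "ennreal (\<eta>\<^sup>2 / ?m\<^sup>2) * ((ennreal (cmod (cX ax z) ^ (2*n)) * indicator ?A (cX ax z)) * indicator ?B (cY ax z))
          \<le> ennreal ((cmod (D z))\<^sup>2) * indicator \<Omega> z"
      proof (cases "cX ax z \<in> ?A \<and> cY ax z \<in> ?B")
        case True
        then have z: "z \<in> \<Omega>" using open_box_in_Omega[OF b, of "cX ax z" "cY ax z"] by simp
        have "\<eta>\<^sup>2 / ?m\<^sup>2 * cmod (cX ax z) ^ (2*n) = (\<eta> * cmod (emon (pr ax n 0) z))\<^sup>2"
          unfolding msq[OF z, symmetric] emon_def using m0 by (simp add: norm_divide power_mult_distrib power_divide)
        also have "\<dots> \<le> (cmod (D z))\<^sup>2"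
          using True by (intro power_mono big z) (use \<eta> in auto)
        finally show ?thesis using True z m0
          by (simp add: ennreal_mult[symmetric] ennreal_leI)
      qed auto
    qed
    also have "\<dots> = ennreal ((nrm D)\<^sup>2)" by (rule L2_nn_integral[OF open_Omega D])
    finally have low: "ennreal (\<eta>\<^sup>2 / ?m\<^sup>2) * (?J * ennreal VB) \<le> ennreal ((nrm D)\<^sup>2)" .
    have Jfin: "?J < \<infinity>"
    proof -
      have "?J * ennreal VB < \<infinity>"
      proof (rule ccontr)
        assume "\<not> ?J * ennreal VB < \<infinity>"
        then have "?J * ennreal VB = \<infinity>" by (simp add: top.not_eq_extremum[symmetric])
        then have "ennreal (\<eta>\<^sup>2 / ?m\<^sup>2) * (?J * ennreal VB) = \<infinity>"
          using \<eta> m0 by (simp add: ennreal_mult_eq_top_iff)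
        then show False using low by (simp add: top_unique)
      qed
      then show ?thesis using VB by (auto simp: ennreal_mult_less_top)
    qed
    then have "\<exists>j\<ge>0. ?J = ennreal j" by (cases "?J" rule: ennreal_cases) auto
    then obtain j where j: "j \<ge> 0" "?J = ennreal j" by blast
    have mle: "?m\<^sup>2 \<le> 2 * j * VR"
    proof -
      have "ennreal (?m\<^sup>2) \<le> ennreal (2 * j * VR)"
        using up unfolding j(2) using j(1) VR by (simp add: ennreal_mult mult.assoc)
      then show ?thesis using j(1) VR by (simp add: ennreal_le_iff)
    qed
    moreover have "\<eta>\<^sup>2 / ?m\<^sup>2 * (j * VB) \<le> (nrm D)\<^sup>2"
    proof -
      have "ennreal (\<eta>\<^sup>2 / ?m\<^sup>2 * (j * VB)) \<le> ennreal ((nrm D)\<^sup>2)"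
      proof -
        have "ennreal (\<eta>\<^sup>2 / ?m\<^sup>2 * (j * VB)) = ennreal (\<eta>\<^sup>2 / ?m\<^sup>2) * ennreal (j * VB)"
          by (rule ennreal_mult) (use j(1) VB in simp_all)
        also have "ennreal (j * VB) = ennreal j * ennreal VB"
          by (rule ennreal_mult) (use j(1) VB in simp_all)
        finally show ?thesis using low unfolding j(2) by (simp only:)
      qed
      then show ?thesis by (simp only: ennreal_le_iff[OF zero_le_power2])
    qed
    moreover have "\<kappa> \<le> \<eta>\<^sup>2 / ?m\<^sup>2 * (j * VB)"
    proof -
      have "\<kappa> * (2 * VR * ?m\<^sup>2) = \<eta>\<^sup>2 * VB * ?m\<^sup>2" using VR by (simp add: \<kappa>_def)
      also have "\<dots> \<le> \<eta>\<^sup>2 * VB * (2 * j * VR)" using mle VB by (intro mult_left_mono) auto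
      finally have "\<kappa> * (2 * VR * ?m\<^sup>2) \<le> (\<eta>\<^sup>2 * (j * VB)) * (2 * VR)" by (simp add: mult_ac)
      then have "\<kappa> * ?m\<^sup>2 \<le> \<eta>\<^sup>2 * (j * VB)" using VR by (simp add: mult_ac)
      then show ?thesis using m0 by (simp add: field_simps)
    qed
    ultimately show ?thesis by linarith
  qed
  then show ?thesis using \<kappa> by (intro exI[of _ \<kappa>] conjI exI[of _ N]) auto
qed

end

section \<open>From the boundary limit to holomorphy on boundary discs\<close>

lemma ex_power_int: "ex a powi k = ex (of_int k * a)"
proof (cases "k \<ge> 0")
  case True
  then show ?thesis by (simp add: power_int_def ex_power)
next
  case False
  then have "ex a powi k = inverse (ex a ^ nat (- k))" by (simp add: power_int_def power_inverse)
  also have "ex a ^ nat (- k) = ex (- (of_int k * a))" using False by (simp add: ex_power)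
  also have "inverse \<dots> = ex (of_int k * a)"
    using ex_add[of "of_int k * a" "- (of_int k * a)"] by (simp add: field_simps)
  finally show ?thesis .
qed

lemma polar_ex: obtains a where "u = ex a * of_real (cmod u)"
proof (cases "u = 0")
  case True
  then show ?thesis using that[of 0] by simp
next
  case False
  then have "cmod (u / of_real (cmod u)) = 1" by (simp add: norm_divide)
  then obtain a where "u / of_real (cmod u) = ex a" by (rule unimodular_ex)
  then show ?thesis using that[of a] False by (simp add: field_simps)
qed

context reinhardt_domain
begin

text \<open>The product of the component with a high normalised power of \<open>X\<close> is close in norm to a monomial, and that power
  has mass over every annulus in \<open>Y\<close>.  So one monomial is close to the component at points near the rim over each of two
  given radii.\<close>

lemma component_near_monomial:
  assumes \<phi>: "sym \<phi>"
    and small: "\<And>\<delta> N. \<delta> > 0 \<Longrightarrow> \<exists>n\<ge>N. nrm (H \<phi> (emon (pr ax n 0))) < \<delta>"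
    and r: "\<And>z. z \<in> \<Omega> \<Longrightarrow> cmod (cX ax z) < r" and b: "pr ax (of_real r) (of_real s) \<in> closure \<Omega>"
    and t1: "0 < t1" "t1 < s" and t2: "0 < t2" "t2 < s" and \<eta>: "0 < \<eta>" "\<eta> < r"
  shows "\<exists>C. \<forall>t\<in>{t1, t2}. \<exists>x y. r - \<eta> < x \<and> x < r \<and> \<bar>y - t\<bar> < \<eta> \<and> pr ax (of_real x) (of_real y) \<in> \<Omega> \<and>
     cmod (tc ax k l \<phi> (pr ax (of_real x) (of_real y)) -
       (if l \<ge> 0 then C * of_real x powi k * of_real y ^ nat l else 0)) < \<eta>"
proof -
  let ?\<psi> = "tc ax k l \<phi>"
  obtain \<kappa>1 N1 where k1: "\<kappa>1 > 0" and N1: "\<And>n D. n \<ge> N1 \<Longrightarrow> D \<in> L2 \<Omega> \<Longrightarrow>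
    (\<forall>z\<in>\<Omega>. r - \<eta> < cmod (cX ax z) \<and> \<bar>cmod (cY ax z) - t1\<bar> < \<eta> \<longrightarrow> \<eta> * cmod (emon (pr ax n 0) z) \<le> cmod (D z)) \<Longrightarrow>
    \<kappa>1 \<le> (nrm D)\<^sup>2"
    using axis_mass_lower_bound[OF r b t1 \<eta>] by blast
  obtain \<kappa>2 N2 where k2: "\<kappa>2 > 0" and N2: "\<And>n D. n \<ge> N2 \<Longrightarrow> D \<in> L2 \<Omega> \<Longrightarrow>
    (\<forall>z\<in>\<Omega>. r - \<eta> < cmod (cX ax z) \<and> \<bar>cmod (cY ax z) - t2\<bar> < \<eta> \<longrightarrow> \<eta> * cmod (emon (pr ax n 0) z) \<le> cmod (D z)) \<Longrightarrow>
    \<kappa>2 \<le> (nrm D)\<^sup>2"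
    using axis_mass_lower_bound[OF r b t2 \<eta>] by blast
  define \<delta> where "\<delta> = sqrt (min \<kappa>1 \<kappa>2)"
  have \<delta>: "\<delta> > 0" "\<delta>\<^sup>2 \<le> \<kappa>1" "\<delta>\<^sup>2 \<le> \<kappa>2" using k1 k2 by (auto simp: \<delta>_def)
  obtain n where n: "n \<ge> N1 + N2 + nat \<bar>k\<bar>" and Hn: "nrm (H \<phi> (emon (pr ax n 0))) < \<delta>"
    using small[OF \<delta>(1)] by blast
  have nk: "int n + k \<ge> 0" using n by linarith
  obtain c where c: "nrm (\<lambda>z. ?\<psi> z * emon (pr ax n 0) z -
      (if l \<ge> 0 then c * cX ax z ^ nat (int n + k) * cY ax z ^ nat l else 0)) \<le> nrm (H \<phi> (emon (pr ax n 0)))"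
    by (rule hankel_monomial_component_axis[OF \<phi> nk]) (rule that)
  define D where "D = (\<lambda>z. ?\<psi> z * emon (pr ax n 0) z -
      (if l \<ge> 0 then c * cX ax z ^ nat (int n + k) * cY ax z ^ nat l else 0))"
  have DL: "D \<in> L2 \<Omega>"
  proof -
    have "(\<lambda>z. if l \<ge> 0 then c * cX ax z ^ nat (int n + k) * cY ax z ^ nat l else 0) \<in> L2 \<Omega> \<longleftrightarrow>
        (\<lambda>z. (if l \<ge> 0 then c else 0) * mono (pr ax (nat (int n + k)) (nat l)) z) \<in> L2 \<Omega>"
      by (rule L2_cong) (simp add: mono_pr)
    then show ?thesis
      unfolding D_def using L2_scale[OF A2D(2)[OF mono_A2]]
      by (intro L2_diff mult_L2 sym_tc \<phi> A2D(2)[OF emon_A2]) blast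
  qed
  have "nrm D < \<delta>" using c Hn unfolding D_def by linarith
  then have Dn: "(nrm D)\<^sup>2 < \<delta>\<^sup>2" by (intro power_strict_mono) auto
  define m where "m = complex_of_real (nrm (mono (pr ax n 0)))"
  have m0: "nrm (mono (pr ax n 0)) > 0" by (rule mono_norm_pos)
  have key: "\<exists>x y. r - \<eta> < x \<and> x < r \<and> \<bar>y - t\<bar> < \<eta> \<and> pr ax (of_real x) (of_real y) \<in> \<Omega> \<and>
     cmod (?\<psi> (pr ax (of_real x) (of_real y)) - (if l \<ge> 0 then c * m * of_real x powi k * of_real y ^ nat l else 0)) < \<eta>"
    if ex: "\<not> (\<forall>z\<in>\<Omega>. r - \<eta> < cmod (cX ax z) \<and> \<bar>cmod (cY ax z) - t\<bar> < \<eta> \<longrightarrow> \<eta> * cmod (emon (pr ax n 0) z) \<le> cmod (D z))" for t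
  proof -
    obtain z where z: "z \<in> \<Omega>" "r - \<eta> < cmod (cX ax z)" "\<bar>cmod (cY ax z) - t\<bar> < \<eta>"
      and Dz: "cmod (D z) < \<eta> * cmod (emon (pr ax n 0) z)" using ex by force
    let ?X = "cX ax z" and ?Y = "cY ax z"
    have X0: "?X \<noteq> 0" using z(2) \<eta> by auto
    have ez: "emon (pr ax n 0) z = ?X ^ n / m" using z(1) by (simp add: emon_def m_def mono_pr)
    have pk: "?X ^ nat (int n + k) = ?X ^ n * ?X powi k"
    proof -
      have "?X ^ nat (int n + k) = ?X powi (int n + k)" using nk by (simp add: power_int_def)
      also have "\<dots> = ?X ^ n * ?X powi k" using X0 by (simp add: power_int_add)
      finally show ?thesis .
    qed
    have m00: "m \<noteq> 0" using m0 by (simp add: m_def)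
    have "D z = (?X ^ n / m) * (?\<psi> z - (if l \<ge> 0 then c * m * ?X powi k * ?Y ^ nat l else 0))"
      unfolding D_def ez pk using m00 by (simp add: field_simps)
    then have "cmod (?X ^ n / m) * cmod (?\<psi> z - (if l \<ge> 0 then c * m * ?X powi k * ?Y ^ nat l else 0)) < cmod (?X ^ n / m) * \<eta>"
      using Dz unfolding ez by (simp only: norm_mult mult.commute)
    then have main: "cmod (?\<psi> z - (if l \<ge> 0 then c * m * ?X powi k * ?Y ^ nat l else 0)) < \<eta>"
      by (rule mult_left_less_imp_less) simp
    define x y where "x = cmod ?X" and "y = cmod ?Y"
    obtain \<alpha> where \<alpha>: "?X = ex \<alpha> * of_real x" unfolding x_def by (rule polar_ex)
    obtain \<beta> where \<beta>: "?Y = ex \<beta> * of_real y" unfolding y_def by (rule polar_ex)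
    have pz: "z = pr ax (ex \<alpha> * of_real x) (ex \<beta> * of_real y)" unfolding \<alpha>[symmetric] \<beta>[symmetric] by simp
    have in\<Omega>: "pr ax (of_real x) (of_real y) \<in> \<Omega>"
      by (rule complete_reinhardtD_pr[OF complete_Omega, of ax ?X ?Y]) (use z(1) in \<open>auto simp: x_def y_def\<close>)
    have "?\<psi> z = ex (of_int k * \<alpha>) * ex (of_int l * \<beta>) * ?\<psi> (pr ax (of_real x) (of_real y))"
      unfolding pz by (rule tc_homogeneous[OF reinhardt_Omega sym_continuous[OF \<phi>] in\<Omega>])
    moreover have "(if l \<ge> 0 then c * m * ?X powi k * ?Y ^ nat l else 0) =
        ex (of_int k * \<alpha>) * ex (of_int l * \<beta>) * (if l \<ge> 0 then c * m * of_real x powi k * of_real y ^ nat l else 0)"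
      unfolding \<alpha> \<beta> by (simp add: power_int_mult_distrib power_mult_distrib ex_power_int ex_power)
    ultimately have "?\<psi> z - (if l \<ge> 0 then c * m * ?X powi k * ?Y ^ nat l else 0) = ex (of_int k * \<alpha>) * ex (of_int l * \<beta>) *
        (?\<psi> (pr ax (of_real x) (of_real y)) - (if l \<ge> 0 then c * m * of_real x powi k * of_real y ^ nat l else 0))"
      by (simp only: right_diff_distrib)
    then have "cmod (?\<psi> (pr ax (of_real x) (of_real y)) - (if l \<ge> 0 then c * m * of_real x powi k * of_real y ^ nat l else 0)) < \<eta>"
      using main by (simp only: norm_mult norm_ex mult_1)
    then show ?thesis using z in\<Omega> r[OF z(1)] unfolding x_def y_def by blast
  qed
  have "\<not> (\<forall>z\<in>\<Omega>. r - \<eta> < cmod (cX ax z) \<and> \<bar>cmod (cY ax z) - t1\<bar> < \<eta> \<longrightarrow> \<eta> * cmod (emon (pr ax n 0) z) \<le> cmod (D z))"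
  proof
    assume "\<forall>z\<in>\<Omega>. r - \<eta> < cmod (cX ax z) \<and> \<bar>cmod (cY ax z) - t1\<bar> < \<eta> \<longrightarrow> \<eta> * cmod (emon (pr ax n 0) z) \<le> cmod (D z)"
    then have "\<kappa>1 \<le> (nrm D)\<^sup>2" by (intro N1[OF _ DL]) (use n in auto)
    then show False using Dn \<delta>(2) by linarith
  qed
  note e1 = key[OF this]
  have "\<not> (\<forall>z\<in>\<Omega>. r - \<eta> < cmod (cX ax z) \<and> \<bar>cmod (cY ax z) - t2\<bar> < \<eta> \<longrightarrow> \<eta> * cmod (emon (pr ax n 0) z) \<le> cmod (D z))"
  proof
    assume "\<forall>z\<in>\<Omega>. r - \<eta> < cmod (cX ax z) \<and> \<bar>cmod (cY ax z) - t2\<bar> < \<eta> \<longrightarrow> \<eta> * cmod (emon (pr ax n 0) z) \<le> cmod (D z)"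
    then have "\<kappa>2 \<le> (nrm D)\<^sup>2" by (intro N2[OF _ DL]) (use n in auto)
    then show False using Dn \<delta>(3) by linarith
  qed
  note e2 = key[OF this]
  show ?thesis
  proof (intro exI[of _ "c * m"] ballI)
    fix t assume "t \<in> {t1, t2}"
    then show "\<exists>x y. r - \<eta> < x \<and> x < r \<and> \<bar>y - t\<bar> < \<eta> \<and> pr ax (of_real x) (of_real y) \<in> \<Omega> \<and>
     cmod (?\<psi> (pr ax (of_real x) (of_real y)) - (if l \<ge> 0 then c * m * of_real x powi k * of_real y ^ nat l else 0)) < \<eta>"
      using e1 e2 by (elim insertE emptyE) (simp_all only:)
  qed
qed

text \<open>Shrinking the rim, the unknown constants of the approximating monomials cancel from the comparison of
  two radii \<open>t\<^sub>1\<close> and \<open>t\<^sub>2\<close>, and the comparison survives in the limit at the boundary.\<close>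

lemma component_ratio:
  assumes \<phi>: "sym \<phi>"
    and small: "\<And>\<delta> N. \<delta> > 0 \<Longrightarrow> \<exists>n\<ge>N. nrm (H \<phi> (emon (pr ax n 0))) < \<delta>"
    and r: "r > 0" "\<And>z. z \<in> \<Omega> \<Longrightarrow> cmod (cX ax z) < r" and b: "pr ax (of_real r) (of_real s) \<in> closure \<Omega>"
    and t1: "0 < t1" "t1 < s" and t2: "0 < t2" "t2 < s"
  shows "if l \<ge> 0 then tc ax k l \<phi> (pr ax (of_real r) (of_real t1)) * of_real t2 ^ nat l
      = tc ax k l \<phi> (pr ax (of_real r) (of_real t2)) * of_real t1 ^ nat l
    else tc ax k l \<phi> (pr ax (of_real r) (of_real t1)) = 0"
proof -
  let ?\<psi> = "tc ax k l \<phi>"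
  define \<eta> where "\<eta> = (\<lambda>j. r / (real j + 2))"
  have \<eta>: "0 < \<eta> j" "\<eta> j < r" for j
    using r(1) by (auto simp: \<eta>_def divide_less_eq algebra_simps intro!: add_pos_nonneg mult_nonneg_nonneg)
  have \<eta>0: "\<eta> \<longlonglongrightarrow> 0"
    unfolding \<eta>_def using LIMSEQ_ignore_initial_segment[OF lim_const_over_n[of r], of 2] by (simp add: add.commute)
  have "\<forall>j. \<exists>C. \<forall>t\<in>{t1, t2}. \<exists>x y. r - \<eta> j < x \<and> x < r \<and> \<bar>y - t\<bar> < \<eta> j \<and> pr ax (of_real x) (of_real y) \<in> \<Omega> \<and>
     cmod (?\<psi> (pr ax (of_real x) (of_real y)) - (if l \<ge> 0 then C * of_real x powi k * of_real y ^ nat l else 0)) < \<eta> j"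
    using component_near_monomial[OF \<phi> small r(2) b t1 t2 \<eta>] by blast
  then obtain C where C: "\<And>j t. t \<in> {t1, t2} \<Longrightarrow> \<exists>x y. r - \<eta> j < x \<and> x < r \<and> \<bar>y - t\<bar> < \<eta> j \<and> pr ax (of_real x) (of_real y) \<in> \<Omega> \<and>
     cmod (?\<psi> (pr ax (of_real x) (of_real y)) - (if l \<ge> 0 then C j * of_real x powi k * of_real y ^ nat l else 0)) < \<eta> j"
    by metis
  have lims: "\<exists>x y. (\<lambda>j. complex_of_real (x j)) \<longlonglongrightarrow> of_real r \<and> (\<lambda>j. complex_of_real (y j)) \<longlonglongrightarrow> of_real t \<and>
      (\<lambda>j. if l \<ge> 0 then C j * of_real (x j) powi k * of_real (y j) ^ nat l else 0) \<longlonglongrightarrow> ?\<psi> (pr ax (of_real r) (of_real t))"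
    if t: "t \<in> {t1, t2}" for t
  proof -
    have "\<forall>j. \<exists>x y. r - \<eta> j < x \<and> x < r \<and> \<bar>y - t\<bar> < \<eta> j \<and> pr ax (of_real x) (of_real y) \<in> \<Omega> \<and>
     cmod (?\<psi> (pr ax (of_real x) (of_real y)) - (if l \<ge> 0 then C j * of_real x powi k * of_real y ^ nat l else 0)) < \<eta> j"
      using C[OF t] by blast
    then obtain x y where xy: "\<And>j. r - \<eta> j < x j" "\<And>j. x j < r" "\<And>j. \<bar>y j - t\<bar> < \<eta> j"
      "\<And>j. pr ax (of_real (x j)) (of_real (y j)) \<in> \<Omega>"
      "\<And>j. cmod (?\<psi> (pr ax (of_real (x j)) (of_real (y j))) - (if l \<ge> 0 then C j * of_real (x j) powi k * of_real (y j) ^ nat l else 0)) < \<eta> j"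
      by metis
    have "(\<lambda>j. x j - r) \<longlonglongrightarrow> 0"
      by (rule Lim_null_comparison[OF _ \<eta>0]) (use xy(1,2) in \<open>auto intro!: always_eventually simp: abs_if less_imp_le algebra_simps\<close>)
    then have xl: "x \<longlonglongrightarrow> r" by (simp add: Lim_null[of x])
    have "(\<lambda>j. y j - t) \<longlonglongrightarrow> 0"
      by (rule Lim_null_comparison[OF _ \<eta>0]) (use xy(3) in \<open>auto intro!: always_eventually simp: less_imp_le\<close>)
    then have yl: "y \<longlonglongrightarrow> t" by (simp add: Lim_null[of y])
    have xl': "(\<lambda>j. complex_of_real (x j)) \<longlonglongrightarrow> of_real r" by (rule tendsto_of_real[OF xl])
    have yl': "(\<lambda>j. complex_of_real (y j)) \<longlonglongrightarrow> of_real t" by (rule tendsto_of_real[OF yl])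
    have rt: "pr ax (of_real r) (of_real t) \<in> closure \<Omega>"
      by (rule complete_reinhardtD_pr[OF complete_closure b]) (use t t1 t2 in auto)
    have "(\<lambda>j. pr ax (complex_of_real (x j)) (complex_of_real (y j))) \<longlonglongrightarrow> pr ax (of_real r) (of_real t)"
      using tendsto_Pair[OF xl' yl'] tendsto_Pair[OF yl' xl'] by (cases ax) (auto simp: pr_def)
    then have p: "(\<lambda>j. ?\<psi> (pr ax (of_real (x j)) (of_real (y j)))) \<longlonglongrightarrow> ?\<psi> (pr ax (of_real r) (of_real t))"
      by (rule continuous_on_tendsto_compose[OF sym_tc[OF \<phi>] _ rt]) (intro always_eventually allI in_closure xy(4))
    have d: "(\<lambda>j. ?\<psi> (pr ax (of_real (x j)) (of_real (y j))) - (if l \<ge> 0 then C j * of_real (x j) powi k * of_real (y j) ^ nat l else 0)) \<longlonglongrightarrow> 0"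
      by (rule Lim_null_comparison[OF always_eventually \<eta>0]) (intro allI less_imp_le xy(5))
    from tendsto_diff[OF p d]
    have "(\<lambda>j. if l \<ge> 0 then C j * of_real (x j) powi k * of_real (y j) ^ nat l else 0) \<longlonglongrightarrow> ?\<psi> (pr ax (of_real r) (of_real t))"
      by simp
    then show ?thesis using xl' yl' by blast
  qed
  obtain x1 y1 where 1: "(\<lambda>j. complex_of_real (x1 j)) \<longlonglongrightarrow> of_real r" "(\<lambda>j. complex_of_real (y1 j)) \<longlonglongrightarrow> of_real t1"
      "(\<lambda>j. if l \<ge> 0 then C j * of_real (x1 j) powi k * of_real (y1 j) ^ nat l else 0) \<longlonglongrightarrow> ?\<psi> (pr ax (of_real r) (of_real t1))"
    using lims[of t1] by blast
  obtain x2 y2 where 2: "(\<lambda>j. complex_of_real (x2 j)) \<longlonglongrightarrow> of_real r" "(\<lambda>j. complex_of_real (y2 j)) \<longlonglongrightarrow> of_real t2"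
      "(\<lambda>j. if l \<ge> 0 then C j * of_real (x2 j) powi k * of_real (y2 j) ^ nat l else 0) \<longlonglongrightarrow> ?\<psi> (pr ax (of_real r) (of_real t2))"
    using lims[of t2] by blast
  show ?thesis
  proof (cases "l \<ge> 0")
    case False
    then have "(\<lambda>j::nat. 0) \<longlonglongrightarrow> ?\<psi> (pr ax (of_real r) (of_real t1))" using 1(3) by simp
    then show ?thesis using False by (simp add: LIMSEQ_const_iff)
  next
    case True
    have rr: "complex_of_real r \<noteq> 0" using r(1) by simp
    have a: "(\<lambda>j. (C j * of_real (x1 j) powi k * of_real (y1 j) ^ nat l) * (of_real (x2 j) powi k * of_real (y2 j) ^ nat l))
        \<longlonglongrightarrow> ?\<psi> (pr ax (of_real r) (of_real t1)) * (of_real r powi k * of_real t2 ^ nat l)"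
      using 1(3) True by (intro tendsto_mult tendsto_power_int tendsto_power 2(1,2) rr) simp
    have b: "(\<lambda>j. (C j * of_real (x2 j) powi k * of_real (y2 j) ^ nat l) * (of_real (x1 j) powi k * of_real (y1 j) ^ nat l))
        \<longlonglongrightarrow> ?\<psi> (pr ax (of_real r) (of_real t2)) * (of_real r powi k * of_real t1 ^ nat l)"
      using 2(3) True by (intro tendsto_mult tendsto_power_int tendsto_power 1(1,2) rr) simp
    have e: "(\<lambda>j. (C j * of_real (x1 j) powi k * of_real (y1 j) ^ nat l) * (of_real (x2 j) powi k * of_real (y2 j) ^ nat l))
      = (\<lambda>j. (C j * of_real (x2 j) powi k * of_real (y2 j) ^ nat l) * (of_real (x1 j) powi k * of_real (y1 j) ^ nat l))"
      by (simp add: fun_eq_iff mult_ac)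
    have "?\<psi> (pr ax (of_real r) (of_real t1)) * (of_real r powi k * of_real t2 ^ nat l)
        = ?\<psi> (pr ax (of_real r) (of_real t2)) * (of_real r powi k * of_real t1 ^ nat l)"
      by (rule LIMSEQ_unique[OF a]) (unfold e, rule b)
    then have "of_real r powi k * (?\<psi> (pr ax (of_real r) (of_real t1)) * of_real t2 ^ nat l)
        = of_real r powi k * (?\<psi> (pr ax (of_real r) (of_real t2)) * of_real t1 ^ nat l)"
      by (simp only: mult.left_commute)
    moreover have "complex_of_real r powi k \<noteq> 0" using rr by simp
    ultimately show ?thesis using True r(1) by auto
  qed
qed

text \<open>On the part of the closure where \<open>|X|\<close> has the largest possible value \<open>r\<close>, every homogeneous component of the
  symbol is holomorphic in the other coordinate \<open>Y\<close>, hence a multiple of a power of it.\<close>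

definition slices_holomorphic :: "(C2 \<Rightarrow> complex) \<Rightarrow> bool" where
  "slices_holomorphic \<phi> \<longleftrightarrow> (\<forall>ax k l r s. 0 < r \<longrightarrow> (\<forall>z\<in>\<Omega>. cmod (cX ax z) < r) \<longrightarrow> 0 < s \<longrightarrow>
     pr ax (of_real r) (of_real s) \<in> closure \<Omega> \<longrightarrow>
     (\<exists>c. \<forall>w. cmod w < s \<longrightarrow> tc ax k l \<phi> (pr ax (of_real r) w) = (if l \<ge> 0 then c * w ^ nat l else 0)))"

text \<open>The comparison of radii determines the dependence on \<open>|Y|\<close>, homogeneity the dependence on the argument, and
  continuity the value at \<open>Y = 0\<close>.\<close>

lemma axis_small_imp_slice:
  assumes \<phi>: "sym \<phi>"
    and small: "\<And>\<delta> N. \<delta> > 0 \<Longrightarrow> \<exists>n\<ge>N. nrm (H \<phi> (emon (pr ax n 0))) < \<delta>"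
    and r: "r > 0" "\<And>z. z \<in> \<Omega> \<Longrightarrow> cmod (cX ax z) < r" and s: "0 < s" "pr ax (of_real r) (of_real s) \<in> closure \<Omega>"
  shows "\<exists>c. \<forall>w. cmod w < s \<longrightarrow> tc ax k l \<phi> (pr ax (of_real r) w) = (if l \<ge> 0 then c * w ^ nat l else 0)"
proof -
  let ?\<psi> = "tc ax k l \<phi>"
  define c where "c = ?\<psi> (pr ax (of_real r) (of_real (s/2))) / of_real (s/2) ^ nat l"
  let ?m = "\<lambda>w. if l \<ge> 0 then c * w ^ nat l else 0"
  have cl: "pr ax (of_real r) w \<in> closure \<Omega>" if "cmod w \<le> s" for w
    by (rule complete_reinhardtD_pr[OF complete_closure s(2)]) (use that in auto)
  have pos: "?\<psi> (pr ax (of_real r) w) = ?m w" if w: "0 < cmod w" "cmod w < s" for w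
  proof -
    obtain b where b: "w = ex b * of_real (cmod w)" by (rule polar_ex)
    have "?\<psi> (pr ax (of_real r) w) = ?\<psi> (pr ax (ex 0 * of_real r) (ex b * of_real (cmod w)))"
      using b by simp
    also have "\<dots> = ex (of_int k * 0) * ex (of_int l * b) * ?\<psi> (pr ax (of_real r) (of_real (cmod w)))"
      by (rule tc_homogeneous[OF reinhardt_closure_Omega \<phi> cl]) (use w in simp)
    finally have h: "?\<psi> (pr ax (of_real r) w) = ex (of_int l * b) * ?\<psi> (pr ax (of_real r) (of_real (cmod w)))"
      by simp
    have rat: "if l \<ge> 0 then ?\<psi> (pr ax (of_real r) (of_real (cmod w))) * of_real (s/2) ^ nat l
      = ?\<psi> (pr ax (of_real r) (of_real (s/2))) * of_real (cmod w) ^ nat l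
      else ?\<psi> (pr ax (of_real r) (of_real (cmod w))) = 0"
      by (rule component_ratio[OF \<phi> small r s(2) w]) (use s(1) in auto)
    show ?thesis
    proof (cases "l \<ge> 0")
      case True
      have "complex_of_real (s/2) \<noteq> 0" using s(1) by simp
      then have "?\<psi> (pr ax (of_real r) (of_real (cmod w))) = c * of_real (cmod w) ^ nat l"
        using rat True unfolding c_def by (simp add: field_simps)
      then have "?\<psi> (pr ax (of_real r) w) = c * (ex b ^ nat l * of_real (cmod w) ^ nat l)"
        unfolding h using True by (simp add: ex_power)
      also have "\<dots> = c * w ^ nat l" using b by (metis power_mult_distrib)
      finally show ?thesis using True by simp
    qed (use h rat in simp)
  qed
  have zero: "?\<psi> (pr ax (of_real r) 0) = ?m 0"
  proof -
    define w where "w = (\<lambda>j :: nat. complex_of_real (s / (real j + 2)))"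
    have wn: "cmod (w j) = s / (real j + 2)" for j using s(1) by (simp add: w_def norm_divide del: of_real_divide) 
    have w1: "0 < cmod (w j)" "cmod (w j) < s" for j
      using s(1) unfolding wn by (auto simp: divide_less_eq algebra_simps intro!: add_pos_nonneg mult_nonneg_nonneg)
    have wl: "w \<longlonglongrightarrow> 0"
    proof -
      have "(\<lambda>j. s / (real j + 2)) \<longlonglongrightarrow> 0"
        using LIMSEQ_ignore_initial_segment[OF lim_const_over_n[of s], of 2] by (simp add: add.commute)
      from tendsto_of_real[OF this, where ?'a = complex] show ?thesis unfolding w_def by simp
    qed
    have "(\<lambda>j. pr ax (complex_of_real r) (w j)) \<longlonglongrightarrow> pr ax (of_real r) 0"
      using tendsto_Pair[OF tendsto_const wl] tendsto_Pair[OF wl tendsto_const] by (cases ax) (auto simp: pr_def)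
    then have "(\<lambda>j. ?\<psi> (pr ax (of_real r) (w j))) \<longlonglongrightarrow> ?\<psi> (pr ax (of_real r) 0)"
      by (rule continuous_on_tendsto_compose[OF sym_tc[OF \<phi>]])
        (use cl s(1) w1 less_imp_le in \<open>auto intro!: always_eventually cl less_imp_le[OF w1(2)]\<close>)
    then have "(\<lambda>j. ?m (w j)) \<longlonglongrightarrow> ?\<psi> (pr ax (of_real r) 0)" by (simp only: pos[OF w1])
    moreover have "(\<lambda>j. ?m (w j)) \<longlonglongrightarrow> ?m 0" by (cases "l \<ge> 0") (auto intro!: tendsto_intros wl)
    ultimately show ?thesis using LIMSEQ_unique by blast
  qed
  show ?thesis
  proof (intro exI[of _ c] allI impI)
    fix w assume "cmod w < s"
    then show "?\<psi> (pr ax (of_real r) w) = ?m w" using pos[of w] zero by (cases "w = 0") auto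
  qed
qed

lemma boundary_limit_imp_slices_holomorphic:
  assumes \<phi>: "sym \<phi>"
    and lim: "\<And>e. e > 0 \<Longrightarrow> \<exists>d>0. \<forall>z\<in>\<Omega>. infdist z (frontier \<Omega>) < d \<longrightarrow> nrm (H \<phi> (nk z)) < e"
  shows "slices_holomorphic \<phi>"
  unfolding slices_holomorphic_def
proof (intro allI impI)
  fix ax k l and r s :: real assume r: "0 < r" "\<forall>z\<in>\<Omega>. cmod (cX ax z) < r" and s: "0 < s" "pr ax (of_real r) (of_real s) \<in> closure \<Omega>"
  have "\<exists>n\<ge>N. nrm (H \<phi> (emon (pr ax n 0))) < \<delta>" if \<delta>: "\<delta> > 0" for \<delta> N
  proof (rule boundary_limit_imp_hankel_axis_small[OF \<phi> lim, where \<alpha> = "\<lambda>n. pr ax n 0" and pt = "\<lambda>c. pr ax c 0" and q = r])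
    show "inj (\<lambda>n :: nat. pr ax n 0)" by (auto simp: inj_def pr_def)
    show "mono (pr ax n 0) (pr ax c 0) = c ^ n" if "pr ax c 0 \<in> \<Omega>" for c n
      by (simp add: mono_pr[OF that])
    show "mono \<beta> (pr ax c 0) = 0" if "pr ax c 0 \<in> \<Omega>" "\<beta> \<notin> range (\<lambda>n. pr ax n 0)" for c \<beta>
    proof -
      have "(if ax then snd \<beta> else fst \<beta>) \<noteq> 0"
      proof
        assume "(if ax then snd \<beta> else fst \<beta>) = 0"
        then have "\<beta> = pr ax (if ax then fst \<beta> else snd \<beta>) 0" by (cases \<beta>) (auto simp: pr_def)
        then show False using that(2) by blast
      qed
      then show ?thesis by (auto simp: mono_def pr_def split: if_splits)
    qed
    show "pr ax c 0 \<in> frontier \<Omega>" if "cmod c = r" for c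
    proof -
      have "pr ax c 0 \<in> closure \<Omega>"
        by (rule complete_reinhardtD_pr[OF complete_closure s(2)]) (use that in auto)
      moreover have "pr ax c 0 \<notin> \<Omega>" using r(2) that by fastforce
      ultimately show ?thesis by (simp add: frontier_eq)
    qed
    show "pr ax c 0 \<in> \<Omega>" if "cmod c < r" for c
      by (rule open_box_in_Omega[OF s(2) that]) (use s(1) in simp)
  qed (use r \<delta> dist_pr_eq in auto)
  then show "\<exists>c. \<forall>w. cmod w < s \<longrightarrow> tc ax k l \<phi> (pr ax (of_real r) w) = (if l \<ge> 0 then c * w ^ nat l else 0)"
    by (rule axis_small_imp_slice[OF \<phi> _ r(1) _ s]) (use r(2) in auto)
qed

lemma cX_less_max:
  assumes "\<And>w. w \<in> closure \<Omega> \<Longrightarrow> cmod (cX ax w) \<le> r" and z: "z \<in> \<Omega>"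
  shows "cmod (cX ax z) < r"
proof -
  obtain e where e: "e > 0" "\<And>w. cmod (fst w) < cmod (fst z) + e \<Longrightarrow> cmod (snd w) < cmod (snd z) + e \<Longrightarrow> w \<in> \<Omega>"
    using complete_reinhardt_enlarge[OF open_Omega complete_Omega z] by metis
  let ?w = "pr ax (of_real (cmod (cX ax z) + e/2)) (of_real (cmod (cY ax z)))"
  have n: "cmod (complex_of_real (cmod (cX ax z) + e/2)) = cmod (cX ax z) + e/2"
    using e(1) by (simp only: norm_of_real) simp
  have "?w \<in> \<Omega>" by (rule e(2)) (use e(1) n in \<open>auto simp: pr_def cX_def cY_def simp del: of_real_add split: if_splits\<close>)
  from assms(1)[OF in_closure[OF this]] have "cmod (cX ax z) + e/2 \<le> r" by (simp only: cX_pr n)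
  then show ?thesis using e(1) by simp
qed

lemma slice_attains_max_modulus:
  assumes w: "pr ax c w \<in> closure \<Omega>"
  obtains w0 where "pr ax c w0 \<in> closure \<Omega>" "\<And>w. pr ax c w \<in> closure \<Omega> \<Longrightarrow> cmod w \<le> cmod w0"
proof -
  let ?S = "(\<lambda>w. pr ax c w) -` closure \<Omega>"
  have cpr: "continuous_on UNIV (\<lambda>w. pr ax c w)" by (intro continuous_intros)
  have "closed ?S"
    by (rule continuous_closed_vimage[OF closed_closure]) (use cpr in \<open>simp add: continuous_on_eq_continuous_at\<close>)
  moreover have "bounded ?S"
  proof -
    obtain R where R: "\<And>z. z \<in> closure \<Omega> \<Longrightarrow> norm z \<le> R"
      using compact_imp_bounded[OF compact_closure_Omega] unfolding bounded_iff by blast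
    have "cmod w \<le> norm (pr ax c w)" for w
      using norm_fst_le[of w c] norm_snd_le[of w c] by (auto simp: pr_def)
    then have "cmod w \<le> R" if "w \<in> ?S" for w using R[of "pr ax c w"] that by (auto intro: order_trans)
    then show ?thesis unfolding bounded_iff by blast
  qed
  ultimately have cS: "compact ?S" by (simp add: compact_eq_bounded_closed)
  moreover have "?S \<noteq> {}" using w by blast
  ultimately obtain w0 where "w0 \<in> ?S" "\<And>w. w \<in> ?S \<Longrightarrow> cmod w \<le> cmod w0"
    using continuous_attains_sup[of ?S cmod] by (auto intro!: continuous_intros)
  then show thesis by (intro that[of w0]) auto
qed

text \<open>By the maximum principle a nonconstant \<open>Y\<close> stays inside the open disc on which the components of the symbol
  are monomials.  The symbol is a uniform limit of sums of components, so it is holomorphic along the disc too.\<close>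

lemma slices_holomorphic_imp_disc_aux:
  assumes \<phi>: "sym \<phi>" and sl: "slices_holomorphic \<phi>"
    and f: "\<And>t. t \<in> ball 0 1 \<Longrightarrow> f t \<in> closure \<Omega>" "(\<lambda>t. cY ax (f t)) holomorphic_on ball 0 1"
    and c: "\<And>t. t \<in> ball 0 1 \<Longrightarrow> cX ax (f t) = c" "c \<noteq> 0" "\<And>w. w \<in> closure \<Omega> \<Longrightarrow> cmod (cX ax w) \<le> cmod c"
  shows "(\<phi> \<circ> f) holomorphic_on ball 0 1"
proof -
  define g where "g = (\<lambda>t. cY ax (f t))"
  have fg: "f t = pr ax c (g t)" if "t \<in> ball 0 1" for t
    unfolding g_def c(1)[OF that, symmetric] by simp
  show ?thesis
  proof (cases "g constant_on ball 0 1")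
    case True
    then obtain w where "\<And>t. t \<in> ball 0 1 \<Longrightarrow> g t = w" unfolding constant_on_def by blast
    then have "(\<phi> \<circ> f) t = \<phi> (pr ax c w)" if "t \<in> ball 0 1" for t using fg[OF that] that by simp
    then show ?thesis using holomorphic_transform[of "\<lambda>t. \<phi> (pr ax c w)" "ball 0 1" "\<phi> \<circ> f"] by (simp add: holomorphic_on_const)
  next
    case False
    have gS: "pr ax c (g t) \<in> closure \<Omega>" if "t \<in> ball 0 1" for t using f(1)[OF that] fg[OF that] by simp
    have "pr ax c (g 0) \<in> closure \<Omega>" by (rule gS) simp
    then obtain w0 where w0: "pr ax c w0 \<in> closure \<Omega>" "\<And>w. pr ax c w \<in> closure \<Omega> \<Longrightarrow> cmod w \<le> cmod w0"
      by (rule slice_attains_max_modulus) (rule that)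
    have glt: "cmod (g t) < cmod w0" if t: "t \<in> ball 0 1" for t
    proof (rule ccontr)
      assume "\<not> ?thesis"
      then have "cmod (g u) \<le> cmod (g t)" if "u \<in> ball 0 1" for u using w0(2)[OF gS[OF that]] by linarith
      then have "g constant_on ball 0 1"
        by (intro maximum_modulus_principle[of g "ball 0 1" "ball 0 1" t]) (use f(2) t in \<open>auto simp: g_def\<close>)
      then show False using False by simp
    qed
    define s where "s = cmod w0"
    have s0: "s > 0" unfolding s_def by (rule order_le_less_trans[OF norm_ge_zero glt[of 0]]) simp
    define r where "r = cmod c"
    have r0: "r > 0" using c(2) by (simp add: r_def)
    obtain a where a: "c = ex a * of_real r" unfolding r_def by (rule polar_ex)
    have rl: "\<forall>z\<in>\<Omega>. cmod (cX ax z) < r" using cX_less_max[OF c(3)] by (simp add: r_def)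
    have rs: "pr ax (of_real r) (of_real s) \<in> closure \<Omega>"
      by (rule complete_reinhardtD_pr[OF complete_closure, of ax c w0]) (use w0(1) in \<open>auto simp: r_def s_def\<close>)
    have comp_hol: "(\<lambda>t. tc ax k l \<phi> (f t)) holomorphic_on ball 0 1" for k l
    proof -
      obtain C where C: "\<And>w. cmod w < s \<Longrightarrow> tc ax k l \<phi> (pr ax (of_real r) w) = (if l \<ge> 0 then C * w ^ nat l else 0)"
        using sl[unfolded slices_holomorphic_def, rule_format, OF r0 _ s0 rs, of k l] rl by blast
      have "tc ax k l \<phi> (f t) = ex (of_int k * a) * (if l \<ge> 0 then C * g t ^ nat l else 0)" if t: "t \<in> ball 0 1" for t
      proof -
        have cl: "pr ax (of_real r) (g t) \<in> closure \<Omega>"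
          by (rule complete_reinhardtD_pr[OF complete_closure rs]) (use glt[OF t] in \<open>auto simp: s_def\<close>)
        have "tc ax k l \<phi> (f t) = tc ax k l \<phi> (pr ax (ex a * of_real r) (ex 0 * g t))" unfolding fg[OF t] a by simp
        also have "\<dots> = ex (of_int k * a) * ex (of_int l * 0) * tc ax k l \<phi> (pr ax (of_real r) (g t))"
          by (rule tc_homogeneous[OF reinhardt_closure_Omega \<phi> cl])
        also have "tc ax k l \<phi> (pr ax (of_real r) (g t)) = (if l \<ge> 0 then C * g t ^ nat l else 0)"
          by (rule C) (use glt[OF t] in \<open>simp add: s_def\<close>)
        finally show ?thesis by simp
      qed
      moreover have "(\<lambda>t. ex (of_int k * a) * (if l \<ge> 0 then C * g t ^ nat l else 0)) holomorphic_on ball 0 1"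
        using f(2) unfolding g_def by (cases "l \<ge> 0") (auto intro!: holomorphic_intros)
      ultimately show ?thesis by (metis (no_types, lifting) holomorphic_cong)
    qed
    have "tcoef K L = tc ax (if ax then K else L) (if ax then L else K)" for K L by (simp add: tc_def)
    then have tcoef_hol: "(\<lambda>t. tcoef K L \<phi> (f t)) holomorphic_on ball 0 1" for K L by (simp only: comp_hol)
    have "\<forall>n. \<exists>h. h holomorphic_on ball 0 1 \<and> (\<forall>t\<in>ball 0 1. dist (h t) (\<phi> (f t)) < 1 / real (Suc n))"
    proof
      fix n
      obtain I :: "(nat \<times> nat) set" and w K L where I: "\<forall>z\<in>closure \<Omega>. cmod (\<phi> z - (\<Sum>i\<in>I. w i * tcoef (K i) (L i) \<phi> z)) < 1 / real (Suc n)"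
        using tcoef_approx[OF compact_closure_Omega reinhardt_closure_Omega \<phi>, of "1 / real (Suc n)"] by auto
      show "\<exists>h. h holomorphic_on ball 0 1 \<and> (\<forall>t\<in>ball 0 1. dist (h t) (\<phi> (f t)) < 1 / real (Suc n))"
      proof (intro exI[of _ "\<lambda>t. \<Sum>i\<in>I. w i * tcoef (K i) (L i) \<phi> (f t)"] conjI ballI)
        show "(\<lambda>t. \<Sum>i\<in>I. w i * tcoef (K i) (L i) \<phi> (f t)) holomorphic_on ball 0 1"
          by (intro holomorphic_intros tcoef_hol)
        fix t :: complex assume "t \<in> ball 0 1"
        then show "dist (\<Sum>i\<in>I. w i * tcoef (K i) (L i) \<phi> (f t)) (\<phi> (f t)) < 1 / real (Suc n)"
          using I f(1)[of t] by (subst dist_commute) (simp add: dist_norm)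
      qed
    qed
    then obtain h where h: "\<And>n. h n holomorphic_on ball 0 1" "\<And>n t. t \<in> ball 0 1 \<Longrightarrow> dist (h n t) (\<phi> (f t)) < 1 / real (Suc n)"
      by metis
    show ?thesis
    proof (rule holomorphic_uniform_sequence[OF open_ball h(1)])
      fix x :: complex assume x: "x \<in> ball 0 1"
      obtain d where d: "d > 0" "cball x d \<subseteq> ball 0 1"
        using bspec[OF open_contains_cball[THEN iffD1, OF open_ball] x] by (elim exE conjE) (rule that)
      have "uniform_limit (cball x d) h (\<phi> \<circ> f) sequentially"
      proof (rule uniform_limitI)
        fix e :: real assume "e > 0"
        obtain N :: nat where N: "1 / real (Suc N) < e"
          by (rule nat_approx_posE[OF \<open>e > 0\<close>]) (rule that)
        show "\<forall>\<^sub>F n in sequentially. \<forall>y\<in>cball x d. dist (h n y) ((\<phi> \<circ> f) y) < e"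
          unfolding eventually_sequentially
        proof (intro exI[of _ N] allI impI ballI)
          fix n y assume n: "N \<le> n" and y: "y \<in> cball x d"
          have "dist (h n y) (\<phi> (f y)) < 1 / real (Suc n)" by (rule h(2)[OF subsetD[OF d(2) y]])
          also have "\<dots> \<le> 1 / real (Suc N)" using n by (simp add: frac_le)
          finally show "dist (h n y) ((\<phi> \<circ> f) y) < e" using N by simp
        qed
      qed
      then show "\<exists>d>0. cball x d \<subseteq> ball 0 1 \<and> uniform_limit (cball x d) h (\<phi> \<circ> f) sequentially"
        by (intro exI[of _ d] conjI d)
    qed
  qed
qed

lemma slices_holomorphic_imp_disc:
  assumes \<phi>: "sym \<phi>" and sl: "slices_holomorphic \<phi>"
    and f: "holomorphic_map_on f (ball 0 1)" "f ` ball 0 1 \<subseteq> frontier \<Omega>"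
  shows "(\<phi> \<circ> f) holomorphic_on ball 0 1"
proof -
  have cl: "f t \<in> closure \<Omega>" if "t \<in> ball 0 1" for t using f(2) that unfolding frontier_eq by blast
  have h: "(\<lambda>t. cY ax (f t)) holomorphic_on ball 0 1" for ax
    using f(1) by (cases ax) (auto simp: holomorphic_map_on_def cY_def)
  show ?thesis
  proof (rule disc_in_frontier[OF open_Omega convex_Omega reinhardt_Omega nonempty_Omega f])
    fix c assume "\<And>t. t \<in> ball 0 1 \<Longrightarrow> f t = c"
    then show ?thesis
      using holomorphic_transform[of "\<lambda>t. \<phi> c" "ball 0 1" "\<phi> \<circ> f"] by (simp add: holomorphic_on_const)
  next
    fix c assume "\<And>t. t \<in> ball 0 1 \<Longrightarrow> fst (f t) = c" "c \<noteq> 0" "\<And>w. w \<in> closure \<Omega> \<Longrightarrow> cmod (fst w) \<le> cmod c"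
    then show ?thesis
      by (intro slices_holomorphic_imp_disc_aux[OF \<phi> sl cl h, of True c]) (auto simp: cX_def)
  next
    fix c assume "\<And>t. t \<in> ball 0 1 \<Longrightarrow> snd (f t) = c" "c \<noteq> 0" "\<And>w. w \<in> closure \<Omega> \<Longrightarrow> cmod (snd w) \<le> cmod c"
    then show ?thesis
      by (intro slices_holomorphic_imp_disc_aux[OF \<phi> sl cl h, of False c]) (auto simp: cX_def)
  qed
qed

end

context reinhardt_domain
begin

section \<open>From holomorphy on boundary discs to compactness\<close>

subsection \<open>Hankel operators of homogeneous symbols\<close>

text \<open>By orthogonality of different weights a homogeneous function has at most one monomial in
  its Bergman projection, so projecting preserves homogeneity.\<close>

lemma P_homog:
  assumes g: "g \<in> L2 \<Omega>" "continuous_on \<Omega> g" and h: "homog k l g"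
  shows "homog k l (P g)"
proof -
  have ze: "homog k l (\<lambda>z. 0)" by (simp add: homog_def)
  have ce: "continuous_on \<Omega> (emon \<alpha>)" "emon \<alpha> \<in> L2 \<Omega>" for \<alpha> using A2D(4,2)[OF emon_A2] by auto
  show ?thesis
  proof (cases "k \<ge> 0 \<and> l \<ge> 0")
    case True
    let ?\<kappa> = "(nat k, nat l)"
    let ?p = "\<lambda>z. inn g (emon ?\<kappa>) * emon ?\<kappa> z"
    have pA: "?p \<in> A2 \<Omega>" by (rule A2_scale[OF emon_A2])
    have o: "inn (\<lambda>z. g z - ?p z) (basis n) = 0" for n
    proof -
      let ?\<beta> = "prod_decode n"
      have "inn (\<lambda>z. g z - ?p z) (emon ?\<beta>) = inn g (emon ?\<beta>) - inn g (emon ?\<kappa>) * inn (emon ?\<kappa>) (emon ?\<beta>)"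
        by (simp only: l2_inner_diff_left[OF g(1) L2_scale[OF ce(2)] ce(2)] l2_inner_scale_left)
      also have "\<dots> = 0"
      proof (cases "?\<beta> = ?\<kappa>")
        case True then show ?thesis by (simp add: emon_orthonormal)
      next
        case False
        then have "(k, l) \<noteq> (int (fst ?\<beta>), int (snd ?\<beta>))" by (cases ?\<beta>) auto
        then have "inn g (emon ?\<beta>) = 0" by (rule homog_inner_zero[OF g(2) h ce(1) emon_homog])
        with False show ?thesis by (simp add: emon_orthonormal)
      qed
      finally show ?thesis by (simp add: basis_def)
    qed
    have "P g = ?p"
    proof (rule P_unique[OF g(1) pA])
      fix h assume "h \<in> A2 \<Omega>"
      then have "inn h (\<lambda>z. g z - ?p z) = 0"
        by (rule orthogonal_basis_imp_A2[OF L2_diff[OF g(1) A2D(2)[OF pA]] inner_zero_sym[OF o]])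
      then show "inn (\<lambda>z. g z - ?p z) h = 0" by (rule inner_zero_sym)
    qed
    moreover have "homog k l ?p" using homog_scale[OF emon_homog[of ?\<kappa>]] True by simp
    ultimately show ?thesis by simp
  next
    case False
    have o: "inn (\<lambda>z. g z - 0) (basis n) = 0" for n
      using homog_inner_zero[OF g(2) h ce(1) emon_homog[of "prod_decode n"]] False by (auto simp: basis_def)
    have "P g = (\<lambda>z. 0)"
    proof (rule P_unique[OF g(1) A2_zero])
      fix h assume "h \<in> A2 \<Omega>"
      then have "inn h (\<lambda>z. g z - 0) = 0"
        by (rule orthogonal_basis_imp_A2[OF L2_diff[OF g(1) L2_zero] inner_zero_sym[OF o]])
      then show "inn (\<lambda>z. g z - 0) h = 0" by (rule inner_zero_sym)
    qed
    then show ?thesis using ze by simp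
  qed
qed

lemma homog_mult: "homog k l f \<Longrightarrow> homog k' l' g \<Longrightarrow> homog (k + k') (l + l') (\<lambda>z. f z * g z)"
  unfolding homog_def of_int_add distrib_right ex_add
  by (intro ballI allI) (simp only: mult_ac)

lemma homog_diff: "homog k l f \<Longrightarrow> homog k l g \<Longrightarrow> homog k l (\<lambda>z. f z - g z)"
  unfolding homog_def by (intro ballI allI) (simp only: right_diff_distrib)

lemma hankel_basis_orthogonal:
  assumes \<psi>: "sym \<psi>" "homog k l \<psi>" and ne: "m \<noteq> n"
  shows "inn (H \<psi> (basis m)) (H \<psi> (basis n)) = 0"
proof -
  have h: "homog (k + int (fst (prod_decode i))) (l + int (snd (prod_decode i))) (H \<psi> (basis i))" for i
  proof -
    have 1: "homog (k + int (fst (prod_decode i))) (l + int (snd (prod_decode i))) (\<lambda>z. \<psi> z * basis i z)"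
      unfolding basis_def by (rule homog_mult[OF \<psi>(2) emon_homog])
    have 2: "(\<lambda>z. \<psi> z * basis i z) \<in> L2 \<Omega>" by (rule mult_L2[OF \<psi>(1) basis_L2])
    have 3: "continuous_on \<Omega> (\<lambda>z. \<psi> z * basis i z)"
      by (intro continuous_on_mult sym_continuous[OF \<psi>(1)] A2D(4)[OF basis_A2])
    show ?thesis unfolding hankel_def by (rule homog_diff[OF 1 P_homog[OF 2 3 1]])
  qed
  have "prod_decode m \<noteq> prod_decode n" using ne by (metis prod_decode_inverse)
  then have "(k + int (fst (prod_decode m)), l + int (snd (prod_decode m))) \<noteq> (k + int (fst (prod_decode n)), l + int (snd (prod_decode n)))"
    by (simp add: prod_eq_iff)
  then show ?thesis
    by (rule homog_inner_zero[OF hankel_continuous[OF \<psi>(1) basis_A2] h hankel_continuous[OF \<psi>(1) basis_A2] h])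
qed

lemma hankel_psum_norm:
  assumes \<psi>: "sym \<psi>" "homog k l \<psi>" and I: "finite I" and d: "\<And>n. n \<in> I \<Longrightarrow> c n \<noteq> 0 \<Longrightarrow> nrm (H \<psi> (basis n)) \<le> d" "d \<ge> 0"
  shows "nrm (H \<psi> (psum c I)) \<le> d * nrm (psum c I)"
proof (rule power2_le_imp_le)
  have L: "(\<lambda>z. c n * H \<psi> (basis n) z) \<in> L2 \<Omega>" for n by (intro L2_scale hankel_L2 \<psi>(1) basis_L2)
  have "(nrm (H \<psi> (psum c I)))\<^sup>2 = (nrm (\<lambda>z. \<Sum>n\<in>I. c n * H \<psi> (basis n) z))\<^sup>2"
    unfolding psum_def by (simp only: hankel_lincomb[OF \<psi>(1) basis_L2])
  also have "\<dots> = (\<Sum>n\<in>I. (nrm (\<lambda>z. c n * H \<psi> (basis n) z))\<^sup>2)"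
  proof (rule l2_norm_orthogonal_sum[OF I L])
    fix i j :: nat assume "i \<noteq> j"
    then show "inn (\<lambda>z. c i * H \<psi> (basis i) z) (\<lambda>z. c j * H \<psi> (basis j) z) = 0"
      by (simp add: l2_inner_scale_left l2_inner_scale_right hankel_basis_orthogonal[OF \<psi>])
  qed
  also have "\<dots> \<le> (\<Sum>n\<in>I. d\<^sup>2 * (cmod (c n))\<^sup>2)"
  proof (rule sum_mono)
    fix n assume n: "n \<in> I"
    have "cmod (c n) * nrm (H \<psi> (basis n)) \<le> cmod (c n) * d"
      using d(1)[OF n] by (cases "c n = 0") (auto intro: mult_left_mono)
    then have "(cmod (c n) * nrm (H \<psi> (basis n)))\<^sup>2 \<le> (cmod (c n) * d)\<^sup>2" by (intro power_mono) auto
    then show "(nrm (\<lambda>z. c n * H \<psi> (basis n) z))\<^sup>2 \<le> d\<^sup>2 * (cmod (c n))\<^sup>2"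
      by (simp add: l2_norm_scale power_mult_distrib mult.commute)
  qed
  also have "\<dots> = (d * nrm (psum c I))\<^sup>2" by (simp add: psum_norm[OF I] power_mult_distrib sum_distrib_left)
  finally show "(nrm (H \<psi> (psum c I)))\<^sup>2 \<le> (d * nrm (psum c I))\<^sup>2" .
qed (use d(2) in simp)

lemma hankel_tail_bound:
  assumes \<psi>: "sym \<psi>" "homog k l \<psi>" and v: "v \<in> A2 \<Omega>" and d: "\<And>n. inn v (basis n) \<noteq> 0 \<Longrightarrow> nrm (H \<psi> (basis n)) \<le> d" "d \<ge> 0"
  shows "nrm (H \<psi> v) \<le> d * nrm v"
proof -
  obtain B where B: "B > 0" "\<And>z. z \<in> closure \<Omega> \<Longrightarrow> cmod (\<psi> z) \<le> B" by (rule sym_bounded[OF \<psi>(1)]) (rule that)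
  let ?s = "\<lambda>N. psum (\<lambda>n. inn v (basis n)) {..<N}"
  let ?e = "\<lambda>N. nrm (\<lambda>z. ?s N z - v z)"
  have sL: "?s N \<in> L2 \<Omega>" for N by (rule A2D(2)[OF psum_A2])
  note vL = A2D(2)[OF v]
  have "nrm (H \<psi> v) \<le> (B + d) * ?e N + d * nrm v" for N
  proof -
    have "nrm (H \<psi> v) \<le> nrm (\<lambda>z. H \<psi> v z - H \<psi> (?s N) z) + nrm (H \<psi> (?s N))"
      by (intro l2_triangle_sub hankel_L2 \<psi>(1) vL sL)
    also have "nrm (\<lambda>z. H \<psi> v z - H \<psi> (?s N) z) = nrm (H \<psi> (\<lambda>z. v z - ?s N z))"
      by (simp only: hankel_diff[OF \<psi>(1) vL sL])
    also have "\<dots> \<le> B * nrm (\<lambda>z. v z - ?s N z)" by (rule hankel_bound[OF \<psi>(1) L2_diff[OF vL sL] B(2)]) (use B(1) in auto)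
    also have "nrm (\<lambda>z. v z - ?s N z) = ?e N" by (rule l2_norm_minus_commute)
    also have "nrm (H \<psi> (?s N)) \<le> d * nrm (?s N)" by (rule hankel_psum_norm[OF \<psi> _ d]) auto
    also have "d * nrm (?s N) \<le> d * (?e N + nrm v)" by (rule mult_left_mono[OF l2_triangle_sub[OF sL vL] d(2)])
    finally show ?thesis by (simp add: algebra_simps)
  qed
  moreover have "(\<lambda>N. (B + d) * ?e N + d * nrm v) \<longlonglongrightarrow> (B + d) * 0 + d * nrm v"
    by (intro tendsto_intros basis_expansion[OF v])
  ultimately have "nrm (H \<psi> v) \<le> (B + d) * 0 + d * nrm v"
    by (intro LIMSEQ_le_const[where X = "\<lambda>N. (B + d) * ?e N + d * nrm v"]) auto
  then show ?thesis by simp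
qed

text \<open>A diagonal operator whose diagonal entries tend to zero sends weakly null sequences to norm
  null ones: the finitely many large entries see coefficients that tend to zero.\<close>

lemma hankel_wc_diagonal:
  assumes \<psi>: "sym \<psi>" "homog k l \<psi>" and fin: "\<And>d. d > 0 \<Longrightarrow> finite {\<alpha>. nrm (H \<psi> (emon \<alpha>)) \<ge> d}"
  shows "hankel_wc \<psi>"
  unfolding hankel_wc_def
proof (intro allI impI)
  fix u assume u: "weakly_null u"
  obtain C where C: "\<And>n. nrm (u n) \<le> C" using weakly_nullD(2)[OF u] by blast
  have C0: "C \<ge> 0" using order_trans[OF l2_norm_nonneg C[of 0]] .
  have uA: "u n \<in> A2 \<Omega>" for n by (rule weakly_nullD(1)[OF u])
  note uL = A2D(2)[OF uA]
  show "(\<lambda>n. nrm (H \<psi> (u n))) \<longlonglongrightarrow> 0"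
  proof (rule LIMSEQ_I)
    fix r :: real assume r: "r > 0"
    define d where "d = r / (4 * (C + 1))"
    have d: "d > 0" "d * (2 * C) < r/2" using r C0 by (auto simp: d_def field_simps)
    define F where "F = {n. nrm (H \<psi> (basis n)) \<ge> d}"
    have "F = prod_decode -` {\<alpha>. nrm (H \<psi> (emon \<alpha>)) \<ge> d}" by (auto simp: F_def basis_def)
    then have F: "finite F" using finite_vimageI[OF fin[OF d(1)] bij_is_inj[OF bij_prod_decode]] by simp
    let ?p = "\<lambda>n. psum (\<lambda>m. inn (u n) (basis m)) F"
    let ?v = "\<lambda>n z. u n z - ?p n z"
    have pL: "?p n \<in> L2 \<Omega>" for n by (rule A2D(2)[OF psum_A2])
    have "nrm (?p n) \<le> C" for n
    proof -
      have "(nrm (?p n))\<^sup>2 \<le> (nrm (u n))\<^sup>2" unfolding psum_norm[OF F] by (rule bessel[OF uL F])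
      then have "nrm (?p n) \<le> nrm (u n)" by (rule power2_le_imp_le) simp
      then show ?thesis using C[of n] by linarith
    qed
    then have 2: "nrm (u n) + nrm (?p n) \<le> C + C" for n by (intro add_mono C)
    have nv: "nrm (?v n) \<le> 2 * C" for n
    proof -
      have "nrm (?v n) \<le> nrm (u n) + nrm (?p n)"
        using l2_triangle_diff[OF uL L2_zero pL, of n n] l2_norm_minus_commute[of \<Omega> "\<lambda>z. 0" "?p n"] by simp
      with 2[of n] show ?thesis by linarith
    qed
    have tail: "nrm (H \<psi> (?v n)) \<le> d * (2 * C)" for n
    proof -
      have "nrm (H \<psi> (?v n)) \<le> d * nrm (?v n)"
      proof (rule hankel_tail_bound[OF \<psi> A2_diff[OF uA psum_A2]])
        fix m assume "inn (?v n) (basis m) \<noteq> 0"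
        then have "m \<notin> F"
          by (auto simp: l2_inner_diff_left[OF uL pL basis_L2] psum_inner[OF F])
        then show "nrm (H \<psi> (basis m)) \<le> d" by (simp add: F_def)
      qed (use d in simp)
      also have "\<dots> \<le> d * (2 * C)" using nv[of n] d(1) by (intro mult_left_mono) auto
      finally show ?thesis .
    qed
    have "(\<lambda>n. \<Sum>m\<in>F. cmod (inn (u n) (basis m)) * nrm (H \<psi> (basis m))) \<longlonglongrightarrow> (\<Sum>m\<in>F. 0 * nrm (H \<psi> (basis m)))"
      by (intro tendsto_intros tendsto_norm_zero weakly_nullD(3)[OF u basis_A2])
    then have "\<exists>N. \<forall>n\<ge>N. norm ((\<Sum>m\<in>F. cmod (inn (u n) (basis m)) * nrm (H \<psi> (basis m))) - 0) < r/2"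
      using r by (intro LIMSEQ_D) auto
    then obtain N where N: "\<And>n. n \<ge> N \<Longrightarrow> (\<Sum>m\<in>F. cmod (inn (u n) (basis m)) * nrm (H \<psi> (basis m))) < r/2"
      by force
    show "\<exists>N. \<forall>n\<ge>N. norm (nrm (H \<psi> (u n)) - 0) < r"
    proof (intro exI[of _ N] allI impI)
      fix n assume n: "N \<le> n"
      have "nrm (H \<psi> (u n)) \<le> nrm (\<lambda>z. H \<psi> (u n) z - H \<psi> (?p n) z) + nrm (H \<psi> (?p n))"
        by (intro l2_triangle_sub hankel_L2 \<psi>(1) uL pL)
      also have "nrm (\<lambda>z. H \<psi> (u n) z - H \<psi> (?p n) z) = nrm (H \<psi> (?v n))"
        by (simp only: hankel_diff[OF \<psi>(1) uL pL])
      also have "nrm (H \<psi> (?p n)) \<le> (\<Sum>m\<in>F. cmod (inn (u n) (basis m)) * nrm (H \<psi> (basis m)))"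
      proof -
        have "nrm (H \<psi> (?p n)) = nrm (\<lambda>z. \<Sum>m\<in>F. inn (u n) (basis m) * H \<psi> (basis m) z)"
          unfolding psum_def by (simp only: hankel_lincomb[OF \<psi>(1) basis_L2])
        also have "\<dots> \<le> (\<Sum>m\<in>F. nrm (\<lambda>z. inn (u n) (basis m) * H \<psi> (basis m) z))"
          by (intro l2_norm_sum L2_scale hankel_L2 \<psi>(1) basis_L2)
        finally show ?thesis by (simp only: l2_norm_scale)
      qed
      finally show "norm (nrm (H \<psi> (u n)) - 0) < r" using tail[of n] N[OF n] d(2) by simp
    qed
  qed
qed

subsection \<open>Assembling the homogeneous components\<close>

lemma hankel_wc_add:
  assumes "sym \<phi>" "sym \<psi>" "hankel_wc \<phi>" "hankel_wc \<psi>"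
  shows "hankel_wc (\<lambda>z. \<phi> z + \<psi> z)"
  unfolding hankel_wc_def
proof (intro allI impI)
  fix u assume u: "weakly_null u"
  have "(\<lambda>n. nrm (H \<phi> (u n)) + nrm (H \<psi> (u n))) \<longlonglongrightarrow> 0 + 0"
    using assms(3,4) u unfolding hankel_wc_def by (intro tendsto_add) auto
  then have "(\<lambda>n. nrm (H \<phi> (u n)) + nrm (H \<psi> (u n))) \<longlonglongrightarrow> 0" by simp
  then show "(\<lambda>n. nrm (H (\<lambda>z. \<phi> z + \<psi> z) (u n))) \<longlonglongrightarrow> 0"
    by (rule Lim_null_comparison[rotated])
       (simp add: always_eventually hankel_add_symbol[OF assms(1,2) A2D(2)[OF weakly_nullD(1)[OF u]]])
qed

lemma hankel_wc_scale:
  assumes "sym \<phi>" "hankel_wc \<phi>"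
  shows "hankel_wc (\<lambda>z. c * \<phi> z)"
  unfolding hankel_wc_def
proof (intro allI impI)
  fix u assume u: "weakly_null u"
  have "(\<lambda>n. nrm (H \<phi> (u n))) \<longlonglongrightarrow> 0" using assms(2) u unfolding hankel_wc_def by blast
  from tendsto_mult_right_zero[OF this, of "cmod c"]
  show "(\<lambda>n. nrm (H (\<lambda>z. c * \<phi> z) (u n))) \<longlonglongrightarrow> 0"
    by (rule Lim_null_comparison[rotated])
       (simp add: always_eventually hankel_scale_symbol[OF assms(1) A2D(2)[OF weakly_nullD(1)[OF u]]])
qed

lemma hankel_wc_zero: "hankel_wc (\<lambda>z. 0)"
proof -
  have "H (\<lambda>z. 0) f = (\<lambda>z. 0)" for f by (simp add: hankel_def P_of_A2[OF A2_zero])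
  then show ?thesis by (simp add: hankel_wc_def)
qed

lemma hankel_wc_sum:
  assumes "finite I" "\<And>i. i \<in> I \<Longrightarrow> sym (f i)" "\<And>i. i \<in> I \<Longrightarrow> hankel_wc (f i)"
  shows "hankel_wc (\<lambda>z. \<Sum>i\<in>I. w i * f i z)"
  using assms
proof (induction I rule: finite_induct)
  case empty
  then show ?case by (simp add: hankel_wc_zero)
next
  case (insert i I)
  have "hankel_wc (\<lambda>z. w i * f i z + (\<Sum>i\<in>I. w i * f i z))"
    by (intro hankel_wc_add hankel_wc_scale continuous_on_mult continuous_on_const continuous_on_sum insert.IH insert.prems) auto
  then show ?case using insert.hyps by simp
qed

lemma hankel_wc_uniform_limit:
  assumes \<phi>: "sym \<phi>" and a: "\<And>e. e > 0 \<Longrightarrow> \<exists>\<psi>. sym \<psi> \<and> hankel_wc \<psi> \<and> (\<forall>z\<in>closure \<Omega>. cmod (\<phi> z - \<psi> z) < e)"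
  shows "hankel_wc \<phi>"
  unfolding hankel_wc_def
proof (intro allI impI)
  fix u assume u: "weakly_null u"
  obtain C where C: "\<And>n. nrm (u n) \<le> C" using weakly_nullD(2)[OF u] by blast
  have C0: "C \<ge> 0" using order_trans[OF l2_norm_nonneg C[of 0]] .
  note uL = A2D(2)[OF weakly_nullD(1)[OF u]]
  show "(\<lambda>n. nrm (H \<phi> (u n))) \<longlonglongrightarrow> 0"
  proof (rule LIMSEQ_I)
    fix r :: real assume r: "r > 0"
    define e where "e = r / (2 * (C + 1))"
    have e: "e > 0" "e * C < r/2" using r C0 by (auto simp: e_def field_simps)
    obtain \<psi> where \<psi>: "sym \<psi>" "hankel_wc \<psi>" "\<And>z. z \<in> closure \<Omega> \<Longrightarrow> cmod (\<phi> z - \<psi> z) < e"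
      using a[OF e(1)] by blast
    have "(\<lambda>n. nrm (H \<psi> (u n))) \<longlonglongrightarrow> 0" using \<psi>(2) u unfolding hankel_wc_def by blast
    then obtain N where N: "\<And>n. n \<ge> N \<Longrightarrow> nrm (H \<psi> (u n)) < r/2"
      using LIMSEQ_D[of "\<lambda>n. nrm (H \<psi> (u n))" 0 "r/2"] r by auto
    have sd: "sym (\<lambda>z. \<phi> z - \<psi> z)" by (intro continuous_on_diff \<phi> \<psi>(1))
    show "\<exists>N. \<forall>n\<ge>N. norm (nrm (H \<phi> (u n)) - 0) < r"
    proof (intro exI[of _ N] allI impI)
      fix n assume n: "N \<le> n"
      have "nrm (H \<phi> (u n)) = nrm (H (\<lambda>z. (\<phi> z - \<psi> z) + \<psi> z) (u n))" by simp
      also have "\<dots> \<le> nrm (H (\<lambda>z. \<phi> z - \<psi> z) (u n)) + nrm (H \<psi> (u n))"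
        by (rule hankel_add_symbol[OF sd \<psi>(1) uL])
      also have "nrm (H (\<lambda>z. \<phi> z - \<psi> z) (u n)) \<le> e * nrm (u n)"
        by (rule hankel_bound[OF sd uL]) (use \<psi>(3) e(1) in \<open>auto intro: less_imp_le\<close>)
      also have "e * nrm (u n) \<le> e * C" using C[of n] e(1) by (intro mult_left_mono) auto
      finally show "norm (nrm (H \<phi> (u n)) - 0) < r" using e(2) N[OF n] by simp
    qed
  qed
qed

text \<open>The symbol is a uniform limit of combinations of its components, and the norm of a Hankel operator is
  at most the supremum of its symbol.\<close>

lemma hankel_wc_of_components:
  assumes \<phi>: "sym \<phi>" and c: "\<And>k l. hankel_wc (tcoef k l \<phi>)"
  shows "hankel_wc \<phi>"
proof (rule hankel_wc_uniform_limit[OF \<phi>])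
  fix e :: real assume "e > 0"
  then obtain I :: "(nat \<times> nat) set" and w K L where I: "finite I"
      "\<forall>z\<in>closure \<Omega>. cmod (\<phi> z - (\<Sum>i\<in>I. w i * tcoef (K i) (L i) \<phi> z)) < e"
    using tcoef_approx[OF compact_closure_Omega reinhardt_closure_Omega \<phi>] by blast
  have "sym (\<lambda>z. \<Sum>i\<in>I. w i * tcoef (K i) (L i) \<phi> z)"
    by (intro continuous_on_sum continuous_on_mult continuous_on_const sym_tcoef \<phi>)
  moreover have "hankel_wc (\<lambda>z. \<Sum>i\<in>I. w i * tcoef (K i) (L i) \<phi> z)"
    by (rule hankel_wc_sum[OF I(1) sym_tcoef[OF \<phi>] c])
  ultimately show "\<exists>\<psi>. sym \<psi> \<and> hankel_wc \<psi> \<and> (\<forall>z\<in>closure \<Omega>. cmod (\<phi> z - \<psi> z) < e)"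
    using I(2) by (intro exI[of _ "\<lambda>z. \<Sum>i\<in>I. w i * tcoef (K i) (L i) \<phi> z"] conjI)
qed

end

subsection \<open>Weighted geometric means of the moduli\<close>

text \<open>Powers with the convention that the exponent zero gives the value one at zero too, as for
  the powers in a monomial.\<close>

definition rpow :: "real \<Rightarrow> real \<Rightarrow> real" where "rpow a x = (if a = 0 then 1 else x powr a)"

definition gmean :: "real \<Rightarrow> C2 \<Rightarrow> real" where
  "gmean a z = rpow a (cmod (fst z)) * rpow (1 - a) (cmod (snd z))"

lemma rpow_nonneg [simp]: "0 \<le> rpow a x" by (simp add: rpow_def)

lemma rpow_mono: "0 \<le> a \<Longrightarrow> 0 \<le> x \<Longrightarrow> x \<le> y \<Longrightarrow> rpow a x \<le> rpow a y"
  by (simp add: rpow_def powr_mono2)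

lemma rpow_pos: "x > 0 \<Longrightarrow> rpow a x = x powr a" by (simp add: rpow_def)

lemma gmean_nonneg [simp]: "0 \<le> gmean a z" by (simp add: gmean_def)

lemma gmean_mono:
  assumes "0 \<le> a" "a \<le> 1" "cmod (fst z) \<le> cmod (fst w)" "cmod (snd z) \<le> cmod (snd w)"
  shows "gmean a z \<le> gmean a w"
  unfolding gmean_def using assms by (intro mult_mono rpow_mono) auto

lemma rpow_power:
  assumes "0 \<le> x" "N > 0"
  shows "rpow (real k / real N) x ^ N = x ^ k"
proof (cases "k = 0 \<or> x = 0")
  case True then show ?thesis using assms by (auto simp: rpow_def zero_power)
next
  case False
  then have "x > 0" "k \<noteq> 0" using assms by auto
  then show ?thesis using assms by (simp add: rpow_def powr_power powr_realpow)
qed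

lemma monomial_gmean:
  fixes \<alpha> :: "nat \<times> nat"
  assumes "fst \<alpha> + snd \<alpha> > 0"
  shows "cmod (fst z ^ fst \<alpha> * snd z ^ snd \<alpha>)
    = gmean (real (fst \<alpha>) / real (fst \<alpha> + snd \<alpha>)) z ^ (fst \<alpha> + snd \<alpha>)"
proof -
  let ?N = "fst \<alpha> + snd \<alpha>"
  have s: "1 - real (fst \<alpha>) / real ?N = real (snd \<alpha>) / real ?N"
  proof -
    have 1: "real (snd \<alpha>) = real ?N - real (fst \<alpha>)" by simp
    have 2: "real ?N \<noteq> 0" using assms by linarith
    show ?thesis unfolding 1 diff_divide_distrib divide_self[OF 2] by (rule refl)
  qed
  show ?thesis unfolding gmean_def s power_mult_distrib norm_mult norm_power
    by (simp only: rpow_power[OF norm_ge_zero assms])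
qed

lemma continuous_on_rpow: "0 \<le> a \<Longrightarrow> continuous_on S f \<Longrightarrow> (\<And>x. x \<in> S \<Longrightarrow> 0 \<le> f x) \<Longrightarrow> continuous_on S (\<lambda>x. rpow a (f x))"
  unfolding rpow_def by (cases "a = 0") (auto intro!: continuous_on_powr' continuous_on_const)

lemma continuous_on_gmean: "0 \<le> a \<Longrightarrow> a \<le> 1 \<Longrightarrow> continuous_on S (gmean a)"
  unfolding gmean_def[abs_def] by (intro continuous_on_mult continuous_on_rpow continuous_intros) auto

text \<open>The powers jump at \<open>0\<^sup>0\<close>, but they are upper semicontinuous jointly in the exponent and in
  the base.\<close>

lemma rpow_upper_semicontinuous:
  assumes a: "u \<longlonglongrightarrow> a" "\<And>n::nat. 0 \<le> u n" and x: "x \<longlonglongrightarrow> y" "\<And>n. 0 \<le> x n" and e: "e > 0"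
  shows "\<forall>\<^sub>F n in sequentially. rpow (u n) (x n) < rpow a y + e"
proof -
  have a0: "a \<ge> 0" by (rule LIMSEQ_le_const[OF a(1)]) (use a(2) in auto)
  have y0: "y \<ge> 0" by (rule LIMSEQ_le_const[OF x(1)]) (use x(2) in auto)
  show ?thesis
  proof (cases "a = 0")
    case False
    then have ap: "a > 0" using a0 by simp
    have "(\<lambda>n. x n powr u n) \<longlonglongrightarrow> y powr a"
      by (rule tendsto_powr2[OF x(1) a(1) _ ap]) (use x(2) in auto)
    then have "\<forall>\<^sub>F n in sequentially. x n powr u n < y powr a + e"
      by (rule order_tendstoD) (use e in simp)
    moreover have "\<forall>\<^sub>F n in sequentially. 0 < u n" by (rule order_tendstoD(1)[OF a(1) ap])
    ultimately show ?thesis by eventually_elim (use ap in \<open>simp add: rpow_def\<close>)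
  next
    case True
    have "(\<lambda>n. (y + 1) powr u n) \<longlonglongrightarrow> (y + 1) powr 0"
      using y0 a(1) True by (intro tendsto_powr' tendsto_const) auto
    then have "\<forall>\<^sub>F n in sequentially. (y + 1) powr u n < 1 + e"
      by (rule order_tendstoD) (use e y0 in simp)
    moreover have "\<forall>\<^sub>F n in sequentially. x n < y + 1" by (rule order_tendstoD(2)[OF x(1)]) simp
    ultimately show ?thesis
    proof eventually_elim
      case (elim n)
      have "x n powr u n \<le> (y + 1) powr u n" by (intro powr_mono2 a(2) x(2)) (use elim in simp)
      then show ?case using True elim e by (simp add: rpow_def)
    qed
  qed
qed

text \<open>Compactness turns semicontinuity into a bound that holds on the whole set at once.\<close>

lemma gmean_upper_on_compact:
  assumes K: "compact K" and q: "\<And>z. z \<in> K \<Longrightarrow> gmean a z < q"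
    and a: "u \<longlonglongrightarrow> a" "\<And>n::nat. 0 \<le> u n" "\<And>n. u n \<le> 1"
  shows "\<forall>\<^sub>F n in sequentially. \<forall>z\<in>K. gmean (u n) z < q"
proof (rule ccontr)
  assume "\<not> ?thesis"
  then have "\<forall>N. \<exists>n\<ge>N. \<exists>z\<in>K. q \<le> gmean (u n) z" by (simp add: eventually_sequentially not_less)
  then have "\<exists>\<^sub>F n in sequentially. \<exists>z\<in>K. q \<le> gmean (u n) z" by (simp add: frequently_sequentially)
  then have "infinite {n. \<exists>z\<in>K. q \<le> gmean (u n) z}" by (simp add: cofinite_eq_sequentially[symmetric] frequently_cofinite)
  then obtain r :: "nat \<Rightarrow> nat" where r: "strict_mono r" "\<And>n. r n \<in> {n. \<exists>z\<in>K. q \<le> gmean (u n) z}"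
    using infinite_enumerate by blast
  then obtain z where z: "\<And>n. z n \<in> K" "\<And>n. q \<le> gmean (u (r n)) (z n)" by simp metis
  obtain w s where w: "w \<in> K" "strict_mono s" "(z \<circ> s) \<longlonglongrightarrow> w"
    using K z(1) unfolding compact_def by blast
  let ?A = "rpow a (cmod (fst w))" and ?B = "rpow (1 - a) (cmod (snd w))"
  have AB: "?A * ?B < q" using q[OF w(1)] by (simp add: gmean_def)
  define e where "e = min 1 ((q - ?A * ?B) / (2 * (?A + ?B + 1)))"
  have pos: "?A + ?B + 1 > 0" by (simp add: add_nonneg_pos)
  have e: "e > 0" using AB pos by (simp add: e_def)
  have 1: "(?A + e) * (?B + e) = ?A * ?B + e * (?A + ?B + e)" by (simp add: algebra_simps)
  have 2: "e * (?A + ?B + e) \<le> e * (?A + ?B + 1)" using e by (intro mult_left_mono) (auto simp: e_def)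
  have 3: "e * (?A + ?B + 1) \<le> (q - ?A * ?B) / (2 * (?A + ?B + 1)) * (?A + ?B + 1)"
    by (rule mult_right_mono) (use pos in \<open>auto simp: e_def\<close>)
  have 4: "(q - ?A * ?B) / (2 * (?A + ?B + 1)) * (?A + ?B + 1) = (q - ?A * ?B) / 2"
    using nonzero_mult_divide_mult_cancel_right[of "?A + ?B + 1" "q - ?A * ?B" 2] pos by simp
  have "X + (q - X) / 2 < q" if "X < q" for X using that by (simp add: field_simps)
  moreover have "(?A + e) * (?B + e) \<le> ?A * ?B + (q - ?A * ?B) / 2"
    unfolding 1 by (intro add_left_mono order_trans[OF 2 3[unfolded 4]])
  ultimately have eq: "(?A + e) * (?B + e) < q" using AB by (blast intro: le_less_trans)
  have ul: "(\<lambda>n. u (r (s n))) \<longlonglongrightarrow> a"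
    using LIMSEQ_subseq_LIMSEQ[OF LIMSEQ_subseq_LIMSEQ[OF a(1) r(1)] w(2)] by (simp add: o_def)
  have zl: "(\<lambda>n. z (s n)) \<longlonglongrightarrow> w" using w(3) by (simp add: o_def)
  have 1: "\<forall>\<^sub>F n in sequentially. rpow (u (r (s n))) (cmod (fst (z (s n)))) < ?A + e"
    by (rule rpow_upper_semicontinuous[OF ul a(2) _ _ e]) (intro tendsto_norm tendsto_fst zl norm_ge_zero)+
  have 2: "\<forall>\<^sub>F n in sequentially. rpow (1 - u (r (s n))) (cmod (snd (z (s n)))) < ?B + e"
    by (rule rpow_upper_semicontinuous[OF _ _ _ _ e])
      (intro tendsto_diff tendsto_const ul tendsto_norm tendsto_snd zl norm_ge_zero | use a(3) in simp)+
  have "\<forall>\<^sub>F n in sequentially. False" using 1 2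
  proof eventually_elim
    case (elim n)
    have "gmean (u (r (s n))) (z (s n)) \<le> (?A + e) * (?B + e)"
      unfolding gmean_def
      by (rule mult_mono[OF less_imp_le[OF elim(1)] less_imp_le[OF elim(2)]]) (use e in \<open>auto intro: add_nonneg_nonneg\<close>)
    then show False using z(2)[of "s n"] eq by simp
  qed
  then show False by simp
qed

lemma l2_norm_lower:
  assumes S: "open S" "bounded S" and V: "open V" "V \<subseteq> S" and f: "f \<in> L2 S" and c: "\<And>z. z \<in> V \<Longrightarrow> c \<le> cmod (f z)" "c \<ge> 0"
  shows "c * sqrt (measure lebesgue V) \<le> l2_norm S f"
proof -
  let ?M = "lebesgue_on S"
  have bV: "bounded V" using S(2) V(2) by (rule bounded_subset)
  have VM: "V \<in> sets ?M" "S \<inter> space lebesgue \<in> sets lebesgue"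
    using open_sets_lebesgue[OF V(1)] open_sets_lebesgue[OF S(1)] V(2) by (auto simp: sets_restrict_space_iff)
  have fin: "emeasure ?M V < \<infinity>"
    unfolding emeasure_restrict_space[OF VM(2) V(2)] infinity_ennreal_def less_top[symmetric]
    by (rule fmeasurableD2[OF lmeasurable_bounded_open[OF bV V(1)]])
  have "c\<^sup>2 * measure lebesgue V = (LINT z|?M. c\<^sup>2 * indicator V z)"
    using V(2) by (simp add: measure_restrict_space[OF VM(2) V(2)] Int_absorb2)
  also have "\<dots> \<le> (LINT z|?M. (cmod (f z))\<^sup>2)"
  proof (rule integral_mono)
    show "integrable ?M (\<lambda>z. c\<^sup>2 * indicator V z)"
      by (intro integrable_mult_right integrable_real_indicator VM(1) fin)
    show "integrable ?M (\<lambda>z. (cmod (f z))\<^sup>2)" by (rule L2_integrable_sq[OF f])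
    show "c\<^sup>2 * indicator V z \<le> (cmod (f z))\<^sup>2" for z
      using c by (cases "z \<in> V") (auto intro: power_mono)
  qed
  finally have "sqrt (c\<^sup>2 * measure lebesgue V) \<le> l2_norm S f" unfolding l2_norm_def by (rule real_sqrt_le_mono)
  then show ?thesis using c(2) by (simp add: real_sqrt_mult)
qed

context reinhardt_domain
begin

text \<open>The mean increases with both moduli, so it is enough to move to an interior point and to lower its moduli a
  little, keeping them positive; at fixed positive moduli the mean is continuous in the exponent.\<close>

lemma gmean_lower_on_open:
  assumes a: "u \<longlonglongrightarrow> a" "0 \<le> a" "a \<le> 1" and u: "\<And>n::nat. 0 \<le> u n" "\<And>n. u n \<le> 1"
    and p: "p \<in> closure \<Omega>" "q < gmean a p"
  obtains V where "open V" "V \<noteq> {}" "V \<subseteq> \<Omega>" "\<forall>\<^sub>F n in sequentially. \<forall>z\<in>V. q < gmean (u n) z"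
proof -
  have "\<exists>z\<in>\<Omega>. q < gmean a z"
  proof (rule ccontr)
    assume "\<not> ?thesis"
    then have "\<And>z. z \<in> \<Omega> \<Longrightarrow> gmean a z \<le> q" by (simp add: not_less)
    then have "gmean a p \<le> q"
      by (rule continuous_le_on_closure[OF continuous_on_gmean[OF a(2,3)] p(1)])
    then show False using p(2) by simp
  qed
  then obtain z where z: "z \<in> \<Omega>" "q < gmean a z" by blast
  obtain e where e: "e > 0" "\<And>w. cmod (fst w) < cmod (fst z) + e \<Longrightarrow> cmod (snd w) < cmod (snd z) + e \<Longrightarrow> w \<in> \<Omega>"
    by (rule complete_reinhardt_enlarge[OF open_Omega complete_Omega z(1)]) (rule that)
  define x where "x = cmod (fst z) + e/4"
  define y where "y = cmod (snd z) + e/4"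
  have xy: "x > 0" "y > 0" using e(1) by (auto simp: x_def y_def add_nonneg_pos)
  let ?p = "(complex_of_real x, complex_of_real y)"
  have np: "cmod (complex_of_real x) = x" "cmod (complex_of_real y) = y" using xy by simp_all
  define V where "V = \<Omega> \<inter> {w. x < cmod (fst w)} \<inter> {w. y < cmod (snd w)}"
  have oV: "open V" unfolding V_def by (intro open_Int open_Omega open_Collect_less continuous_intros)
  let ?w = "(complex_of_real (x + e/4), complex_of_real (y + e/4))"
  have "?w \<in> V"
  proof -
    have n: "cmod (complex_of_real (x + e/4)) = x + e/4" "cmod (complex_of_real (y + e/4)) = y + e/4"
      using xy e(1) by (simp_all only: norm_of_real)
    have "x + e/4 < cmod (fst z) + e" "y + e/4 < cmod (snd z) + e" "x < x + e/4" "y < y + e/4"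
      using e(1) by (auto simp: x_def y_def)
    then have "cmod (fst ?w) < cmod (fst z) + e" "cmod (snd ?w) < cmod (snd z) + e" "x < cmod (fst ?w)" "y < cmod (snd ?w)"
      by (simp_all only: fst_conv snd_conv n)
    then show ?thesis unfolding V_def using e(2)[of ?w] by blast
  qed
  then have neV: "V \<noteq> {}" by blast
  have ev: "\<forall>\<^sub>F n in sequentially. \<forall>w\<in>V. q < gmean (u n) w"
  proof -
    have "q < gmean a ?p"
    proof (rule less_le_trans[OF z(2) gmean_mono[OF a(2,3)]])
      show "cmod (fst z) \<le> cmod (fst ?p)" unfolding fst_conv np using e(1) by (simp add: x_def)
      show "cmod (snd z) \<le> cmod (snd ?p)" unfolding snd_conv np using e(1) by (simp add: y_def)
    qed
    moreover have g: "gmean b ?p = x powr b * y powr (1 - b)" for b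
      unfolding gmean_def fst_conv snd_conv np by (simp only: rpow_pos[OF xy(1)] rpow_pos[OF xy(2)])
    moreover have "(\<lambda>n. x powr u n * y powr (1 - u n)) \<longlonglongrightarrow> x powr a * y powr (1 - a)"
      using xy a(1) by (intro tendsto_mult tendsto_powr tendsto_const tendsto_diff) auto
    ultimately have "\<forall>\<^sub>F n in sequentially. q < gmean (u n) ?p"
      unfolding g by (intro order_tendstoD(1))
    then show ?thesis
    proof eventually_elim
      case (elim n)
      show ?case
      proof
        fix w assume "w \<in> V"
        then have "gmean (u n) ?p \<le> gmean (u n) w"
          using xy by (intro gmean_mono u) (auto simp: V_def)
        then show "q < gmean (u n) w" using elim by simp
      qed
    qed
  qed
  show thesis by (rule that[OF oV neV _ ev]) (auto simp: V_def)
qed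

lemma gmean_max_pos:
  assumes p: "p \<in> closure \<Omega>" "\<And>w. w \<in> closure \<Omega> \<Longrightarrow> gmean a w \<le> gmean a p"
  shows "gmean a p > 0"
proof -
  obtain e where e: "e > 0" "\<And>w. cmod (fst w) < cmod (fst ((0, 0) :: C2)) + e \<Longrightarrow> cmod (snd w) < cmod (snd ((0, 0) :: C2)) + e \<Longrightarrow> w \<in> \<Omega>"
    by (rule complete_reinhardt_enlarge[OF open_Omega complete_Omega zero_in_Omega]) (rule that)
  let ?w = "(complex_of_real (e/2), complex_of_real (e/2))"
  have "?w \<in> \<Omega>" by (rule e(2)) (use e(1) in auto)
  then have "gmean a ?w \<le> gmean a p" by (intro p(2) in_closure)
  moreover have "gmean a ?w > 0" using e(1) by (simp add: gmean_def rpow_def)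
  ultimately show ?thesis by simp
qed

text \<open>When the exponents grow in the direction \<open>(a, 1 - a)\<close>, the modulus of the monomial is a large
  power of nearly the geometric mean with weights \<open>a\<close> and \<open>1 - a\<close>.  Hence the mass concentrates on
  the maximum set of that mean: off a neighbourhood of it the monomial is exponentially smaller than
  on some fixed open set.\<close>

lemma monomial_concentration:
  fixes \<beta> :: "nat \<Rightarrow> nat \<times> nat"
  assumes a: "(\<lambda>n. real (fst (\<beta> n)) / real (fst (\<beta> n) + snd (\<beta> n))) \<longlonglongrightarrow> a"
    and N: "filterlim (\<lambda>n. fst (\<beta> n) + snd (\<beta> n)) at_top sequentially"
    and F: "sym F" "\<And>z. z \<in> closure \<Omega> \<Longrightarrow> (\<And>w. w \<in> closure \<Omega> \<Longrightarrow> gmean a w \<le> gmean a z) \<Longrightarrow> F z = 0"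
  shows "(\<lambda>n. nrm (\<lambda>z. F z * emon (\<beta> n) z)) \<longlonglongrightarrow> 0"
proof -
  let ?N = "\<lambda>n. fst (\<beta> n) + snd (\<beta> n)"
  define u where "u = (\<lambda>n. real (fst (\<beta> n)) / real (?N n))"
  have ul: "u \<longlonglongrightarrow> a" using a by (simp add: u_def)
  have u: "0 \<le> u n" "u n \<le> 1" for n by (auto simp: u_def divide_le_eq_1)
  have a01: "0 \<le> a" "a \<le> 1"
    by (rule LIMSEQ_le_const[OF ul], use u in blast) (rule LIMSEQ_le_const2[OF ul], use u in blast)
  have cg: "continuous_on (closure \<Omega>) (gmean a)" by (rule continuous_on_gmean[OF a01])
  have ne: "closure \<Omega> \<noteq> {}" using nonempty_Omega by simp
  obtain p where p: "p \<in> closure \<Omega>" "\<And>w. w \<in> closure \<Omega> \<Longrightarrow> gmean a w \<le> gmean a p"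
    using continuous_attains_sup[OF compact_closure_Omega ne cg] by blast
  define m where "m = gmean a p"
  have m0: "m > 0" unfolding m_def by (rule gmean_max_pos[OF p])
  obtain B where B: "B > 0" "\<And>z. z \<in> closure \<Omega> \<Longrightarrow> cmod (F z) \<le> B" by (rule sym_bounded[OF F(1)]) (rule that)
  show ?thesis
  proof (rule LIMSEQ_I)
    fix r :: real assume r: "r > 0"
    define e where "e = r/2"
    have e: "e > 0" using r by (simp add: e_def)
    define K where "K = closure \<Omega> \<inter> F -` {w. e \<le> cmod w}"
    have "closed K" unfolding K_def
      by (rule continuous_closed_preimage[OF F(1) closed_closure]) (intro closed_Collect_le continuous_intros)
    then have K: "compact K"
      using compact_Int_closed[OF compact_closure_Omega, of K] by (simp add: K_def Int_absorb1 Int_assoc[symmetric])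
    have Km: "gmean a z < m" if z: "z \<in> K" for z
    proof (rule ccontr)
      assume "\<not> gmean a z < m"
      then have "gmean a w \<le> gmean a z" if "w \<in> closure \<Omega>" for w using p(2)[OF that] by (simp add: m_def)
      then have "F z = 0" using z by (intro F(2)) (auto simp: K_def)
      then show False using z e by (simp add: K_def)
    qed
    obtain q where q: "0 \<le> q" "q < m" "\<And>z. z \<in> K \<Longrightarrow> gmean a z \<le> q"
    proof (cases "K = {}")
      case True then show ?thesis using that[of 0] m0 by simp
    next
      case False
      have "continuous_on K (gmean a)" by (rule continuous_on_gmean[OF a01])
      then obtain z where "z \<in> K" "\<And>w. w \<in> K \<Longrightarrow> gmean a w \<le> gmean a z"
        using continuous_attains_sup[OF K False] by blast
      then show ?thesis using that[of "gmean a z"] Km by simp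
    qed
    \<comment> \<open>Two levels strictly between the maximum over \<open>K\<close> and the global maximum: the monomial is below the first on \<open>K\<close>
      and above the second on an open set.\<close>
    define q1 where "q1 = (2 * q + m) / 3"
    define q2 where "q2 = (q + 2 * m) / 3"
    have qs: "q < q1" "q1 < q2" "q2 < m" "0 < q1" "0 < q2" using q(1,2) by (auto simp: q1_def q2_def)
    have U: "\<forall>\<^sub>F n in sequentially. \<forall>z\<in>K. gmean (u n) z < q1"
      by (rule gmean_upper_on_compact[OF K _ ul u]) (use q(3) qs(1) in force)
    obtain V where V: "open V" "V \<noteq> {}" "V \<subseteq> \<Omega>" and L: "\<forall>\<^sub>F n in sequentially. \<forall>z\<in>V. q2 < gmean (u n) z"
      by (rule gmean_lower_on_open[OF ul a01 u p(1) qs(3)[unfolded m_def]]) (rule that)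
    define v where "v = sqrt (measure lebesgue V)"
    have v: "v > 0" using measure_open_pos[OF V(1,2) bounded_subset[OF bounded_Omega V(3)]] by (simp add: v_def)
    define D where "D = B * sqrt (measure lebesgue \<Omega>) / v"
    have "(\<lambda>n. D * (q1 / q2) ^ ?N n) \<longlonglongrightarrow> D * 0"
      by (intro tendsto_mult tendsto_const filterlim_compose[OF LIMSEQ_power_zero N]) (use qs in simp)
    then have T: "\<forall>\<^sub>F n in sequentially. D * (q1 / q2) ^ ?N n < r/2"
      by (rule order_tendstoD) (use r in simp)
    have "\<forall>\<^sub>F n in sequentially. 1 \<le> ?N n" using N unfolding filterlim_at_top by blast
    then have N0: "\<forall>\<^sub>F n in sequentially. 0 < ?N n" by (rule eventually_mono) linarith
    have "\<forall>\<^sub>F n in sequentially. norm (nrm (\<lambda>z. F z * emon (\<beta> n) z) - 0) < r"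
      using U L T N0
    proof eventually_elim
      case (elim n)
      let ?e = "emon (\<beta> n)"
      let ?w = "nrm (mono (\<beta> n))"
      have w0: "?w > 0" by (rule mono_norm_pos)
      have mg: "cmod (mono (\<beta> n) z) = gmean (u n) z ^ ?N n" if "z \<in> \<Omega>" for z
        using monomial_gmean[OF elim(4), of z] that by (simp add: mono_def u_def)
      have wl: "q2 ^ ?N n * v \<le> ?w"
        unfolding v_def
      proof (rule l2_norm_lower[OF open_Omega bounded_Omega V(1,3) A2D(2)[OF mono_A2]])
        fix z assume z: "z \<in> V"
        then show "q2 ^ ?N n \<le> cmod (mono (\<beta> n) z)"
          unfolding mg[OF subsetD[OF V(3) z]] using elim(2) qs by (intro power_mono) (auto intro: less_imp_le)
      qed (use qs in simp)
      define b where "b = B * (q1 ^ ?N n / ?w)"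
      have b0: "b \<ge> 0" using B(1) qs w0 by (simp add: b_def)
      let ?g = "\<lambda>z. complex_of_real (e * cmod (?e z)) + complex_of_real b"
      obtain C where C: "\<And>z. z \<in> \<Omega> \<Longrightarrow> cmod (?e z) \<le> C" by (rule emon_bounded) (rule that)
      have L1: "(\<lambda>z. complex_of_real (e * cmod (?e z))) \<in> L2 \<Omega>"
      proof (rule continuous_bounded_L2)
        show "continuous_on \<Omega> (\<lambda>z. complex_of_real (e * cmod (?e z)))"
          by (intro continuous_intros A2D(4)[OF emon_A2])
        show "cmod (complex_of_real (e * cmod (?e z))) \<le> e * C" if "z \<in> \<Omega>" for z
          using C[OF that] e by (simp add: norm_mult)
      qed
      have L2: "(\<lambda>z. complex_of_real b) \<in> L2 \<Omega>"
        by (rule continuous_bounded_L2[OF continuous_on_const, of _ b]) (use b0 in simp)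
      have "nrm (\<lambda>z. F z * ?e z) \<le> nrm ?g"
      proof (rule l2_norm_mono[OF L2_add[OF L1 L2] mult_L2[OF F(1) A2D(2)[OF emon_A2]]])
        fix z assume z: "z \<in> \<Omega>"
        have g: "cmod (?g z) = e * cmod (?e z) + b"
        proof -
          have "?g z = complex_of_real (e * cmod (?e z) + b)" by simp
          then show ?thesis using e b0 by (simp only: norm_of_real) simp
        qed
        show "cmod (F z * ?e z) \<le> cmod (?g z)"
        proof (cases "z \<in> K")
          case True
          have "cmod (?e z) = gmean (u n) z ^ ?N n / ?w"
            using w0 by (simp add: emon_def norm_mult norm_divide mg[OF z])
          also have "\<dots> \<le> q1 ^ ?N n / ?w"
            using elim(1) True w0 by (intro divide_right_mono power_mono) (auto intro: less_imp_le)
          finally have "cmod (F z * ?e z) \<le> b" unfolding norm_mult b_def using B in_closure[OF z] by (intro mult_mono) auto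
          then show ?thesis unfolding g using e by (simp add: add_increasing)
        next
          case False
          then have "cmod (F z) \<le> e" using in_closure[OF z] by (simp add: K_def)
          then have "cmod (F z * ?e z) \<le> e * cmod (?e z)" unfolding norm_mult by (intro mult_right_mono) auto
          then show ?thesis unfolding g using b0 by simp
        qed
      qed
      also have "\<dots> \<le> nrm (\<lambda>z. complex_of_real (e * cmod (?e z))) + nrm (\<lambda>z. complex_of_real b)"
        by (rule l2_triangle[OF L1 L2])
      also have "nrm (\<lambda>z. complex_of_real (e * cmod (?e z))) = nrm (\<lambda>z. complex_of_real e * ?e z)"
        by (rule l2_norm_cong) (simp add: norm_mult)
      also have "\<dots> = e" using e by (simp add: l2_norm_scale emon_norm)
      also have "nrm (\<lambda>z. complex_of_real b) = b * sqrt (measure lebesgue \<Omega>)"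
        using b0 by (simp add: l2_norm_const[OF open_Omega bounded_Omega])
      also have "b * sqrt (measure lebesgue \<Omega>) \<le> D * (q1 / q2) ^ ?N n"
      proof -
        have "q1 ^ ?N n / ?w \<le> q1 ^ ?N n / (q2 ^ ?N n * v)"
          by (intro divide_left_mono wl mult_pos_pos w0 zero_less_power) (use qs v in auto)
        then have "b * sqrt (measure lebesgue \<Omega>) \<le> B * (q1 ^ ?N n / (q2 ^ ?N n * v)) * sqrt (measure lebesgue \<Omega>)"
          unfolding b_def using B(1) by (intro mult_right_mono mult_left_mono) auto
        also have "\<dots> = D * (q1 / q2) ^ ?N n" by (simp add: D_def power_divide mult_ac)
        finally show ?thesis .
      qed
      finally show ?case using elim(3) by (simp add: e_def)
    qed
    then show "\<exists>N. \<forall>n\<ge>N. norm (nrm (\<lambda>z. F z * emon (\<beta> n) z) - 0) < r"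
      by (simp only: eventually_sequentially)
  qed
qed

end

context reinhardt_domain
begin

subsection \<open>Maximum sets of the geometric means\<close>

text \<open>For weights strictly between 0 and 1 the mean is strictly concave in the moduli, so by
  convexity its maximum set is a single torus.\<close>

lemma gmean_max_moduli:
  assumes a: "0 < a" "a < 1"
    and z: "z \<in> closure \<Omega>" "\<And>w. w \<in> closure \<Omega> \<Longrightarrow> gmean a w \<le> gmean a z"
    and z': "z' \<in> closure \<Omega>" "\<And>w. w \<in> closure \<Omega> \<Longrightarrow> gmean a w \<le> gmean a z'"
  shows "cmod (fst z) = cmod (fst z') \<and> cmod (snd z) = cmod (snd z') \<and> fst z \<noteq> 0 \<and> snd z \<noteq> 0"
proof -
  define x y x' y' where d: "x = cmod (fst z)" "y = cmod (snd z)" "x' = cmod (fst z')" "y' = cmod (snd z')"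
  have g: "gmean a z = x powr a * y powr (1 - a)" "gmean a z' = x' powr a * y' powr (1 - a)"
    using a by (simp_all add: gmean_def rpow_def d)
  have "gmean a z > 0" by (rule gmean_max_pos[OF z])
  moreover have "gmean a z' > 0" by (rule gmean_max_pos[OF z'])
  ultimately have "x \<noteq> 0" "y \<noteq> 0" "x' \<noteq> 0" "y' \<noteq> 0" unfolding g by auto
  then have pos: "x > 0" "y > 0" "x' > 0" "y' > 0" by (auto simp: d)
  define m where "m = gmean a z"
  have m: "gmean a z' = m" using z(2)[OF z'(1)] z'(2)[OF z(1)] by (simp add: m_def)
  let ?P = "(x + x') / 2" and ?Q = "(y + y') / 2"
  let ?p = "(complex_of_real ?P, complex_of_real ?Q)"
  have in1: "(complex_of_real x, complex_of_real y) \<in> closure \<Omega>"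
    by (rule complete_reinhardtD[OF complete_closure z(1)]) (simp_all add: d)
  have in2: "(complex_of_real x', complex_of_real y') \<in> closure \<Omega>"
    by (rule complete_reinhardtD[OF complete_closure z'(1)]) (simp_all add: d)
  have "(1/2) *\<^sub>R (complex_of_real x, complex_of_real y) + (1/2) *\<^sub>R (complex_of_real x', complex_of_real y') \<in> closure \<Omega>"
    by (rule convexD[OF convex_closure[OF convex_Omega] in1 in2]) auto
  also have "(1/2) *\<^sub>R (complex_of_real x, complex_of_real y) + (1/2) *\<^sub>R (complex_of_real x', complex_of_real y') = ?p"
    by (simp add: scaleR_conv_of_real add_divide_distrib)
  finally have "gmean a ?p \<le> m" unfolding m_def by (rule z(2))
  moreover have n: "cmod (complex_of_real ?P) = ?P" "cmod (complex_of_real ?Q) = ?Q"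
    using pos by (simp_all del: of_real_add of_real_divide)
  ultimately have le: "?P powr a * ?Q powr (1 - a) \<le> m"
    using a by (simp only: gmean_def rpow_def fst_conv snd_conv n) simp
  have sq: "(t powr c)\<^sup>2 = t\<^sup>2 powr c" if "t > 0" for t c :: real
    using that by (simp add: power2_eq_square powr_mult)
  have le2: "(?P\<^sup>2) powr a * (?Q\<^sup>2) powr (1 - a) \<le> (x * x') powr a * (y * y') powr (1 - a)"
  proof -
    have "(?P powr a * ?Q powr (1 - a))\<^sup>2 \<le> m\<^sup>2" using le by (intro power_mono) auto
    also have "m\<^sup>2 = gmean a z * gmean a z'" by (simp add: m m_def[symmetric] power2_eq_square)
    also have "\<dots> = (x * x') powr a * (y * y') powr (1 - a)" unfolding g powr_mult by (simp only: mult_ac)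
    finally show ?thesis unfolding power_mult_distrib using pos by (simp only: sq add_pos_pos half_gt_zero)
  qed
  have sqd: "((s + t) / 2)\<^sup>2 = s * t + ((s - t) / 2)\<^sup>2" for s t :: real by (simp add: power2_eq_square field_simps)
  have P: "x * x' \<le> ?P\<^sup>2" "x \<noteq> x' \<Longrightarrow> x * x' < ?P\<^sup>2" unfolding sqd by simp_all
  have Q: "y * y' \<le> ?Q\<^sup>2" "y \<noteq> y' \<Longrightarrow> y * y' < ?Q\<^sup>2" unfolding sqd by simp_all
  have pp: "0 < (x * x') powr a" "0 < (y * y') powr (1 - a)" using pos by simp_all
  have mP: "(x * x') powr a \<le> (?P\<^sup>2) powr a" using a pos P(1) by (intro powr_mono2) auto
  have mQ: "(y * y') powr (1 - a) \<le> (?Q\<^sup>2) powr (1 - a)" using a pos Q(1) by (intro powr_mono2) auto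
  have "x = x'"
  proof (rule ccontr)
    assume "x \<noteq> x'"
    then have "(x * x') powr a < (?P\<^sup>2) powr a" using a pos P(2) by (intro powr_less_mono2) auto
    then have "(x * x') powr a * (y * y') powr (1 - a) < (?P\<^sup>2) powr a * (?Q\<^sup>2) powr (1 - a)"
      using mQ pp by (intro mult_less_le_imp_less) auto
    then show False using le2 by linarith
  qed
  moreover have "y = y'"
  proof (rule ccontr)
    assume "y \<noteq> y'"
    then have "(y * y') powr (1 - a) < (?Q\<^sup>2) powr (1 - a)" using a pos Q(2) by (intro powr_less_mono2) auto
    then have "(x * x') powr a * (y * y') powr (1 - a) < (?P\<^sup>2) powr a * (?Q\<^sup>2) powr (1 - a)"
      using mP pp by (intro mult_le_less_imp_less) auto
    then show False using le2 by linarith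
  qed
  ultimately show ?thesis using pos by (auto simp: d)
qed

subsection \<open>Slices in the boundary\<close>

lemma tc_iterated:
  assumes \<phi>: "sym \<phi>" and z: "pr ax x w \<in> closure \<Omega>"
  shows "tc ax k l \<phi> (pr ax x w)
    = integral {0..1} (\<lambda>s. integral {0..1} (\<lambda>t. \<phi> (pr ax (ex s * x) (ex t * w)) * ex (- of_int l * t)) * ex (- of_int k * s))"
proof (cases ax)
  case True
  then show ?thesis by (simp add: tc_def tcoef_def fcoef_def act_def pr_def)
next
  case False
  then show ?thesis using tcoef_swap[OF reinhardt_closure_Omega \<phi> z, of l k]
    by (simp add: tc_def fcoef_def act_def pr_def)
qed

text \<open>Where the modulus of one coordinate is maximal, the boundary contains a family of parallel
  discs.  Holomorphy along them leaves of a homogeneous component of the symbol a monomial in the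
  disc variable.\<close>

lemma disc_condition_imp_slice:
  assumes \<phi>: "sym \<phi>"
    and iv: "\<And>f. holomorphic_map_on f (ball 0 1) \<Longrightarrow> f ` ball 0 1 \<subseteq> frontier \<Omega> \<Longrightarrow> (\<phi> \<circ> f) holomorphic_on ball 0 1"
    and r: "r > 0" "p \<in> closure \<Omega>" "cmod (cX ax p) = r" "\<And>z. z \<in> closure \<Omega> \<Longrightarrow> cmod (cX ax z) \<le> r"
  obtains c where "\<And>w. pr ax (of_real r) w \<in> closure \<Omega> \<Longrightarrow>
    tc ax k l \<phi> (pr ax (of_real r) w) = (if l \<ge> 0 then c * w ^ nat l else 0)"
proof -
  let ?\<psi> = "\<lambda>w. tc ax k l \<phi> (pr ax (of_real r) w)"
  have "pr ax (of_real r) (cY ax p) \<in> closure \<Omega>"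
    by (rule complete_reinhardtD_pr[OF complete_closure, of ax "cX ax p" "cY ax p"]) (use r in auto)
  then obtain w0 where w0: "pr ax (of_real r) w0 \<in> closure \<Omega>"
      "\<And>w. pr ax (of_real r) w \<in> closure \<Omega> \<Longrightarrow> cmod w \<le> cmod w0"
    by (rule slice_attains_max_modulus) (rule that)
  define s where "s = cmod w0"
  have mem: "pr ax u w \<in> closure \<Omega>" if "cmod u \<le> r" "cmod w \<le> s" for u w
    by (rule complete_reinhardtD_pr[OF complete_closure, of ax "of_real r" w0]) (use w0(1) that r(1) in \<open>auto simp: s_def\<close>)
  have le: "cmod w \<le> s" if "pr ax (of_real r) w \<in> closure \<Omega>" for w using w0(2)[of w] that by (simp add: s_def)
  show thesis
  proof (cases "s = 0")
    case True
    have z: "pr ax (of_real r) 0 \<in> closure \<Omega>" by (rule mem) (use r(1) True in auto)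
    have "?\<psi> w = (if l \<ge> 0 then ?\<psi> 0 * w ^ nat l else 0)" if "pr ax (of_real r) w \<in> closure \<Omega>" for w
    proof -
      have w: "w = 0" using le[OF that] True by simp
      show ?thesis
      proof (cases "l = 0")
        case False
        have "?\<psi> 0 = ex (of_int l * (1 / (2 * of_int l))) * ?\<psi> 0"
          using tc_homogeneous[OF reinhardt_closure_Omega \<phi> z, of k l 0 "1 / (2 * of_int l)"] by simp
        also have "ex (of_int l * (1 / (2 * of_int l))) = ex (1/2)" using False by simp
        also have "ex (1/2) = -1" by (simp add: ex_def)
        finally have "?\<psi> 0 = 0" by simp
        then show ?thesis using w False by simp
      qed (use w in simp)
    qed
    then show thesis by (rule that)
  next
    case False
    then have s: "s > 0" by (simp add: s_def)
    let ?f = "\<lambda>a t. pr ax (ex a * of_real r) (of_real s * t)"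
    define D where "D = (\<lambda>a. (deriv ^^ nat l) (\<lambda>t. \<phi> (?f a t)) 0 / fact (nat l))"
    define c where "c = integral {0..1} (\<lambda>a. D a * ex (- of_int k * a)) / of_real s ^ nat l"
    have fr: "?f a t \<in> frontier \<Omega>" if "t \<in> ball 0 1" for a t
    proof -
      have "?f a t \<in> closure \<Omega>"
        by (rule mem) (use r(1) s that in \<open>auto simp: norm_mult norm_ex mult_le_cancel_left1\<close>)
      moreover have "?f a t \<notin> \<Omega>"
      proof
        assume "?f a t \<in> \<Omega>"
        from cX_less_max[OF r(4) this] show False using r(1) by (simp add: norm_mult norm_ex)
      qed
      ultimately show ?thesis by (simp add: frontier_eq)
    qed
    have hol: "(\<lambda>t. \<phi> (?f a t)) holomorphic_on ball 0 1" for a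
    proof -
      have "(\<phi> \<circ> ?f a) holomorphic_on ball 0 1"
      proof (rule iv)
        show "holomorphic_map_on (?f a) (ball 0 1)"
          unfolding holomorphic_map_on_def pr_def by (cases ax) (auto intro!: holomorphic_intros)
        show "?f a ` ball 0 1 \<subseteq> frontier \<Omega>" using fr by blast
      qed
      then show ?thesis by (simp only: o_def)
    qed
    have inn: "?\<psi> w = (if l \<ge> 0 then c * w ^ nat l else 0)" if w: "cmod w < s" for w
    proof -
      define \<zeta> where "\<zeta> = w / of_real s"
      have z: "cmod \<zeta> < 1" "w = of_real s * \<zeta>" using w s by (simp_all add: \<zeta>_def norm_divide)
      have wc: "pr ax (of_real r) w \<in> closure \<Omega>" by (rule mem) (use w r(1) in auto)
      have "integral {0..1} (\<lambda>t. \<phi> (pr ax (ex a * of_real r) (ex t * w)) * ex (- of_int l * t))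
          = (if l \<ge> 0 then D a * \<zeta> ^ nat l else 0)" for a
        using circle_mean_holomorphic[OF hol z(1), of a l] by (simp add: z(2) D_def mult.left_commute)
      then have e: "?\<psi> w = integral {0..1} (\<lambda>a. (if l \<ge> 0 then D a * \<zeta> ^ nat l else 0) * ex (- of_int k * a))"
        by (simp only: tc_iterated[OF \<phi> wc])
      show ?thesis
      proof (cases "l \<ge> 0")
        case True
        have "?\<psi> w = integral {0..1} (\<lambda>a. (D a * ex (- of_int k * a)) * \<zeta> ^ nat l)"
          unfolding e using True by (simp add: mult_ac)
        also have "\<dots> = integral {0..1} (\<lambda>a. D a * ex (- of_int k * a)) * \<zeta> ^ nat l" by (rule integral_mult_left)
        also have "\<dots> = c * w ^ nat l" using s by (simp add: c_def z(2) power_mult_distrib)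
        finally show ?thesis using True by simp
      qed (use e in simp)
    qed
    show thesis
    proof (rule that)
      fix w assume w: "pr ax (of_real r) w \<in> closure \<Omega>"
      let ?h = "\<lambda>w. ?\<psi> w - (if l \<ge> 0 then c * w ^ nat l else 0)"
      have cb: "closure (ball (0::complex) s) = cball 0 s" using s by simp
      have "continuous_on (closure (ball 0 s)) ?h"
        unfolding cb
      proof (intro continuous_on_diff)
        show "continuous_on (cball 0 s) ?\<psi>"
        proof (rule continuous_on_compose2[OF sym_tc[OF \<phi>]])
          show "continuous_on (cball 0 s) (\<lambda>w. pr ax (complex_of_real r) w)" by (intro continuous_intros)
          show "(\<lambda>w. pr ax (complex_of_real r) w) ` cball 0 s \<subseteq> closure \<Omega>" using mem r(1) by auto
        qed
        show "continuous_on (cball 0 s) (\<lambda>w. if l \<ge> 0 then c * w ^ nat l else 0)"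
          by (cases "l \<ge> 0") (auto intro!: continuous_intros)
      qed
      then have "?h w = 0"
        by (rule continuous_constant_on_closure) (use inn le[OF w] in \<open>auto simp: cb\<close>)
      then show "?\<psi> w = (if l \<ge> 0 then c * w ^ nat l else 0)" by simp
    qed
  qed
qed

end

context reinhardt_domain
begin

subsection \<open>Compactness from the boundary discs\<close>

text \<open>Dividing a monomial \<open>z\<^sup>\<gamma>\<close> out of the basis element makes room for a negative weight of the
  symbol.  If \<open>\<psi> z\<^sup>\<gamma>\<close> agrees with a holomorphic monomial where the mass concentrates, then
  \<open>\<psi> e\<^sub>\<alpha>\<close> is nearly holomorphic.\<close>

lemma hankel_emon_tendsto_zero:
  fixes \<beta> :: "nat \<Rightarrow> nat \<times> nat" and \<gamma> \<kappa> :: "nat \<times> nat"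
  assumes \<psi>: "sym \<psi>"
    and a: "(\<lambda>n. real (fst (\<beta> n)) / real (fst (\<beta> n) + snd (\<beta> n))) \<longlonglongrightarrow> a"
    and N: "filterlim (\<lambda>n. fst (\<beta> n) + snd (\<beta> n)) at_top sequentially"
    and d: "d > 0"
    and M: "\<And>z. z \<in> closure \<Omega> \<Longrightarrow> (\<And>w. w \<in> closure \<Omega> \<Longrightarrow> gmean a w \<le> gmean a z) \<Longrightarrow>
      \<psi> z * (fst z ^ fst \<gamma> * snd z ^ snd \<gamma>) = c * (fst z ^ fst \<kappa> * snd z ^ snd \<kappa>)
      \<and> cmod (fst z ^ fst \<gamma> * snd z ^ snd \<gamma>) = d"
  shows "(\<lambda>n. nrm (H \<psi> (emon (fst (\<beta> n) + fst \<gamma>, snd (\<beta> n) + snd \<gamma>)))) \<longlonglongrightarrow> 0"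
proof -
  define g where "g = (\<lambda>z :: C2. fst z ^ fst \<gamma> * snd z ^ snd \<gamma>)"
  define F1 where "F1 = (\<lambda>z. \<psi> z * g z - c * (fst z ^ fst \<kappa> * snd z ^ snd \<kappa>))"
  define F2 where "F2 = (\<lambda>z. complex_of_real (d - cmod (g z)))"
  have cg: "continuous_on S g" for S unfolding g_def by (intro continuous_intros)
  have s1: "sym F1" unfolding F1_def by (intro continuous_intros \<psi> cg)
  have s2: "sym F2" unfolding F2_def by (intro continuous_intros cg)
  have l1: "(\<lambda>n. nrm (\<lambda>z. F1 z * emon (\<beta> n) z)) \<longlonglongrightarrow> 0"
    by (rule monomial_concentration[OF a N s1]) (use M in \<open>simp add: F1_def g_def\<close>)
  have l2: "(\<lambda>n. nrm (\<lambda>z. F2 z * emon (\<beta> n) z)) \<longlonglongrightarrow> 0"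
    by (rule monomial_concentration[OF a N s2]) (use M in \<open>simp add: F2_def g_def\<close>)
  let ?\<alpha> = "\<lambda>n. (fst (\<beta> n) + fst \<gamma>, snd (\<beta> n) + snd \<gamma>)"
  have "\<forall>\<^sub>F n in sequentially. nrm (\<lambda>z. F2 z * emon (\<beta> n) z) < d/2"
    by (rule order_tendstoD(2)[OF l2]) (use d in simp)
  then have "\<forall>\<^sub>F n in sequentially. norm (nrm (H \<psi> (emon (?\<alpha> n)))) \<le> 2/d * nrm (\<lambda>z. F1 z * emon (\<beta> n) z)"
  proof eventually_elim
    case (elim n)
    let ?e = "emon (\<beta> n)"
    define wa where "wa = nrm (mono (?\<alpha> n))"
    define wb where "wb = nrm (mono (\<beta> n))"
    have w: "wa > 0" "wb > 0" unfolding wa_def wb_def by (rule mono_norm_pos)+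
    have eL: "?e \<in> L2 \<Omega>" by (rule A2D(2)[OF emon_A2])
    have me: "mono (?\<alpha> n) z = complex_of_real wb * (g z * ?e z)" if "z \<in> \<Omega>" for z
      using that w by (simp add: mono_def emon_def g_def wb_def[symmetric] power_add)
    have gsym: "sym g" by (rule cg)
    have dsym: "sym (\<lambda>z. complex_of_real (cmod (g z)))" by (intro continuous_intros cg)
    have "wa = wb * nrm (\<lambda>z. g z * ?e z)"
    proof -
      have "wa = nrm (\<lambda>z. complex_of_real wb * (g z * ?e z))" unfolding wa_def by (rule l2_norm_cong) (simp add: me)
      then show ?thesis using w by (simp add: l2_norm_scale)
    qed
    moreover have "d \<le> nrm (\<lambda>z. F2 z * ?e z) + nrm (\<lambda>z. g z * ?e z)"
    proof -
      have "d = nrm (\<lambda>z. complex_of_real d * ?e z)" using d by (simp add: l2_norm_scale emon_norm)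
      also have "\<dots> = nrm (\<lambda>z. F2 z * ?e z + complex_of_real (cmod (g z)) * ?e z)"
        by (rule l2_norm_cong) (simp add: F2_def algebra_simps)
      also have "\<dots> \<le> nrm (\<lambda>z. F2 z * ?e z) + nrm (\<lambda>z. complex_of_real (cmod (g z)) * ?e z)"
        by (rule l2_triangle[OF mult_L2[OF s2 eL] mult_L2[OF dsym eL]])
      also have "nrm (\<lambda>z. complex_of_real (cmod (g z)) * ?e z) = nrm (\<lambda>z. g z * ?e z)"
        by (rule l2_norm_cong) (simp add: norm_mult)
      finally show ?thesis .
    qed
    ultimately have wd: "wb * (d/2) \<le> wa" using elim w by (simp add: mult_left_mono)
    let ?h = "\<lambda>z. c / complex_of_real wa * mono (fst (\<beta> n) + fst \<kappa>, snd (\<beta> n) + snd \<kappa>) z"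
    have hA: "?h \<in> A2 \<Omega>" by (rule A2_scale[OF mono_A2])
    have eq: "\<psi> z * emon (?\<alpha> n) z - ?h z = complex_of_real (wb / wa) * (F1 z * ?e z)" if z: "z \<in> \<Omega>" for z
    proof -
      have 1: "emon (?\<alpha> n) z = mono (?\<alpha> n) z / complex_of_real wa" by (simp only: emon_def wa_def) simp
      have 2: "mono (fst (\<beta> n) + fst \<kappa>, snd (\<beta> n) + snd \<kappa>) z = complex_of_real wb * (fst z ^ fst \<kappa> * snd z ^ snd \<kappa> * ?e z)"
        using z w by (simp add: mono_def emon_def wb_def[symmetric] power_add)
      show ?thesis unfolding 1 2 me[OF z] F1_def using w by (simp add: field_simps)
    qed
    have "nrm (H \<psi> (emon (?\<alpha> n))) \<le> nrm (\<lambda>z. \<psi> z * emon (?\<alpha> n) z - ?h z)"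
      by (rule hankel_best[OF \<psi> A2D(2)[OF emon_A2] hA])
    also have "\<dots> = nrm (\<lambda>z. complex_of_real (wb / wa) * (F1 z * ?e z))" by (rule l2_norm_cong) (simp only: eq)
    also have "\<dots> = wb / wa * nrm (\<lambda>z. F1 z * ?e z)" using w by (simp only: l2_norm_scale norm_of_real) simp
    also have "\<dots> \<le> 2/d * nrm (\<lambda>z. F1 z * ?e z)"
      using wd w d by (intro mult_right_mono) (auto simp: field_simps)
    finally show ?case by simp
  qed
  moreover have "(\<lambda>n. 2/d * nrm (\<lambda>z. F1 z * emon (\<beta> n) z)) \<longlonglongrightarrow> 0"
    by (rule tendsto_mult_right_zero[OF l1])
  ultimately show ?thesis by (rule Lim_null_comparison)
qed

text \<open>Removing a fixed monomial does not change the limiting direction of the exponents.\<close>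

lemma hankel_emon_tendsto_zero_shifted:
  fixes \<alpha> :: "nat \<Rightarrow> nat \<times> nat" and \<gamma> \<kappa> :: "nat \<times> nat"
  assumes \<psi>: "sym \<psi>"
    and a: "(\<lambda>n. real (fst (\<alpha> n)) / real (fst (\<alpha> n) + snd (\<alpha> n))) \<longlonglongrightarrow> a"
    and N: "filterlim (\<lambda>n. fst (\<alpha> n) + snd (\<alpha> n)) at_top sequentially"
    and \<gamma>: "\<forall>\<^sub>F n in sequentially. fst \<gamma> \<le> fst (\<alpha> n)" "\<forall>\<^sub>F n in sequentially. snd \<gamma> \<le> snd (\<alpha> n)"
    and d: "d > 0"
    and M: "\<And>z. z \<in> closure \<Omega> \<Longrightarrow> (\<And>w. w \<in> closure \<Omega> \<Longrightarrow> gmean a w \<le> gmean a z) \<Longrightarrow>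
      \<psi> z * (fst z ^ fst \<gamma> * snd z ^ snd \<gamma>) = c * (fst z ^ fst \<kappa> * snd z ^ snd \<kappa>)
      \<and> cmod (fst z ^ fst \<gamma> * snd z ^ snd \<gamma>) = d"
  shows "(\<lambda>n. nrm (H \<psi> (emon (\<alpha> n)))) \<longlonglongrightarrow> 0"
proof -
  from eventually_conj[OF \<gamma>] obtain n0 where n0: "\<And>n. n \<ge> n0 \<Longrightarrow> fst \<gamma> \<le> fst (\<alpha> n) \<and> snd \<gamma> \<le> snd (\<alpha> n)"
    unfolding eventually_sequentially by blast
  define A where "A = (\<lambda>n. \<alpha> (n + n0))"
  define \<beta> where "\<beta> = (\<lambda>n. (fst (A n) - fst \<gamma>, snd (A n) - snd \<gamma>))"
  have A: "fst \<gamma> \<le> fst (A n)" "snd \<gamma> \<le> snd (A n)" for n using n0[of "n + n0"] by (auto simp: A_def)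
  let ?N = "\<lambda>n. fst (A n) + snd (A n)" and ?q = "fst \<gamma> + snd \<gamma>"
  have NA: "filterlim ?N at_top sequentially"
    unfolding A_def by (rule filterlim_compose[OF N filterlim_add_const_nat_at_top])
  have rN: "filterlim (\<lambda>n. real (?N n)) at_top sequentially"
    by (rule filterlim_compose[OF filterlim_real_sequentially NA])
  have uA: "(\<lambda>n. real (fst (A n)) / real (?N n)) \<longlonglongrightarrow> a" unfolding A_def by (rule LIMSEQ_ignore_initial_segment[OF a])
  have N\<beta>: "fst (\<beta> n) + snd (\<beta> n) + ?q = ?N n" for n using A[of n] by (simp add: \<beta>_def)
  have ev: "\<forall>\<^sub>F n in sequentially. Z \<le> ?N n" for Z using NA unfolding filterlim_at_top by blast
  have "filterlim (\<lambda>n. fst (\<beta> n) + snd (\<beta> n)) at_top sequentially"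
    unfolding filterlim_at_top
  proof
    fix Z
    show "\<forall>\<^sub>F n in sequentially. Z \<le> fst (\<beta> n) + snd (\<beta> n)"
      using ev[of "Z + ?q"]
    proof eventually_elim
      case (elim n)
      then show ?case using N\<beta>[of n] by linarith
    qed
  qed
  moreover have "(\<lambda>n. real (fst (\<beta> n)) / real (fst (\<beta> n) + snd (\<beta> n))) \<longlonglongrightarrow> a"
  proof -
    have z: "(\<lambda>n. c / real (?N n)) \<longlonglongrightarrow> 0" for c :: real
      by (rule real_tendsto_divide_at_top[OF tendsto_const rN])
    have "(\<lambda>n. (real (fst (A n)) / real (?N n) - real (fst \<gamma>) / real (?N n)) / (1 - real ?q / real (?N n))) \<longlonglongrightarrow> (a - 0) / (1 - 0)"
      by (intro tendsto_divide tendsto_diff uA z tendsto_const) simp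
    moreover have "\<forall>\<^sub>F n in sequentially. (real (fst (A n)) / real (?N n) - real (fst \<gamma>) / real (?N n)) / (1 - real ?q / real (?N n))
        = real (fst (\<beta> n)) / real (fst (\<beta> n) + snd (\<beta> n))"
      using ev[of 1]
    proof eventually_elim
      case (elim n)
      define x where "x = real (?N n)"
      have x: "x \<noteq> 0" using elim unfolding x_def by linarith
      have 1: "real (fst (A n)) - real (fst \<gamma>) = real (fst (\<beta> n))" using A[of n] by (simp add: \<beta>_def of_nat_diff)
      have 2: "x - real ?q = real (fst (\<beta> n) + snd (\<beta> n))" unfolding x_def N\<beta>[of n, symmetric] by simp
      have "1 - real ?q / x = (x - real ?q) / x" using x by (simp add: diff_divide_distrib)
      then have "(real (fst (A n)) / x - real (fst \<gamma>) / x) / (1 - real ?q / x)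
          = ((real (fst (A n)) - real (fst \<gamma>)) / x) / ((x - real ?q) / x)"
        by (simp only: diff_divide_distrib)
      also have "\<dots> = (real (fst (A n)) - real (fst \<gamma>)) / (x - real ?q)" using x by simp
      finally show ?case unfolding x_def[symmetric] 1 2 .
    qed
    ultimately show ?thesis by (simp add: tendsto_cong)
  qed
  ultimately have "(\<lambda>n. nrm (H \<psi> (emon (fst (\<beta> n) + fst \<gamma>, snd (\<beta> n) + snd \<gamma>)))) \<longlonglongrightarrow> 0"
    by (intro hankel_emon_tendsto_zero[OF \<psi> _ _ d M])
  moreover have "(fst (\<beta> n) + fst \<gamma>, snd (\<beta> n) + snd \<gamma>) = \<alpha> (n + n0)" for n
    using A[of n] by (simp add: \<beta>_def A_def prod_eq_iff)
  ultimately have "(\<lambda>n. nrm (H \<psi> (emon (\<alpha> (n + n0))))) \<longlonglongrightarrow> 0" by simp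
  then show ?thesis by (rule LIMSEQ_offset)
qed

lemma monomial_pr: "fst z ^ fst (pr ax A B) * snd z ^ snd (pr ax A B) = cX ax z ^ A * cY ax z ^ B" for z :: C2
  by (simp add: pr_def cX_def cY_def)

text \<open>If \<open>0 < a < 1\<close> the mass concentrates on a torus, where the component is a constant multiple of its
  character.  If \<open>a\<close> is 0 or 1 it concentrates where one coordinate has maximal modulus; that set is made of boundary
  discs, along which the component is a monomial.\<close>

lemma disc_condition_imp_component_small:
  assumes \<phi>: "sym \<phi>"
    and iv: "\<And>f. holomorphic_map_on f (ball 0 1) \<Longrightarrow> f ` ball 0 1 \<subseteq> frontier \<Omega> \<Longrightarrow> (\<phi> \<circ> f) holomorphic_on ball 0 1"
    and a: "(\<lambda>n. real (fst (\<alpha> n)) / real (fst (\<alpha> n) + snd (\<alpha> n))) \<longlonglongrightarrow> a"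
    and N: "filterlim (\<lambda>n :: nat. fst (\<alpha> n) + snd (\<alpha> n)) at_top sequentially"
  shows "(\<lambda>n. nrm (H (tcoef k l \<phi>) (emon (\<alpha> n)))) \<longlonglongrightarrow> 0"
proof -
  let ?\<psi> = "tcoef k l \<phi>"
  have \<psi>: "sym ?\<psi>" by (rule sym_tcoef[OF \<phi>])
  define u where "u = (\<lambda>n. real (fst (\<alpha> n)) / real (fst (\<alpha> n) + snd (\<alpha> n)))"
  have ul: "u \<longlonglongrightarrow> a" using a by (simp add: u_def)
  have u: "0 \<le> u n" "u n \<le> 1" for n by (auto simp: u_def divide_le_eq_1)
  have a01: "0 \<le> a" "a \<le> 1"
    by (rule LIMSEQ_le_const[OF ul], use u in blast) (rule LIMSEQ_le_const2[OF ul], use u in blast)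
  have rN: "filterlim (\<lambda>n. real (fst (\<alpha> n) + snd (\<alpha> n))) at_top sequentially"
    by (rule filterlim_compose[OF filterlim_real_sequentially N])
  have uN: "u n * real (fst (\<alpha> n) + snd (\<alpha> n)) = real (fst (\<alpha> n))"
      "(1 - u n) * real (fst (\<alpha> n) + snd (\<alpha> n)) = real (snd (\<alpha> n))" for n
    by (cases "fst (\<alpha> n) + snd (\<alpha> n) = 0"; auto simp: u_def left_diff_distrib)+
  have g1: "\<forall>\<^sub>F n in sequentially. j \<le> fst (\<alpha> n)" if "a > 0" for j
  proof -
    have "filterlim (\<lambda>n. u n * real (fst (\<alpha> n) + snd (\<alpha> n))) at_top sequentially"
      by (rule filterlim_tendsto_pos_mult_at_top[OF ul that rN])
    then have "\<forall>\<^sub>F n in sequentially. real j \<le> real (fst (\<alpha> n))" unfolding uN filterlim_at_top by blast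
    then show ?thesis by (simp only: of_nat_le_iff)
  qed
  have g2: "\<forall>\<^sub>F n in sequentially. j \<le> snd (\<alpha> n)" if "a < 1" for j
  proof -
    have "filterlim (\<lambda>n. (1 - u n) * real (fst (\<alpha> n) + snd (\<alpha> n))) at_top sequentially"
      by (rule filterlim_tendsto_pos_mult_at_top[OF tendsto_diff[OF tendsto_const ul] _ rN]) (use that in simp)
    then have "\<forall>\<^sub>F n in sequentially. real j \<le> real (snd (\<alpha> n))" unfolding uN filterlim_at_top by blast
    then show ?thesis by (simp only: of_nat_le_iff)
  qed
  have ne: "closure \<Omega> \<noteq> {}" using nonempty_Omega by simp
  obtain p where p: "p \<in> closure \<Omega>" "\<And>w. w \<in> closure \<Omega> \<Longrightarrow> gmean a w \<le> gmean a p"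
    using continuous_attains_sup[OF compact_closure_Omega ne continuous_on_gmean[OF a01]] by blast
  show ?thesis
  proof (cases "0 < a \<and> a < 1")
    case True
    \<comment> \<open>Large enough that \<open>z\<^sub>1\<^sup>j z\<^sub>2\<^sup>j\<close> absorbs negative weights in both coordinates.\<close>
    define j where "j = nat (max \<bar>k\<bar> \<bar>l\<bar>)"
    have j: "int j + k \<ge> 0" "int j + l \<ge> 0" by (auto simp: j_def)
    let ?\<kappa> = "(nat (int j + k), nat (int j + l))"
    have p0: "fst p \<noteq> 0" "snd p \<noteq> 0" using gmean_max_moduli[of a p p] True p by auto
    define d where "d = cmod (fst p ^ j * snd p ^ j)"
    define c where "c = ?\<psi> p * (fst p ^ j * snd p ^ j) / (fst p ^ fst ?\<kappa> * snd p ^ snd ?\<kappa>)"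
    show ?thesis
    proof (rule hankel_emon_tendsto_zero_shifted[OF \<psi> a N, where \<gamma> = "(j, j)" and \<kappa> = ?\<kappa> and d = d and c = c])
      show "d > 0" using p0 by (simp add: d_def)
      fix z assume z: "z \<in> closure \<Omega>" "\<And>w. w \<in> closure \<Omega> \<Longrightarrow> gmean a w \<le> gmean a z"
      have m: "cmod (fst z) = cmod (fst p)" "cmod (snd z) = cmod (snd p)"
        using gmean_max_moduli[of a z p] True p z by auto
      obtain s where s: "fst z / fst p = ex s" using unimodular_ex[of "fst z / fst p"] m p0 by (auto simp: norm_divide)
      obtain t where t: "snd z / snd p = ex t" using unimodular_ex[of "snd z / snd p"] m p0 by (auto simp: norm_divide)
      have zp: "fst z = ex s * fst p" "snd z = ex t * snd p" using s t p0 by (simp_all add: field_simps)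
      then have za: "z = act (ex s) (ex t) p" by (simp add: act_def prod_eq_iff)
      have 1: "?\<psi> z = ex (of_int k * s) * ex (of_int l * t) * ?\<psi> p"
        unfolding za by (rule tcoef_homogeneous[OF reinhardt_closure_Omega \<phi> p(1)])
      have 2: "fst z ^ j * snd z ^ j = ex (real j * s) * ex (real j * t) * (fst p ^ j * snd p ^ j)"
        unfolding zp power_mult_distrib ex_power by (simp only: mult_ac)
      have 3: "fst z ^ fst ?\<kappa> * snd z ^ snd ?\<kappa> = ex (of_int k * s) * ex (real j * s) * (ex (of_int l * t) * ex (real j * t)) * (fst p ^ fst ?\<kappa> * snd p ^ snd ?\<kappa>)"
      proof -
        have "real (nat (int j + k)) = of_int k + real j" "real (nat (int j + l)) = of_int l + real j" using j by simp_all
        then show ?thesis unfolding zp power_mult_distrib ex_power fst_conv snd_conv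
          by (simp only: distrib_right ex_add) (simp only: mult_ac)
      qed
      have 4: "?\<psi> p * (fst p ^ j * snd p ^ j) = c * (fst p ^ fst ?\<kappa> * snd p ^ snd ?\<kappa>)"
        using p0 by (simp add: c_def)
      have "?\<psi> z * (fst z ^ j * snd z ^ j) = ex (of_int k * s) * ex (real j * s) * (ex (of_int l * t) * ex (real j * t)) * (?\<psi> p * (fst p ^ j * snd p ^ j))"
        unfolding 1 2 by (simp only: mult_ac)
      also have "\<dots> = c * (fst z ^ fst ?\<kappa> * snd z ^ snd ?\<kappa>)"
        unfolding 4 3 by (simp only: mult_ac)
      finally have "?\<psi> z * (fst z ^ j * snd z ^ j) = c * (fst z ^ fst ?\<kappa> * snd z ^ snd ?\<kappa>)" .
      moreover have "cmod (fst z ^ j * snd z ^ j) = d" unfolding d_def norm_mult norm_power m ..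
      ultimately show "?\<psi> z * (fst z ^ fst (j, j) * snd z ^ snd (j, j)) = c * (fst z ^ fst ?\<kappa> * snd z ^ snd ?\<kappa>)
          \<and> cmod (fst z ^ fst (j, j) * snd z ^ snd (j, j)) = d" by simp
    qed (use True g1 g2 in simp_all)
  next
    case False
    then obtain ax :: bool where ax: "a = (if ax then 1 else 0)" using a01 by (metis antisym_conv2)
    have gm: "gmean a z = cmod (cX ax z)" for z by (simp add: ax gmean_def rpow_def cX_def)
    define r where "r = cmod (cX ax p)"
    have r0: "r > 0" using gmean_max_pos[OF p] by (simp add: r_def gm)
    define k' where "k' = (if ax then k else l)"
    define l' where "l' = (if ax then l else k)"
    have tce: "?\<psi> = tc ax k' l' \<phi>" by (simp add: tc_def k'_def l'_def)
    obtain C where C: "\<And>w. pr ax (of_real r) w \<in> closure \<Omega> \<Longrightarrow>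
        tc ax k' l' \<phi> (pr ax (of_real r) w) = (if l' \<ge> 0 then C * w ^ nat l' else 0)"
      by (rule disc_condition_imp_slice[OF \<phi> iv r0 p(1) r_def[symmetric], of k' l']) (use p(2) in \<open>auto simp: gm r_def\<close>)
    \<comment> \<open>Only the distinguished coordinate needs a shift: for \<open>l' < 0\<close> the component vanishes on the maximum set.\<close>
    define j where "j = nat \<bar>k'\<bar>"
    have j: "int j + k' \<ge> 0" by (auto simp: j_def)
    let ?\<kappa> = "pr ax (nat (int j + k')) (nat l')"
    define c where "c = (if l' \<ge> 0 then C * of_real r ^ j / of_real r ^ nat (int j + k') else 0)"
    show ?thesis
    proof (rule hankel_emon_tendsto_zero_shifted[OF \<psi> a N, where \<gamma> = "pr ax j 0" and \<kappa> = ?\<kappa> and d = "r ^ j" and c = c])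
      show "0 < r ^ j" using r0 by simp
      show "\<forall>\<^sub>F n in sequentially. fst (pr ax j 0) \<le> fst (\<alpha> n)" using g1[of j] ax by (cases ax) (auto simp: pr_def)
      show "\<forall>\<^sub>F n in sequentially. snd (pr ax j 0) \<le> snd (\<alpha> n)" using g2[of j] ax by (cases ax) (auto simp: pr_def)
      fix z assume z: "z \<in> closure \<Omega>" "\<And>w. w \<in> closure \<Omega> \<Longrightarrow> gmean a w \<le> gmean a z"
      have zr: "cmod (cX ax z) = r" using p(2)[OF z(1)] z(2)[OF p(1)] by (simp add: gm r_def)
      obtain s where s: "cX ax z = ex s * of_real r" unfolding zr[symmetric] by (rule polar_ex)
      have mem: "pr ax (of_real r) (cY ax z) \<in> closure \<Omega>"
        by (rule complete_reinhardtD_pr[OF complete_closure, of ax "cX ax z" "cY ax z"]) (use z(1) zr r0 in auto)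
      have "?\<psi> z = tc ax k' l' \<phi> (pr ax (ex s * of_real r) (ex 0 * cY ax z))" unfolding tce s[symmetric] by simp
      also have "\<dots> = ex (of_int k' * s) * ex (of_int l' * 0) * tc ax k' l' \<phi> (pr ax (of_real r) (cY ax z))"
        by (rule tc_homogeneous[OF reinhardt_closure_Omega \<phi> mem])
      finally have e: "?\<psi> z = ex (of_int k' * s) * (if l' \<ge> 0 then C * cY ax z ^ nat l' else 0)"
        by (simp add: C[OF mem])
      have x1: "cX ax z ^ j = ex (real j * s) * of_real r ^ j" unfolding s power_mult_distrib ex_power ..
      have x2: "cX ax z ^ nat (int j + k') = ex (of_int k' * s) * ex (real j * s) * of_real r ^ nat (int j + k')"
      proof -
        have "real (nat (int j + k')) = of_int k' + real j" using j by simp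
        then show ?thesis unfolding s power_mult_distrib ex_power by (simp only: distrib_right ex_add)
      qed
      have "?\<psi> z * (cX ax z ^ j * cY ax z ^ 0) = c * (cX ax z ^ nat (int j + k') * cY ax z ^ nat l')"
        unfolding e x1 x2 using r0 by (cases "l' \<ge> 0") (simp_all add: c_def mult_ac)
      moreover have "cmod (cX ax z ^ j * cY ax z ^ 0) = r ^ j" by (simp add: norm_mult norm_power zr)
      ultimately show "?\<psi> z * (fst z ^ fst (pr ax j 0) * snd z ^ snd (pr ax j 0)) = c * (fst z ^ fst ?\<kappa> * snd z ^ snd ?\<kappa>)
          \<and> cmod (fst z ^ fst (pr ax j 0) * snd z ^ snd (pr ax j 0)) = r ^ j"
        unfolding monomial_pr by blast
    qed
  qed
qed

text \<open>If infinitely many diagonal entries of a component were large, a subsequence of their exponents would have a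
  limiting direction, contradicting the smallness along such sequences.\<close>

lemma disc_condition_imp_hankel_wc:
  assumes \<phi>: "sym \<phi>"
    and iv: "\<And>f. holomorphic_map_on f (ball 0 1) \<Longrightarrow> f ` ball 0 1 \<subseteq> frontier \<Omega> \<Longrightarrow> (\<phi> \<circ> f) holomorphic_on ball 0 1"
  shows "hankel_wc \<phi>"
proof (rule hankel_wc_of_components[OF \<phi>])
  fix k l
  have h: "homog k l (tcoef k l \<phi>)"
    unfolding homog_def using tcoef_homogeneous[OF reinhardt_closure_Omega \<phi> in_closure] by blast
  show "hankel_wc (tcoef k l \<phi>)"
  proof (rule hankel_wc_diagonal[OF sym_tcoef[OF \<phi>] h])
    fix d :: real assume d: "d > 0"
    show "finite {\<alpha>. nrm (H (tcoef k l \<phi>) (emon \<alpha>)) \<ge> d}"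
    proof (rule ccontr)
      assume "infinite {\<alpha>. nrm (H (tcoef k l \<phi>) (emon \<alpha>)) \<ge> d}"
      then obtain A :: "nat \<Rightarrow> nat \<times> nat" where A: "inj A" "range A \<subseteq> {\<alpha>. nrm (H (tcoef k l \<phi>) (emon \<alpha>)) \<ge> d}"
        using infinite_countable_subset by blast
      define u where "u = (\<lambda>n. real (fst (A n)) / real (fst (A n) + snd (A n)))"
      have "u n \<in> {0..1}" for n by (auto simp: u_def divide_le_eq_1)
      then obtain a r where r: "strict_mono (r :: nat \<Rightarrow> nat)" "(u \<circ> r) \<longlonglongrightarrow> a"
        using compact_Icc[of "0::real" 1] unfolding compact_def by blast
      define \<alpha> where "\<alpha> = (\<lambda>n. A (r n))"
      have inj: "inj \<alpha>" using inj_compose[OF A(1) strict_mono_imp_inj_on[OF r(1)]] by (simp only: \<alpha>_def o_def)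
      have dir: "(\<lambda>n. real (fst (\<alpha> n)) / real (fst (\<alpha> n) + snd (\<alpha> n))) \<longlonglongrightarrow> a"
        using r(2) by (simp add: o_def u_def \<alpha>_def)
      have N: "filterlim (\<lambda>n. fst (\<alpha> n) + snd (\<alpha> n)) at_top sequentially"
        unfolding filterlim_at_top
      proof
        fix Z
        have "finite (\<alpha> -` ({..Z} \<times> {..Z}))" by (rule finite_vimageI[OF _ inj]) simp
        moreover have "{n. \<not> Z \<le> fst (\<alpha> n) + snd (\<alpha> n)} \<subseteq> \<alpha> -` ({..Z} \<times> {..Z})"
          by (auto simp: mem_Times_iff)
        ultimately have "finite {n. \<not> Z \<le> fst (\<alpha> n) + snd (\<alpha> n)}" by (rule finite_subset[rotated])
        then show "\<forall>\<^sub>F n in sequentially. Z \<le> fst (\<alpha> n) + snd (\<alpha> n)"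
          by (simp only: cofinite_eq_sequentially[symmetric] eventually_cofinite)
      qed
      have "(\<lambda>n. nrm (H (tcoef k l \<phi>) (emon (\<alpha> n)))) \<longlonglongrightarrow> 0"
        by (rule disc_condition_imp_component_small[OF \<phi> iv dir N])
      then have "d \<le> 0"
        by (rule LIMSEQ_le_const) (use A(2) in \<open>auto simp: \<alpha>_def\<close>)
      then show False using d by simp
    qed
  qed
qed

end

section \<open>The equivalence of the four conditions\<close>

theorem corollary1p2:
  fixes \<Omega> :: "(complex \<times> complex) set" and \<phi> :: "complex \<times> complex \<Rightarrow> complex"
  assumes "open \<Omega>" and "connected \<Omega>" and "\<Omega> \<noteq> {}"
    and "bounded \<Omega>" and "convex \<Omega>" and "reinhardt \<Omega>"
    and "continuous_on (closure \<Omega>) \<phi>"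
  defines "H \<equiv> hankel \<Omega> \<phi>"
  defines "HH \<equiv> (\<lambda>f. A2_adjoint \<Omega> H (H f))"
  defines "cond_i \<equiv> compact_operator \<Omega> (A2 \<Omega>) (L2 \<Omega>) H"
  defines "cond_ii \<equiv> compact_operator \<Omega> (A2 \<Omega>) (A2 \<Omega>) HH"
  defines "cond_iii \<equiv> (berezin \<Omega> HH \<longlongrightarrow> 0) (to_boundary \<Omega>)"
  defines "cond_iv \<equiv> (\<forall>f. holomorphic_map_on f (ball 0 1) \<and> f ` ball 0 1 \<subseteq> frontier \<Omega> \<longrightarrow>
                           (\<phi> \<circ> f) holomorphic_on ball 0 1)"
  shows "(\<forall>z\<in>\<Omega>. berezin \<Omega> HH z = complex_of_real ((l2_norm \<Omega> (H (normalized_kernel \<Omega> z)))\<^sup>2))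
    \<and> (cond_i \<longleftrightarrow> cond_ii) \<and> (cond_i \<longleftrightarrow> cond_iii) \<and> (cond_i \<longleftrightarrow> cond_iv)"
proof -
  interpret reinhardt_domain \<Omega>
    by unfold_locales (fact assms)+
  have \<phi>: "sym \<phi>" by fact
  have ber: "berezin \<Omega> HH z = complex_of_real ((l2_norm \<Omega> (H (normalized_kernel \<Omega> z)))\<^sup>2)" if "z \<in> \<Omega>" for z
    unfolding HH_def H_def by (rule berezin_HH[OF \<phi> that])
  have i: "cond_i \<longleftrightarrow> hankel_wc \<phi>" unfolding cond_i_def H_def by (rule compact_hankel_iff[OF \<phi>])
  have ii: "cond_ii \<longleftrightarrow> hankel_wc \<phi>" unfolding cond_ii_def HH_def H_def by (rule compact_HH_iff[OF \<phi>])
  have small: "cmod (berezin \<Omega> HH z) < e\<^sup>2 \<longleftrightarrow> nrm (hankel \<Omega> \<phi> (nk z)) < e" if "z \<in> \<Omega>" "e > 0" for z e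
  proof -
    have "cmod (berezin \<Omega> HH z) = (nrm (hankel \<Omega> \<phi> (nk z)))\<^sup>2"
      unfolding ber[OF that(1)] H_def by (simp only: norm_of_real abs_power2)
    then show ?thesis
      using power_mono_iff[of e "nrm (hankel \<Omega> \<phi> (nk z))" 2] that(2) by (simp add: not_le[symmetric])
  qed
  have iii: "cond_iii \<longleftrightarrow> (\<forall>e>0. \<exists>d>0. \<forall>z\<in>\<Omega>. infdist z (frontier \<Omega>) < d \<longrightarrow> nrm (hankel \<Omega> \<phi> (nk z)) < e)"
  proof
    assume cond_iii
    show "\<forall>e>0. \<exists>d>0. \<forall>z\<in>\<Omega>. infdist z (frontier \<Omega>) < d \<longrightarrow> nrm (hankel \<Omega> \<phi> (nk z)) < e"
    proof (intro allI impI)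
      fix e :: real assume e: "e > 0"
      then have "\<forall>\<^sub>F z in to_boundary \<Omega>. dist (berezin \<Omega> HH z) 0 < e\<^sup>2"
        using \<open>cond_iii\<close> unfolding cond_iii_def by (intro tendstoD) simp_all
      then show "\<exists>d>0. \<forall>z\<in>\<Omega>. infdist z (frontier \<Omega>) < d \<longrightarrow> nrm (hankel \<Omega> \<phi> (nk z)) < e"
        unfolding eventually_to_boundary dist_norm diff_zero using small[OF _ e] by blast
    qed
  next
    assume l: "\<forall>e>0. \<exists>d>0. \<forall>z\<in>\<Omega>. infdist z (frontier \<Omega>) < d \<longrightarrow> nrm (hankel \<Omega> \<phi> (nk z)) < e"
    show cond_iii unfolding cond_iii_def
    proof (rule tendstoI)
      fix e :: real assume e: "e > 0"
      then have "sqrt e > 0" by simp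
      then have "\<exists>d>0. \<forall>z\<in>\<Omega>. infdist z (frontier \<Omega>) < d \<longrightarrow> cmod (berezin \<Omega> HH z) < (sqrt e)\<^sup>2"
        using l small by (meson less_trans)
      then show "\<forall>\<^sub>F z in to_boundary \<Omega>. dist (berezin \<Omega> HH z) 0 < e"
        using e unfolding eventually_to_boundary dist_norm diff_zero by simp
    qed
  qed
  have wc_iii: "cond_iii" if "hankel_wc \<phi>"
    unfolding iii using hankel_wc_imp_boundary_limit[OF that] by blast
  have iii_iv: "cond_iv" if "cond_iii"
  proof -
    have "slices_holomorphic \<phi>"
      by (rule boundary_limit_imp_slices_holomorphic[OF \<phi>]) (use that in \<open>simp only: iii\<close>)
    then show ?thesis unfolding cond_iv_def using slices_holomorphic_imp_disc[OF \<phi>] by blast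
  qed
  have iv_wc: "hankel_wc \<phi>" if "cond_iv"
    by (rule disc_condition_imp_hankel_wc[OF \<phi>]) (use that in \<open>simp add: cond_iv_def\<close>)
  show ?thesis using ber i ii wc_iii iii_iv iv_wc by blast
qed

end
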